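(* There is an $O(n^2\log n)$-time randomized algorithm that, given an $n$-vertex graph $G$, computes a biclique decomposition $\mathcal{B}$ of $G$ such that $\mathcal{B}$ has size: \begin{itemize} \item $O(n^{2-1/d}\log n)$ if $G$ has neighborhood complexity $\eta_G(m)\le c\,m^d$ for all $m$, for fixed real numbers $c>0$ and $d>1$ (the implied constant depends only on $c$ and $d$); \item $O(n\log^2 n)$ if $G$ has neighborhood complexity $\eta_G(m)\le c\,m$ for all $m$, for a fixed real number $c>0$ (the implied constant depends only on $c$). \end{itemize}
   Context: Graphs are finite, simple and undirected. $N(v)$ denotes the set of neighbors of a vertex $v$ (so $v\notin N(v)$). The neighborhood complexity of a graph $G$ is the function $$\eta_G(m)=\max_{C\subseteq V(G),\,|C|=m}\ \bigl|\{N(v)\cap C: v\in V(G)\}\bigr|,\qquad 1\le m\le |V(G)|.$$ A biclique of $G$ is a complete bipartite subgraph of $G$ (not necessarily induced). A biclique cover of $G$ is a collection of bicliques of $G$ such that every edge of $G$ is contained in at least one of them. A biclique decomposition is a biclique cover in which every edge is covered exactly once. The size of a biclique cover $\mathcal{B}$ is $\sum_{B\in\mathcal{B}}|V(B)|$. Running times are in the standard unit-cost RAM model. For randomized algorithms, the stated guarantees hold with high probability, i.e. with probability tending to $1$ as $n\to\infty$. *)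

theory Defs
  imports "HOL-Probability.Probability" "HOL-Library.Landau_Symbols"
begin

section \<open>Graphs, neighborhood complexity, bicliques\<close>

datatype 'a ugraph = UGraph (verts: "'a set") (edges: "'a set set")

definition simple_graph :: "'a ugraph \<Rightarrow> bool" where
  "simple_graph G \<longleftrightarrow> finite (verts G) \<and> (\<forall>e\<in>edges G. e \<subseteq> verts G \<and> card e = 2)"

definition nbhd :: "'a ugraph \<Rightarrow> 'a \<Rightarrow> 'a set" where
  "nbhd G v = {w. {v, w} \<in> edges G}"

definition nbh_complexity :: "'a ugraph \<Rightarrow> nat \<Rightarrow> nat" where
  "nbh_complexity G m =
     Max {card {nbhd G v \<inter> C | v. v \<in> verts G} | C. C \<subseteq> verts G \<and> card C = m}"

definition is_subgraph :: "'a ugraph \<Rightarrow> 'a ugraph \<Rightarrow> bool" where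
  "is_subgraph H G \<longleftrightarrow> simple_graph H \<and> verts H \<subseteq> verts G \<and> edges H \<subseteq> edges G"

definition join_graph :: "'a set \<Rightarrow> 'a set \<Rightarrow> 'a ugraph" where
  "join_graph A B = UGraph (A \<union> B) {{a, b} | a b. a \<in> A \<and> b \<in> B}"

definition complete_bipartite :: "'a ugraph \<Rightarrow> bool" where
  "complete_bipartite H \<longleftrightarrow>
     (\<exists>A B. A \<noteq> {} \<and> B \<noteq> {} \<and> A \<inter> B = {} \<and> H = join_graph A B)"

definition biclique :: "'a ugraph \<Rightarrow> 'a ugraph \<Rightarrow> bool" where
  "biclique G H \<longleftrightarrow> is_subgraph H G \<and> complete_bipartite H"

text \<open>Collections of bicliques are multisets, so that a repeated biclique would count repeatedly,
  both in the size and in the number of times that an edge is covered.\<close>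

definition biclique_cover :: "'a ugraph \<Rightarrow> 'a ugraph multiset \<Rightarrow> bool" where
  "biclique_cover G \<B> \<longleftrightarrow>
     (\<forall>H\<in>#\<B>. biclique G H) \<and> (\<forall>e\<in>edges G. \<exists>H\<in>#\<B>. e \<in> edges H)"

definition biclique_decomposition :: "'a ugraph \<Rightarrow> 'a ugraph multiset \<Rightarrow> bool" where
  "biclique_decomposition G \<B> \<longleftrightarrow>
     biclique_cover G \<B> \<and> (\<forall>e\<in>edges G. size {#H \<in># \<B>. e \<in> edges H#} = 1)"

definition cover_size :: "'a ugraph multiset \<Rightarrow> nat" where
  "cover_size \<B> = (\<Sum>H\<in>#\<B>. card (verts H))"

section \<open>Randomized unit-cost RAM\<close>

text \<open>
  A program is a fixed list of instructions with absolute jump targets. The machine has registers,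
  named directly by the instructions, and a memory, addressed indirectly through registers;
  both hold natural numbers. Every instruction takes one unit of time. As usual for the unit-cost
  measure, words have \<open>O(log n)\<close> bits: on inputs with \<open>n\<close> vertices, registers are only assigned
  numbers up to a bound \<open>M\<close> polynomial in \<open>n\<close> (see \<open>word_max\<close> below).
  \<^item> \<open>Sub\<close> truncates at \<open>0\<close>; \<open>Div\<close> and \<open>Mod\<close> follow the conventions \<open>x div 0 = 0\<close> and
    \<open>x mod 0 = x\<close>.
  \<^item> \<open>Rand i j\<close> draws register \<open>i\<close> uniformly from \<open>{0..<r}\<close>, where \<open>r > 0\<close> is the content of
    register \<open>j\<close>, independently of all earlier draws.
  \<^item> \<open>Write i\<close> appends the content of register \<open>i\<close> to the write-only output.
\<close>

datatype arith_op = Add | Sub | Mul | Div | Mod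

datatype instr =
    LoadConst nat nat
  | Arith arith_op nat nat nat
  | Load nat nat
  | Store nat nat
  | Rand nat nat
  | Write nat
  | Jump nat
  | JumpIfZero nat nat

type_synonym program = "instr list"

record ram_state =
  pc :: nat
  regs :: "nat \<Rightarrow> nat"
  mem :: "nat \<Rightarrow> nat"
  outp :: "nat list"

fun arith :: "arith_op \<Rightarrow> nat \<Rightarrow> nat \<Rightarrow> nat" where
  "arith Add x y = x + y"
| "arith Sub x y = x - y"
| "arith Mul x y = x * y"
| "arith Div x y = x div y"
| "arith Mod x y = x mod y"

text \<open>An assignment that exceeds the word bound \<open>M\<close> leaves the state unchanged, so the machine is
  stuck at this instruction and never halts.\<close>

definition set_reg :: "nat \<Rightarrow> nat \<Rightarrow> nat \<Rightarrow> ram_state \<Rightarrow> ram_state" where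
  "set_reg M i v \<sigma> =
     (if v \<le> M then \<sigma>\<lparr>pc := Suc (pc \<sigma>), regs := (regs \<sigma>)(i := v)\<rparr> else \<sigma>)"

fun exec :: "nat \<Rightarrow> instr \<Rightarrow> ram_state \<Rightarrow> ram_state pmf" where
  "exec M (LoadConst i v) \<sigma> = return_pmf (set_reg M i v \<sigma>)"
| "exec M (Arith f i j k) \<sigma> = return_pmf (set_reg M i (arith f (regs \<sigma> j) (regs \<sigma> k)) \<sigma>)"
| "exec M (Load i j) \<sigma> = return_pmf (set_reg M i (mem \<sigma> (regs \<sigma> j)) \<sigma>)"
| "exec M (Store i j) \<sigma> =
     return_pmf (\<sigma>\<lparr>pc := Suc (pc \<sigma>), mem := (mem \<sigma>)(regs \<sigma> i := regs \<sigma> j)\<rparr>)"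
| "exec M (Rand i j) \<sigma> =
     (if regs \<sigma> j = 0 then return_pmf \<sigma>
      else map_pmf (\<lambda>v. set_reg M i v \<sigma>) (pmf_of_set {0..<regs \<sigma> j}))"
| "exec M (Write i) \<sigma> = return_pmf (\<sigma>\<lparr>pc := Suc (pc \<sigma>), outp := outp \<sigma> @ [regs \<sigma> i]\<rparr>)"
| "exec M (Jump l) \<sigma> = return_pmf (\<sigma>\<lparr>pc := l\<rparr>)"
| "exec M (JumpIfZero i l) \<sigma> =
     return_pmf (\<sigma>\<lparr>pc := (if regs \<sigma> i = 0 then l else Suc (pc \<sigma>))\<rparr>)"

definition halted :: "program \<Rightarrow> ram_state \<Rightarrow> bool" where
  "halted P \<sigma> \<longleftrightarrow> length P \<le> pc \<sigma>"

definition step :: "nat \<Rightarrow> program \<Rightarrow> ram_state \<Rightarrow> ram_state pmf" where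
  "step M P \<sigma> = (if halted P \<sigma> then return_pmf \<sigma> else exec M (P ! pc \<sigma>) \<sigma>)"

primrec run :: "nat \<Rightarrow> program \<Rightarrow> nat \<Rightarrow> ram_state \<Rightarrow> ram_state pmf" where
  "run M P 0 \<sigma> = return_pmf \<sigma>"
| "run M P (Suc t) \<sigma> = bind_pmf (step M P \<sigma>) (run M P t)"

definition word_max :: "nat \<Rightarrow> nat \<Rightarrow> nat" where
  "word_max k n = (n + 2) ^ k"

section \<open>Graph algorithms on the RAM\<close>

text \<open>The input is a graph on the vertices \<open>0, \<dots>, n - 1\<close>, given by \<open>n\<close> in register \<open>0\<close> and its
  adjacency matrix, stored row by row from memory address \<open>0\<close> on.\<close>

definition init_state :: "nat ugraph \<Rightarrow> ram_state" where
  "init_state G =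
     (let n = card (verts G) in
      \<lparr>pc = 0,
       regs = (\<lambda>i. if i = 0 then n else 0),
       mem = (\<lambda>a. if a < n * n \<and> {a div n, a mod n} \<in> edges G then 1 else 0),
       outp = []\<rparr>)"

text \<open>A biclique with parts \<open>A\<close> and \<open>B\<close> is written as \<open>|A|\<close>, \<open>|B|\<close>, the elements of \<open>A\<close>, the elements
  of \<open>B\<close>; the output is the concatenation of these blocks.\<close>

definition encode_parts :: "nat list \<times> nat list \<Rightarrow> nat list" where
  "encode_parts = (\<lambda>(as, bs). length as # length bs # as @ bs)"

definition represents :: "nat list \<Rightarrow> nat ugraph multiset \<Rightarrow> bool" where
  "represents xs \<B> \<longleftrightarrow>
     (\<exists>ps. xs = concat (map encode_parts ps) \<and>
           \<B> = mset (map (\<lambda>(as, bs). join_graph (set as) (set bs)) ps))"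

lemma encode_parts_unique:
  assumes "concat (map encode_parts ps) = concat (map encode_parts qs)"
  shows "ps = qs"
  using assms
proof (induction ps arbitrary: qs)
  case Nil
  then show ?case by (cases qs) (auto simp: encode_parts_def split: prod.splits)
next
  case (Cons p ps)
  then obtain q qs' where qs: "qs = q # qs'"
    by (cases qs) (auto simp: encode_parts_def split: prod.splits)
  obtain a b where p: "p = (a, b)" by (cases p)
  obtain a' b' where q: "q = (a', b')" by (cases q)
  show ?case
    using Cons.prems Cons.IH[of qs'] unfolding qs p q
    by (auto simp: encode_parts_def)
qed

lemma represents_unique:
  "represents xs \<B> \<Longrightarrow> represents xs \<C> \<Longrightarrow> \<B> = \<C>"
  unfolding represents_def using encode_parts_unique by blast

text \<open>The probability that within \<open>t\<close> steps the program halts with an output satisfying \<open>Q\<close>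
  (a halted machine does not change its state any more).\<close>

definition success_prob ::
  "program \<Rightarrow> nat \<Rightarrow> nat \<Rightarrow> nat ugraph \<Rightarrow> (nat ugraph multiset \<Rightarrow> bool) \<Rightarrow> real" where
  "success_prob P k t G Q =
     measure_pmf.prob (run (word_max k (card (verts G))) P t (init_state G))
       {\<sigma>. halted P \<sigma> \<and> (\<exists>\<B>. represents (outp \<sigma>) \<B> \<and> Q \<B>)}"

text \<open>\<open>p n G\<close> tends to \<open>1\<close> as \<open>n \<rightarrow> \<infinity>\<close>, uniformly over the \<open>n\<close>-vertex graphs \<open>G\<close> with property
  \<open>\<Phi>\<close>.\<close>

definition whp :: "(nat ugraph \<Rightarrow> bool) \<Rightarrow> (nat \<Rightarrow> nat ugraph \<Rightarrow> real) \<Rightarrow> bool" where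
  "whp \<Phi> p \<longleftrightarrow>
     (\<forall>\<epsilon>>0. \<forall>\<^sub>F n in sequentially. \<forall>G.
        simple_graph G \<and> verts G = {0..<n} \<and> \<Phi> G \<longrightarrow> p n G \<ge> 1 - \<epsilon>)"

end

theory Submission
  imports Defs "HOL-Real_Asymp.Real_Asymp"
begin

text \<open>If the rows of the adjacency matrix are listed in an order along which the columns alternate
  \<open>A\<close> times in total, then the positions of the neighbors of a vertex decompose into dyadic blocks,
  \<open>O(log n)\<close> of them per alternation. Each block together with the vertices using it is a biclique;
  orienting the edges along the order makes these a decomposition of size \<open>O((n + A) log n)\<close>,
  whatever the order is.

  A good order comes from hierarchical clustering: in the round with sample size \<open>m = n, n / 2, n / 4, \<dots>\<close>
  the current representatives are grouped by their traces on \<open>m\<close> random columns, the lists of each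
  group are concatenated, and a random member represents the group. Placing a list next to another one
  costs at most the Hamming distances of their representatives to the new one. By exchangeability of
  \<open>m + 1\<close> random columns, the expected distance is controlled by the edge density of the one-inclusion
  graph of the traces (Haussler's argument), that is by the VC dimension, which polynomial neighborhood
  complexity bounds by a constant. The round thus costs \<open>O(n r / m)\<close>, where the number \<open>r\<close> of
  representatives is at most the neighborhood complexity at the previous sample size. The best of
  \<open>O(log n)\<close> independent attempts is good with probability at least \<open>1 - 1 / n\<close>.\<close>

section \<open>Counting measure on finite sequences of draws\<close>

section \<open>Random tapes\<close>

text \<open>The program must not depend on \<open>c\<close> and \<open>d\<close>, so no sample size
  can be tuned to them; running through all scales \<open>n div 2 ^ i\<close> replaces the tuning.
  Scales that are wrong for the given exponent do no harm: the number of representatives entering a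
  round is bounded both by \<open>n\<close> and by \<open>c m^d\<close>, and the resulting costs, of
  order \<open>n min(n / m, c m^(d - 1))\<close>, form two geometric sums. Halving also keeps one
  clustering within quadratic time.

  Chance affects only the size, since every tape leads to a decomposition. The alternations of an
  ordering can be counted outright in quadratic time, so the best of several orderings can be
  selected; this turns a bound on an expectation into one that holds with high probability.

  Probabilities are handled by counting: the draws are read from a tape fixed beforehand, and
  expectations are sums over all tapes of a given length. Between the clustering and the RAM stands
  a small loop language whose semantics records running times and word sizes, so that machine code
  is analysed only once, in the proof of the compiler.\<close>

definition tapes :: "nat \<Rightarrow> nat \<Rightarrow> nat list set" where
  "tapes n k = {xs. length xs = k \<and> set xs \<subseteq> {..<n}}"

lemma tapes_0 [simp]: "tapes n 0 = {[]}"
  by (auto simp: tapes_def)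

lemma tapes_Suc: "tapes n (Suc k) = (\<lambda>(x, xs). x # xs) ` ({..<n} \<times> tapes n k)"
  by (auto simp: tapes_def length_Suc_conv image_iff)

lemma finite_tapes [simp]: "finite (tapes n k)"
  unfolding tapes_def using finite_lists_length_eq[of "{..<n}" k] by (simp add: conj_commute)

lemma card_tapes [simp]: "card (tapes n k) = n ^ k"
  unfolding tapes_def using card_lists_length_eq[of "{..<n}" k] by (simp add: conj_commute)

lemma tapes_nonempty: "n > 0 \<Longrightarrow> tapes n k \<noteq> {}"
  by (metis card.empty card_tapes less_irrefl zero_less_power)

lemma sum_tapes_Suc: "(\<Sum>t\<in>tapes n (Suc k). f t) = (\<Sum>x<n. \<Sum>t\<in>tapes n k. f (x # t))"
  unfolding tapes_Suc
  by (subst sum.reindex) (auto simp: inj_on_def sum.cartesian_product case_prod_unfold)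

text \<open>Independence of consecutive segments of a tape. Expectations over tapes of length
  \<open>k\<close> appear throughout as plain sums, compared with multiples of
  \<open>n ^ k\<close>.\<close>

lemma sum_tapes_add:
  "(\<Sum>t\<in>tapes n (j + k). f t) = (\<Sum>s\<in>tapes n j. \<Sum>t\<in>tapes n k. f (s @ t))"
  by (induction j arbitrary: f) (simp_all add: sum_tapes_Suc)

lemma tapes_Suc_pmf:
  assumes "n > 0"
  shows "pmf_of_set (tapes n (Suc k)) =
    bind_pmf (pmf_of_set {0..<n}) (\<lambda>x. map_pmf ((#) x) (pmf_of_set (tapes n k)))"
proof -
  have ne: "{..<n} \<noteq> {}" "tapes n k \<noteq> {}" using assms tapes_nonempty by auto
  have "pmf_of_set (tapes n (Suc k)) =
      map_pmf (\<lambda>(x, xs). x # xs) (pmf_of_set ({..<n} \<times> tapes n k))"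
    unfolding tapes_Suc using ne
    by (subst map_pmf_of_set_inj) (auto simp: inj_on_def)
  also have "pmf_of_set ({..<n} \<times> tapes n k) = pair_pmf (pmf_of_set {..<n}) (pmf_of_set (tapes n k))"
    using ne by (intro pmf_eqI) (auto simp: pmf_pair indicator_def pmf_of_set[OF ne(1)] pmf_of_set[OF ne(2)])
  finally show ?thesis
    by (simp add: pair_pmf_def map_bind_pmf map_pmf_def bind_assoc_pmf bind_return_pmf lessThan_atLeast0)
qed

section \<open>Drawing step by step versus reading a tape fixed beforehand\<close>

section \<open>Execution with a random tape\<close>

fun det_exec :: "nat \<Rightarrow> instr \<Rightarrow> ram_state \<Rightarrow> ram_state" where
  "det_exec M (LoadConst i v) \<sigma> = set_reg M i v \<sigma>"
| "det_exec M (Arith f i j k) \<sigma> = set_reg M i (arith f (regs \<sigma> j) (regs \<sigma> k)) \<sigma>"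
| "det_exec M (Load i j) \<sigma> = set_reg M i (mem \<sigma> (regs \<sigma> j)) \<sigma>"
| "det_exec M (Store i j) \<sigma> = \<sigma>\<lparr>pc := Suc (pc \<sigma>), mem := (mem \<sigma>)(regs \<sigma> i := regs \<sigma> j)\<rparr>"
| "det_exec M (Rand i j) \<sigma> = \<sigma>"
| "det_exec M (Write i) \<sigma> = \<sigma>\<lparr>pc := Suc (pc \<sigma>), outp := outp \<sigma> @ [regs \<sigma> i]\<rparr>"
| "det_exec M (Jump l) \<sigma> = \<sigma>\<lparr>pc := l\<rparr>"
| "det_exec M (JumpIfZero i l) \<sigma> = \<sigma>\<lparr>pc := (if regs \<sigma> i = 0 then l else Suc (pc \<sigma>))\<rparr>"

fun is_rand :: "instr \<Rightarrow> bool" where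
  "is_rand (Rand i j) = True"
| "is_rand _ = False"

fun tape_exec :: "nat \<Rightarrow> instr \<Rightarrow> ram_state \<times> nat list \<Rightarrow> ram_state \<times> nat list" where
  "tape_exec M (Rand i j) (\<sigma>, xs) = (set_reg M i (hd xs) \<sigma>, tl xs)"
| "tape_exec M ins (\<sigma>, xs) = (det_exec M ins \<sigma>, xs)"

lemma tape_exec_det: "\<not> is_rand ins \<Longrightarrow> tape_exec M ins (\<sigma>, xs) = (det_exec M ins \<sigma>, xs)"
  by (cases ins) auto

definition tape_step :: "nat \<Rightarrow> program \<Rightarrow> ram_state \<times> nat list \<Rightarrow> ram_state \<times> nat list" where
  "tape_step M P c = (if halted P (fst c) then c else tape_exec M (P ! pc (fst c)) c)"

text \<open>Instructions that keep the number of vertices in register 0 and draw only from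
  \<open>{0..<n}\<close>, so that the draws can be made in advance.\<close>

fun keeps_size :: "instr \<Rightarrow> bool" where
  "keeps_size (LoadConst i v) = (i \<noteq> 0)"
| "keeps_size (Arith f i j k) = (i \<noteq> 0)"
| "keeps_size (Load i j) = (i \<noteq> 0)"
| "keeps_size (Rand i j) = (i \<noteq> 0 \<and> j = 0)"
| "keeps_size _ = True"

lemma regs0_det_exec: "keeps_size ins \<Longrightarrow> regs (det_exec M ins \<sigma>) 0 = regs \<sigma> 0"
  by (cases ins) (auto simp: set_reg_def)

lemma exec_det: "\<not> is_rand ins \<Longrightarrow> exec M ins \<sigma> = return_pmf (det_exec M ins \<sigma>)"
  by (cases ins) auto

text \<open>The head of a uniform tape is uniform and independent of its tail, so reading it is the
  same as drawing. A step consumes at most one cell, hence any length \<open>k \<ge> t\<close> will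
  do. The induction relies on this freedom: a deterministic step lowers \<open>t\<close> but leaves
  the tape as long as it was.\<close>

lemma run_eq_tape:
  assumes "\<And>ins. ins \<in> set P \<Longrightarrow> keeps_size ins" "n > 0" "regs \<sigma> 0 = n" "t \<le> k"
  shows "run M P t \<sigma> =
    map_pmf (\<lambda>xs. fst ((tape_step M P ^^ t) (\<sigma>, xs))) (pmf_of_set (tapes n k))"
  using assms(3,4)
proof (induction t arbitrary: \<sigma> k)
  case 0
  show ?case by (simp add: map_pmf_const)
next
  case (Suc t)
  show ?case
  proof (cases "halted P \<sigma>")
    case True
    then have "step M P \<sigma> = return_pmf \<sigma>" by (simp add: step_def)
    moreover have "tape_step M P (\<sigma>, xs) = (\<sigma>, xs)" for xs
      using True by (simp add: tape_step_def)
    ultimately show ?thesis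
      using Suc by (simp add: bind_return_pmf funpow_swap1 del: funpow.simps add: funpow_Suc_right)
  next
    case False
    then have in_P: "P ! pc \<sigma> \<in> set P" by (simp add: halted_def)
    show ?thesis
    proof (cases "is_rand (P ! pc \<sigma>)")
      case False
      let ?\<tau> = "det_exec M (P ! pc \<sigma>) \<sigma>"
      have "step M P \<sigma> = return_pmf ?\<tau>"
        using False \<open>\<not> halted P \<sigma>\<close> by (simp add: step_def exec_det)
      moreover have "tape_step M P (\<sigma>, xs) = (?\<tau>, xs)" for xs
        using False \<open>\<not> halted P \<sigma>\<close> by (simp add: tape_step_def tape_exec_det)
      moreover have "regs ?\<tau> 0 = n"
        using assms(1)[OF in_P] Suc.prems by (simp add: regs0_det_exec)
      ultimately show ?thesis
        using Suc.IH[of ?\<tau> k] Suc.prems by (simp add: bind_return_pmf funpow_Suc_right del: funpow.simps)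
    next
      case True
      then obtain i j where ij: "P ! pc \<sigma> = Rand i j" by (cases "P ! pc \<sigma>") auto
      then have "i \<noteq> 0" "j = 0" using assms(1)[OF in_P] by auto
      then have step: "step M P \<sigma> = map_pmf (\<lambda>v. set_reg M i v \<sigma>) (pmf_of_set {0..<n})"
        using ij \<open>\<not> halted P \<sigma>\<close> Suc.prems assms(2) by (simp add: step_def)
      have tstep: "tape_step M P (\<sigma>, xs) = (set_reg M i (hd xs) \<sigma>, tl xs)" for xs
        using ij \<open>\<not> halted P \<sigma>\<close> by (simp add: tape_step_def)
      obtain k' where k: "k = Suc k'" "t \<le> k'" using Suc.prems by (cases k) auto
      have IH: "run M P t (set_reg M i v \<sigma>) =
          map_pmf (\<lambda>xs. fst ((tape_step M P ^^ t) (set_reg M i v \<sigma>, xs))) (pmf_of_set (tapes n k'))" for v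
        using Suc.IH[of "set_reg M i v \<sigma>" k'] Suc.prems k \<open>i \<noteq> 0\<close> by (simp add: set_reg_def)
      show ?thesis
        unfolding k tapes_Suc_pmf[OF assms(2)]
        by (simp add: step tstep IH map_bind_pmf bind_map_pmf map_pmf_comp funpow_Suc_right del: funpow.simps)
    qed
  qed
qed

lemma halted_tape_steps: "halted P (fst c) \<Longrightarrow> (tape_step M P ^^ t) c = c"
  by (induction t) (auto simp: tape_step_def)

text \<open>Halted states are absorbing, so runs that stop at different times up to \<open>T\<close>
  may all be inspected at time \<open>T\<close>. What remains of the probability is the share of
  good tapes among all \<open>n ^ k\<close>.\<close>

lemma success_prob_ge:
  assumes good: "\<And>ins. ins \<in> set P \<Longrightarrow> keeps_size ins"
    and n: "n > 0" "card (verts G) = n" and k: "T \<le> k"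
    and succ: "\<And>xs. xs \<in> A \<Longrightarrow> \<exists>t\<le>T. \<exists>\<sigma> ys. (tape_step (word_max K n) P ^^ t) (init_state G, xs) = (\<sigma>, ys) \<and>
       halted P \<sigma> \<and> (\<exists>\<B>. represents (outp \<sigma>) \<B> \<and> Q \<B>)"
    and A: "A \<subseteq> tapes n k"
  shows "success_prob P K T G Q \<ge> real (card A) / real n ^ k"
proof -
  let ?M = "word_max K n"
  let ?good = "{\<sigma>. halted P \<sigma> \<and> (\<exists>\<B>. represents (outp \<sigma>) \<B> \<and> Q \<B>)}"
  let ?f = "\<lambda>xs. fst ((tape_step ?M P ^^ T) (init_state G, xs))"
  have "?f xs \<in> ?good" if "xs \<in> A" for xs
  proof -
    from succ[OF that] obtain t \<sigma> ys where *: "t \<le> T"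
      "(tape_step ?M P ^^ t) (init_state G, xs) = (\<sigma>, ys)" "halted P \<sigma>"
      "\<exists>\<B>. represents (outp \<sigma>) \<B> \<and> Q \<B>" by blast
    have "(tape_step ?M P ^^ T) (init_state G, xs) =
        (tape_step ?M P ^^ (T - t)) ((tape_step ?M P ^^ t) (init_state G, xs))"
      using \<open>t \<le> T\<close> by (simp flip: funpow_add comp_apply[of "_ ^^ _" "_ ^^ _"])
    then show ?thesis using * by (simp add: halted_tape_steps)
  qed
  then have sub: "A \<subseteq> ?f -` ?good" by auto
  have "regs (init_state G) 0 = n" using n by (simp add: init_state_def Let_def)
  from run_eq_tape[where M = ?M, OF good n(1) this k]
  have "success_prob P K T G Q = measure_pmf.prob (pmf_of_set (tapes n k)) (?f -` ?good)"
    unfolding success_prob_def n(2) by simp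
  also have "\<dots> = card (tapes n k \<inter> ?f -` ?good) / card (tapes n k)"
    by (intro measure_pmf_of_set) (auto simp: tapes_nonempty n)
  also have "\<dots> \<ge> card A / card (tapes n k)"
    using A sub by (intro divide_right_mono) (auto intro!: card_mono)
  finally show ?thesis by simp
qed

section \<open>Structured programs whose semantics records time and word sizes\<close>

section \<open>A loop language compiled to the RAM\<close>

text \<open>The state separates the input size \<open>vsize\<close>, the input matrix \<open>vadj\<close>, the word bound
  \<open>wmax\<close> (all constant), variables, 16 arrays of unbounded length, the tape and the output.\<close>

record loop_state =
  vsize :: nat
  vadj :: "nat \<Rightarrow> nat \<Rightarrow> nat"
  wmax :: nat
  vars :: "nat \<Rightarrow> nat"
  arrs :: "nat \<Rightarrow> nat \<Rightarrow> nat"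
  tape :: "nat list"
  outs :: "nat list"

datatype aexp = Const nat | Var nat | Size | Bin arith_op aexp aexp | Get nat aexp | Adj aexp aexp

datatype com = Assign nat aexp | Put nat aexp aexp | Emit aexp | Draw nat
  | Seq com com (infixr ";;" 60) | If aexp com com | For nat aexp com

abbreviation "Skip \<equiv> For 0 (Const 0) (Assign 0 (Const 0))"

primrec aval :: "aexp \<Rightarrow> loop_state \<Rightarrow> nat" where
  "aval (Const c) s = c"
| "aval (Var x) s = vars s x"
| "aval Size s = vsize s"
| "aval (Bin f a b) s = arith f (aval a s) (aval b s)"
| "aval (Get a e) s = arrs s a (aval e s)"
| "aval (Adj a b) s = vadj s (aval a s) (aval b s)"

text \<open>The machine is stuck as soon as it would assign a number above the word bound. So every
  value that the compiled code puts into a register has to be bounded, including intermediate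
  addresses and the constant 16 used in computing them.\<close>

primrec aok :: "aexp \<Rightarrow> loop_state \<Rightarrow> bool" where
  "aok (Const c) s = (c \<le> wmax s)"
| "aok (Var x) s = (vars s x \<le> wmax s)"
| "aok Size s = (vsize s \<le> wmax s)"
| "aok (Bin f a b) s = (aok a s \<and> aok b s \<and> arith f (aval a s) (aval b s) \<le> wmax s)"
| "aok (Get a e) s = (aok e s \<and> a < 16 \<and> 16 \<le> wmax s \<and>
     vsize s * vsize s + (16 * aval e s + a) \<le> wmax s \<and> arrs s a (aval e s) \<le> wmax s)"
| "aok (Adj a b) s = (aok a s \<and> aok b s \<and> aval a s < vsize s \<and> aval b s < vsize s \<and>
     vsize s * vsize s \<le> wmax s \<and> vadj s (aval a s) (aval b s) \<le> wmax s)"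

text \<open>Expressions compile to straight-line code, so this is both the length of the code and
  its exact running time.\<close>

primrec alen :: "aexp \<Rightarrow> nat" where
  "alen (Const c) = 1"
| "alen (Var x) = 2"
| "alen Size = 2"
| "alen (Bin f a b) = alen a + alen b + 1"
| "alen (Get a e) = alen e + 6"
| "alen (Adj a b) = alen a + alen b + 3"

abbreviation set_var :: "nat \<Rightarrow> nat \<Rightarrow> loop_state \<Rightarrow> loop_state" where
  "set_var x k s \<equiv> s\<lparr>vars := (vars s)(x := k)\<rparr>"

text \<open>The bound of a loop is evaluated once, on entry, and the counter is kept apart from the
  variables; so the body may change the loop variable and whatever the bound was computed
  from.\<close>

primrec sem :: "com \<Rightarrow> loop_state \<Rightarrow> loop_state" where
  "sem (Assign x e) s = set_var x (aval e s) s"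
| "sem (Put a e1 e2) s = s\<lparr>arrs := (arrs s)(a := (arrs s a)(aval e1 s := aval e2 s))\<rparr>"
| "sem (Emit e) s = s\<lparr>outs := outs s @ [aval e s]\<rparr>"
| "sem (Draw x) s = set_var x (hd (tape s)) (s\<lparr>tape := tl (tape s)\<rparr>)"
| "sem (c1 ;; c2) s = sem c2 (sem c1 s)"
| "sem (If e c1 c2) s = (if aval e s \<noteq> 0 then sem c1 s else sem c2 s)"
| "sem (For x e c) s = fold (\<lambda>k s. sem c (set_var x k s)) [0..<aval e s] s"

abbreviation iter :: "nat \<Rightarrow> com \<Rightarrow> nat \<Rightarrow> loop_state \<Rightarrow> loop_state" where
  "iter x c k s \<equiv> fold (\<lambda>k s. sem c (set_var x k s)) [0..<k] s"

primrec cok :: "com \<Rightarrow> loop_state \<Rightarrow> bool" where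
  "cok (Assign x e) s = aok e s"
| "cok (Put a e1 e2) s = (aok e1 s \<and> aok e2 s \<and> a < 16 \<and> 16 \<le> wmax s \<and>
     vsize s * vsize s + (16 * aval e1 s + a) \<le> wmax s)"
| "cok (Emit e) s = aok e s"
| "cok (Draw x) s = (tape s \<noteq> [] \<and> hd (tape s) \<le> wmax s)"
| "cok (c1 ;; c2) s = (cok c1 s \<and> cok c2 (sem c1 s))"
| "cok (If e c1 c2) s = (aok e s \<and> (if aval e s \<noteq> 0 then cok c1 s else cok c2 s))"
| "cok (For x e c) s = (aok e s \<and> (\<forall>k<aval e s. cok c (set_var x k (iter x c k s))))"

text \<open>An upper bound, since only one branch of a conditional executes the closing jump. An
  iteration of a loop has 7 instructions besides the body: 4 that test and copy the counter, 3 that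
  increment it and jump back. Of the 3 outside the iterations, one initializes the counter and two
  perform the final test.\<close>

primrec cost :: "com \<Rightarrow> loop_state \<Rightarrow> nat" where
  "cost (Assign x e) s = alen e + 2"
| "cost (Put a e1 e2) s = alen e1 + alen e2 + 6"
| "cost (Emit e) s = alen e + 1"
| "cost (Draw x) s = 1"
| "cost (c1 ;; c2) s = cost c1 s + cost c2 (sem c1 s)"
| "cost (If e c1 c2) s = alen e + 2 + (if aval e s \<noteq> 0 then cost c1 s else cost c2 s)"
| "cost (For x e c) s = alen e + 3 + (\<Sum>k<aval e s. cost c (set_var x k (iter x c k s)) + 7)"

text \<open>Register 0 holds the size, register 1 its square (where the arrays begin, interleaved);
  variables live in the even registers from 2 on and temporaries in the odd ones from 3 on.\<close>

definition vreg :: "nat \<Rightarrow> nat" where "vreg x = 2 * x + 2"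
definition treg :: "nat \<Rightarrow> nat" where "treg t = 2 * t + 3"

lemma reg_simps [simp]:
  "vreg x \<noteq> treg t" "treg t \<noteq> vreg x" "vreg x = vreg y \<longleftrightarrow> x = y" "treg t = treg u \<longleftrightarrow> t = u"
  "vreg x \<noteq> 0" "vreg x \<noteq> Suc 0" "treg t \<noteq> 0" "treg t \<noteq> Suc 0"
  "0 \<noteq> vreg x" "Suc 0 \<noteq> vreg x" "0 \<noteq> treg t" "Suc 0 \<noteq> treg t"
  unfolding vreg_def treg_def by presburger+

abbreviation addr_code :: "nat \<Rightarrow> nat \<Rightarrow> program" where
  "addr_code a t \<equiv> [LoadConst (treg (Suc t)) 16, Arith Mul (treg t) (treg t) (treg (Suc t)),
     LoadConst (treg (Suc t)) a, Arith Add (treg t) (treg t) (treg (Suc t)),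
     Arith Add (treg t) (Suc 0) (treg t)]"

primrec acomp :: "aexp \<Rightarrow> nat \<Rightarrow> program" where
  "acomp (Const c) t = [LoadConst (treg t) c]"
| "acomp (Var x) t = [LoadConst (treg t) 0, Arith Add (treg t) (treg t) (vreg x)]"
| "acomp Size t = [LoadConst (treg t) 0, Arith Add (treg t) (treg t) 0]"
| "acomp (Bin f a b) t =
     acomp a t @ acomp b (Suc t) @ [Arith f (treg t) (treg t) (treg (Suc t))]"
| "acomp (Get a e) t = acomp e t @ addr_code a t @ [Load (treg t) (treg t)]"
| "acomp (Adj a b) t = acomp a t @ acomp b (Suc t) @ [Arith Mul (treg t) (treg t) 0,
     Arith Add (treg t) (treg t) (treg (Suc t)), Load (treg t) (treg t)]"

primrec clen :: "com \<Rightarrow> nat" where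
  "clen (Assign x e) = alen e + 2"
| "clen (Put a e1 e2) = alen e1 + alen e2 + 6"
| "clen (Emit e) = alen e + 1"
| "clen (Draw x) = 1"
| "clen (c1 ;; c2) = clen c1 + clen c2"
| "clen (If e c1 c2) = alen e + 2 + clen c1 + clen c2"
| "clen (For x e c) = alen e + 8 + clen c"

text \<open>Jump targets are absolute, so the address \<open>p\<close> of the code is a parameter. A
  loop claims the temporaries \<open>t\<close>, \<open>t + 1\<close> and \<open>t + 2\<close> for
  counter, bound and scratch space, and its body is compiled from \<open>t + 3\<close> on.\<close>

primrec ccomp :: "com \<Rightarrow> nat \<Rightarrow> nat \<Rightarrow> program" where
  "ccomp (Assign x e) t p =
     acomp e t @ [LoadConst (vreg x) 0, Arith Add (vreg x) (vreg x) (treg t)]"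
| "ccomp (Put a e1 e2) t p =
     acomp e1 t @ addr_code a t @ acomp e2 (Suc t) @ [Store (treg t) (treg (Suc t))]"
| "ccomp (Emit e) t p = acomp e t @ [Write (treg t)]"
| "ccomp (Draw x) t p = [Rand (vreg x) 0]"
| "ccomp (c1 ;; c2) t p = ccomp c1 t p @ ccomp c2 t (p + clen c1)"
| "ccomp (If e c1 c2) t p = acomp e t @ [JumpIfZero (treg t) (p + alen e + 2 + clen c1)] @
     ccomp c1 t (p + alen e + 1) @ [Jump (p + alen e + 2 + clen c1 + clen c2)] @
     ccomp c2 t (p + alen e + 2 + clen c1)"
| "ccomp (For x e c) t p = acomp e (Suc t) @ [LoadConst (treg t) 0] @
     [Arith Sub (treg (t + 2)) (treg (Suc t)) (treg t),
      JumpIfZero (treg (t + 2)) (p + alen e + 8 + clen c),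
      LoadConst (vreg x) 0, Arith Add (vreg x) (vreg x) (treg t)] @
     ccomp c (t + 3) (Suc (Suc (Suc (Suc (Suc (p + alen e)))))) @
     [LoadConst (treg (t + 2)) 1, Arith Add (treg t) (treg t) (treg (t + 2)),
      Jump (p + alen e + 1)]"

lemma length_acomp [simp]: "length (acomp e t) = alen e"
  by (induction e arbitrary: t) auto

lemma length_ccomp [simp]: "length (ccomp c t p) = clen c"
  by (induction c arbitrary: t p) auto

lemma keeps_size_acomp: "ins \<in> set (acomp e t) \<Longrightarrow> keeps_size ins"
  by (induction e arbitrary: t) auto

lemma keeps_size_ccomp: "ins \<in> set (ccomp c t p) \<Longrightarrow> keeps_size ins"
  by (induction c arbitrary: t p) (auto dest: keeps_size_acomp)

lemma aval_le_wmax: "aok e s \<Longrightarrow> aval e s \<le> wmax s"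
  by (cases e) auto

section \<open>Forward simulation of loop programs by the machine\<close>

subsection \<open>Correctness of the compiler\<close>

definition code_at :: "program \<Rightarrow> nat \<Rightarrow> program \<Rightarrow> bool" where
  "code_at P p is \<longleftrightarrow> (\<forall>i<length is. p + i < length P \<and> P ! (p + i) = is ! i)"

lemma code_at_Nil [simp]: "code_at P p []"
  by (simp add: code_at_def)

lemma code_at_Cons [simp]:
  "code_at P p (i # is) \<longleftrightarrow> p < length P \<and> P ! p = i \<and> code_at P (Suc p) is"
  by (auto simp: code_at_def less_Suc_eq_0_disj nth_Cons')

lemma code_at_append [simp]:
  "code_at P p (is @ js) \<longleftrightarrow> code_at P p is \<and> code_at P (p + length is) js"
  by (induction "is" arbitrary: p) auto

definition reach :: "nat \<Rightarrow> program \<Rightarrow> nat \<Rightarrow> ram_state \<times> nat list \<Rightarrow> ram_state \<times> nat list \<Rightarrow> bool" where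
  "reach M P k c c' \<longleftrightarrow> (tape_step M P ^^ k) c = c'"

lemma reach_0: "reach M P 0 c c"
  by (simp add: reach_def)

lemma reach_trans: "reach M P j a b \<Longrightarrow> reach M P k b c \<Longrightarrow> reach M P (j + k) a c"
  unfolding reach_def by (subst add.commute) (simp add: funpow_add)

lemma reach_step: "pc \<sigma> < length P \<Longrightarrow> tape_exec M (P ! pc \<sigma>) (\<sigma>, xs) = c \<Longrightarrow> reach M P 1 (\<sigma>, xs) c"
  by (simp add: reach_def tape_step_def halted_def)

primrec advances :: "nat \<Rightarrow> program \<Rightarrow> ram_state \<Rightarrow> bool" where
  "advances M [] \<sigma> \<longleftrightarrow> True"
| "advances M (i # is) \<sigma> \<longleftrightarrow> \<not> is_rand i \<and> pc (det_exec M i \<sigma>) = Suc (pc \<sigma>) \<and>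
     advances M is (det_exec M i \<sigma>)"

lemma reach_line:
  "code_at P (pc \<sigma>) is \<Longrightarrow> advances M is \<sigma> \<Longrightarrow> length is = k \<Longrightarrow>
    reach M P k (\<sigma>, xs) (fold (det_exec M) is \<sigma>, xs)"
proof (induction "is" arbitrary: \<sigma> k)
  case Nil
  then show ?case by (simp add: reach_0)
next
  case (Cons i "is")
  have "reach M P 1 (\<sigma>, xs) (det_exec M i \<sigma>, xs)"
    using Cons.prems by (intro reach_step) (auto simp: tape_exec_det)
  moreover have "reach M P (length is) (det_exec M i \<sigma>, xs) (fold (det_exec M) is (det_exec M i \<sigma>), xs)"
    using Cons by auto
  ultimately have "reach M P (1 + length is) (\<sigma>, xs) (fold (det_exec M) is (det_exec M i \<sigma>), xs)"
    by (rule reach_trans)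
  then show ?case using Cons.prems by simp
qed

text \<open>The tape is missing because it is not part of the machine state but travels beside it;
  \<open>ends_in\<close> compares it directly.\<close>

definition sim :: "loop_state \<Rightarrow> ram_state \<Rightarrow> bool" where
  "sim s \<sigma> \<longleftrightarrow> regs \<sigma> 0 = vsize s \<and> regs \<sigma> (Suc 0) = vsize s * vsize s \<and>
     (\<forall>x. regs \<sigma> (vreg x) = vars s x) \<and>
     (\<forall>a i. a < 16 \<longrightarrow> mem \<sigma> (vsize s * vsize s + (16 * i + a)) = arrs s a i) \<and>
     (\<forall>u v. u < vsize s \<longrightarrow> v < vsize s \<longrightarrow> mem \<sigma> (u * vsize s + v) = vadj s u v) \<and>
     outp \<sigma> = outs s"

definition same_but_temps :: "nat \<Rightarrow> ram_state \<Rightarrow> ram_state \<Rightarrow> bool" where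
  "same_but_temps t \<sigma> \<sigma>' \<longleftrightarrow> mem \<sigma>' = mem \<sigma> \<and> outp \<sigma>' = outp \<sigma> \<and>
     (\<forall>r. (\<forall>j\<ge>t. r \<noteq> treg j) \<longrightarrow> regs \<sigma>' r = regs \<sigma> r)"

lemma same_but_temps_refl: "same_but_temps t \<sigma> \<sigma>"
  by (simp add: same_but_temps_def)

lemma same_but_temps_trans:
  "same_but_temps t \<sigma> \<sigma>' \<Longrightarrow> same_but_temps t' \<sigma>' \<sigma>'' \<Longrightarrow> t \<le> t' \<Longrightarrow> same_but_temps t \<sigma> \<sigma>''"
  unfolding same_but_temps_def by (metis le_trans)

lemma same_but_temps_sim: "same_but_temps t \<sigma> \<sigma>' \<Longrightarrow> sim s \<sigma> \<Longrightarrow> sim s \<sigma>'"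
proof -
  assume *: "same_but_temps t \<sigma> \<sigma>'" "sim s \<sigma>"
  have "regs \<sigma>' (vreg x) = regs \<sigma> (vreg x)" for x
    using * reg_simps unfolding same_but_temps_def by blast
  moreover have "regs \<sigma>' 0 = regs \<sigma> 0" "regs \<sigma>' (Suc 0) = regs \<sigma> (Suc 0)"
    using * unfolding same_but_temps_def by auto
  ultimately show ?thesis using * unfolding same_but_temps_def sim_def by simp
qed

lemma same_but_temps_treg: "same_but_temps t \<sigma> \<sigma>' \<Longrightarrow> j < t \<Longrightarrow> regs \<sigma>' (treg j) = regs \<sigma> (treg j)"
  unfolding same_but_temps_def by auto

lemma same_but_temps_upd:
  "same_but_temps t \<sigma> \<tau> \<Longrightarrow> t \<le> j \<Longrightarrow>
    same_but_temps t \<sigma> (\<tau>\<lparr>pc := p, regs := (regs \<tau>)(treg j := v)\<rparr>)"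
  unfolding same_but_temps_def by auto

lemma addr_bound: "(u::nat) < n \<Longrightarrow> v < n \<Longrightarrow> u * n + v < n * n"
proof -
  assume "u < n" "v < n"
  then have "Suc u * n \<le> n * n" by (intro mult_le_mono1) simp
  then show ?thesis using \<open>v < n\<close> by simp
qed

lemma acomp_correct:
  assumes "code_at P (pc \<sigma>) (acomp e t)" "sim s \<sigma>" "aok e s"
  shows "\<exists>\<sigma>'. (\<forall>xs. reach (wmax s) P (alen e) (\<sigma>, xs) (\<sigma>', xs)) \<and> pc \<sigma>' = pc \<sigma> + alen e \<and>
    regs \<sigma>' (treg t) = aval e s \<and> same_but_temps t \<sigma> \<sigma>'"
  using assms
proof (induction e arbitrary: t \<sigma>)
  case (Const c)
  let ?is = "acomp (Const c) t"
  have "reach (wmax s) P 1 (\<sigma>, xs) (fold (det_exec (wmax s)) ?is \<sigma>, xs)" for xs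
    by (rule reach_line) (use Const in \<open>auto simp: set_reg_def\<close>)
  then show ?case using Const
    by (intro exI[of _ "fold (det_exec (wmax s)) ?is \<sigma>"])
       (auto simp: set_reg_def same_but_temps_def simp del: One_nat_def)
next
  case (Var x)
  let ?is = "acomp (Var x) t"
  have *: "regs \<sigma> (vreg x) = vars s x" using Var by (simp add: sim_def)
  have "reach (wmax s) P 2 (\<sigma>, xs) (fold (det_exec (wmax s)) ?is \<sigma>, xs)" for xs
    by (rule reach_line) (use Var *  in \<open>auto simp: set_reg_def\<close>)
  then show ?case using Var * 
    by (intro exI[of _ "fold (det_exec (wmax s)) ?is \<sigma>"])
       (auto simp: set_reg_def same_but_temps_def simp del: One_nat_def)
next
  case Size
  let ?is = "acomp Size t"
  have *: "regs \<sigma> 0 = vsize s" using Size by (simp add: sim_def)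
  have "reach (wmax s) P 2 (\<sigma>, xs) (fold (det_exec (wmax s)) ?is \<sigma>, xs)" for xs
    by (rule reach_line) (use Size * in \<open>auto simp: set_reg_def\<close>)
  then show ?case using Size *
    by (intro exI[of _ "fold (det_exec (wmax s)) ?is \<sigma>"])
       (auto simp: set_reg_def same_but_temps_def simp del: One_nat_def)
next
  case (Bin f a b)
  obtain \<sigma>1 where 1: "\<And>xs. reach (wmax s) P (alen a) (\<sigma>, xs) (\<sigma>1, xs)" "pc \<sigma>1 = pc \<sigma> + alen a"
    "regs \<sigma>1 (treg t) = aval a s" "same_but_temps t \<sigma> \<sigma>1"
    using Bin.IH(1)[of \<sigma> t] Bin.prems by auto
  obtain \<sigma>2 where 2: "\<And>xs. reach (wmax s) P (alen b) (\<sigma>1, xs) (\<sigma>2, xs)" "pc \<sigma>2 = pc \<sigma>1 + alen b"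
    "regs \<sigma>2 (treg (Suc t)) = aval b s" "same_but_temps (Suc t) \<sigma>1 \<sigma>2"
    using Bin.IH(2)[of \<sigma>1 "Suc t"] Bin.prems 1 by (auto simp: same_but_temps_sim)
  have t: "regs \<sigma>2 (treg t) = aval a s" using same_but_temps_treg[OF 2(4), of t] 1 by simp
  let ?is = "[Arith f (treg t) (treg t) (treg (Suc t))]"
  have "reach (wmax s) P 1 (\<sigma>2, xs) (fold (det_exec (wmax s)) ?is \<sigma>2, xs)" for xs
    by (rule reach_line) (use Bin.prems 1 2 t in \<open>auto simp: set_reg_def ac_simps\<close>)
  from reach_trans[OF reach_trans[OF 1(1) 2(1)] this]
  have "reach (wmax s) P (alen (Bin f a b)) (\<sigma>, xs) (fold (det_exec (wmax s)) ?is \<sigma>2, xs)" for xs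
    by simp
  then show ?case
    using Bin.prems 1 2 t same_but_temps_trans[OF 1(4) 2(4)]
    by (intro exI[of _ "fold (det_exec (wmax s)) ?is \<sigma>2"])
       (auto simp: set_reg_def intro!: same_but_temps_upd)
next
  case (Get a e)
  obtain \<sigma>1 where 1: "\<And>xs. reach (wmax s) P (alen e) (\<sigma>, xs) (\<sigma>1, xs)" "pc \<sigma>1 = pc \<sigma> + alen e"
    "regs \<sigma>1 (treg t) = aval e s" "same_but_temps t \<sigma> \<sigma>1"
    using Get.IH[of \<sigma> t] Get.prems by auto
  have sim: "sim s \<sigma>1" using 1 Get.prems same_but_temps_sim by blast
  then have r: "regs \<sigma>1 (Suc 0) = vsize s * vsize s"
    "mem \<sigma>1 (vsize s * vsize s + (16 * aval e s + a)) = arrs s a (aval e s)"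
    using Get.prems by (auto simp: sim_def)
  let ?is = "addr_code a t @ [Load (treg t) (treg t)]"
  have bnd: "16 \<le> wmax s" "a \<le> wmax s" "aval e s * 16 \<le> wmax s" "aval e s * 16 + a \<le> wmax s"
    "vsize s * vsize s + (aval e s * 16 + a) \<le> wmax s" "arrs s a (aval e s) \<le> wmax s"
    using Get.prems by auto
  have "reach (wmax s) P 6 (\<sigma>1, xs) (fold (det_exec (wmax s)) ?is \<sigma>1, xs)" for xs
    by (rule reach_line) (use Get.prems(1) 1 r bnd in \<open>auto simp: set_reg_def ac_simps\<close>)
  from reach_trans[OF 1(1) this]
  have "reach (wmax s) P (alen (Get a e)) (\<sigma>, xs) (fold (det_exec (wmax s)) ?is \<sigma>1, xs)" for xs
    by simp
  then show ?case
    using 1 r bnd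
    by (intro exI[of _ "fold (det_exec (wmax s)) ?is \<sigma>1"])
       (auto simp: set_reg_def same_but_temps_def ac_simps)
next
  case (Adj a b)
  obtain \<sigma>1 where 1: "\<And>xs. reach (wmax s) P (alen a) (\<sigma>, xs) (\<sigma>1, xs)" "pc \<sigma>1 = pc \<sigma> + alen a"
    "regs \<sigma>1 (treg t) = aval a s" "same_but_temps t \<sigma> \<sigma>1"
    using Adj.IH(1)[of \<sigma> t] Adj.prems by auto
  obtain \<sigma>2 where 2: "\<And>xs. reach (wmax s) P (alen b) (\<sigma>1, xs) (\<sigma>2, xs)" "pc \<sigma>2 = pc \<sigma>1 + alen b"
    "regs \<sigma>2 (treg (Suc t)) = aval b s" "same_but_temps (Suc t) \<sigma>1 \<sigma>2"
    using Adj.IH(2)[of \<sigma>1 "Suc t"] Adj.prems 1 by (auto simp: same_but_temps_sim)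
  have t: "regs \<sigma>2 (treg t) = aval a s" using same_but_temps_treg[OF 2(4), of t] 1 by simp
  have sim: "sim s \<sigma>2" using 1 2 Adj.prems same_but_temps_sim by blast
  then have r: "regs \<sigma>2 0 = vsize s"
    "mem \<sigma>2 (aval a s * vsize s + aval b s) = vadj s (aval a s) (aval b s)"
    using Adj.prems by (auto simp: sim_def)
  let ?is = "[Arith Mul (treg t) (treg t) 0, Arith Add (treg t) (treg t) (treg (Suc t)), Load (treg t) (treg t)]"
  have bnd: "aval a s * vsize s + aval b s \<le> wmax s" "vadj s (aval a s) (aval b s) \<le> wmax s"
    using Adj.prems addr_bound[of "aval a s" "vsize s" "aval b s"] by auto
  have "reach (wmax s) P 3 (\<sigma>2, xs) (fold (det_exec (wmax s)) ?is \<sigma>2, xs)" for xs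
    by (rule reach_line) (use Adj.prems(1) 1 2 r t bnd in \<open>auto simp: set_reg_def ac_simps\<close>)
  from reach_trans[OF reach_trans[OF 1(1) 2(1)] this]
  have "reach (wmax s) P (alen (Adj a b)) (\<sigma>, xs) (fold (det_exec (wmax s)) ?is \<sigma>2, xs)" for xs
    by simp
  then show ?case
    using 1 2 r t bnd same_but_temps_trans[OF 1(4) 2(4)]
    by (intro exI[of _ "fold (det_exec (wmax s)) ?is \<sigma>2"])
       (auto simp: set_reg_def same_but_temps_def ac_simps)
qed

text \<open>Here \<open>t\<close> is the number of temporaries in use by the enclosing loops.\<close>

definition ends_in :: "nat \<Rightarrow> program \<Rightarrow> nat \<Rightarrow> nat \<Rightarrow> nat \<Rightarrow> ram_state \<times> nat list \<Rightarrow> loop_state \<Rightarrow> bool" where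
  "ends_in M P k p t c s \<longleftrightarrow> (\<exists>j\<le>k. \<exists>\<sigma>'. reach M P j c (\<sigma>', tape s) \<and> sim s \<sigma>' \<and> pc \<sigma>' = p \<and>
     (\<forall>i<t. regs \<sigma>' (treg i) = regs (fst c) (treg i)))"

lemma sem_const [simp]: "vsize (sem c s) = vsize s" "vadj (sem c s) = vadj s" "wmax (sem c s) = wmax s"
proof -
  have *: "vsize (sem c s) = vsize s \<and> vadj (sem c s) = vadj s \<and> wmax (sem c s) = wmax s"
  proof (induction c arbitrary: s)
    case (For x e c)
    have "vsize (iter x c k s) = vsize s \<and> vadj (iter x c k s) = vadj s \<and> wmax (iter x c k s) = wmax s" for k
      by (induction k) (auto simp: For)
    then show ?case by simp
  qed auto
  then show "vsize (sem c s) = vsize s" "vadj (sem c s) = vadj s" "wmax (sem c s) = wmax s" by auto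
qed

lemma iter_const [simp]:
  "vsize (iter x c k s) = vsize s" "vadj (iter x c k s) = vadj s" "wmax (iter x c k s) = wmax s"
  by (induction k) auto

lemma sim_set_var:
  "sim s \<sigma> \<Longrightarrow> sim (set_var x v s) (\<sigma>\<lparr>pc := p, regs := (regs \<sigma>)(vreg x := v)\<rparr>)"
  unfolding sim_def by auto

lemma sim_treg:
  "sim s \<sigma> \<Longrightarrow> sim s (\<sigma>\<lparr>pc := p, regs := (regs \<sigma>)(treg t := v)\<rparr>)"
  by (rule same_but_temps_sim[of t \<sigma>]) (auto intro!: same_but_temps_upd same_but_temps_refl)

lemma array_addr_inj: "a < 16 \<Longrightarrow> b < 16 \<Longrightarrow> 16 * i + a = 16 * j + b \<longleftrightarrow> i = j \<and> a = (b::nat)"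
  by (cases i j rule: linorder_cases) auto

lemma sim_set_arr:
  "sim s \<sigma> \<Longrightarrow> a < 16 \<Longrightarrow>
    sim (s\<lparr>arrs := (arrs s)(a := (arrs s a)(i := v))\<rparr>)
      (\<sigma>\<lparr>pc := p, mem := (mem \<sigma>)(vsize s * vsize s + (16 * i + a) := v)\<rparr>)"
proof -
  assume *: "sim s \<sigma>" "a < 16"
  have "u * vsize s + v \<noteq> vsize s * vsize s + (16 * i + a)" if "u < vsize s" "v < vsize s" for u v
    using addr_bound[OF that] by linarith
  then show ?thesis using * unfolding sim_def by (simp add: array_addr_inj)
qed

text \<open>Induction on the command. The clause of \<open>ends_in\<close> that the temporaries
  below \<open>t\<close> survive is what lets a loop find its counter and bound intact after each
  execution of the body.\<close>

lemma ccomp_correct: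
  assumes "code_at P (pc \<sigma>) (ccomp c t (pc \<sigma>))" "sim s \<sigma>" "cok c s"
  shows "ends_in (wmax s) P (cost c s) (pc \<sigma> + clen c) t (\<sigma>, tape s) (sem c s)"
  using assms
proof (induction c arbitrary: t \<sigma> s)
  case (Assign x e)
  obtain \<sigma>1 where 1: "\<And>xs. reach (wmax s) P (alen e) (\<sigma>, xs) (\<sigma>1, xs)" "pc \<sigma>1 = pc \<sigma> + alen e"
    "regs \<sigma>1 (treg t) = aval e s" "same_but_temps t \<sigma> \<sigma>1"
    using acomp_correct[of P \<sigma> e t s] Assign by auto
  let ?is = "[LoadConst (vreg x) 0, Arith Add (vreg x) (vreg x) (treg t)]"
  have *: "advances (wmax s) ?is \<sigma>1" "fold (det_exec (wmax s)) ?is \<sigma>1 =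
      \<sigma>1\<lparr>pc := pc \<sigma> + alen e + 2, regs := (regs \<sigma>1)(vreg x := aval e s)\<rparr>"
    using 1 aval_le_wmax[of e s] Assign.prems by (auto simp: set_reg_def)
  have "reach (wmax s) P 2 (\<sigma>1, tape s) (fold (det_exec (wmax s)) ?is \<sigma>1, tape s)"
    by (rule reach_line[OF _ *(1)]) (use Assign.prems 1 in auto)
  from reach_trans[OF 1(1) this] have "reach (wmax s) P (alen e + 2) (\<sigma>, tape s)
     (\<sigma>1\<lparr>pc := pc \<sigma> + alen e + 2, regs := (regs \<sigma>1)(vreg x := aval e s)\<rparr>, tape s)"
    unfolding *(2) by simp
  moreover have "sim s \<sigma>1" using Assign 1 same_but_temps_sim by blast
  ultimately show ?case unfolding ends_in_def
    using sim_set_var[of s \<sigma>1 x] same_but_temps_treg[OF 1(4)]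
    by (intro exI[of _ "alen e + 2"] conjI exI[of _ "\<sigma>1\<lparr>pc := pc \<sigma> + alen e + 2, regs := (regs \<sigma>1)(vreg x := aval e s)\<rparr>"])
      (simp_all del: One_nat_def add_2_eq_Suc')
next
  case (Put a e1 e2)
  obtain \<sigma>1 where 1: "\<And>xs. reach (wmax s) P (alen e1) (\<sigma>, xs) (\<sigma>1, xs)" "pc \<sigma>1 = pc \<sigma> + alen e1"
    "regs \<sigma>1 (treg t) = aval e1 s" "same_but_temps t \<sigma> \<sigma>1"
    using acomp_correct[of P \<sigma> e1 t s] Put by auto
  have sim1: "sim s \<sigma>1" using 1 Put.prems same_but_temps_sim by blast
  then have r: "regs \<sigma>1 (Suc 0) = vsize s * vsize s" by (auto simp: sim_def)
  have bnd: "16 \<le> wmax s" "a \<le> wmax s" "aval e1 s * 16 \<le> wmax s" "aval e1 s * 16 + a \<le> wmax s"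
    "vsize s * vsize s + (aval e1 s * 16 + a) \<le> wmax s" "a < 16"
    using Put.prems by auto
  let ?is = "addr_code a t"
  define \<sigma>2 where "\<sigma>2 = fold (det_exec (wmax s)) ?is \<sigma>1"
  have reach2: "reach (wmax s) P 5 (\<sigma>1, xs) (\<sigma>2, xs)" for xs
    unfolding \<sigma>2_def by (rule reach_line) (use Put.prems(1) 1 r bnd in \<open>auto simp: set_reg_def ac_simps\<close>)
  have 2: "regs \<sigma>2 (treg t) = vsize s * vsize s + (16 * aval e1 s + a)" "same_but_temps t \<sigma>1 \<sigma>2"
    "pc \<sigma>2 = Suc (Suc (Suc (Suc (Suc (pc \<sigma> + alen e1)))))"
    using 1 r bnd unfolding \<sigma>2_def by (auto simp: set_reg_def same_but_temps_def ac_simps)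
  have sim2: "sim s \<sigma>2" using 2 sim1 same_but_temps_sim by blast
  obtain \<sigma>3 where 3: "\<And>xs. reach (wmax s) P (alen e2) (\<sigma>2, xs) (\<sigma>3, xs)" "pc \<sigma>3 = pc \<sigma>2 + alen e2"
    "regs \<sigma>3 (treg (Suc t)) = aval e2 s" "same_but_temps (Suc t) \<sigma>2 \<sigma>3"
    using acomp_correct[of P \<sigma>2 e2 "Suc t" s] Put.prems 2 sim2 by auto
  have sim3: "sim s \<sigma>3" using 3 sim2 same_but_temps_sim by blast
  have t3: "regs \<sigma>3 (treg t) = vsize s * vsize s + (16 * aval e1 s + a)"
    using same_but_temps_treg[OF 3(4), of t] 2 by simp
  let ?\<tau> = "\<sigma>3\<lparr>pc := Suc (pc \<sigma>3), mem := (mem \<sigma>3)(vsize s * vsize s + (16 * aval e1 s + a) := aval e2 s)\<rparr>"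
  have "reach (wmax s) P 1 (\<sigma>3, xs) (?\<tau>, xs)" for xs
    using Put.prems(1) 1 2 3 t3 by (intro reach_step) (auto simp: ac_simps)
  from reach_trans[OF reach_trans[OF reach_trans[OF 1(1) reach2] 3(1)] this]
  have "reach (wmax s) P (alen e1 + alen e2 + 6) (\<sigma>, tape s) (?\<tau>, tape s)" by (simp add: ac_simps)
  moreover have "sim (sem (Put a e1 e2) s) ?\<tau>" using sim_set_arr[OF sim3] bnd by simp
  moreover have "regs ?\<tau> (treg i) = regs \<sigma> (treg i)" if "i < t" for i
    using same_but_temps_treg[OF 3(4), of i] same_but_temps_treg[OF 2(2), of i] same_but_temps_treg[OF 1(4), of i] that
    by simp
  ultimately show ?case unfolding ends_in_def using 2 3
    by (intro exI[of _ "alen e1 + alen e2 + 6"] conjI exI[of _ ?\<tau>]) auto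
next
  case (Emit e)
  obtain \<sigma>1 where 1: "\<And>xs. reach (wmax s) P (alen e) (\<sigma>, xs) (\<sigma>1, xs)" "pc \<sigma>1 = pc \<sigma> + alen e"
    "regs \<sigma>1 (treg t) = aval e s" "same_but_temps t \<sigma> \<sigma>1"
    using acomp_correct[of P \<sigma> e t s] Emit by auto
  have sim1: "sim s \<sigma>1" using 1 Emit.prems same_but_temps_sim by blast
  let ?\<tau> = "\<sigma>1\<lparr>pc := Suc (pc \<sigma>1), outp := outp \<sigma>1 @ [aval e s]\<rparr>"
  have "reach (wmax s) P 1 (\<sigma>1, xs) (?\<tau>, xs)" for xs
    using Emit.prems(1) 1 by (intro reach_step) auto
  from reach_trans[OF 1(1) this] have "reach (wmax s) P (alen e + 1) (\<sigma>, tape s) (?\<tau>, tape s)" by simp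
  moreover have "sim (sem (Emit e) s) ?\<tau>" using sim1 by (auto simp: sim_def)
  ultimately show ?case unfolding ends_in_def using 1 same_but_temps_treg[OF 1(4)]
    by (intro exI[of _ "alen e + 1"] conjI exI[of _ ?\<tau>]) auto
next
  case (Draw x)
  let ?\<tau> = "\<sigma>\<lparr>pc := Suc (pc \<sigma>), regs := (regs \<sigma>)(vreg x := hd (tape s))\<rparr>"
  have "reach (wmax s) P 1 (\<sigma>, tape s) (?\<tau>, tl (tape s))"
    using Draw.prems by (intro reach_step) (auto simp: set_reg_def)
  moreover have "sim (sem (Draw x) s) ?\<tau>"
    using Draw.prems by (auto simp: sim_def)
  ultimately show ?case unfolding ends_in_def
    by (intro exI[of _ 1] conjI exI[of _ ?\<tau>]) auto
next
  case (Seq c1 c2)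
  obtain j1 \<sigma>1 where 1: "j1 \<le> cost c1 s" "reach (wmax s) P j1 (\<sigma>, tape s) (\<sigma>1, tape (sem c1 s))"
    "sim (sem c1 s) \<sigma>1" "pc \<sigma>1 = pc \<sigma> + clen c1" "\<forall>i<t. regs \<sigma>1 (treg i) = regs \<sigma> (treg i)"
    using Seq.IH(1)[of \<sigma> t s] Seq.prems by (auto simp: ends_in_def)
  obtain j2 \<sigma>2 where 2: "j2 \<le> cost c2 (sem c1 s)"
    "reach (wmax s) P j2 (\<sigma>1, tape (sem c1 s)) (\<sigma>2, tape (sem c2 (sem c1 s)))"
    "sim (sem c2 (sem c1 s)) \<sigma>2" "pc \<sigma>2 = pc \<sigma>1 + clen c2" "\<forall>i<t. regs \<sigma>2 (treg i) = regs \<sigma>1 (treg i)"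
    using Seq.IH(2)[of \<sigma>1 t "sem c1 s"] Seq.prems 1 by (auto simp: ends_in_def)
  show ?case unfolding ends_in_def using 1 2 reach_trans[OF 1(2) 2(2)]
    by (intro exI[of _ "j1 + j2"] conjI exI[of _ \<sigma>2]) auto
next
  case (If e c1 c2)
  obtain \<sigma>1 where 1: "\<And>xs. reach (wmax s) P (alen e) (\<sigma>, xs) (\<sigma>1, xs)" "pc \<sigma>1 = pc \<sigma> + alen e"
    "regs \<sigma>1 (treg t) = aval e s" "same_but_temps t \<sigma> \<sigma>1"
    using acomp_correct[of P \<sigma> e t s] If.prems by auto
  have sim1: "sim s \<sigma>1" using 1 If.prems same_but_temps_sim by blast
  let ?p = "if aval e s = 0 then pc \<sigma> + alen e + 2 + clen c1 else pc \<sigma> + alen e + 1"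
  let ?\<sigma>2 = "\<sigma>1\<lparr>pc := ?p\<rparr>"
  have "reach (wmax s) P 1 (\<sigma>1, xs) (?\<sigma>2, xs)" for xs
    using If.prems(1) 1 by (intro reach_step) auto
  from reach_trans[OF 1(1) this]
  have reach2: "reach (wmax s) P (alen e + 1) (\<sigma>, tape s) (?\<sigma>2, tape s)" by simp
  have sim2: "sim s ?\<sigma>2" using sim1 by (simp add: sim_def)
  have t2: "\<forall>i<t. regs ?\<sigma>2 (treg i) = regs \<sigma> (treg i)" using same_but_temps_treg[OF 1(4)] by simp
  show ?case
  proof (cases "aval e s = 0")
    case True
    obtain j3 \<sigma>3 where 3: "j3 \<le> cost c2 s" "reach (wmax s) P j3 (?\<sigma>2, tape s) (\<sigma>3, tape (sem c2 s))"
      "sim (sem c2 s) \<sigma>3" "pc \<sigma>3 = pc ?\<sigma>2 + clen c2" "\<forall>i<t. regs \<sigma>3 (treg i) = regs ?\<sigma>2 (treg i)"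
      using If.IH(2)[of ?\<sigma>2 t s] If.prems sim2 True by (auto simp: ends_in_def ac_simps)
    show ?thesis unfolding ends_in_def using True 3 t2 reach_trans[OF reach2 3(2)]
      by (intro exI[of _ "alen e + 1 + j3"] conjI exI[of _ \<sigma>3]) auto
  next
    case False
    obtain j3 \<sigma>3 where 3: "j3 \<le> cost c1 s" "reach (wmax s) P j3 (?\<sigma>2, tape s) (\<sigma>3, tape (sem c1 s))"
      "sim (sem c1 s) \<sigma>3" "pc \<sigma>3 = pc ?\<sigma>2 + clen c1" "\<forall>i<t. regs \<sigma>3 (treg i) = regs ?\<sigma>2 (treg i)"
      using If.IH(1)[of ?\<sigma>2 t s] If.prems sim2 False by (auto simp: ends_in_def ac_simps)
    let ?\<sigma>4 = "\<sigma>3\<lparr>pc := pc \<sigma> + alen e + 2 + clen c1 + clen c2\<rparr>"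
    have "reach (wmax s) P 1 (\<sigma>3, xs) (?\<sigma>4, xs)" for xs
      using If.prems(1) 3 False by (intro reach_step) (auto simp: ac_simps)
    from reach_trans[OF reach_trans[OF reach2 3(2)] this]
    have "reach (wmax s) P (alen e + 1 + j3 + 1) (\<sigma>, tape s) (?\<sigma>4, tape (sem c1 s))" .
    moreover have "sim (sem c1 s) ?\<sigma>4" using 3 by (simp add: sim_def)
    ultimately show ?thesis unfolding ends_in_def using False 3 t2
      by (intro exI[of _ "alen e + 1 + j3 + 1"] conjI exI[of _ ?\<sigma>4]) auto
  qed
next
  case (For x e c)
  let ?M = "wmax s" and ?b = "aval e s" and ?L = "pc \<sigma> + alen e + 1"
  let ?E = "pc \<sigma> + alen e + 8 + clen c"
  obtain \<sigma>1 where 1: "\<And>xs. reach ?M P (alen e) (\<sigma>, xs) (\<sigma>1, xs)" "pc \<sigma>1 = pc \<sigma> + alen e"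
    "regs \<sigma>1 (treg (Suc t)) = ?b" "same_but_temps (Suc t) \<sigma> \<sigma>1"
    using acomp_correct[of P \<sigma> e "Suc t" s] For.prems by auto
  have sim1: "sim s \<sigma>1" using 1 For.prems same_but_temps_sim by blast
  have b: "?b \<le> ?M" using For.prems aval_le_wmax by auto
  let ?\<sigma>2 = "\<sigma>1\<lparr>pc := ?L, regs := (regs \<sigma>1)(treg t := 0)\<rparr>"
  have "reach ?M P 1 (\<sigma>1, xs) (?\<sigma>2, xs)" for xs
    using For.prems(1) 1 by (intro reach_step) (auto simp: set_reg_def)
  from reach_trans[OF 1(1) this] have reach2: "reach ?M P (alen e + 1) (\<sigma>, xs) (?\<sigma>2, xs)" for xs .
  have sim2: "sim s ?\<sigma>2" using sim1 by (rule sim_treg)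
  \<comment> \<open>The state at the loop head, before the test, after \<open>k\<close> iterations.
    The loop variable still has the value left by the previous iteration; the counter is copied into
    it only after the test.\<close>
  define inv where "inv k \<tau> \<longleftrightarrow> sim (iter x c k s) \<tau> \<and> pc \<tau> = ?L \<and> regs \<tau> (treg t) = k \<and>
    regs \<tau> (treg (Suc t)) = ?b \<and> (\<forall>i<t. regs \<tau> (treg i) = regs \<sigma> (treg i))" for k \<tau>
  have code: "code_at P ?L [Arith Sub (treg (t + 2)) (treg (Suc t)) (treg t),
      JumpIfZero (treg (t + 2)) ?E, LoadConst (vreg x) 0, Arith Add (vreg x) (vreg x) (treg t)]"
    "code_at P (?L + 4) (ccomp c (t + 3) (?L + 4))"
    "code_at P (?L + 4 + clen c) [LoadConst (treg (t + 2)) 1, Arith Add (treg t) (treg t) (treg (t + 2)), Jump ?L]"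
  proof -
    have L: "?L + 4 = Suc (Suc (Suc (Suc (Suc (pc \<sigma> + alen e)))))"
      "?L + 4 + clen c = Suc (Suc (Suc (Suc (Suc (pc \<sigma> + alen e + clen c)))))" by simp_all
    show "code_at P ?L [Arith Sub (treg (t + 2)) (treg (Suc t)) (treg t),
        JumpIfZero (treg (t + 2)) ?E, LoadConst (vreg x) 0, Arith Add (vreg x) (vreg x) (treg t)]"
      "code_at P (?L + 4) (ccomp c (t + 3) (?L + 4))"
      "code_at P (?L + 4 + clen c) [LoadConst (treg (t + 2)) 1, Arith Add (treg t) (treg t) (treg (t + 2)), Jump ?L]"
      unfolding L using For.prems(1) by (simp_all add: ac_simps)
  qed
  have loop: "\<exists>j \<tau>. j \<le> (\<Sum>i<k. cost c (set_var x i (iter x c i s)) + 7) \<and>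
      reach ?M P j (?\<sigma>2, tape s) (\<tau>, tape (iter x c k s)) \<and> inv k \<tau>" if "k \<le> ?b" for k
    using that
  proof (induction k)
    case 0
    have "inv 0 ?\<sigma>2" unfolding inv_def using sim2 1 same_but_temps_treg[OF 1(4)] by auto
    moreover have "reach ?M P 0 (?\<sigma>2, tape s) (?\<sigma>2, tape (iter x c 0 s))" by (simp add: reach_0)
    moreover have "0 \<le> (\<Sum>i<0. cost c (set_var x i (iter x c i s)) + 7)" by simp
    ultimately show ?case by blast
  next
    case (Suc k)
    let ?s = "iter x c k s"
    obtain j \<tau> where \<tau>: "j \<le> (\<Sum>i<k. cost c (set_var x i (iter x c i s)) + 7)"
      "reach ?M P j (?\<sigma>2, tape s) (\<tau>, tape ?s)" "inv k \<tau>"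
      using Suc.IH[OF Suc_leD[OF Suc.prems]] by blast
    let ?is = "[Arith Sub (treg (t + 2)) (treg (Suc t)) (treg t),
      JumpIfZero (treg (t + 2)) ?E, LoadConst (vreg x) 0, Arith Add (vreg x) (vreg x) (treg t)]"
    let ?\<tau>1 = "\<tau>\<lparr>pc := ?L, regs := (regs \<tau>)(treg (t + 2) := ?b - k)\<rparr>"
    let ?\<tau>2 = "?\<tau>1\<lparr>pc := ?L + 4, regs := (regs ?\<tau>1)(vreg x := k)\<rparr>"
    have *: "advances ?M ?is \<tau>" "fold (det_exec ?M) ?is \<tau> = ?\<tau>2"
      using Suc.prems b \<tau>(3) by (auto simp: set_reg_def inv_def)
    have reach3: "reach ?M P 4 (\<tau>, xs) (?\<tau>2, xs)" for xs
      unfolding *(2)[symmetric] by (rule reach_line[OF _ *(1)]) (use code(1) \<tau>(3) in \<open>auto simp: inv_def\<close>)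
    have "sim ?s ?\<tau>1" using \<tau>(3) sim_treg unfolding inv_def by blast
    then have sim3: "sim (set_var x k ?s) ?\<tau>2" by (rule sim_set_var)
    have ok: "cok c (set_var x k ?s)" using For.prems Suc.prems by auto
    obtain j4 \<tau>3 where 4: "j4 \<le> cost c (set_var x k ?s)"
      "reach ?M P j4 (?\<tau>2, tape ?s) (\<tau>3, tape (sem c (set_var x k ?s)))"
      "sim (sem c (set_var x k ?s)) \<tau>3" "pc \<tau>3 = ?L + 4 + clen c"
      "\<forall>i<t+3. regs \<tau>3 (treg i) = regs ?\<tau>2 (treg i)"
      using For.IH[of ?\<tau>2 "t + 3" "set_var x k ?s"] code(2) sim3 ok by (auto simp: ends_in_def)
    have t3: "regs \<tau>3 (treg t) = k" "regs \<tau>3 (treg (Suc t)) = ?b" "\<forall>i<t. regs \<tau>3 (treg i) = regs \<sigma> (treg i)"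
      using 4(5)[rule_format, of t] 4(5)[rule_format, of "Suc t"] 4(5) \<tau>(3)
      by (simp_all add: inv_def)
    let ?js = "[LoadConst (treg (t + 2)) 1, Arith Add (treg t) (treg t) (treg (t + 2))]"
    let ?\<tau>4 = "\<tau>3\<lparr>pc := ?L + 4 + clen c + 2, regs := (regs \<tau>3)(treg (t + 2) := 1, treg t := Suc k)\<rparr>"
    let ?\<tau>5 = "\<tau>3\<lparr>pc := ?L, regs := (regs \<tau>3)(treg (t + 2) := 1, treg t := Suc k)\<rparr>"
    have **: "advances ?M ?js \<tau>3" "fold (det_exec ?M) ?js \<tau>3 = ?\<tau>4"
      using Suc.prems b t3 4(4) by (auto simp: set_reg_def)
    have "reach ?M P 2 (\<tau>3, xs) (?\<tau>4, xs)" for xs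
      unfolding **(2)[symmetric] by (rule reach_line[OF _ **(1)]) (use code(3) 4(4) in auto)
    moreover have "reach ?M P 1 (?\<tau>4, xs) (?\<tau>5, xs)" for xs
      using code(3) by (intro reach_step) auto
    ultimately have "reach ?M P (2 + 1) (\<tau>3, xs) (?\<tau>5, xs)" for xs
      by (rule reach_trans)
    then have reach5: "reach ?M P 3 (\<tau>3, xs) (?\<tau>5, xs)" for xs by simp
    have "sim (sem c (set_var x k ?s)) (\<tau>3\<lparr>pc := ?L, regs := (regs \<tau>3)(treg (t + 2) := 1)\<rparr>)"
      using 4(3) by (rule sim_treg)
    from sim_treg[OF this, where p = ?L and t = t and v = "Suc k"] have "sim (iter x c (Suc k) s) ?\<tau>5" by simp
    then have "inv (Suc k) ?\<tau>5" unfolding inv_def using t3 by simp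
    moreover have "reach ?M P (j + 4 + j4 + 3) (?\<sigma>2, tape s) (?\<tau>5, tape (iter x c (Suc k) s))"
      using reach_trans[OF reach_trans[OF reach_trans[OF \<tau>(2) reach3] 4(2)] reach5] by simp
    moreover have "j + 4 + j4 + 3 \<le> (\<Sum>i<Suc k. cost c (set_var x i (iter x c i s)) + 7)"
      using \<tau>(1) 4(1) by simp
    ultimately show ?case by blast
  qed
  obtain j \<tau> where \<tau>: "j \<le> (\<Sum>i<?b. cost c (set_var x i (iter x c i s)) + 7)"
      "reach ?M P j (?\<sigma>2, tape s) (\<tau>, tape (iter x c ?b s))" "inv ?b \<tau>" using loop[OF order_refl] by blast
  let ?\<tau>1 = "\<tau>\<lparr>pc := Suc ?L, regs := (regs \<tau>)(treg (t + 2) := 0)\<rparr>"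
  let ?\<tau>2 = "\<tau>\<lparr>pc := ?E, regs := (regs \<tau>)(treg (t + 2) := 0)\<rparr>"
  have "reach ?M P 1 (\<tau>, xs) (?\<tau>1, xs)" for xs
    using code(1) \<tau>(3) by (intro reach_step) (auto simp: inv_def set_reg_def)
  moreover have "reach ?M P 1 (?\<tau>1, xs) (?\<tau>2, xs)" for xs
    using code(1) \<tau>(3) by (intro reach_step) (auto simp: inv_def set_reg_def)
  ultimately have "reach ?M P 2 (\<tau>, xs) (?\<tau>2, xs)" for xs
    using reach_trans by (metis one_add_one)
  from reach_trans[OF reach_trans[OF reach2 \<tau>(2)] this]
  have "reach ?M P (alen e + 1 + j + 2) (\<sigma>, tape s) (?\<tau>2, tape (sem (For x e c) s))" by simp
  moreover have "sim (sem (For x e c) s) ?\<tau>2"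
    using \<tau>(3) sim_treg unfolding inv_def by (metis sem.simps(7))
  ultimately show ?case unfolding ends_in_def using \<tau>(1) \<tau>(3)
    by (intro exI[of _ "alen e + 1 + j + 2"] conjI exI[of _ ?\<tau>2]) (auto simp: inv_def)
qed

section \<open>VC dimension and induced subgraphs of the hypercube\<close>

section \<open>Edge density of one-inclusion graphs\<close>

text \<open>The sum counts, direction by direction, the edges of the subgraph of the hypercube
  induced by \<open>F\<close>; the bound is due to Haussler, Littlestone and Warmuth. The induction
  deletes a point \<open>x\<close>: \<open>F1\<close> consists of the traces, \<open>F2\<close> of
  the sets that lie in \<open>F\<close> both with and without \<open>x\<close>. Then
  \<open>card F = card F1 + card F2\<close>, and \<open>card F2\<close> edges have direction
  \<open>x\<close>. A set shattered by \<open>F2\<close> remains shattered by \<open>F\<close> when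
  \<open>x\<close> is added, so the dimension of \<open>F2\<close> is smaller by one, which pays for
  these edges.\<close>

lemma one_inclusion_edges:
  assumes "finite X" "F \<subseteq> Pow X"
    and "\<And>S. S \<subseteq> X \<Longrightarrow> (\<forall>T\<subseteq>S. \<exists>f\<in>F. f \<inter> S = T) \<Longrightarrow> card S \<le> d"
  shows "(\<Sum>x\<in>X. card {S\<in>F. x \<notin> S \<and> insert x S \<in> F}) \<le> d * card F"
  using assms
proof (induction X arbitrary: F d)
  case empty
  then show ?case by simp
next
  case (insert x X)
  let ?r = "\<lambda>S. S - {x}"
  let ?E = "\<lambda>y F. {S\<in>F. y \<notin> S \<and> insert y S \<in> F}"
  define F1 where "F1 = ?r ` F"
  define F2 where "F2 = ?E x F"
  define F0 where "F0 = {S\<in>F. x \<notin> S}"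
  define Fx where "Fx = {S\<in>F. x \<in> S}"
  have fin: "finite F" using insert.prems(1) insert.hyps(1) by (meson finite_Pow_iff finite_insert finite_subset)
  have inj: "inj_on ?r {S. x \<in> S}" by (auto simp: inj_on_def)
  have sub: "F1 \<subseteq> Pow X" "F2 \<subseteq> Pow X" using insert.prems(1) by (auto simp: F1_def F2_def)
  have fin': "finite F1" "finite F2" using fin by (auto simp: F1_def F2_def)
  have F: "F = F0 \<union> Fx" "F0 \<inter> Fx = {}" "finite F0" "finite Fx" using fin by (auto simp: F0_def Fx_def)
  then have "card F = card F0 + card Fx" using card_Un_disjoint by metis
  moreover have "card Fx = card (?r ` Fx)"
    by (intro card_image[symmetric] inj_on_subset[OF inj]) (auto simp: Fx_def)
  moreover have "card F0 + card (?r ` Fx) = card (F0 \<union> ?r ` Fx) + card (F0 \<inter> ?r ` Fx)"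
    using fin by (intro card_Un_Int) (auto simp: F0_def Fx_def)
  moreover have "F0 \<union> ?r ` Fx = F1"
  proof -
    have "?r ` F0 = (\<lambda>S. S) ` F0" by (rule image_cong) (auto simp: F0_def)
    then show ?thesis unfolding F1_def F(1) image_Un by simp
  qed
  moreover have "F0 \<inter> ?r ` Fx = F2"
  proof -
    have "S \<in> ?r ` Fx" if "S \<in> F" "x \<notin> S" "insert x S \<in> F" for S
      using that by (intro image_eqI[of _ _ "insert x S"]) (auto simp: Fx_def)
    moreover have "insert x S \<in> F" if "S \<in> ?r ` Fx" for S
    proof -
      obtain S' where "S' \<in> F" "x \<in> S'" "S = ?r S'" using \<open>S \<in> ?r ` Fx\<close> by (auto simp: Fx_def)
      then show ?thesis by (simp add: insert_absorb)
    qed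
    ultimately show ?thesis unfolding F2_def F0_def by blast
  qed
  ultimately have card_F: "card F = card F1 + card F2" by simp
  \<comment> \<open>Split the edges in direction \<open>y\<close> by whether their sets contain
    \<open>x\<close>. After deletion of \<open>x\<close> both kinds are edges of \<open>F1\<close>,
    and those that arise from both kinds are edges of \<open>F2\<close>.\<close>
  have edge: "card (?E y F) \<le> card (?E y F1) + card (?E y F2)" if y: "y \<in> X" for y
  proof -
    have "y \<noteq> x" using y insert.hyps by auto
    define A where "A = {S\<in>?E y F. x \<notin> S}"
    define B where "B = {S\<in>?E y F. x \<in> S}"
    have "?E y F = A \<union> B" "A \<inter> B = {}" "finite A" "finite B" using fin by (auto simp: A_def B_def)
    then have 1: "card (?E y F) = card A + card B" using card_Un_disjoint by metis
    have 2: "card B = card (?r ` B)"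
      by (intro card_image[symmetric] inj_on_subset[OF inj]) (auto simp: B_def)
    have 3: "card A + card (?r ` B) = card (A \<union> ?r ` B) + card (A \<inter> ?r ` B)"
      using fin by (intro card_Un_Int) (auto simp: A_def B_def)
    have 4: "card (A \<union> ?r ` B) \<le> card (?E y F1)"
    proof (intro card_mono)
      show "A \<union> ?r ` B \<subseteq> ?E y F1"
      proof
        fix S assume "S \<in> A \<union> ?r ` B"
        then show "S \<in> ?E y F1"
        proof
          assume S: "S \<in> A"
          then have "S = ?r S" "insert y S = ?r (insert y S)" using \<open>y \<noteq> x\<close> by (auto simp: A_def)
          then have "S \<in> F1" "insert y S \<in> F1" using S unfolding A_def F1_def by blast+
          then show ?thesis using S by (auto simp: A_def)
        next
          assume "S \<in> ?r ` B"
          then obtain S' where S': "S' \<in> B" "S = ?r S'" by auto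
          then have "insert y S = ?r (insert y S')" using \<open>y \<noteq> x\<close> by auto
          moreover have "S' \<in> F" "insert y S' \<in> F" "y \<notin> S'" using S'(1) by (auto simp: B_def)
          ultimately have "S \<in> F1" "insert y S \<in> F1" "y \<notin> S" unfolding F1_def S'(2) by auto
          then show ?thesis by simp
        qed
      qed
    qed (use fin' in auto)
    have 5: "card (A \<inter> ?r ` B) \<le> card (?E y F2)"
    proof (intro card_mono)
      show "A \<inter> ?r ` B \<subseteq> ?E y F2"
      proof
        fix S assume S: "S \<in> A \<inter> ?r ` B"
        then obtain S' where S': "S' \<in> B" "S = ?r S'" by auto
        then have "S' = insert x S" by (auto simp: B_def)
        moreover have "S' \<in> F" "insert y S' \<in> F" using S'(1) by (auto simp: B_def)
        moreover have "S \<in> F" "y \<notin> S" "insert y S \<in> F" "x \<notin> S" using S by (auto simp: A_def)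
        ultimately show "S \<in> ?E y F2" using \<open>y \<noteq> x\<close> unfolding F2_def
          by (simp add: insert_commute)
      qed
    qed (use fin' in auto)
    have "card (?E y F) = card (A \<union> ?r ` B) + card (A \<inter> ?r ` B)"
      by (rule trans[OF 1], subst 2, rule 3)
    then show ?thesis by (rule order_trans[OF eq_refl add_mono[OF 4 5]])
  qed
  have IH1: "(\<Sum>y\<in>X. card (?E y F1)) \<le> d * card F1"
  proof (rule insert.IH[OF sub(1)])
    fix S assume S: "S \<subseteq> X" "\<forall>T\<subseteq>S. \<exists>f\<in>F1. f \<inter> S = T"
    have "\<exists>f\<in>F. f \<inter> S = T" if T: "T \<subseteq> S" for T
    proof -
      obtain g where "g \<in> F1" "g \<inter> S = T" using S(2) T by blast
      moreover from this(1) obtain f where "f \<in> F" "g = f - {x}" unfolding F1_def by blast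
      ultimately have "f \<in> F" "(f - {x}) \<inter> S = T" by simp_all
      then show ?thesis using S(1) insert.hyps by (intro bexI[of _ f]) auto
    qed
    then show "card S \<le> d" using S(1) by (intro insert.prems(2)) (auto simp only: subset_insertI2)
  qed
  have bound2: "(\<Sum>y\<in>X. card (?E y F2)) + card F2 \<le> d * card F2"
  proof (cases "F2 = {}")
    case False
    have shat: "card S + 1 \<le> d" if S: "S \<subseteq> X" "\<forall>T\<subseteq>S. \<exists>f\<in>F2. f \<inter> S = T" for S
    proof -
      have "\<exists>f\<in>F. f \<inter> insert x S = T" if T: "T \<subseteq> insert x S" for T
      proof -
        have "T - {x} \<subseteq> S" using T by auto
        then obtain f where f: "f \<in> F2" "f \<inter> S = T - {x}" using S(2) by blast
        then have "f \<in> F" "insert x f \<in> F" "x \<notin> f" by (auto simp: F2_def)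
        show ?thesis
        proof (cases "x \<in> T")
          case True
          then have "insert x f \<inter> insert x S = T" using f(2) T by auto
          then show ?thesis using \<open>insert x f \<in> F\<close> by blast
        next
          case False
          then have "f \<inter> insert x S = T" using f(2) T \<open>x \<notin> f\<close> by auto
          then show ?thesis using \<open>f \<in> F\<close> by blast
        qed
      qed
      moreover have "insert x S \<subseteq> insert x X" using S(1) by auto
      ultimately have "card (insert x S) \<le> d" by (metis (no_types, lifting) insert.prems(2))
      moreover have "x \<notin> S" "finite S" using S(1) insert.hyps finite_subset by auto
      ultimately show ?thesis by simp
    qed
    \<comment> \<open>Makes the truncated \<open>d - 1\<close> harmless: a nonempty
      \<open>F2\<close> shatters the empty set, so \<open>F\<close> shatters
      \<open>{x}\<close>.\<close>
    have "d \<ge> 1"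
    proof -
      have "\<forall>T\<subseteq>{}. \<exists>f\<in>F2. f \<inter> {} = T" using False by auto
      from shat[OF _ this] show ?thesis by simp
    qed
    have "(\<Sum>y\<in>X. card (?E y F2)) \<le> (d - 1) * card F2"
    proof (rule insert.IH[OF sub(2)])
      fix S assume "S \<subseteq> X" "\<forall>T\<subseteq>S. \<exists>f\<in>F2. f \<inter> S = T"
      from shat[OF this] show "card S \<le> d - 1" by simp
    qed
    then have "(\<Sum>y\<in>X. card (?E y F2)) + card F2 \<le> (d - 1 + 1) * card F2" by (simp only: add_mult_distrib)
    then show ?thesis using \<open>d \<ge> 1\<close> by simp
  qed simp
  have "(\<Sum>y\<in>insert x X. card (?E y F)) = card F2 + (\<Sum>y\<in>X. card (?E y F))"
    using insert.hyps by (simp add: F2_def)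
  moreover have "(\<Sum>y\<in>X. card (?E y F)) \<le> (\<Sum>y\<in>X. card (?E y F1) + card (?E y F2))"
    by (intro sum_mono edge)
  ultimately show ?case
    using IH1 bound2 by (simp add: card_F distrib_left sum.distrib)
qed

text \<open>Layer-cake formula, which reduces weighted families to plain ones.\<close>

lemma sum_card_levels:
  fixes f :: "'a \<Rightarrow> nat"
  assumes "finite A" "\<And>x. x \<in> A \<Longrightarrow> f x \<le> W"
  shows "(\<Sum>t<W. card {x\<in>A. t < f x}) = (\<Sum>x\<in>A. f x)"
proof -
  have "(\<Sum>t<W. card {x\<in>A. t < f x}) = (\<Sum>t<W. \<Sum>x\<in>A. if t < f x then 1 else 0)"
    using assms(1) by (intro sum.cong) (auto simp: sum.If_cases Collect_conj_eq)
  also have "\<dots> = (\<Sum>x\<in>A. \<Sum>t<W. if t < f x then 1 else 0)" by (rule sum.swap)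
  also have "\<dots> = (\<Sum>x\<in>A. f x)"
  proof (intro sum.cong refl)
    fix x assume "x \<in> A"
    then have "{..<W} \<inter> {t. t < f x} = {..<f x}" using assms(2) by fastforce
    then show "(\<Sum>t<W. if t < f x then 1 else 0) = f x" by (simp add: sum.If_cases)
  qed
  finally show ?thesis .
qed

text \<open>Applied to the superlevel sets of the weight, the edge bound yields its weighted form.\<close>

lemma weighted_one_inclusion_edges:
  fixes w :: "'a set \<Rightarrow> nat"
  assumes X: "finite X"
    and shatter: "\<And>S. S \<subseteq> X \<Longrightarrow> (\<forall>T\<subseteq>S. \<exists>f. f \<subseteq> X \<and> w f > 0 \<and> f \<inter> S = T) \<Longrightarrow> card S \<le> d"
  shows "(\<Sum>x\<in>X. \<Sum>S\<in>{S\<in>Pow X. x \<notin> S}. min (w S) (w (insert x S))) \<le> d * (\<Sum>S\<in>Pow X. w S)"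
proof -
  define W where "W = (\<Sum>S\<in>Pow X. w S)"
  have W: "w S \<le> W" if "S \<subseteq> X" for S
    unfolding W_def using X that by (intro member_le_sum) auto
  define F where "F t = {S\<in>Pow X. t < w S}" for t
  have "(\<Sum>x\<in>X. \<Sum>S\<in>{S\<in>Pow X. x \<notin> S}. min (w S) (w (insert x S))) =
      (\<Sum>x\<in>X. \<Sum>t<W. card {S\<in>{S\<in>Pow X. x \<notin> S}. t < min (w S) (w (insert x S))})"
    using X W by (intro sum.cong refl sum_card_levels[symmetric]) (auto intro: min.coboundedI1)
  also have "\<dots> = (\<Sum>t<W. \<Sum>x\<in>X. card {S\<in>F t. x \<notin> S \<and> insert x S \<in> F t})"
    by (subst sum.swap) (intro sum.cong refl arg_cong[where f = card], auto simp: F_def)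
  also have "\<dots> \<le> (\<Sum>t<W. d * card (F t))"
  proof (intro sum_mono one_inclusion_edges X)
    fix t S assume "S \<subseteq> X" "\<forall>T\<subseteq>S. \<exists>f\<in>F t. f \<inter> S = T"
    moreover have "f \<subseteq> X \<and> w f > 0" if "f \<in> F t" for f using that by (auto simp: F_def)
    ultimately show "card S \<le> d" using shatter by meson
  qed (auto simp: F_def)
  also have "\<dots> = d * (\<Sum>S\<in>Pow X. w S)"
    unfolding F_def sum_distrib_left[symmetric] using sum_card_levels[of "Pow X" w W] X W by simp
  finally show ?thesis .
qed

section \<open>Haussler's exchangeability argument for random columns\<close>

section \<open>Clustering by random columns\<close>

definition agree :: "(nat \<Rightarrow> nat \<Rightarrow> bool) \<Rightarrow> nat list \<Rightarrow> nat \<Rightarrow> nat \<Rightarrow> bool" where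
  "agree a xs u v \<longleftrightarrow> (\<forall>x\<in>set xs. a u x = a v x)"

definition hamming :: "nat \<Rightarrow> (nat \<Rightarrow> nat \<Rightarrow> bool) \<Rightarrow> nat \<Rightarrow> nat \<Rightarrow> nat" where
  "hamming n a u v = card {x. x < n \<and> a u x \<noteq> a v x}"

definition vc_at_most :: "nat \<Rightarrow> (nat \<Rightarrow> nat \<Rightarrow> bool) \<Rightarrow> nat set \<Rightarrow> nat \<Rightarrow> bool" where
  "vc_at_most n a R d \<longleftrightarrow>
     (\<forall>Y\<subseteq>{..<n}. (\<forall>T\<subseteq>Y. \<exists>u\<in>R. {x\<in>Y. a u x} = T) \<longrightarrow> card Y \<le> d)"

lemma vc_at_most_mono: "vc_at_most n a R d \<Longrightarrow> R' \<subseteq> R \<Longrightarrow> vc_at_most n a R' d"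
  unfolding vc_at_most_def by (meson subsetD)

text \<open>Only the \<open>k\<close>-th sampled column separates: this is the distance, measured by that column, from a
  vertex of \<open>R\<close> to a random member of its class with respect to the other columns, summed over \<open>R\<close>.\<close>

definition split_weight :: "(nat \<Rightarrow> nat \<Rightarrow> bool) \<Rightarrow> nat set \<Rightarrow> nat list \<Rightarrow> nat \<Rightarrow> real" where
  "split_weight a R ys k = (\<Sum>u\<in>R.
     real (card {v\<in>R. (\<forall>j<length ys. j \<noteq> k \<longrightarrow> a v (ys ! j) = a u (ys ! j)) \<and> a v (ys ! k) \<noteq> a u (ys ! k)}) /
     real (card {v\<in>R. \<forall>j<length ys. j \<noteq> k \<longrightarrow> a v (ys ! j) = a u (ys ! j)}))"

text \<open>The weight of a single edge of the one-inclusion graph: \<open>p\<close> vertices have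
  one trace and \<open>q\<close> the neighboring one, and a random one of these \<open>p + q\<close>
  vertices lies on the other side with probability \<open>q / (p + q)\<close> and
  \<open>p / (p + q)\<close> respectively.\<close>

lemma harmonic_le_min: "2 * real p * real q / real (p + q) \<le> 2 * real (min p q)"
proof (cases "p + q = 0")
  case False
  have "real p * real q \<le> real (min p q) * real (p + q)"
    by (cases "p \<le> q") (auto simp: min_def mult_mono distrib_left mult.commute)
  then show ?thesis using False by (simp add: divide_le_eq)
qed simp

text \<open>Ignoring position \<open>k\<close> merges the vertices with traces \<open>S\<close> and
  \<open>insert k S\<close>. With multiplicities as weights each merged pair contributes as in
  \<open>harmonic_le_min\<close>, so the sum over \<open>k\<close> is a weighted edge count. The
  ground set consists of the positions in the sample rather than of columns, because a column may be
  drawn repeatedly.\<close>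

lemma sum_split_weight_le:
  assumes R: "finite R" and ys: "set ys \<subseteq> {..<n}" and vc: "vc_at_most n a R d"
  shows "(\<Sum>k<length ys. split_weight a R ys k) \<le> 2 * real d * real (card R)"
proof -
  let ?I = "{..<length ys}"
  define tr where "tr u = {j. j < length ys \<and> a u (ys ! j)}" for u
  define w where "w S = card {u\<in>R. tr u = S}" for S
  have tr_sub: "tr u \<subseteq> ?I" for u by (auto simp: tr_def)
  have sum_w: "(\<Sum>S\<in>Pow ?I. w S) = card R"
  proof -
    have "(\<Sum>S\<in>Pow ?I. \<Sum>u\<in>{u\<in>R. tr u = S}. 1::nat) = (\<Sum>u\<in>R. 1)"
      using R tr_sub by (intro sum.group) auto
    then show ?thesis by (simp add: w_def)
  qed
  have *: "split_weight a R ys k \<le> (\<Sum>S\<in>{S\<in>Pow ?I. k \<notin> S}. 2 * real (min (w S) (w (insert k S))))"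
    if k: "k < length ys" for k
  proof -
    define f where "f u = real (card {v\<in>R. tr v - {k} = tr u - {k} \<and> (k \<in> tr v) \<noteq> (k \<in> tr u)}) /
      real (card {v\<in>R. tr v - {k} = tr u - {k}})" for u
    have "(\<forall>j<length ys. j \<noteq> k \<longrightarrow> a v (ys ! j) = a u (ys ! j)) \<longleftrightarrow> tr v - {k} = tr u - {k}"
      "(a v (ys ! k) \<noteq> a u (ys ! k)) \<longleftrightarrow> (k \<in> tr v) \<noteq> (k \<in> tr u)" for u v
      using k by (auto simp: tr_def set_eq_iff)
    then have "split_weight a R ys k = (\<Sum>u\<in>R. f u)"
      unfolding split_weight_def f_def by (simp only:)
    also have "\<dots> = (\<Sum>S\<in>{S\<in>Pow ?I. k \<notin> S}. \<Sum>u\<in>{u\<in>R. tr u - {k} = S}. f u)"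
      using R tr_sub by (intro sum.group[symmetric]) auto
    also have "\<dots> \<le> (\<Sum>S\<in>{S\<in>Pow ?I. k \<notin> S}. 2 * real (min (w S) (w (insert k S))))"
    proof (intro sum_mono)
      fix S assume S: "S \<in> {S\<in>Pow ?I. k \<notin> S}"
      define Q0 where "Q0 = {u\<in>R. tr u = S}"
      define Q1 where "Q1 = {u\<in>R. tr u = insert k S}"
      have Q: "finite Q0" "finite Q1" "Q0 \<inter> Q1 = {}" using R S by (auto simp: Q0_def Q1_def)
      have eq: "tr u - {k} = S \<longleftrightarrow> tr u = S \<or> tr u = insert k S" for u using S by auto
      have un: "{u\<in>R. tr u - {k} = S} = Q0 \<union> Q1" unfolding eq by (auto simp: Q0_def Q1_def)
      have f0: "f u = card Q1 / (card Q0 + card Q1)" if "u \<in> Q0" for u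
      proof -
        have u: "tr u - {k} = S" "k \<notin> tr u" using that S by (auto simp: Q0_def)
        have "{v\<in>R. tr v - {k} = tr u - {k} \<and> (k \<in> tr v) \<noteq> (k \<in> tr u)} = Q1"
          unfolding u(1) eq Q1_def using u(2) S by auto
        moreover have "{v\<in>R. tr v - {k} = tr u - {k}} = Q0 \<union> Q1"
          unfolding u(1) by (rule un)
        ultimately show ?thesis unfolding f_def using Q by (simp add: card_Un_disjoint)
      qed
      have f1: "f u = card Q0 / (card Q0 + card Q1)" if "u \<in> Q1" for u
      proof -
        have u: "tr u - {k} = S" "k \<in> tr u" using that S by (auto simp: Q1_def)
        have "{v\<in>R. tr v - {k} = tr u - {k} \<and> (k \<in> tr v) \<noteq> (k \<in> tr u)} = Q0"
          unfolding u(1) eq Q0_def using u(2) S by auto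
        moreover have "{v\<in>R. tr v - {k} = tr u - {k}} = Q0 \<union> Q1"
          unfolding u(1) by (rule un)
        ultimately show ?thesis unfolding f_def using Q by (simp add: card_Un_disjoint)
      qed
      have "(\<Sum>u\<in>{u\<in>R. tr u - {k} = S}. f u) = (\<Sum>u\<in>Q0. f u) + (\<Sum>u\<in>Q1. f u)"
        unfolding un using Q by (rule sum.union_disjoint)
      also have "\<dots> = 2 * real (card Q0) * real (card Q1) / real (card Q0 + card Q1)"
        by (simp add: f0 f1)
      also have "\<dots> \<le> 2 * real (min (card Q0) (card Q1))" by (rule harmonic_le_min)
      finally show "(\<Sum>u\<in>{u\<in>R. tr u - {k} = S}. f u) \<le> 2 * real (min (w S) (w (insert k S)))"
        by (simp add: w_def Q0_def Q1_def)
    qed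
    finally show ?thesis .
  qed
  have "(\<Sum>k\<in>?I. \<Sum>S\<in>{S\<in>Pow ?I. k \<notin> S}. min (w S) (w (insert k S))) \<le> d * (\<Sum>S\<in>Pow ?I. w S)"
  proof (intro weighted_one_inclusion_edges)
    fix S assume S: "S \<subseteq> ?I" "\<forall>T\<subseteq>S. \<exists>f. f \<subseteq> ?I \<and> w f > 0 \<and> f \<inter> S = T"
    have ex: "\<exists>u\<in>R. tr u \<inter> S = T" if "T \<subseteq> S" for T
    proof -
      obtain f where "w f > 0" "f \<inter> S = T" using S(2) \<open>T \<subseteq> S\<close> by blast
      then have "{u\<in>R. tr u = f} \<noteq> {}" unfolding w_def by (metis card.empty less_irrefl)
      then show ?thesis using \<open>f \<inter> S = T\<close> by auto
    qed
    \<comment> \<open>Two positions holding the same column are never separated, so a shattered set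
      of positions yields equally many columns, to which the VC bound applies.\<close>
    have inj: "inj_on ((!) ys) S"
    proof (rule inj_onI)
      fix i j assume ij: "i \<in> S" "j \<in> S" "ys ! i = ys ! j"
      obtain u where u: "tr u \<inter> S = {i}" using ex[of "{i}"] ij by blast
      then have "i \<in> tr u" by blast
      then have "a u (ys ! j)" using ij(3) by (simp add: tr_def)
      moreover have "j < length ys" using ij S(1) by auto
      ultimately have "j \<in> tr u \<inter> S" using ij by (simp add: tr_def)
      then show "i = j" unfolding u by simp
    qed
    let ?Y = "(!) ys ` S"
    have "\<exists>u\<in>R. {x\<in>?Y. a u x} = T" if T: "T \<subseteq> ?Y" for T
    proof -
      obtain u where u: "u \<in> R" "tr u \<inter> S = {j\<in>S. ys ! j \<in> T}" using ex[of "{j\<in>S. ys ! j \<in> T}"] by blast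
      have mem: "a u (ys ! j) \<longleftrightarrow> ys ! j \<in> T" if "j \<in> S" for j
      proof -
        have "j \<in> tr u \<longleftrightarrow> a u (ys ! j)" using that S(1) by (auto simp: tr_def)
        moreover have "j \<in> tr u \<inter> S \<longleftrightarrow> ys ! j \<in> T" unfolding u(2) using that by simp
        ultimately show ?thesis using that by simp
      qed
      have "{x\<in>?Y. a u x} = T"
      proof (intro equalityI subsetI)
        fix x assume "x \<in> {x\<in>?Y. a u x}"
        then show "x \<in> T" using mem by auto
      next
        fix x assume "x \<in> T"
        moreover from this obtain j where "j \<in> S" "x = ys ! j" using T by auto
        ultimately show "x \<in> {x\<in>?Y. a u x}" using mem by auto
      qed
      then show ?thesis using u(1) by blast
    qed
    moreover have "?Y \<subseteq> {..<n}"
    proof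
      fix y assume "y \<in> ?Y"
      then have "y \<in> set ys" using S(1) by auto
      then show "y \<in> {..<n}" using ys by blast
    qed
    ultimately have "card ?Y \<le> d"
      using vc[unfolded vc_at_most_def, rule_format, of ?Y] by simp
    then show "card S \<le> d" using inj by (simp add: card_image)
  qed simp
  then have "real (\<Sum>k\<in>?I. \<Sum>S\<in>{S\<in>Pow ?I. k \<notin> S}. min (w S) (w (insert k S))) \<le> real (d * card R)"
    unfolding sum_w by (rule of_nat_mono)
  then have le: "(\<Sum>k<length ys. \<Sum>S\<in>{S\<in>Pow ?I. k \<notin> S}. real (min (w S) (w (insert k S)))) \<le> real d * real (card R)"
    by (simp only: of_nat_sum of_nat_mult)
  have "(\<Sum>k<length ys. split_weight a R ys k) \<le>
      (\<Sum>k<length ys. \<Sum>S\<in>{S\<in>Pow ?I. k \<notin> S}. 2 * real (min (w S) (w (insert k S))))"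
    by (rule sum_mono) (rule *, simp)
  also have "\<dots> = 2 * (\<Sum>k<length ys. \<Sum>S\<in>{S\<in>Pow ?I. k \<notin> S}. real (min (w S) (w (insert k S))))"
    by (simp only: sum_distrib_left)
  finally show ?thesis using le by linarith
qed

text \<open>The columns of a random sample are exchangeable.\<close>

lemma sum_split_weight_swap:
  assumes k: "k \<le> m"
  shows "(\<Sum>ys\<in>tapes n (Suc m). split_weight a R ys k) = (\<Sum>ys\<in>tapes n (Suc m). split_weight a R ys m)"
proof -
  define h where "h ys = ys[k := ys ! m, m := ys ! k]" for ys :: "nat list"
  have h_nth: "h ys ! j = (if j = m then ys ! k else if j = k then ys ! m else ys ! j)"
    if "length ys = Suc m" "j \<le> m" for ys j
    using that k by (auto simp: h_def nth_list_update)
  have len_h: "length (h ys) = length ys" for ys by (simp add: h_def)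
  have h_h: "h (h ys) = ys" if "length ys = Suc m" for ys
    using that k by (intro nth_equalityI) (auto simp: h_nth len_h)
  have h_tapes: "h ys \<in> tapes n (Suc m)" if ys: "ys \<in> tapes n (Suc m)" for ys
  proof -
    have "h ys ! j \<in> set ys" if "j < length (h ys)" for j
      using that ys k by (auto simp: h_nth len_h tapes_def)
    then have "set (h ys) \<subseteq> set ys" by (auto simp: in_set_conv_nth)
    then show ?thesis using ys by (auto simp: tapes_def len_h)
  qed
  have weight: "split_weight a R (h ys) m = split_weight a R ys k" if ys: "ys \<in> tapes n (Suc m)" for ys
  proof -
    have len: "length ys = Suc m" using ys by (simp add: tapes_def)
    have all: "(\<forall>j<Suc m. j \<noteq> m \<longrightarrow> Q (h ys ! j)) \<longleftrightarrow> (\<forall>j<Suc m. j \<noteq> k \<longrightarrow> Q (ys ! j))" for Q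
    proof (intro iffI allI impI)
      fix j assume *: "\<forall>j<Suc m. j \<noteq> m \<longrightarrow> Q (h ys ! j)" "j < Suc m" "j \<noteq> k"
      show "Q (ys ! j)"
      proof (cases "j = m")
        case True
        then have "k \<noteq> m" "Q (h ys ! k)" using * k by auto
        then show ?thesis using k True by (simp add: h_nth len)
      next
        case False
        then have "Q (h ys ! j)" using * by auto
        then show ?thesis using * False by (simp add: h_nth len)
      qed
    next
      fix j assume *: "\<forall>j<Suc m. j \<noteq> k \<longrightarrow> Q (ys ! j)" "j < Suc m" "j \<noteq> m"
      then have "h ys ! j = (if j = k then ys ! m else ys ! j)" by (simp add: h_nth len)
      then show "Q (h ys ! j)" using * by (cases "j = k") auto
    qed
    have "h ys ! m = ys ! k" using k by (simp add: h_nth len)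
    then show ?thesis
      unfolding split_weight_def len len_h by (simp add: all[of "\<lambda>x. a _ x = a _ x"])
  qed
  show ?thesis
    by (rule sum.reindex_bij_witness[where i = h and j = h])
      (use h_h h_tapes weight in \<open>auto simp: tapes_def\<close>)
qed

text \<open>Summed over all tapes, every position has the same share; so the last one has the
  fraction \<open>1 / Suc m\<close> of a total that is bounded tape by tape.\<close>

lemma sum_split_weight_last:
  assumes "finite R" "vc_at_most n a R d"
  shows "real (Suc m) * (\<Sum>ys\<in>tapes n (Suc m). split_weight a R ys m) \<le>
    real n ^ Suc m * (2 * real d * real (card R))"
proof -
  have "real (Suc m) * (\<Sum>ys\<in>tapes n (Suc m). split_weight a R ys m) =
      (\<Sum>k<Suc m. \<Sum>ys\<in>tapes n (Suc m). split_weight a R ys m)" by simp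
  also have "\<dots> = (\<Sum>k<Suc m. \<Sum>ys\<in>tapes n (Suc m). split_weight a R ys k)"
    by (intro sum.cong refl sum_split_weight_swap[symmetric]) simp
  also have "\<dots> = (\<Sum>ys\<in>tapes n (Suc m). \<Sum>k<Suc m. split_weight a R ys k)" by (rule sum.swap)
  also have "\<dots> \<le> (\<Sum>ys\<in>tapes n (Suc m). 2 * real d * real (card R))"
  proof (intro sum_mono)
    fix ys assume "ys \<in> tapes n (Suc m)"
    then have "length ys = Suc m" "set ys \<subseteq> {..<n}" by (auto simp: tapes_def)
    then show "(\<Sum>k<Suc m. split_weight a R ys k) \<le> 2 * real d * real (card R)"
      using sum_split_weight_le[OF assms(1) _ assms(2), of ys] by simp
  qed
  finally show ?thesis by simp
qed

text \<open>The first \<open>m\<close> columns form the classes and the last one is a test column.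
  Summing over the \<open>n\<close> possible test columns turns disagreement there into Hamming
  distance, which explains the exponent \<open>Suc m\<close> opposite tapes of length
  \<open>m\<close>.\<close>

lemma sum_hamming_class:
  assumes R: "finite R" and vc: "vc_at_most n a R d"
  shows "(\<Sum>xs\<in>tapes n m. \<Sum>u\<in>R. (\<Sum>v\<in>{v\<in>R. agree a xs v u}. real (hamming n a u v)) /
      real (card {v\<in>R. agree a xs v u})) \<le> real n ^ Suc m * (2 * real d * real (card R) / real (Suc m))"
proof -
  have agree_snoc: "(\<forall>j<length (xs @ [y]). j \<noteq> m \<longrightarrow> a v ((xs @ [y]) ! j) = a u ((xs @ [y]) ! j)) \<longleftrightarrow> agree a xs v u"
    if "length xs = m" for xs y u v
  proof -
    have "(\<forall>j<Suc m. j \<noteq> m \<longrightarrow> a v ((xs @ [y]) ! j) = a u ((xs @ [y]) ! j)) \<longleftrightarrow>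
        (\<forall>j<m. a v (xs ! j) = a u (xs ! j))" using that by (auto simp: nth_append less_Suc_eq)
    then show ?thesis using that by (auto simp: agree_def all_set_conv_all_nth)
  qed
  have "(\<Sum>ys\<in>tapes n (Suc m). split_weight a R ys m) =
      (\<Sum>xs\<in>tapes n m. \<Sum>y<n. split_weight a R (xs @ [y]) m)"
    using sum_tapes_add[of "\<lambda>ys. split_weight a R ys m" n m 1] by (simp add: sum_tapes_Suc)
  also have "\<dots> = (\<Sum>xs\<in>tapes n m. \<Sum>y<n. \<Sum>u\<in>R. real (card {v\<in>R. agree a xs v u \<and> a v y \<noteq> a u y}) /
      real (card {v\<in>R. agree a xs v u}))"
  proof (intro sum.cong refl)
    fix xs y assume "xs \<in> tapes n m"
    then have "length xs = m" by (simp add: tapes_def)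
    then show "split_weight a R (xs @ [y]) m = (\<Sum>u\<in>R. real (card {v\<in>R. agree a xs v u \<and> a v y \<noteq> a u y}) /
      real (card {v\<in>R. agree a xs v u}))"
      unfolding split_weight_def agree_snoc[OF \<open>length xs = m\<close>] by (auto simp: nth_append)
  qed
  also have "\<dots> = (\<Sum>xs\<in>tapes n m. \<Sum>u\<in>R. (\<Sum>v\<in>{v\<in>R. agree a xs v u}. real (hamming n a u v)) /
      real (card {v\<in>R. agree a xs v u}))"
  proof (rule sum.cong[OF refl], subst sum.swap, rule sum.cong[OF refl])
    fix xs u
    let ?Q = "{v\<in>R. agree a xs v u}"
    have "(\<Sum>y<n. card {v\<in>R. agree a xs v u \<and> a v y \<noteq> a u y}) =
        (\<Sum>y<n. \<Sum>v\<in>?Q. if a u y \<noteq> a v y then 1 else 0)"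
      using R by (intro sum.cong refl) (auto simp: sum.If_cases intro!: arg_cong[where f = card])
    also have "\<dots> = (\<Sum>v\<in>?Q. hamming n a u v)"
      by (subst sum.swap) (auto simp: sum.If_cases hamming_def intro!: sum.cong arg_cong[where f = card])
    finally show "(\<Sum>y<n. real (card {v\<in>R. agree a xs v u \<and> a v y \<noteq> a u y}) / real (card ?Q)) =
        (\<Sum>v\<in>?Q. real (hamming n a u v)) / real (card ?Q)"
      by (simp flip: sum_divide_distrib of_nat_sum)
  qed
  finally have eq: "(\<Sum>ys\<in>tapes n (Suc m). split_weight a R ys m) = \<dots>" .
  have "(\<Sum>ys\<in>tapes n (Suc m). split_weight a R ys m) \<le>
      real n ^ Suc m * (2 * real d * real (card R)) / real (Suc m)"
    using sum_split_weight_last[OF assms, of m] by (subst pos_le_divide_eq) (simp_all add: mult.commute)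
  then show ?thesis unfolding eq by simp
qed

lemma card_mod_eq_le:
  assumes "0 < c"
  shows "card {z. z < n \<and> z mod c = i} \<le> n div c + 1"
proof -
  have "inj_on (\<lambda>z. z div c) {z. z < n \<and> z mod c = i}"
    by (rule inj_onI) (metis (mono_tags, lifting) div_mult_mod_eq mem_Collect_eq)
  moreover have "(\<lambda>z. z div c) ` {z. z < n \<and> z mod c = i} \<subseteq> {..n div c}"
    by (auto intro: div_le_mono)
  ultimately have "card {z. z < n \<and> z mod c = i} \<le> card {..n div c}"
    by (meson card_inj_on_le finite_atMost)
  then show ?thesis by simp
qed

text \<open>A residue class has at most \<open>n div length l + 1\<close> elements below
  \<open>n\<close>, and \<open>length l \<le> n\<close> absorbs the \<open>+ 1\<close> into the
  factor 2.\<close>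

lemma sum_mod_choice_le:
  fixes f :: "'a \<Rightarrow> real"
  assumes l: "distinct l" "l \<noteq> []" "length l \<le> n" and f: "\<And>x. f x \<ge> 0"
  shows "(\<Sum>z<n. f (l ! (z mod length l))) \<le> 2 * real n / real (length l) * (\<Sum>x\<in>set l. f x)"
proof -
  let ?c = "length l"
  have c: "0 < ?c" using l by simp
  have card: "real (card {z\<in>{..<n}. z mod ?c = i}) \<le> 2 * real n / real ?c" for i
  proof -
    have "real (card {z. z < n \<and> z mod ?c = i}) \<le> real (n div ?c) + 1"
      using card_mod_eq_le[OF c, of n i] by linarith
    also have "\<dots> \<le> real n / real ?c + real n / real ?c"
      using of_nat_div_le_of_nat[of n ?c] l c by (intro add_mono) (auto simp: le_divide_eq)
    finally show ?thesis by simp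
  qed
  have "(\<Sum>z<n. f (l ! (z mod ?c))) = (\<Sum>i<?c. \<Sum>z\<in>{z\<in>{..<n}. z mod ?c = i}. f (l ! (z mod ?c)))"
    using c by (intro sum.group[symmetric]) auto
  also have "\<dots> = (\<Sum>i<?c. real (card {z\<in>{..<n}. z mod ?c = i}) * f (l ! i))"
    by (intro sum.cong refl) simp
  also have "\<dots> \<le> (\<Sum>i<?c. 2 * real n / real ?c * f (l ! i))"
    by (intro sum_mono mult_right_mono card f)
  also have "\<dots> = 2 * real n / real ?c * (\<Sum>x\<in>set l. f x)"
    unfolding sum_distrib_left[symmetric]
    using sum.reindex_bij_betw[OF bij_betw_nth[OF l(1) refl refl], of f] by simp
  finally show ?thesis .
qed

section \<open>Merging clusters in rounds, and the expected cost\<close>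

definition active :: "nat \<Rightarrow> (nat \<Rightarrow> nat) \<Rightarrow> nat set" where
  "active n \<rho> = {v. v < n \<and> \<rho> v = v}"

text \<open>A clustering is given by the map to the representatives, which are its fixed points; the
  program stores it in this form as well.\<close>

definition retraction :: "nat \<Rightarrow> (nat \<Rightarrow> nat) \<Rightarrow> bool" where
  "retraction n \<rho> \<longleftrightarrow> (\<forall>v<n. \<rho> v < n \<and> \<rho> (\<rho> v) = \<rho> v)"

definition members :: "nat \<Rightarrow> (nat \<Rightarrow> nat \<Rightarrow> bool) \<Rightarrow> (nat \<Rightarrow> nat) \<Rightarrow> nat list \<Rightarrow> nat \<Rightarrow> nat list" where
  "members n a \<rho> xs v = filter (\<lambda>w. \<rho> w = w \<and> agree a xs w (\<rho> v)) [0..<n]"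

text \<open>For \<open>z\<close> uniform in \<open>{0..<n}\<close> the choice is uniform only up to a factor of 2, which suffices.\<close>

definition new_rep :: "nat \<Rightarrow> (nat \<Rightarrow> nat \<Rightarrow> bool) \<Rightarrow> (nat \<Rightarrow> nat) \<Rightarrow> nat list \<Rightarrow> nat \<Rightarrow> nat \<Rightarrow> nat" where
  "new_rep n a \<rho> xs z v = (let l = members n a \<rho> xs v in l ! (z mod length l))"

definition merge_lists :: "nat \<Rightarrow> (nat \<Rightarrow> nat \<Rightarrow> bool) \<Rightarrow> (nat \<Rightarrow> nat) \<Rightarrow> nat list \<Rightarrow> (nat \<Rightarrow> nat list) \<Rightarrow> nat \<Rightarrow> nat list" where
  "merge_lists n a \<rho> xs L v = concat (map L (members n a \<rho> xs v))"

definition round_cost :: "nat \<Rightarrow> (nat \<Rightarrow> nat \<Rightarrow> bool) \<Rightarrow> (nat \<Rightarrow> nat) \<Rightarrow> (nat \<Rightarrow> nat) \<Rightarrow> nat" where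
  "round_cost n a \<rho> \<rho>' = (\<Sum>u\<in>active n \<rho>. hamming n a u (\<rho>' u))"

lemma finite_active [simp]: "finite (active n \<rho>)"
  by (simp add: active_def)

lemma agree_refl: "agree a xs u u"
  by (simp add: agree_def)

lemma agree_cong: "agree a xs u v \<Longrightarrow> agree a xs w u \<longleftrightarrow> agree a xs w v"
  by (simp add: agree_def)

lemma set_members: "set (members n a \<rho> xs v) = {w\<in>active n \<rho>. agree a xs w (\<rho> v)}"
  by (auto simp: members_def active_def)

lemma distinct_members: "distinct (members n a \<rho> xs v)"
  by (simp add: members_def)

lemma rep_in_members: "retraction n \<rho> \<Longrightarrow> v < n \<Longrightarrow> \<rho> v \<in> set (members n a \<rho> xs v)"
  by (auto simp: set_members active_def retraction_def agree_refl)

lemma members_cong: "agree a xs (\<rho> u) (\<rho> v) \<Longrightarrow> members n a \<rho> xs u = members n a \<rho> xs v"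
  unfolding members_def using agree_cong by metis

lemma new_rep_in_members:
  assumes "retraction n \<rho>" "v < n"
  shows "new_rep n a \<rho> xs z v \<in> set (members n a \<rho> xs v)"
proof -
  have "members n a \<rho> xs v \<noteq> []" using rep_in_members[OF assms, of a xs] by auto
  then show ?thesis unfolding new_rep_def Let_def by (intro nth_mem) simp
qed

lemma new_rep_props:
  assumes "retraction n \<rho>" "v < n"
  shows "new_rep n a \<rho> xs z v < n" "\<rho> (new_rep n a \<rho> xs z v) = new_rep n a \<rho> xs z v"
    "agree a xs (new_rep n a \<rho> xs z v) (\<rho> v)"
  using new_rep_in_members[OF assms, of a xs z] by (auto simp: set_members active_def)

lemma new_rep_cong: "agree a xs (\<rho> u) (\<rho> v) \<Longrightarrow> new_rep n a \<rho> xs z u = new_rep n a \<rho> xs z v"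
  unfolding new_rep_def using members_cong by metis

lemma retraction_new_rep:
  assumes "retraction n \<rho>"
  shows "retraction n (new_rep n a \<rho> xs z)"
  unfolding retraction_def
proof (intro allI impI conjI)
  fix v assume v: "v < n"
  note p = new_rep_props[OF assms v, of a xs z]
  show "new_rep n a \<rho> xs z v < n" by (rule p)
  show "new_rep n a \<rho> xs z (new_rep n a \<rho> xs z v) = new_rep n a \<rho> xs z v"
    by (rule new_rep_cong) (simp add: p)
qed

text \<open>Surviving representatives with equal traces would have received the same new
  representative, so the traces tell them apart.\<close>

lemma card_active_new_rep:
  assumes "retraction n \<rho>"
  shows "card (active n (new_rep n a \<rho> xs z)) \<le> card ((\<lambda>u. {x\<in>set xs. a u x}) ` {..<n})"
proof (rule card_inj_on_le)
  show "inj_on (\<lambda>u. {x\<in>set xs. a u x}) (active n (new_rep n a \<rho> xs z))"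
  proof (rule inj_onI)
    fix u v assume uv: "u \<in> active n (new_rep n a \<rho> xs z)" "v \<in> active n (new_rep n a \<rho> xs z)"
      "{x\<in>set xs. a u x} = {x\<in>set xs. a v x}"
    then have u: "u < n" "new_rep n a \<rho> xs z u = u" and v: "v < n" "new_rep n a \<rho> xs z v = v"
      by (auto simp: active_def)
    have "\<rho> u = u" "\<rho> v = v" using new_rep_props(2)[OF assms u(1)] new_rep_props(2)[OF assms v(1)] u v by metis+
    moreover have "agree a xs u v" using uv(3) by (auto simp: agree_def)
    ultimately have "new_rep n a \<rho> xs z u = new_rep n a \<rho> xs z v" by (intro new_rep_cong) simp
    then show "u = v" using u v by simp
  qed
qed (auto simp: active_def)

lemma sum_tapes_snoc: "(\<Sum>t\<in>tapes n (Suc m). f t) = (\<Sum>xs\<in>tapes n m. \<Sum>z<n. f (xs @ [z]))"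
  using sum_tapes_add[of f n m 1] by (simp add: sum_tapes_Suc)

text \<open>A tape segment of length \<open>Suc m\<close> holds the \<open>m\<close> columns
  followed by the offset that picks the new representatives. One offset serves all classes, since
  linearity of expectation asks for no independence between them. The factor 4 combines the 2 of the
  imperfectly uniform choice with the 2 of \<open>harmonic_le_min\<close>.\<close>

lemma sum_round_cost:
  assumes \<rho>: "retraction n \<rho>" and vc: "vc_at_most n a {..<n} d"
  shows "(\<Sum>t\<in>tapes n (Suc m). real (round_cost n a \<rho> (new_rep n a \<rho> (take m t) (t ! m)))) \<le>
    real n ^ Suc m * (4 * real n * real d * real (card (active n \<rho>)) / real (Suc m))"
proof -
  let ?R = "active n \<rho>"
  let ?Q = "\<lambda>xs u. {v\<in>?R. agree a xs v u}"
  have vcR: "vc_at_most n a ?R d" by (rule vc_at_most_mono[OF vc]) (auto simp: active_def)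
  have "(\<Sum>t\<in>tapes n (Suc m). real (round_cost n a \<rho> (new_rep n a \<rho> (take m t) (t ! m)))) =
      (\<Sum>xs\<in>tapes n m. \<Sum>z<n. real (round_cost n a \<rho> (new_rep n a \<rho> xs z)))"
    unfolding sum_tapes_snoc by (intro sum.cong refl) (auto simp: tapes_def nth_append)
  also have "\<dots> = (\<Sum>xs\<in>tapes n m. \<Sum>u\<in>?R. \<Sum>z<n. real (hamming n a u (new_rep n a \<rho> xs z u)))"
    unfolding round_cost_def of_nat_sum by (rule sum.cong[OF refl]) (rule sum.swap)
  also have "\<dots> \<le> (\<Sum>xs\<in>tapes n m. \<Sum>u\<in>?R. 2 * real n * ((\<Sum>v\<in>?Q xs u. real (hamming n a u v)) / real (card (?Q xs u))))"
  proof (intro sum_mono)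
    fix xs u assume u: "u \<in> ?R"
    then have "u < n" "\<rho> u = u" by (auto simp: active_def)
    let ?l = "members n a \<rho> xs u"
    have set: "set ?l = ?Q xs u" by (simp add: set_members \<open>\<rho> u = u\<close>)
    have dist: "distinct ?l" by (rule distinct_members)
    have ne: "?l \<noteq> []" using rep_in_members[OF \<rho> \<open>u < n\<close>, of a xs] by auto
    have len: "length ?l \<le> n" unfolding members_def using length_filter_le[of _ "[0..<n]"] by (metis length_upt minus_nat.diff_0)
    have "length ?l = card (?Q xs u)" using distinct_card[OF dist] set by simp
    have "(\<Sum>z<n. real (hamming n a u (new_rep n a \<rho> xs z u))) =
        (\<Sum>z<n. real (hamming n a u (?l ! (z mod length ?l))))" by (simp add: new_rep_def Let_def)
    also have "\<dots> \<le> 2 * real n / real (length ?l) * (\<Sum>v\<in>set ?l. real (hamming n a u v))"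
      by (rule sum_mod_choice_le[OF dist ne len]) simp
    finally show "(\<Sum>z<n. real (hamming n a u (new_rep n a \<rho> xs z u))) \<le>
        2 * real n * ((\<Sum>v\<in>?Q xs u. real (hamming n a u v)) / real (card (?Q xs u)))"
      unfolding set \<open>length ?l = card (?Q xs u)\<close> by simp
  qed
  also have "\<dots> = 2 * real n * (\<Sum>xs\<in>tapes n m. \<Sum>u\<in>?R. (\<Sum>v\<in>?Q xs u. real (hamming n a u v)) / real (card (?Q xs u)))"
    by (simp only: sum_distrib_left)
  also have "\<dots> \<le> 2 * real n * (real n ^ Suc m * (2 * real d * real (card ?R) / real (Suc m)))"
    by (intro mult_left_mono sum_hamming_class finite_active vcR) simp
  also have "\<dots> = real n ^ Suc m * (4 * real n * real d * real (card ?R) / real (Suc m))"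
    by (simp add: ac_simps)
  finally show ?thesis .
qed

text \<open>The component \<open>c\<close> belongs to the analysis; the program counts the
  alternations of the final ordering instead. The last component is the unread part of the
  tape.\<close>

definition cluster_round :: "nat \<Rightarrow> (nat \<Rightarrow> nat \<Rightarrow> bool) \<Rightarrow> nat \<Rightarrow>
    (nat \<Rightarrow> nat) \<times> (nat \<Rightarrow> nat list) \<times> nat \<times> nat list \<Rightarrow> (nat \<Rightarrow> nat) \<times> (nat \<Rightarrow> nat list) \<times> nat \<times> nat list" where
  "cluster_round n a m = (\<lambda>(\<rho>, L, c, t). let \<rho>' = new_rep n a \<rho> (take m t) (t ! m) in
     (\<rho>', merge_lists n a \<rho> (take m t) L, c + round_cost n a \<rho> \<rho>', drop (Suc m) t))"

lemma cluster_round_apply: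
  "cluster_round n a m (\<rho>, L, c, t) = (new_rep n a \<rho> (take m t) (t ! m), merge_lists n a \<rho> (take m t) L,
     c + round_cost n a \<rho> (new_rep n a \<rho> (take m t) (t ! m)), drop (Suc m) t)"
  by (simp add: cluster_round_def Let_def)

abbreviation rounds where "rounds n a ms \<equiv> fold (cluster_round n a) ms"

fun cost_of :: "(nat \<Rightarrow> nat) \<times> (nat \<Rightarrow> nat list) \<times> nat \<times> nat list \<Rightarrow> nat" where
  "cost_of (\<rho>, L, c, t) = c"

definition draws :: "nat list \<Rightarrow> nat" where
  "draws ms = sum_list (map Suc ms)"

primrec cost_bound :: "nat \<Rightarrow> nat \<Rightarrow> (nat \<Rightarrow> real) \<Rightarrow> real \<Rightarrow> nat list \<Rightarrow> real" where
  "cost_bound n d g r [] = 0"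
| "cost_bound n d g r (m # ms) = 4 * real n * real d * r / real (Suc m) + cost_bound n d g (g m) ms"

text \<open>Each round costs about \<open>n r / m\<close> on average, where the number \<open>r\<close> of representatives is bounded
  by the number of traces on the columns sampled in the previous round.\<close>

lemma sum_rounds_cost:
  assumes "retraction n \<rho>" "real (card (active n \<rho>)) \<le> r"
    and vc: "vc_at_most n a {..<n} d"
    and g: "\<And>xs. set xs \<subseteq> {..<n} \<Longrightarrow> real (card ((\<lambda>u. {x\<in>set xs. a u x}) ` {..<n})) \<le> g (length xs)"
  shows "(\<Sum>t\<in>tapes n (draws ms). real (cost_of (rounds n a ms (\<rho>, L, c, t)))) \<le>
    real n ^ draws ms * (real c + cost_bound n d g r ms)"
  using assms(1,2)
proof (induction ms arbitrary: \<rho> L c r)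
  case Nil
  then show ?case by (simp add: draws_def)
next
  case (Cons m ms)
  let ?D = "draws ms"
  let ?N = "\<lambda>s. new_rep n a \<rho> (take m s) (s ! m)"
  have D: "draws (m # ms) = Suc m + ?D" by (simp add: draws_def)
  have "(\<Sum>t\<in>tapes n (draws (m # ms)). real (cost_of (rounds n a (m # ms) (\<rho>, L, c, t)))) =
    (\<Sum>s\<in>tapes n (Suc m). \<Sum>t\<in>tapes n ?D. real (cost_of (rounds n a ms
       (?N s, merge_lists n a \<rho> (take m s) L, c + round_cost n a \<rho> (?N s), t))))"
    unfolding D sum_tapes_add by (intro sum.cong refl) (auto simp: tapes_def cluster_round_apply nth_append)
  also have "\<dots> \<le> (\<Sum>s\<in>tapes n (Suc m). real n ^ ?D * (real (c + round_cost n a \<rho> (?N s)) + cost_bound n d g (g m) ms))"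
  proof (intro sum_mono Cons.IH)
    fix s assume s: "s \<in> tapes n (Suc m)"
    show "retraction n (?N s)" by (rule retraction_new_rep[OF Cons.prems(1)])
    have "set (take m s) \<subseteq> {..<n}" "length (take m s) = m"
      using s set_take_subset[of m s] by (auto simp: tapes_def)
    with g[of "take m s"] card_active_new_rep[OF Cons.prems(1), of a "take m s" "s ! m"]
    show "real (card (active n (?N s))) \<le> g m" by (metis (lifting) of_nat_mono order_trans)
  qed
  also have "\<dots> = real n ^ ?D * (\<Sum>s\<in>tapes n (Suc m). real (round_cost n a \<rho> (?N s))) +
      real n ^ draws (m # ms) * (real c + cost_bound n d g (g m) ms)"
    unfolding D sum_distrib_left[symmetric] by (simp add: sum.distrib algebra_simps power_add)
  also have "\<dots> \<le> real n ^ ?D * (real n ^ Suc m * (4 * real n * real d * r / real (Suc m))) +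
      real n ^ draws (m # ms) * (real c + cost_bound n d g (g m) ms)"
  proof (intro add_right_mono mult_left_mono)
    have "4 * real n * real d * real (card (active n \<rho>)) / real (Suc m) \<le> 4 * real n * real d * r / real (Suc m)"
      by (intro divide_right_mono mult_left_mono Cons.prems(2)) auto
    then show "(\<Sum>s\<in>tapes n (Suc m). real (round_cost n a \<rho> (?N s))) \<le>
       real n ^ Suc m * (4 * real n * real d * r / real (Suc m))"
      using sum_round_cost[OF Cons.prems(1) vc, of m]
      by (meson mult_left_mono of_nat_0_le_iff order_trans zero_le_power)
  qed simp
  also have "\<dots> = real n ^ draws (m # ms) * (real c + cost_bound n d g r (m # ms))"
    unfolding D by (simp add: power_add algebra_simps)
  finally show ?case .
qed

section \<open>Closed tours and their behavior under concatenation\<close>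

section \<open>Alternations along the merged lists\<close>

fun alternations :: "(nat \<Rightarrow> bool) \<Rightarrow> nat list \<Rightarrow> nat" where
  "alternations b (x # y # l) = of_bool (b x \<noteq> b y) + alternations b (y # l)"
| "alternations b l = 0"

text \<open>Alternations along the closed walk from \<open>p\<close> through \<open>l\<close> and
  back to \<open>p\<close>. Closing the walk at the representative makes the quantity subadditive
  under concatenation, whatever the order of the lists.\<close>

definition tour :: "(nat \<Rightarrow> bool) \<Rightarrow> nat \<Rightarrow> nat list \<Rightarrow> nat" where
  "tour b p l = of_bool (b p \<noteq> b (hd l)) + alternations b l + of_bool (b (last l) \<noteq> b p)"

lemma alternations_append:
  "l1 \<noteq> [] \<Longrightarrow> l2 \<noteq> [] \<Longrightarrow>
    alternations b (l1 @ l2) = alternations b l1 + of_bool (b (last l1) \<noteq> b (hd l2)) + alternations b l2"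
proof (induction l1)
  case (Cons x l1)
  then show ?case by (cases l1; cases l2) auto
qed simp

lemma alternations_conv_nth:
  "alternations b l = card {j. Suc j < length l \<and> b (l ! j) \<noteq> b (l ! Suc j)}"
proof (induction b l rule: alternations.induct)
  case (1 b x y l)
  let ?A = "{j. Suc j < length (y # l) \<and> b ((y # l) ! j) \<noteq> b ((y # l) ! Suc j)}"
  have fin: "finite ?A" by (rule finite_subset[of _ "{..<length (y # l)}"]) auto
  have eq: "{j. Suc j < length (x # y # l) \<and> b ((x # y # l) ! j) \<noteq> b ((x # y # l) ! Suc j)} =
      (if b x \<noteq> b y then {0} else {}) \<union> Suc ` ?A" (is "?B = _")
  proof (rule set_eqI)
    fix j show "j \<in> ?B \<longleftrightarrow> j \<in> (if b x \<noteq> b y then {0} else {}) \<union> Suc ` ?A"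
      by (cases j) auto
  qed
  have "card ((if b x \<noteq> b y then {0} else {}) \<union> Suc ` ?A) = of_bool (b x \<noteq> b y) + card ?A"
    using fin by (subst card_Un_disjoint) (auto simp: card_image)
  then show ?case unfolding eq using 1 by simp
qed auto

lemma tour_le_change: "tour b q l \<le> tour b p l + 2 * of_bool (b p \<noteq> b q)"
  unfolding tour_def by auto

text \<open>A detour to \<open>p\<close> between the lists cannot reduce the alternations: if
  \<open>last l1\<close> and \<open>hd l2\<close> differ under \<open>b\<close>, then one of them
  differs from \<open>p\<close>.\<close>

lemma tour_append_le:
  assumes "l1 \<noteq> []" "l2 \<noteq> []"
  shows "tour b p (l1 @ l2) \<le> tour b p l1 + tour b p l2"
  using assms unfolding tour_def by (auto simp: alternations_append)

lemma tour_concat_le: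
  assumes "bs \<noteq> []" "\<And>x. x \<in> set bs \<Longrightarrow> L x \<noteq> []"
  shows "tour b p (concat (map L bs)) \<le> (\<Sum>x\<leftarrow>bs. tour b x (L x) + 2 * of_bool (b x \<noteq> b p))"
  using assms
proof (induction bs)
  case (Cons y bs)
  show ?case
  proof (cases "bs = []")
    case True
    then show ?thesis using tour_le_change[of b p "L y" y] by simp
  next
    case False
    then have "concat (map L bs) \<noteq> []" using Cons.prems(2) by (cases bs) auto
    then have "tour b p (L y @ concat (map L bs)) \<le> tour b p (L y) + tour b p (concat (map L bs))"
      using Cons.prems by (intro tour_append_le) auto
    also have "\<dots> \<le> (tour b y (L y) + 2 * of_bool (b y \<noteq> b p)) + (\<Sum>x\<leftarrow>bs. tour b x (L x) + 2 * of_bool (b x \<noteq> b p))"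
      using False Cons by (intro add_mono tour_le_change Cons.IH) auto
    finally show ?thesis by simp
  qed
qed simp

definition cluster_lists :: "nat \<Rightarrow> (nat \<Rightarrow> nat) \<Rightarrow> (nat \<Rightarrow> nat list) \<Rightarrow> bool" where
  "cluster_lists n \<rho> L \<longleftrightarrow> (\<forall>u\<in>active n \<rho>. distinct (L u) \<and> set (L u) = {v. v < n \<and> \<rho> v = u})"

lemma cluster_lists_nonempty: "cluster_lists n \<rho> L \<Longrightarrow> u \<in> active n \<rho> \<Longrightarrow> L u \<noteq> []"
  unfolding cluster_lists_def active_def by fastforce

lemma members_new_rep:
  assumes "retraction n \<rho>" "p \<in> active n (new_rep n a \<rho> xs z)"
  shows "set (members n a \<rho> xs p) = {u\<in>active n \<rho>. new_rep n a \<rho> xs z u = p}"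
proof -
  have p: "p < n" "new_rep n a \<rho> xs z p = p" using assms(2) by (auto simp: active_def)
  then have "\<rho> p = p" using new_rep_props(2)[OF assms(1) p(1)] by metis
  show ?thesis
  proof (rule set_eqI)
    fix u
    show "u \<in> set (members n a \<rho> xs p) \<longleftrightarrow> u \<in> {u\<in>active n \<rho>. new_rep n a \<rho> xs z u = p}"
    proof (cases "u \<in> active n \<rho>")
      case True
      then have u: "u < n" "\<rho> u = u" by (auto simp: active_def)
      have "new_rep n a \<rho> xs z u = p" if "agree a xs u p"
        using new_rep_cong[of a xs \<rho> u p n z] that p u \<open>\<rho> p = p\<close> by simp
      moreover have "agree a xs u p" if "new_rep n a \<rho> xs z u = p"
        using new_rep_props(3)[OF assms(1) u(1), of a xs z] that u by (simp add: agree_def)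
      ultimately show ?thesis using True \<open>\<rho> p = p\<close> by (auto simp: set_members)
    qed (simp add: set_members)
  qed
qed

lemma new_rep_rep:
  assumes "retraction n \<rho>" "v < n"
  shows "new_rep n a \<rho> xs z (\<rho> v) = new_rep n a \<rho> xs z v"
  using assms by (intro new_rep_cong) (simp add: retraction_def agree_refl)

lemma cluster_lists_merge:
  assumes \<rho>: "retraction n \<rho>" and L: "cluster_lists n \<rho> L"
  shows "cluster_lists n (new_rep n a \<rho> xs z) (merge_lists n a \<rho> xs L)"
  unfolding cluster_lists_def
proof (intro ballI conjI)
  fix p assume p: "p \<in> active n (new_rep n a \<rho> xs z)"
  let ?l = "members n a \<rho> xs p"
  have l: "u \<in> active n \<rho>" "new_rep n a \<rho> xs z u = p" if "u \<in> set ?l" for u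
    using that members_new_rep[OF \<rho> p] by auto
  have Lu: "distinct (L u)" "set (L u) = {v. v < n \<and> \<rho> v = u}" if "u \<in> set ?l" for u
    using l(1)[OF that] L by (auto simp: cluster_lists_def)
  have "distinct (concat (map L bs))" if "distinct bs" "set bs \<subseteq> set ?l" for bs
    using that
  proof (induction bs)
    case (Cons u bs)
    have "set (L u) \<inter> set (L w) = {}" if "w \<in> set bs" for w
      using Lu(2)[of u] Lu(2)[of w] that Cons.prems by auto
    then show ?case using Cons Lu(1)[of u] by auto
  qed simp
  then show "distinct (merge_lists n a \<rho> xs L p)" unfolding merge_lists_def using distinct_members by blast
  have "set (merge_lists n a \<rho> xs L p) = (\<Union>u\<in>set ?l. {v. v < n \<and> \<rho> v = u})"
    unfolding merge_lists_def using Lu(2) by simp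
  also have "\<dots> = {v. v < n \<and> \<rho> v \<in> set ?l}" by auto
  also have "\<dots> = {v. v < n \<and> new_rep n a \<rho> xs z v = p}"
  proof (rule Collect_cong, rule conj_cong[OF refl])
    fix v assume v: "v < n"
    then have "\<rho> v \<in> active n \<rho>" using \<rho> by (simp add: active_def retraction_def)
    then show "\<rho> v \<in> set ?l \<longleftrightarrow> new_rep n a \<rho> xs z v = p"
      unfolding members_new_rep[OF \<rho> p] using new_rep_rep[OF \<rho> v] by simp
  qed
  finally show "set (merge_lists n a \<rho> xs L p) = {v. v < n \<and> new_rep n a \<rho> xs z v = p}" .
qed

definition total_tour :: "nat \<Rightarrow> (nat \<Rightarrow> nat \<Rightarrow> bool) \<Rightarrow> (nat \<Rightarrow> nat) \<Rightarrow> (nat \<Rightarrow> nat list) \<Rightarrow> nat" where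
  "total_tour n a \<rho> L = (\<Sum>u\<in>active n \<rho>. \<Sum>x<n. tour (\<lambda>v. a v x) u (L u))"

lemma sum_of_bool_hamming: "(\<Sum>x<n. of_bool (a u x \<noteq> a v x)) = hamming n a u v"
  by (auto simp: hamming_def of_bool_def sum.If_cases intro!: arg_cong[where f = card])

text \<open>Moving the base point of the tour of \<open>u\<close> to its new representative costs at
  most 2 in each column where the two rows differ. Summed over the columns this is twice a Hamming
  distance.\<close>

lemma total_tour_merge:
  fixes a xs z
  assumes \<rho>: "retraction n \<rho>" and L: "cluster_lists n \<rho> L"
  defines "\<rho>' \<equiv> new_rep n a \<rho> xs z"
  shows "total_tour n a \<rho>' (merge_lists n a \<rho> xs L) \<le> total_tour n a \<rho> L + 2 * round_cost n a \<rho> \<rho>'"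
proof -
  let ?T = "\<lambda>u. \<Sum>x<n. tour (\<lambda>v. a v x) u (L u)"
  have "(\<Sum>x<n. tour (\<lambda>v. a v x) p (merge_lists n a \<rho> xs L p)) \<le>
      (\<Sum>u\<in>{u\<in>active n \<rho>. \<rho>' u = p}. ?T u + 2 * hamming n a u (\<rho>' u))" if p: "p \<in> active n \<rho>'" for p
  proof -
    let ?l = "members n a \<rho> xs p"
    have l: "set ?l = {u\<in>active n \<rho>. \<rho>' u = p}"
      using members_new_rep[OF \<rho>, of p a xs z] p unfolding \<rho>'_def by simp
    have "p < n" using p by (simp add: active_def)
    then have ne: "?l \<noteq> []" using rep_in_members[OF \<rho>, of p a xs] by fastforce
    have "(\<Sum>x<n. tour (\<lambda>v. a v x) p (merge_lists n a \<rho> xs L p)) \<le>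
        (\<Sum>x<n. \<Sum>u\<leftarrow>?l. tour (\<lambda>v. a v x) u (L u) + 2 * of_bool (a u x \<noteq> a p x))"
      unfolding merge_lists_def
    proof (intro sum_mono tour_concat_le ne)
      fix u assume "u \<in> set ?l"
      then show "L u \<noteq> []" using cluster_lists_nonempty[OF L] l by auto
    qed
    also have "\<dots> = (\<Sum>x<n. \<Sum>u\<in>set ?l. tour (\<lambda>v. a v x) u (L u) + 2 * of_bool (a u x \<noteq> a p x))"
      by (simp only: sum_list_distinct_conv_sum_set[OF distinct_members])
    also have "\<dots> = (\<Sum>u\<in>set ?l. \<Sum>x<n. tour (\<lambda>v. a v x) u (L u) + 2 * of_bool (a u x \<noteq> a p x))"
      by (rule sum.swap)
    also have "\<dots> = (\<Sum>u\<in>set ?l. ?T u + 2 * hamming n a u p)"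
      by (simp only: sum.distrib sum_distrib_left[symmetric] sum_of_bool_hamming)
    also have "\<dots> = (\<Sum>u\<in>{u\<in>active n \<rho>. \<rho>' u = p}. ?T u + 2 * hamming n a u (\<rho>' u))"
      unfolding l by (intro sum.cong refl) simp
    finally show ?thesis .
  qed
  then have "total_tour n a \<rho>' (merge_lists n a \<rho> xs L) \<le>
      (\<Sum>p\<in>active n \<rho>'. \<Sum>u\<in>{u\<in>active n \<rho>. \<rho>' u = p}. ?T u + 2 * hamming n a u (\<rho>' u))"
    unfolding total_tour_def by (rule sum_mono)
  also have "\<dots> = (\<Sum>u\<in>active n \<rho>. ?T u + 2 * hamming n a u (\<rho>' u))"
  proof (rule sum.group)
    have "retraction n \<rho>'" unfolding \<rho>'_def by (rule retraction_new_rep[OF \<rho>])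
    then show "\<rho>' ` active n \<rho> \<subseteq> active n \<rho>'" by (auto simp: active_def retraction_def)
  qed auto
  also have "\<dots> = total_tour n a \<rho> L + 2 * round_cost n a \<rho> \<rho>'"
    unfolding total_tour_def round_cost_def by (simp only: sum.distrib sum_distrib_left)
  finally show ?thesis .
qed

lemma rounds_invariant:
  assumes "rounds n a ms (\<rho>, L, c, t) = (\<rho>', L', c', t')" "retraction n \<rho>" "cluster_lists n \<rho> L"
    "total_tour n a \<rho> L \<le> 2 * c"
  shows "retraction n \<rho>' \<and> cluster_lists n \<rho>' L' \<and> total_tour n a \<rho>' L' \<le> 2 * c'"
  using assms
proof (induction ms arbitrary: \<rho> L c t)
  case (Cons m ms)
  let ?\<rho> = "new_rep n a \<rho> (take m t) (t ! m)"
  let ?L = "merge_lists n a \<rho> (take m t) L"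
  have "rounds n a ms (?\<rho>, ?L, c + round_cost n a \<rho> ?\<rho>, drop (Suc m) t) = (\<rho>', L', c', t')"
    using Cons.prems(1) by (simp add: cluster_round_apply)
  moreover have "total_tour n a ?\<rho> ?L \<le> 2 * (c + round_cost n a \<rho> ?\<rho>)"
    by (rule order_trans[OF total_tour_merge[OF Cons.prems(2,3)]]) (simp add: Cons.prems(4))
  ultimately show ?case
    by (rule Cons.IH[OF _ retraction_new_rep[OF Cons.prems(2)] cluster_lists_merge[OF Cons.prems(2,3)]])
qed simp

abbreviation start :: "nat list \<Rightarrow> (nat \<Rightarrow> nat) \<times> (nat \<Rightarrow> nat list) \<times> nat \<times> nat list" where
  "start t \<equiv> (\<lambda>v. v, \<lambda>v. [v], 0, t)"

lemma start_invariant: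
  "retraction n (\<lambda>v. v)" "cluster_lists n (\<lambda>v. v) (\<lambda>v. [v])" "total_tour n a (\<lambda>v. v) (\<lambda>v. [v]) \<le> 2 * 0"
  by (auto simp: retraction_def cluster_lists_def active_def) (simp add: total_tour_def tour_def)

text \<open>In the final round the sample is empty, so all vertices agree and a single
  representative remains; its list is an ordering of all vertices. The term \<open>\<rho> 0\<close>
  merely names that representative.\<close>

lemma rounds_order:
  assumes "rounds n a (ms @ [0]) (start t) = (\<rho>, L, c, t')" "n > 0"
  shows "distinct (L (\<rho> 0))" "set (L (\<rho> 0)) = {..<n}" "\<forall>v<n. \<rho> v = \<rho> 0"
    "(\<Sum>x<n. alternations (\<lambda>v. a v x) (L (\<rho> 0))) \<le> 2 * c"
proof -
  have inv: "retraction n \<rho>" "cluster_lists n \<rho> L" "total_tour n a \<rho> L \<le> 2 * c"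
    using rounds_invariant[OF assms(1) start_invariant] by auto
  obtain \<rho>1 L1 c1 t1 where 1: "rounds n a ms (start t) = (\<rho>1, L1, c1, t1)" by (metis prod_cases4)
  then have "\<rho> = new_rep n a \<rho>1 [] (t1 ! 0)" using assms(1) by (simp add: cluster_round_apply)
  then have "\<rho> v = \<rho> 0" for v
    using new_rep_cong[of a "[]" \<rho>1 v 0] by (simp add: agree_def)
  then show const: "\<forall>v<n. \<rho> v = \<rho> 0" by blast
  have "\<rho> 0 < n" "\<rho> (\<rho> 0) = \<rho> 0" using inv(1) assms(2) by (auto simp: retraction_def)
  have act: "active n \<rho> = {\<rho> 0}"
  proof (rule set_eqI)
    fix v
    show "v \<in> active n \<rho> \<longleftrightarrow> v \<in> {\<rho> 0}"
    proof
      assume "v \<in> active n \<rho>"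
      then have "v < n" "\<rho> v = v" by (simp_all add: active_def)
      then show "v \<in> {\<rho> 0}" using const by (metis singletonI)
    qed (use \<open>\<rho> 0 < n\<close> \<open>\<rho> (\<rho> 0) = \<rho> 0\<close> in \<open>simp add: active_def\<close>)
  qed
  then have L: "distinct (L (\<rho> 0))" "set (L (\<rho> 0)) = {v. v < n \<and> \<rho> v = \<rho> 0}"
    using inv(2) by (simp_all add: cluster_lists_def)
  show "distinct (L (\<rho> 0))" by (rule L)
  have "{v. v < n \<and> \<rho> v = \<rho> 0} = {..<n}" using const by blast
  then show "set (L (\<rho> 0)) = {..<n}" using L(2) by simp
  have "(\<Sum>x<n. alternations (\<lambda>v. a v x) (L (\<rho> 0))) \<le> (\<Sum>x<n. tour (\<lambda>v. a v x) (\<rho> 0) (L (\<rho> 0)))"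
    by (intro sum_mono) (simp add: tour_def)
  also have "\<dots> \<le> 2 * c" using inv(3) by (simp add: total_tour_def act)
  finally show "(\<Sum>x<n. alternations (\<lambda>v. a v x) (L (\<rho> 0))) \<le> 2 * c" .
qed

text \<open>Surplus tape is passed on unread, so the cost of a segment can be evaluated inside a
  longer tape.\<close>

lemma rounds_tape:
  "draws ms \<le> length s \<Longrightarrow> rounds n a ms (\<rho>, L, c, s @ t) =
    (let (\<rho>', L', c', s') = rounds n a ms (\<rho>, L, c, s) in (\<rho>', L', c', s' @ t))"
proof (induction ms arbitrary: \<rho> L c s)
  case (Cons m ms)
  then have "Suc m \<le> length s" "draws ms \<le> length (drop (Suc m) s)" by (auto simp: draws_def)
  then show ?case using Cons.IH[of "drop (Suc m) s"] by (simp add: cluster_round_apply nth_append)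
qed simp

section \<open>Maximal dyadic blocks inside a set of positions\<close>

section \<open>Dyadic blocks\<close>

definition full :: "(nat \<Rightarrow> bool) \<Rightarrow> nat \<Rightarrow> nat \<Rightarrow> bool" where
  "full b s q \<longleftrightarrow> (\<forall>j. j div 2 ^ s = q \<longrightarrow> b j)"

definition sibling :: "nat \<Rightarrow> nat" where
  "sibling q = q + 1 - 2 * (q mod 2)"

text \<open>These are the maximal full blocks: by \<open>full_Suc_sibling\<close> the parent of a
  full block is full exactly if the sibling is. Phrased with the sibling, the condition refers to a
  single level, and a single level is what the program keeps in memory.\<close>

definition chosen :: "(nat \<Rightarrow> bool) \<Rightarrow> nat \<Rightarrow> nat \<Rightarrow> bool" where
  "chosen b s q \<longleftrightarrow> full b s q \<and> \<not> full b s (sibling q)"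

lemma sibling_double [simp]: "sibling (2 * m) = 2 * m + 1" "sibling (2 * m + 1) = 2 * m"
  by (simp_all add: sibling_def)

lemma sibling_div_2: "q div 2 = r div 2 \<longleftrightarrow> r = q \<or> r = sibling q"
proof (cases "even q")
  case True
  then obtain m where q: "q = 2 * m" by (rule evenE)
  show ?thesis unfolding q sibling_double by presburger
next
  case False
  then obtain m where q: "q = 2 * m + 1" by (rule oddE)
  show ?thesis unfolding q sibling_double by presburger
qed

lemma full_0: "full b 0 q \<longleftrightarrow> b q"
  by (simp add: full_def)

lemma full_Suc: "full b (Suc s) p \<longleftrightarrow> full b s (2 * p) \<and> full b s (2 * p + 1)"
proof -
  have half: "x div 2 = p \<longleftrightarrow> x = 2 * p \<or> x = 2 * p + 1" for x :: nat by presburger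
  have "j div 2 ^ Suc s = j div 2 ^ s div 2" for j :: nat
    by (simp add: div_mult2_eq[symmetric] mult.commute)
  then have eq: "j div 2 ^ Suc s = p \<longleftrightarrow> j div 2 ^ s = 2 * p \<or> j div 2 ^ s = 2 * p + 1" for j :: nat
    by (simp only: half)
  show ?thesis unfolding full_def eq by blast
qed

lemma full_Suc_sibling: "full b (Suc s) (q div 2) \<longleftrightarrow> full b s q \<and> full b s (sibling q)"
proof (cases "even q")
  case True
  then obtain m where q: "q = 2 * m" by (rule evenE)
  have "q div 2 = m" by (simp add: q)
  then show ?thesis by (simp only: q sibling_double full_Suc)
next
  case False
  then obtain m where q: "q = 2 * m + 1" by (rule oddE)
  have "q div 2 = m" by (simp add: q)
  then have "full b (Suc s) (q div 2) \<longleftrightarrow> full b s (2 * m) \<and> full b s (2 * m + 1)" by (simp only: full_Suc)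
  then show ?thesis unfolding q sibling_double by blast
qed

text \<open>Along the chain of blocks containing \<open>j\<close> fullness can only be lost. It
  holds at level 0 and fails at level \<open>k\<close>, so there is exactly one last level at which
  it holds.\<close>

lemma chosen_unique:
  assumes "b j" "\<not> full b k (j div 2 ^ k)"
  shows "\<exists>!s. s < k \<and> chosen b s (j div 2 ^ s)"
proof -
  let ?F = "\<lambda>s. full b s (j div 2 ^ s)"
  have div: "j div 2 ^ Suc s = j div 2 ^ s div 2" for s
    by (simp add: div_mult2_eq[symmetric] mult.commute)
  have F_Suc: "?F (Suc s) \<longleftrightarrow> ?F s \<and> full b s (sibling (j div 2 ^ s))" for s
    unfolding div by (rule full_Suc_sibling)
  have chosen: "chosen b s (j div 2 ^ s) \<longleftrightarrow> ?F s \<and> \<not> ?F (Suc s)" for s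
    unfolding chosen_def F_Suc by blast
  have anti: "?F t" if "?F s" "t \<le> s" for s t
    using that(2,1)
  proof (induction rule: dec_induct)
    case (step i)
    then show ?case using F_Suc[of i] by blast
  qed
  define s0 where "s0 = (LEAST s. \<not> ?F s)"
  have s0: "\<not> ?F s0" unfolding s0_def by (rule LeastI[of _ k]) (rule assms)
  have below: "?F s" if "s < s0" for s using not_less_Least[of s "\<lambda>s. \<not> ?F s"] that unfolding s0_def by blast
  have "s0 \<le> k" unfolding s0_def by (rule Least_le) (rule assms)
  have "s0 \<noteq> 0" using s0 assms(1) by (metis div_by_1 full_0 power_0)
  then obtain s1 where s1: "s0 = Suc s1" by (cases s0) auto
  show ?thesis
  proof (rule ex1I[of _ s1])
    show "s1 < k \<and> chosen b s1 (j div 2 ^ s1)"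
      unfolding chosen using below[of s1] s0 s1 \<open>s0 \<le> k\<close> by simp
  next
    fix s assume "s < k \<and> chosen b s (j div 2 ^ s)"
    then have "?F s" "\<not> ?F (Suc s)" unfolding chosen by auto
    have "s < s0" using anti[OF \<open>?F s\<close>] s0 by (meson leI)
    moreover have "s0 \<le> Suc s" using below[of "Suc s"] \<open>\<not> ?F (Suc s)\<close> by (meson leI)
    ultimately show "s = s1" using s1 by simp
  qed
qed

lemma adjacent_change:
  fixes b :: "nat \<Rightarrow> bool"
  assumes "lo \<le> i" "i < hi" "lo \<le> k" "k < hi" "b i" "\<not> b k"
  shows "\<exists>j. lo \<le> j \<and> Suc j < hi \<and> b j \<noteq> b (Suc j)"
proof (rule ccontr)
  assume no: "\<not> ?thesis"
  have "b (lo + d) = b lo" if "lo + d < hi" for d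
    using that
  proof (induction d)
    case (Suc d)
    have "lo \<le> lo + d \<and> Suc (lo + d) < hi" using Suc.prems by simp
    then have "b (lo + d) = b (Suc (lo + d))" using no by blast
    then show ?case using Suc by simp
  qed simp
  from this[of "i - lo"] this[of "k - lo"] assms show False by simp
qed

lemma div_eq_iff:
  fixes m :: nat
  assumes "0 < m"
  shows "j div m = p \<longleftrightarrow> p * m \<le> j \<and> j < Suc p * m"
proof
  assume "j div m = p"
  then show "p * m \<le> j \<and> j < Suc p * m"
    using dividend_less_div_times[OF assms, of j] div_times_less_eq_dividend[of j m] by simp
next
  assume "p * m \<le> j \<and> j < Suc p * m"
  then show "j div m = p" by (intro div_nat_eqI) (simp_all add: mult.commute)
qed

text \<open>The parent of a chosen block contains positions with and without the property, hence an
  adjacent change. Siblings are never both chosen, so distinct chosen blocks of a level have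
  distinct parents and thus distinct changes.\<close>

lemma card_chosen_le:
  assumes "s < k"
  shows "card {q. q < 2 ^ (k - s) \<and> chosen b s q} \<le> card {j. Suc j < 2 ^ k \<and> b j \<noteq> b (Suc j)}"
proof -
  let ?Q = "{q. q < 2 ^ (k - s) \<and> chosen b s q}"
  let ?good = "\<lambda>q j. j div 2 ^ Suc s = q div 2 \<and> Suc j < 2 ^ k \<and> b j \<noteq> b (Suc j)"
  have ex: "\<exists>j. ?good q j" if q: "q \<in> ?Q" for q
  proof -
    let ?p = "q div 2"
    have "\<not> full b s (sibling q)" "full b s q" using q by (simp_all add: chosen_def)
    then have "b (q * 2 ^ s)" by (simp add: full_def)
    obtain l where l: "l div 2 ^ s = sibling q" "\<not> b l" using \<open>\<not> full b s (sibling q)\<close> unfolding full_def by blast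
    have div: "j div 2 ^ Suc s = j div 2 ^ s div 2" for j :: nat
      by (simp add: div_mult2_eq[symmetric] mult.commute)
    have "sibling q div 2 = q div 2" using sibling_div_2[of q "sibling q"] by simp
    then have lp: "l div 2 ^ Suc s = ?p" unfolding div l(1) .
    have qp: "q * 2 ^ s div 2 ^ Suc s = ?p" unfolding div by simp
    have range: "j div 2 ^ Suc s = ?p \<longleftrightarrow> ?p * 2 ^ Suc s \<le> j \<and> j < Suc ?p * 2 ^ Suc s" for j :: nat
      by (rule div_eq_iff) simp
    obtain j where j: "?p * 2 ^ Suc s \<le> j" "Suc j < Suc ?p * 2 ^ Suc s" "b j \<noteq> b (Suc j)"
      using adjacent_change[of "?p * 2 ^ Suc s" "q * 2 ^ s" "Suc ?p * 2 ^ Suc s" l b]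
        lp[unfolded range] qp[unfolded range] \<open>b (q * 2 ^ s)\<close> l(2) by blast
    have "?p < 2 ^ (k - Suc s)"
    proof -
      have "(2::nat) ^ (k - s) = 2 * 2 ^ (k - Suc s)" using assms by (simp flip: power_Suc add: Suc_diff_Suc)
      moreover have "q < 2 ^ (k - s)" using q by blast
      ultimately have "q < 2 ^ (k - Suc s) * 2" by (simp only: mult.commute)
      then show ?thesis by (rule less_mult_imp_div_less)
    qed
    then have "Suc ?p * 2 ^ Suc s \<le> 2 ^ (k - Suc s) * 2 ^ Suc s" by (intro mult_le_mono1) simp
    also have "\<dots> = 2 ^ k" using assms by (simp flip: power_add del: power_Suc)
    finally have "Suc ?p * 2 ^ Suc s \<le> 2 ^ k" .
    then have "Suc j < 2 ^ k" by (rule less_le_trans[OF j(2)])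
    moreover have "j div 2 ^ Suc s = ?p"
      by (rule range[THEN iffD2]) (rule conjI[OF j(1) Suc_lessD[OF j(2)]])
    ultimately show ?thesis using j(3) by (intro exI[of _ j] conjI)
  qed
  define h where "h q = (SOME j. ?good q j)" for q
  have h: "?good q (h q)" if "q \<in> ?Q" for q
    unfolding h_def using ex[OF that] by (rule someI_ex)
  have "inj_on h ?Q"
  proof (rule inj_onI)
    fix q r assume qr: "q \<in> ?Q" "r \<in> ?Q" "h q = h r"
    then have "q div 2 = r div 2"
      using h[OF qr(1), THEN conjunct1] h[OF qr(2), THEN conjunct1] by (simp only:)
    moreover have "r \<noteq> sibling q" using qr(1,2) by (auto simp: chosen_def)
    ultimately show "q = r" using sibling_div_2[of q r] by simp
  qed
  moreover have "h ` ?Q \<subseteq> {j. Suc j < 2 ^ k \<and> b j \<noteq> b (Suc j)}"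
  proof
    fix j assume "j \<in> h ` ?Q"
    then obtain q where "q \<in> ?Q" "j = h q" by (rule imageE)
    then show "j \<in> {j. Suc j < 2 ^ k \<and> b j \<noteq> b (Suc j)}" using h[of q] by simp
  qed
  moreover have "finite {j. Suc j < 2 ^ k \<and> b j \<noteq> b (Suc j)}"
    by (rule finite_subset[of _ "{..<2 ^ k}"]) auto
  ultimately show ?thesis by (rule card_inj_on_le)
qed

section \<open>Bicliques from dyadic blocks along an ordering\<close>

section \<open>The decomposition given by an ordering\<close>

text \<open>Edges are oriented along the ordering, so that each of them is covered from its first endpoint only.\<close>

definition later_nbr :: "nat \<Rightarrow> (nat \<Rightarrow> nat \<Rightarrow> bool) \<Rightarrow> nat list \<Rightarrow> (nat \<Rightarrow> nat) \<Rightarrow> nat \<Rightarrow> nat \<Rightarrow> bool" where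
  "later_nbr n a ord ps v j \<longleftrightarrow> j < n \<and> ps v < j \<and> a v (ord ! j)"

definition users :: "nat \<Rightarrow> (nat \<Rightarrow> nat \<Rightarrow> bool) \<Rightarrow> nat list \<Rightarrow> (nat \<Rightarrow> nat) \<Rightarrow> nat \<times> nat \<Rightarrow> nat list" where
  "users n a ord ps = (\<lambda>(s, q). filter (\<lambda>v. chosen (later_nbr n a ord ps v) s q) [0..<n])"

definition block :: "nat list \<Rightarrow> nat \<times> nat \<Rightarrow> nat list" where
  "block ord = (\<lambda>(s, q). map (\<lambda>j. ord ! (q * 2 ^ s + j)) [0..<2 ^ s])"

text \<open>Here \<open>k\<close> fixes the binary tree over \<open>2 ^ k\<close> positions and
  \<open>l\<close> the number of levels listed. The decomposition uses \<open>blocks k k\<close>;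
  the shorter lists describe the output produced so far between two levels.\<close>

definition blocks :: "nat \<Rightarrow> nat \<Rightarrow> (nat \<times> nat) list" where
  "blocks k l = concat (map (\<lambda>s. map (Pair s) [0..<2 ^ (k - s)]) [0..<l])"

text \<open>Blocks without users are dropped, since a biclique needs two nonempty sides. Lists of
  pairs are kept, rather than a multiset of graphs, because they are what the output
  encodes.\<close>

definition parts :: "nat \<Rightarrow> (nat \<Rightarrow> nat \<Rightarrow> bool) \<Rightarrow> nat list \<Rightarrow> (nat \<Rightarrow> nat) \<Rightarrow> (nat \<times> nat) list \<Rightarrow> (nat list \<times> nat list) list" where
  "parts n a ord ps bs = map (\<lambda>sq. (block ord sq, users n a ord ps sq)) (filter (\<lambda>sq. users n a ord ps sq \<noteq> []) bs)"

lemma set_blocks: "set (blocks k l) = {(s, q). s < l \<and> q < 2 ^ (k - s)}"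
  by (auto simp: blocks_def)

lemma distinct_blocks: "distinct (blocks k l)"
proof (induction l)
  case 0
  then show ?case by (simp add: blocks_def)
next
  case (Suc l)
  have "blocks k (Suc l) = blocks k l @ map (Pair l) [0..<2 ^ (k - l)]" by (simp add: blocks_def)
  moreover have "distinct (map (Pair l) [0..<2 ^ (k - l)])" by (simp add: distinct_map inj_on_def)
  ultimately show ?case using Suc set_blocks[of k l] by auto
qed

locale ordered_graph =
  fixes G :: "nat ugraph" and n :: nat and a :: "nat \<Rightarrow> nat \<Rightarrow> bool" and ord :: "nat list"
    and ps :: "nat \<Rightarrow> nat" and k :: nat
  assumes graph: "simple_graph G" "verts G = {0..<n}"
    and a_def: "a u v \<longleftrightarrow> {u, v} \<in> edges G"
    and ord: "set ord = {..<n}" "length ord = n"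
    and ps: "\<And>j. j < n \<Longrightarrow> ps (ord ! j) = j"
    and k: "n < 2 ^ k"
begin

abbreviation "B v \<equiv> later_nbr n a ord ps v"
abbreviation "U sq \<equiv> users n a ord ps sq"
abbreviation "J sq \<equiv> join_graph (set (block ord sq)) (set (U sq))"

lemma ps_less: "v < n \<Longrightarrow> ps v < n \<and> ord ! ps v = v"
  using ord ps by (metis in_set_conv_nth lessThan_iff)

lemma a_less: "a u v \<Longrightarrow> u < n \<and> v < n \<and> u \<noteq> v"
proof -
  assume "a u v"
  then have "{u, v} \<subseteq> {0..<n}" "card {u, v} = 2" using graph unfolding simple_graph_def a_def by auto
  then show ?thesis by (cases "u = v") auto
qed

lemma a_sym: "a u v \<longleftrightarrow> a v u"
  by (simp add: a_def insert_commute)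

lemma mem_block: "x \<in> set (block ord (s, q)) \<longleftrightarrow> (\<exists>j. j div 2 ^ s = q \<and> x = ord ! j)"
proof
  assume "x \<in> set (block ord (s, q))"
  then obtain i where i: "i < 2 ^ s" "x = ord ! (q * 2 ^ s + i)" by (auto simp: block_def)
  then have "(q * 2 ^ s + i) div 2 ^ s = q" by simp
  then show "\<exists>j. j div 2 ^ s = q \<and> x = ord ! j" using i by blast
next
  assume "\<exists>j. j div 2 ^ s = q \<and> x = ord ! j"
  then obtain j where j: "j div 2 ^ s = q" "x = ord ! j" by blast
  then have "x = ord ! (q * 2 ^ s + j mod 2 ^ s)" using div_mult_mod_eq[of j "2 ^ s"] by simp
  moreover have "j mod 2 ^ s < 2 ^ s" by simp
  ultimately show "x \<in> set (block ord (s, q))" by (auto simp: block_def)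
qed

text \<open>A block that is full for \<open>v\<close> contains only positions after that of
  \<open>v\<close> and below \<open>n\<close>. Therefore the padding of the positions up to
  \<open>2 ^ k\<close> leaves no trace in the bicliques, and the two sides of a biclique are
  disjoint.\<close>

lemma block_user:
  assumes "x \<in> set (block ord (s, q))" "v \<in> set (U (s, q))"
  shows "x < n" "v < n" "ps v < ps x" "a v x" "ps x div 2 ^ s = q"
proof -
  obtain j where j: "j div 2 ^ s = q" "x = ord ! j" using assms(1) unfolding mem_block by blast
  have v: "v < n" "full (B v) s q" using assms(2) by (auto simp: users_def chosen_def)
  then have "B v j" using j(1) by (auto simp: full_def)
  then have *: "j < n" "ps v < j" "a v (ord ! j)" by (auto simp: later_nbr_def)
  show "v < n" by (rule v)
  show "x < n" using *(3) a_less j(2) by blast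
  show "ps v < ps x" "a v x" "ps x div 2 ^ s = q" using * j ps by auto
qed

lemma block_nonempty: "block ord (s, q) \<noteq> []"
  by (simp add: block_def)

lemma biclique_J: assumes "U (s, q) \<noteq> []" shows "biclique G (J (s, q))"
proof -
  let ?A = "set (block ord (s, q))" and ?U = "set (U (s, q))"
  have disj: "?A \<inter> ?U = {}"
  proof (rule equals0I)
    fix x assume "x \<in> ?A \<inter> ?U"
    then have "ps x < ps x" by (intro block_user(3)) (rule IntD1, assumption, rule IntD2, assumption)
    then show False by simp
  qed
  have edge: "{x, v} \<in> edges G" if "x \<in> ?A" "v \<in> ?U" for x v
    using block_user(4)[OF that] a_sym a_def by blast
  have verts: "?A \<subseteq> verts G" "?U \<subseteq> verts G"
  proof -
    have v: "hd (U (s, q)) \<in> ?U" using assms by (rule hd_in_set)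
    show "?A \<subseteq> verts G"
    proof
      fix x assume "x \<in> ?A"
      then show "x \<in> verts G" using block_user(1)[OF _ v] graph(2) by simp
    qed
    show "?U \<subseteq> verts G" unfolding graph(2) users_def by auto
  qed
  have fin: "finite (verts (J (s, q)))" by (simp add: join_graph_def)
  have "e \<subseteq> verts (J (s, q)) \<and> card e = 2" if "e \<in> edges (J (s, q))" for e
  proof -
    obtain x v where "e = {x, v}" "x \<in> ?A" "v \<in> ?U" using \<open>e \<in> edges _\<close> by (auto simp: join_graph_def)
    moreover from this have "x \<noteq> v" using disj by blast
    ultimately show ?thesis by (simp add: join_graph_def)
  qed
  then have "simple_graph (J (s, q))" unfolding simple_graph_def using fin by blast
  moreover have "edges (J (s, q)) \<subseteq> edges G" using edge by (auto simp: join_graph_def)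
  moreover have "verts (J (s, q)) \<subseteq> verts G" using verts by (simp add: join_graph_def)
  moreover have "complete_bipartite (J (s, q))"
    unfolding complete_bipartite_def using disj assms block_nonempty[of s q]
    by (intro exI[of _ ?A] exI[of _ ?U] conjI) simp_all
  ultimately show ?thesis by (simp add: biclique_def is_subgraph_def)
qed

text \<open>All members of a block come after all its users, so the earlier endpoint can only be the
  user and the later one the member. Without the orientation an edge could be covered from both of
  its ends.\<close>

lemma edge_covered_iff:
  assumes uw: "a u w" "ps u < ps w"
  shows "{u, w} \<in> edges (J (s, q)) \<longleftrightarrow> q = ps w div 2 ^ s \<and> chosen (B u) s q"
proof
  assume "{u, w} \<in> edges (J (s, q))"
  then obtain x v where xv: "{u, w} = {x, v}" "x \<in> set (block ord (s, q))" "v \<in> set (U (s, q))"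
    by (auto simp: join_graph_def)
  note b = block_user[OF xv(2,3)]
  have "x = w" "v = u" using xv(1) b(3) uw(2) by (auto simp: doubleton_eq_iff)
  then show "q = ps w div 2 ^ s \<and> chosen (B u) s q" using b(5) xv(3) by (simp add: users_def)
next
  assume *: "q = ps w div 2 ^ s \<and> chosen (B u) s q"
  have "u < n" "w < n" using a_less[OF uw(1)] by auto
  then have "w \<in> set (block ord (s, q))" "u \<in> set (U (s, q))"
    using * ps_less[of w] unfolding mem_block by (auto simp: users_def intro!: exI[of _ "ps w"])
  then show "{u, w} \<in> edges (J (s, q))" unfolding join_graph_def by auto
qed

definition "bicliques = mset (map (\<lambda>(as, bs). join_graph (set as) (set bs)) (parts n a ord ps (blocks k k)))"

lemma bicliques_eq: "bicliques = mset (map J (filter (\<lambda>sq. U sq \<noteq> []) (blocks k k)))"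
  by (simp add: bicliques_def parts_def comp_def)

text \<open>For the earlier endpoint \<open>chosen_unique\<close> yields exactly one level, and the
  position of the later endpoint fixes the block on it. Distinctness of the list of blocks turns the
  multiset count into a cardinality.\<close>

lemma edge_once:
  assumes "e \<in> edges G"
  shows "size {#H \<in># bicliques. e \<in> edges H#} = 1"
proof -
  obtain u w where uw: "e = {u, w}" "a u w" "ps u < ps w"
  proof -
    have "card e = 2" "e \<subseteq> {0..<n}" using assms graph unfolding simple_graph_def by auto
    then obtain x y where xy: "e = {x, y}" "x \<noteq> y" by (auto simp: card_2_iff)
    then have "a x y" "a y x" using assms by (auto simp: a_def insert_commute)
    have "ps x \<noteq> ps y" using ps_less a_less[OF \<open>a x y\<close>] xy(2) by metis
    then show ?thesis using that[of x y] that[of y x] xy \<open>a x y\<close> \<open>a y x\<close>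
      by (cases "ps x < ps y") (auto simp: insert_commute)
  qed
  let ?j = "ps w"
  have "w < n" using a_less uw(2) by blast
  then have "?j < n" using ps_less by blast
  have "B u ?j" using uw(2,3) ps_less[OF \<open>w < n\<close>] by (simp add: later_nbr_def)
  \<comment> \<open>The root block contains the position of \<open>u\<close>, which is not among its
    own later neighbors; so the levels below \<open>k\<close> suffice.\<close>
  moreover have "\<not> full (B u) k (?j div 2 ^ k)"
  proof -
    have "?j div 2 ^ k = 0" "ps u div 2 ^ k = 0" using \<open>?j < n\<close> k uw(3) by auto
    moreover have "\<not> B u (ps u)" by (simp add: later_nbr_def)
    ultimately show ?thesis unfolding full_def by metis
  qed
  ultimately obtain s0 where s0: "s0 < k" "chosen (B u) s0 (?j div 2 ^ s0)"
    "\<And>s. s < k \<Longrightarrow> chosen (B u) s (?j div 2 ^ s) \<Longrightarrow> s = s0"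
    using chosen_unique[of "B u" ?j k] by blast
  have q0: "?j div 2 ^ s0 < 2 ^ (k - s0)"
  proof -
    have "?j < 2 ^ (k - s0) * 2 ^ s0" using \<open>?j < n\<close> k s0(1) by (simp flip: power_add)
    then show ?thesis by (simp add: div_less_iff_less_mult)
  qed
  have "{sq \<in> set (blocks k k). U sq \<noteq> [] \<and> e \<in> edges (J sq)} = {(s0, ?j div 2 ^ s0)}"
  proof (intro equalityI subsetI)
    fix sq assume "sq \<in> {sq \<in> set (blocks k k). U sq \<noteq> [] \<and> e \<in> edges (J sq)}"
    then obtain s q where "sq = (s, q)" "s < k" "e \<in> edges (J (s, q))" by (auto simp: set_blocks)
    then show "sq \<in> {(s0, ?j div 2 ^ s0)}"
      using edge_covered_iff[OF uw(2,3), of s q] s0(3)[of s] uw(1) by auto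
  next
    fix sq assume "sq \<in> {(s0, ?j div 2 ^ s0)}"
    then have sq: "sq = (s0, ?j div 2 ^ s0)" by simp
    have "e \<in> edges (J sq)" unfolding sq uw(1) using edge_covered_iff[OF uw(2,3)] s0(2) by blast
    moreover have "u \<in> set (U sq)" using s0(2) a_less[OF uw(2)] by (simp add: sq users_def)
    ultimately show "sq \<in> {sq \<in> set (blocks k k). U sq \<noteq> [] \<and> e \<in> edges (J sq)}"
      using s0(1) q0 sq by (auto simp: set_blocks)
  qed
  moreover have "size {#H \<in># bicliques. e \<in> edges H#} = card {sq \<in> set (blocks k k). U sq \<noteq> [] \<and> e \<in> edges (J sq)}"
  proof -
    have "size {#H \<in># bicliques. e \<in> edges H#} = length (filter (\<lambda>sq. U sq \<noteq> [] \<and> e \<in> edges (J sq)) (blocks k k))"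
      unfolding bicliques_eq by (simp only: mset_filter[symmetric] size_mset filter_map length_map filter_filter comp_def)
    then show ?thesis using distinct_length_filter[OF distinct_blocks] by (simp add: Int_def conj_commute)
  qed
  ultimately show ?thesis by simp
qed

lemma decomposition: "biclique_decomposition G bicliques"
proof -
  have "biclique G H" if "H \<in># bicliques" for H
  proof -
    obtain sq where "H = J sq" "U sq \<noteq> []" using \<open>H \<in># bicliques\<close> unfolding bicliques_eq by auto
    moreover obtain s q where "sq = (s, q)" by (cases sq)
    ultimately show ?thesis using biclique_J by simp
  qed
  moreover have "\<exists>H\<in>#bicliques. e \<in> edges H" if "e \<in> edges G" for e
  proof -
    have "{#H \<in># bicliques. e \<in> edges H#} \<noteq> {#}" 
    proof
      assume *: "{#H \<in># bicliques. e \<in> edges H#} = {#}"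
      show False using edge_once[OF \<open>e \<in> edges G\<close>] unfolding * by simp
    qed
    then obtain H where "H \<in># {#H \<in># bicliques. e \<in> edges H#}" by (rule multiset_nonemptyE)
    then show ?thesis by auto
  qed
  ultimately show ?thesis unfolding biclique_decomposition_def biclique_cover_def
    by (intro conjI ballI) (simp_all only: edge_once)
qed

text \<open>Cutting the row of \<open>v\<close> down to the positions after \<open>v\<close> and
  below \<open>n\<close> adds at most two changes, at \<open>ps v\<close> and at
  \<open>n - 1\<close>.\<close>

lemma card_change_le:
  assumes "v < n"
  shows "card {j. Suc j < 2 ^ k \<and> B v j \<noteq> B v (Suc j)} \<le> alternations (a v) ord + 2"
proof -
  let ?A = "{j. Suc j < length ord \<and> a v (ord ! j) \<noteq> a v (ord ! Suc j)}"
  have sub: "{j. Suc j < 2 ^ k \<and> B v j \<noteq> B v (Suc j)} \<subseteq> ?A \<union> {ps v, n - 1}"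
  proof
    fix j assume "j \<in> {j. Suc j < 2 ^ k \<and> B v j \<noteq> B v (Suc j)}"
    then have j: "B v j \<noteq> B v (Suc j)" by simp
    show "j \<in> ?A \<union> {ps v, n - 1}"
    proof (cases "j = ps v \<or> j = n - 1")
      case False
      then have "Suc j < n" "ps v < j" using j unfolding later_nbr_def by auto
      then have "j \<in> ?A" using j ord(2) unfolding later_nbr_def by auto
      then show ?thesis by blast
    qed blast
  qed
  have fin: "finite ?A" by (rule finite_subset[of _ "{..<length ord}"]) auto
  have "card {j. Suc j < 2 ^ k \<and> B v j \<noteq> B v (Suc j)} \<le> card (?A \<union> {ps v, n - 1})"
    using fin by (intro card_mono sub) simp
  also have "\<dots> \<le> card ?A + card {ps v, n - 1}" by (rule card_Un_le)
  also have "card {ps v, n - 1} \<le> 2" by (simp add: card_insert_if)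
  finally show ?thesis by (simp add: alternations_conv_nth)
qed

text \<open>On each of the \<open>k\<close> levels the blocks together have \<open>2 ^ k\<close>
  positions, while the pairs of a block and one of its users are controlled by the changes of each
  vertex along the ordering.\<close>

lemma cover_size_le: "cover_size bicliques \<le> k * 2 ^ k + k * ((\<Sum>x<n. alternations (\<lambda>v. a v x) ord) + 2 * n)"
proof -
  have card_J: "card (verts (J sq)) \<le> 2 ^ fst sq + length (U sq)" for sq
  proof -
    have "card (verts (J sq)) \<le> card (set (block ord sq)) + card (set (U sq))"
      by (simp add: join_graph_def card_Un_le)
    also have "\<dots> \<le> length (block ord sq) + length (U sq)" by (intro add_mono card_length)
    also have "length (block ord sq) = 2 ^ fst sq" by (simp add: block_def case_prod_unfold)
    finally show ?thesis .
  qed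
  have "cover_size bicliques = (\<Sum>sq\<leftarrow>filter (\<lambda>sq. U sq \<noteq> []) (blocks k k). card (verts (J sq)))"
    unfolding cover_size_def bicliques_eq by (simp add: sum_mset_sum_list comp_def flip: mset_map)
  also have "\<dots> \<le> (\<Sum>sq\<leftarrow>filter (\<lambda>sq. U sq \<noteq> []) (blocks k k). 2 ^ fst sq + length (U sq))"
    by (intro sum_list_mono card_J)
  also have "\<dots> \<le> (\<Sum>sq\<leftarrow>blocks k k. 2 ^ fst sq + length (U sq))"
    by (rule sum_list_filter_le_nat)
  also have "\<dots> = (\<Sum>(s, q)\<in>Sigma {..<k} (\<lambda>s. {..<2 ^ (k - s)}). 2 ^ s + length (U (s, q)))"
    by (subst sum_list_distinct_conv_sum_set[OF distinct_blocks]) (auto simp: set_blocks intro!: sum.cong)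
  also have "\<dots> = (\<Sum>s<k. \<Sum>q<2 ^ (k - s). 2 ^ s + length (U (s, q)))"
    by (simp add: sum.Sigma)
  also have "\<dots> \<le> (\<Sum>s<k. 2 ^ k + (\<Sum>v<n. alternations (a v) ord + 2))"
  proof (rule sum_mono)
    fix s assume "s \<in> {..<k}"
    then have s: "s < k" by simp
    have "(\<Sum>q<2 ^ (k - s). length (U (s, q))) = (\<Sum>q<2 ^ (k - s). \<Sum>v<n. of_bool (chosen (B v) s q))"
    proof (intro sum.cong refl)
      fix q
      have "length (U (s, q)) = card {v. v < n \<and> chosen (B v) s q}"
        unfolding users_def using distinct_length_filter[of "[0..<n]"] by (simp add: Int_def conj_commute atLeast0LessThan)
      also have "\<dots> = (\<Sum>v<n. of_bool (chosen (B v) s q))"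
        by (auto simp: of_bool_def sum.If_cases intro!: arg_cong[where f = card])
      finally show "length (U (s, q)) = (\<Sum>v<n. of_bool (chosen (B v) s q))" .
    qed
    also have "\<dots> = (\<Sum>v<n. \<Sum>q<2 ^ (k - s). of_bool (chosen (B v) s q))" by (rule sum.swap)
    also have "\<dots> = (\<Sum>v<n. card {q. q < 2 ^ (k - s) \<and> chosen (B v) s q})"
      by (auto simp: of_bool_def sum.If_cases intro!: sum.cong arg_cong[where f = card])
    also have "\<dots> \<le> (\<Sum>v<n. alternations (a v) ord + 2)"
      by (intro sum_mono order_trans[OF card_chosen_le[OF s] card_change_le]) simp
    finally have "(\<Sum>q<2 ^ (k - s). length (U (s, q))) \<le> (\<Sum>v<n. alternations (a v) ord + 2)" .
    moreover have "(\<Sum>q<(2::nat) ^ (k - s). 2 ^ s) = (2::nat) ^ k" using s by (simp flip: power_add)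
    ultimately show "(\<Sum>q<2 ^ (k - s). 2 ^ s + length (U (s, q))) \<le> 2 ^ k + (\<Sum>v<n. alternations (a v) ord + 2)"
      unfolding sum.distrib[of "\<lambda>_. 2 ^ s"] by simp
  qed
  also have "\<dots> = k * 2 ^ k + k * ((\<Sum>x<n. alternations (\<lambda>v. a v x) ord) + 2 * n)"
  proof -
    \<comment> \<open>The blocks of a vertex depend on the alternations of its row, whereas the
      clustering controls those of the columns; the matrix is symmetric.\<close>
    have "(\<lambda>v. a v x) = a x" for x using a_sym by blast
    moreover have "(\<Sum>v<n. alternations (a v) ord + 2) = (\<Sum>v<n. alternations (a v) ord) + 2 * n"
      by (simp only: sum.distrib) simp
    ultimately show ?thesis by (simp add: algebra_simps)
  qed
  finally show ?thesis .
qed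

end

section \<open>Total-correctness triples with frame conditions\<close>

section \<open>Program logic with running times\<close>

text \<open>A start state takes the place of a precondition, so that postconditions can refer to it
  freely, in particular through \<open>frame\<close>.\<close>

definition hoare :: "com \<Rightarrow> loop_state \<Rightarrow> nat \<Rightarrow> (loop_state \<Rightarrow> bool) \<Rightarrow> bool" where
  "hoare c s T Q \<longleftrightarrow> cok c s \<and> cost c s \<le> T \<and> Q (sem c s)"

primrec writes :: "com \<Rightarrow> nat set" where
  "writes (Assign x e) = {x}"
| "writes (Put a e1 e2) = {}"
| "writes (Emit e) = {}"
| "writes (Draw x) = {x}"
| "writes (c1 ;; c2) = writes c1 \<union> writes c2"
| "writes (If e c1 c2) = writes c1 \<union> writes c2"
| "writes (For x e c) = insert x (writes c)"

primrec puts :: "com \<Rightarrow> nat set" where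
  "puts (Assign x e) = {}"
| "puts (Put a e1 e2) = {a}"
| "puts (Emit e) = {}"
| "puts (Draw x) = {}"
| "puts (c1 ;; c2) = puts c1 \<union> puts c2"
| "puts (If e c1 c2) = puts c1 \<union> puts c2"
| "puts (For x e c) = puts c"

primrec pure_tape :: "com \<Rightarrow> bool" where
  "pure_tape (Assign x e) = True"
| "pure_tape (Put a e1 e2) = True"
| "pure_tape (Emit e) = True"
| "pure_tape (Draw x) = False"
| "pure_tape (c1 ;; c2) = (pure_tape c1 \<and> pure_tape c2)"
| "pure_tape (If e c1 c2) = (pure_tape c1 \<and> pure_tape c2)"
| "pure_tape (For x e c) = pure_tape c"

primrec silent :: "com \<Rightarrow> bool" where
  "silent (Assign x e) = True"
| "silent (Put a e1 e2) = True"
| "silent (Emit e) = False"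
| "silent (Draw x) = True"
| "silent (c1 ;; c2) = (silent c1 \<and> silent c2)"
| "silent (If e c1 c2) = (silent c1 \<and> silent c2)"
| "silent (For x e c) = silent c"

definition frame :: "com \<Rightarrow> loop_state \<Rightarrow> loop_state \<Rightarrow> bool" where
  "frame c s s' \<longleftrightarrow> vsize s' = vsize s \<and> vadj s' = vadj s \<and> wmax s' = wmax s \<and>
     (\<forall>x. x \<notin> writes c \<longrightarrow> vars s' x = vars s x) \<and>
     (\<forall>a. a \<notin> puts c \<longrightarrow> arrs s' a = arrs s a) \<and>
     (pure_tape c \<longrightarrow> tape s' = tape s) \<and> (silent c \<longrightarrow> outs s' = outs s)"

lemma frame_sem: "frame c s (sem c s)"
proof (induction c arbitrary: s)
  case (Seq c1 c2)
  from Seq(1)[of s] Seq(2)[of "sem c1 s"] show ?case unfolding frame_def by simp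
next
  case (If e c1 c2)
  from If(1)[of s] If(2)[of s] show ?case unfolding frame_def by simp
next
  case (For x e c)
  have "frame (For x e c) s (iter x c k s)" for k
  proof (induction k)
    case (Suc k)
    then show ?case using For[of "set_var x k (iter x c k s)"] unfolding frame_def by simp
  qed (simp add: frame_def)
  then show ?case by simp
qed (simp_all add: frame_def)

lemma hoare_frame: "hoare c s T Q \<Longrightarrow> hoare c s T (\<lambda>s'. Q s' \<and> frame c s s')"
  by (simp add: hoare_def frame_sem)

lemma hoare_weaken:
  "hoare c s T Q \<Longrightarrow> T \<le> T' \<Longrightarrow> (\<And>s'. Q s' \<Longrightarrow> Q' s') \<Longrightarrow> hoare c s T' Q'"
  unfolding hoare_def by (meson le_trans)

lemma hoare_Seq:
  assumes "hoare c1 s V R" "\<And>s'. R s' \<Longrightarrow> frame c1 s s' \<Longrightarrow> hoare c2 s' U Q" "V + U \<le> T"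
  shows "hoare (c1 ;; c2) s T Q"
proof -
  have 1: "cok c1 s" "cost c1 s \<le> V" "R (sem c1 s)" using assms(1) by (auto simp: hoare_def)
  have 2: "hoare c2 (sem c1 s) U Q" by (rule assms(2)[OF 1(3) frame_sem])
  then show ?thesis using 1 assms(3) by (simp add: hoare_def)
qed

lemma hoare_If:
  assumes "aok e s" "aval e s \<noteq> 0 \<Longrightarrow> hoare c1 s U Q" "aval e s = 0 \<Longrightarrow> hoare c2 s U Q"
    "alen e + 2 + U \<le> T"
  shows "hoare (If e c1 c2) s T Q"
  using assms by (cases "aval e s = 0") (auto simp: hoare_def)

text \<open>The step may use \<open>frame\<close> relative to the start of the loop, so an invariant
  need only mention what the body changes.\<close>

lemma hoare_For:
  assumes "aok e s" "aval e s = b" "I 0 s"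
    and step: "\<And>k s'. k < b \<Longrightarrow> I k s' \<Longrightarrow> frame (For x e c) s s' \<Longrightarrow> hoare c (set_var x k s') (T k) (I (Suc k))"
    and T: "alen e + 3 + (\<Sum>k<b. T k + 7) \<le> T'"
  shows "hoare (For x e c) s T' (I b)"
proof -
  \<comment> \<open>The first \<open>k\<close> iterations are a complete run of the same loop with
    bound \<open>Const k\<close>, and \<open>frame\<close> does not depend on the bound.\<close>
  have fr: "frame (For x e c) s (iter x c k s)" for k
    using frame_sem[of "For x (Const k) c" s] unfolding frame_def by simp
  have inv: "I k (iter x c k s)" if "k \<le> b" for k
    using that
  proof (induction k)
    case (Suc k)
    then have "k < b" "I k (iter x c k s)" by (simp_all only: Suc_le_lessD Suc_leD)
    from step[OF this fr] have "I (Suc k) (sem c (set_var x k (iter x c k s)))"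
      unfolding hoare_def by blast
    then show ?case by (simp only: upt_Suc fold_append fold_simps comp_apply if_True le0)
  qed (simp add: assms(3))
  have body: "hoare c (set_var x k (iter x c k s)) (T k) (I (Suc k))" if "k < b" for k
    using that inv[of k] by (intro step fr) auto
  have "(\<Sum>k<b. cost c (set_var x k (iter x c k s)) + 7) \<le> (\<Sum>k<b. T k + 7)"
    using body by (intro sum_mono add_right_mono) (auto simp: hoare_def)
  then show ?thesis
    using assms(1,2) T body inv[of b] by (auto simp: hoare_def)
qed

lemma hoare_For_const:
  assumes "aok e s" "aval e s = b" "I 0 s"
    "\<And>k s'. k < b \<Longrightarrow> I k s' \<Longrightarrow> frame (For x e c) s s' \<Longrightarrow> hoare c (set_var x k s') T (I (Suc k))"
    "alen e + 3 + b * (T + 7) \<le> T'"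
  shows "hoare (For x e c) s T' (I b)"
  by (rule hoare_For[where T = "\<lambda>_. T"]) (use assms in simp_all)

abbreviation eadd (infixl "[+]" 65) where "a [+] b \<equiv> Bin Add a b"
abbreviation esub (infixl "[-]" 65) where "a [-] b \<equiv> Bin Sub a b"
abbreviation emul (infixl "[*]" 70) where "a [*] b \<equiv> Bin Mul a b"
abbreviation ediv (infixl "['/]" 70) where "a [/] b \<equiv> Bin Div a b"
abbreviation emod (infixl "[%]" 70) where "a [%] b \<equiv> Bin Mod a b"
text \<open>The absolute difference by truncated subtraction; as a condition it tests for
  inequality.\<close>

abbreviation edist where "edist a b \<equiv> (a [-] b) [+] (b [-] a)"

section \<open>Partition refinement and list merging in linear time per pass\<close>

section \<open>The clustering program\<close>

text \<open>Variables: 0 loop vertex, 1 leader, 2 sampled column, 3 random offset, 4 loop over samples,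
  5 sample size, 6 round, 7 number of alternations, 8 least such number, 9 attempt,
  10 number of levels, 11 number of positions (a power of two), 12 blocks of the current level,
  13 block length, 14 level, 15 block, 16 number of users, 17 position.
  Arrays: 0 leader, 1 second leader, 2 representative, 3 class size, 4 accumulated cluster sizes,
  5 rank in the class, 6 shift, 7 new representative, 8 position in the cluster, 9 cluster size,
  10 ordering, 11 best ordering, 12 its inverse, 13 full blocks, 14 users.\<close>

definition refine :: com where
  "refine = For 0 Size (Put 1 (Var 0) (Const 0)) ;;
    For 0 Size (Assign 1 (Get 0 (Var 0)) ;;
      If (edist (Adj (Get 2 (Var 0)) (Var 2)) (Adj (Get 2 (Var 1)) (Var 2)))
        (If (Get 1 (Var 1)) Skip (Put 1 (Var 1) (Var 0 [+] Const 1)) ;;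
         Put 0 (Var 0) (Get 1 (Var 1) [-] Const 1))
        Skip)"

text \<open>After the counters are cleared, one pass gives each old representative its rank in its
  class and the total length of the lists before its own; the next one finds the member whose rank
  is the random offset modulo the class size; the last one shifts positions and installs the new
  representatives. No list is ever copied, so every pass is linear.\<close>

definition regroup :: com where
  "regroup = For 0 Size (Put 3 (Var 0) (Const 0) ;; Put 4 (Var 0) (Const 0)) ;;
    For 0 Size (If (edist (Get 2 (Var 0)) (Var 0)) Skip
      (Assign 1 (Get 0 (Var 0)) ;; Put 5 (Var 0) (Get 3 (Var 1)) ;;
       Put 3 (Var 1) (Get 3 (Var 1) [+] Const 1) ;; Put 6 (Var 0) (Get 4 (Var 1)) ;;
       Put 4 (Var 1) (Get 4 (Var 1) [+] Get 9 (Var 0)))) ;;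
    For 0 Size (If (edist (Get 2 (Var 0)) (Var 0)) Skip
      (Assign 1 (Get 0 (Var 0)) ;;
       If (edist (Get 5 (Var 0)) (Var 3 [%] Get 3 (Var 1))) Skip (Put 7 (Var 1) (Var 0)))) ;;
    For 0 Size (Put 8 (Var 0) (Get 8 (Var 0) [+] Get 6 (Get 2 (Var 0))) ;;
      Put 2 (Var 0) (Get 7 (Get 0 (Var 0))) ;; Put 9 (Var 0) (Get 4 (Get 0 (Var 0))))"

definition cluster :: com where
  "cluster = For 0 Size (Put 0 (Var 0) (Const 0)) ;; For 4 (Var 5) (Draw 2 ;; refine) ;; Draw 3 ;; regroup"

text \<open>A canonical name for the class of \<open>v\<close>: its least vertex, which need not be
  a representative. Leaders index the arrays with one entry per class.\<close>

definition leader :: "(nat \<Rightarrow> nat \<Rightarrow> bool) \<Rightarrow> (nat \<Rightarrow> nat) \<Rightarrow> nat list \<Rightarrow> nat \<Rightarrow> nat" where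
  "leader a \<rho> xs v = (LEAST w. agree a xs (\<rho> w) (\<rho> v))"

lemma agree_sym: "agree a xs u v \<longleftrightarrow> agree a xs v u"
  by (auto simp: agree_def)

lemma agree_trans: "agree a xs u v \<Longrightarrow> agree a xs v w \<Longrightarrow> agree a xs u w"
  by (auto simp: agree_def)

lemma leader_le: "leader a \<rho> xs v \<le> v"
  unfolding leader_def by (rule Least_le) (rule agree_refl)

lemma leader_agree: "agree a xs (\<rho> (leader a \<rho> xs v)) (\<rho> v)"
  unfolding leader_def by (rule LeastI[of _ v]) (rule agree_refl)

lemma leader_cong: "agree a xs (\<rho> u) (\<rho> v) \<Longrightarrow> leader a \<rho> xs u = leader a \<rho> xs v"
  unfolding leader_def using agree_cong[of a xs "\<rho> u" "\<rho> v"] by simp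

lemma leader_eq_iff: "leader a \<rho> xs u = leader a \<rho> xs v \<longleftrightarrow> agree a xs (\<rho> u) (\<rho> v)"
  using leader_cong leader_agree agree_sym agree_trans by metis

lemma leader_leader: "leader a \<rho> xs (leader a \<rho> xs v) = leader a \<rho> xs v"
  by (rule leader_cong) (rule leader_agree)

lemma agree_snoc: "agree a (xs @ [x]) u v \<longleftrightarrow> agree a xs u v \<and> a u x = a v x"
  by (auto simp: agree_def)

lemma leader_snoc_same:
  assumes "a (\<rho> (leader a \<rho> xs v)) x = a (\<rho> v) x"
  shows "leader a \<rho> (xs @ [x]) v = leader a \<rho> xs v"
proof (rule antisym)
  show "leader a \<rho> (xs @ [x]) v \<le> leader a \<rho> xs v"
    unfolding leader_def[of a \<rho> "xs @ [x]"] using assms leader_agree by (intro Least_le) (simp add: agree_snoc)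
  have "agree a xs (\<rho> (leader a \<rho> (xs @ [x]) v)) (\<rho> v)"
    using leader_agree[of a "xs @ [x]" \<rho> v] by (simp add: agree_snoc)
  then show "leader a \<rho> xs v \<le> leader a \<rho> (xs @ [x]) v"
    unfolding leader_def[of a \<rho> xs] by (rule Least_le)
qed

abbreviation splits where
  "splits a \<rho> xs x u w \<equiv> agree a xs (\<rho> w) (\<rho> u) \<and> a (\<rho> w) x \<noteq> a (\<rho> u) x"

text \<open>A column has two values, so a class splits into at most two parts: the part of the old
  leader keeps it, and the other is named after its own least vertex.\<close>

lemma leader_snoc_split:
  assumes "a (\<rho> (leader a \<rho> xs v)) x \<noteq> a (\<rho> v) x"
  shows "leader a \<rho> (xs @ [x]) v = (LEAST w. splits a \<rho> xs x (leader a \<rho> xs v) w)"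
proof -
  have "agree a (xs @ [x]) (\<rho> w) (\<rho> v) \<longleftrightarrow> splits a \<rho> xs x (leader a \<rho> xs v) w" for w
    using assms agree_cong[OF leader_agree[of a xs \<rho> v], of "\<rho> w"] by (auto simp: agree_snoc)
  then show ?thesis unfolding leader_def[of a \<rho> "xs @ [x]"] by simp
qed

text \<open>The bound on \<open>M\<close> leaves room for every address
  \<open>n * n + (16 * i + c)\<close> with \<open>i \<le> 5 * (n * n) + 5 * n + 5\<close>; the
  largest indices, up to \<open>2 * (n * n)\<close>, occur in the array of full blocks.\<close>

locale graph_input =
  fixes n :: nat and a :: "nat \<Rightarrow> nat \<Rightarrow> bool" and M :: nat
  assumes n: "0 < n" and M: "1000 * (n * n) + 1000 * n + 1000 \<le> M"
begin

definition env :: "loop_state \<Rightarrow> bool" where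
  "env s \<longleftrightarrow> vsize s = n \<and> wmax s = M \<and> (\<forall>u<n. \<forall>v<n. vadj s u v = of_bool (a u v))"

lemma env_frame: "frame c s s' \<Longrightarrow> env s \<Longrightarrow> env s'"
  unfolding frame_def env_def by simp

lemma envD: "env s \<Longrightarrow> vsize s = n" "env s \<Longrightarrow> wmax s = M"
  "env s \<Longrightarrow> u < n \<Longrightarrow> v < n \<Longrightarrow> vadj s u v = of_bool (a u v)"
  by (auto simp: env_def)

lemma env_upd [simp]: "env (s\<lparr>vars := f\<rparr>) = env s" "env (s\<lparr>arrs := g\<rparr>) = env s"
  "env (s\<lparr>tape := t\<rparr>) = env s" "env (s\<lparr>outs := l\<rparr>) = env s"
  by (auto simp: env_def)

lemma word_ok: "v \<le> 5 * (n * n) + 5 * n + 5 \<Longrightarrow> v \<le> M"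
  using M by linarith

lemma addr_ok: "i \<le> 5 * (n * n) + 5 * n + 5 \<Longrightarrow> c < 16 \<Longrightarrow> n * n + (16 * i + c) \<le> M"
  using M by linarith

lemma less_ok: "v < n \<Longrightarrow> v \<le> M" "v < n \<Longrightarrow> Suc v \<le> M" "v < n \<Longrightarrow> c < 16 \<Longrightarrow> n * n + (16 * v + c) \<le> M"
  "v < n \<Longrightarrow> n * n + 16 * v \<le> M" "v < n \<Longrightarrow> Suc (n * n + 16 * v) \<le> M"
  "v < n \<Longrightarrow> Suc (Suc (n * n + 16 * v)) \<le> M"
  "n * n \<le> M" "n \<le> M" "of_bool P \<le> M" "16 \<le> M" "Suc 0 \<le> M" "of_bool P - of_bool Q + (of_bool Q - of_bool P) \<le> M"
  "of_bool P - (of_bool Q :: nat) \<le> M" 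
  using M n by (auto simp: of_bool_def)

text \<open>For a leader, array 1 records the first vertex seen that leaves its class, increased by
  one because 0 means that none has been seen. Scanning in increasing order makes that vertex the
  least one, which is the leader of the part split off.\<close>

lemma refine_correct:
  assumes s: "env s" and x: "vars s 2 = x" "x < n"
    and \<rho>: "\<And>v. v < n \<Longrightarrow> arrs s 2 v = \<rho> v" "\<And>v. v < n \<Longrightarrow> \<rho> v < n"
    and lead: "\<And>v. v < n \<Longrightarrow> arrs s 0 v = leader a \<rho> xs v"
  shows "hoare refine s (200 * n + 20) (\<lambda>s'. \<forall>v<n. arrs s' 0 v = leader a \<rho> (xs @ [x]) v)"
  unfolding refine_def
proof (rule hoare_Seq)
  show "hoare (For 0 Size (Put 1 (Var 0) (Const 0))) s (20 * n + 5) (\<lambda>s'. \<forall>u<n. arrs s' 1 u = 0)"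
  proof (rule hoare_For_const[where T = 10 and I = "\<lambda>k s'. \<forall>u<k. arrs s' 1 u = 0"])
    fix k s' assume k: "k < n" and I: "\<forall>u<k. arrs s' 1 u = 0"
      and fr: "frame (For 0 Size (Put 1 (Var 0) (Const 0))) s s'"
    then have "env s'" using env_frame s by blast
    then show "hoare (Put 1 (Var 0) (Const 0)) (set_var 0 k s') 10 (\<lambda>s'. \<forall>u<Suc k. arrs s' 1 u = 0)"
      using k I by (simp add: hoare_def envD less_ok less_Suc_eq)
  qed (use s in \<open>simp_all add: envD less_ok\<close>)
next
  let ?body = "Assign 1 (Get 0 (Var 0)) ;;
      If (edist (Adj (Get 2 (Var 0)) (Var 2)) (Adj (Get 2 (Var 1)) (Var 2)))
        (If (Get 1 (Var 1)) Skip (Put 1 (Var 1) (Var 0 [+] Const 1)) ;;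
         Put 0 (Var 0) (Get 1 (Var 1) [-] Const 1))
        Skip"
  let ?L = "leader a \<rho> xs" and ?L' = "leader a \<rho> (xs @ [x])"
  let ?S = "splits a \<rho> xs x"
  define I where "I k s' \<longleftrightarrow> (\<forall>v<n. arrs s' 0 v = (if v < k then ?L' v else ?L v)) \<and>
    (\<forall>u<n. ?L u = u \<longrightarrow> arrs s' 1 u = (if \<exists>w<k. ?S u w then Suc (LEAST w. ?S u w) else 0))"
    for k and s' :: loop_state
  fix s1 assume alt: "\<forall>u<n. arrs s1 1 u = 0" and fr1: "frame (For 0 Size (Put 1 (Var 0) (Const 0))) s s1"
  have env1: "env s1" using env_frame[OF fr1 s] .
  have s1: "arrs s1 0 = arrs s 0" "arrs s1 2 = arrs s 2" "vars s1 2 = vars s 2"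
    using fr1 unfolding frame_def by simp_all
  have "hoare (For 0 Size ?body) s1 (150 * n + 10) (I n)"
  proof (rule hoare_For_const[where T = 120])
    show "I 0 s1" unfolding I_def using alt lead s1 by simp
  next
    fix k s' assume k: "k < n" and I: "I k s'" and fr: "frame (For 0 Size ?body) s1 s'"
    have env: "env s'" using env_frame[OF fr env1] .
    have s': "arrs s' 2 v = \<rho> v" if "v < n" for v using fr s1 \<rho>(1)[OF that] unfolding frame_def by simp
    have x': "vars s' 2 = x" using fr s1 x unfolding frame_def by simp
    let ?u = "?L k"
    have u: "?u < n" "?L ?u = ?u" using leader_le[of a \<rho> xs k] k leader_leader by (auto simp: le_less_trans)
    have lead_k: "arrs s' 0 k = ?u" using I k unfolding I_def by simp
    define A where "A = arrs s' 1 ?u"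
    then have A1: "arrs s' (Suc 0) ?u = A" by simp
    have A: "A = (if \<exists>w<k. ?S ?u w then Suc (LEAST w. ?S ?u w) else 0)"
      using I u unfolding I_def A_def by simp
    have ex_Suc: "(\<exists>w<Suc k. ?S v w) \<longleftrightarrow> (\<exists>w<k. ?S v w) \<or> ?S v k" for v
      using less_Suc_eq by auto
    \<comment> \<open>Vertex \<open>k\<close> can split only its own class, so at most one entry of
      array 1 is affected.\<close>
    have split_k: "?S v k \<longleftrightarrow> v = ?u \<and> a (\<rho> k) x \<noteq> a (\<rho> ?u) x" if "?L v = v" for v
      using leader_eq_iff[of a \<rho> xs k v] leader_agree[of a xs \<rho> k] agree_sym[of a xs "\<rho> k"] that by metis
    show "hoare ?body (set_var 0 k s') 120 (I (Suc k))"
    proof (cases "a (\<rho> k) x = a (\<rho> ?u) x")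
      case True
      have "?L' k = ?u" using leader_snoc_same[of a \<rho> xs k x] True by simp
      then have "I (Suc k) (set_var 1 ?u (set_var 0 k s'))"
        using I unfolding I_def ex_Suc using split_k True by (auto simp: less_Suc_eq)
      then show ?thesis
        using k u True x \<rho>(2) by (simp add: hoare_def env envD less_ok s' x' lead_k)
    next
      case False
      then have L': "?L' k = (LEAST w. ?S ?u w)" by (intro leader_snoc_split) simp
      have Sk: "?S ?u k" using split_k[OF u(2)] False by simp
      have Least: "(LEAST w. ?S ?u w) \<le> k" using Sk by (rule Least_le)
      have A0: "(LEAST w. ?S ?u w) = k" if "A = 0"
      proof -
        have "\<not> (\<exists>w<k. ?S ?u w)" using \<open>A = 0\<close> A by (metis nat.distinct(1))
        moreover have "?S ?u (LEAST w. ?S ?u w)" using Sk by (rule LeastI)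
        ultimately show ?thesis using Least by (meson le_neq_implies_less)
      qed
      define A' where "A' = (if A = 0 then Suc k else A)"
      have A': "A' = Suc (?L' k)" unfolding A'_def L' using A A0 by auto
      let ?s = "s'\<lparr>vars := (vars s')(0 := k, 1 := ?u), arrs := (arrs s')(1 := (arrs s' 1)(?u := A'), 0 := (arrs s' 0)(k := ?L' k))\<rparr>"
      have I1: "I (Suc k) ?s"
        unfolding I_def
      proof (intro conjI allI impI)
        fix v assume "v < n"
        then show "arrs ?s 0 v = (if v < Suc k then ?L' v else ?L v)"
          using I unfolding I_def by (simp add: less_Suc_eq)
      next
        fix v assume v: "v < n" "?L v = v"
        show "arrs ?s 1 v = (if \<exists>w<Suc k. ?S v w then Suc (LEAST w. ?S v w) else 0)"
        proof (cases "v = ?u")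
          case True
          then show ?thesis using Sk A' L' by auto
        next
          case False
          then have "\<not> ?S v k" using split_k[OF v(2)] by blast
          then have 1: "(\<exists>w<Suc k. ?S v w) \<longleftrightarrow> (\<exists>w<k. ?S v w)" using ex_Suc[of v] by blast
          have 2: "arrs s' 1 v = (if \<exists>w<k. ?S v w then Suc (LEAST w. ?S v w) else 0)"
            using I v unfolding I_def by blast
          have "arrs ?s 1 v = arrs s' 1 v" using False by simp
          then show ?thesis by (simp only: 1 2)
        qed
      qed
      have S1: "sem ?body (set_var 0 k s') = ?s"
      proof (cases "A = 0")
        case True
        then have "?L' k = k" using A' by (simp add: A'_def)
        then show ?thesis
          using False k u x \<rho>(2) True by (simp add: env envD s' x' lead_k A1 A'_def fun_upd_twist)
      next
        case A: False
        have "(arrs s' (Suc 0))(?u := A) = arrs s' (Suc 0)" using A1 by (simp add: fun_upd_idem)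
        then have "(arrs s')(Suc 0 := (arrs s' (Suc 0))(?u := A)) = arrs s'" by simp
        moreover have "A - 1 = ?L' k" "A' = A" using A' A by (simp_all add: A'_def)
        ultimately show ?thesis
          using False k u x \<rho>(2) A by (simp add: env envD s' x' lead_k A1)
      qed
      have C1: "cok ?body (set_var 0 k s') \<and> cost ?body (set_var 0 k s') \<le> 120"
      proof -
        have "A \<le> Suc k" using A' L' Least by (auto simp: A'_def split: if_splits)
        then have A_ok: "A \<le> M" using less_ok(2)[OF k] by (rule le_trans)
        then have "A - Suc 0 \<le> M" by simp
        then show ?thesis
          using A_ok False k u x \<rho>(2) by (simp add: env envD less_ok s' x' lead_k A1)
      qed
      show ?thesis unfolding hoare_def S1 using I1 C1 by blast
    qed
  qed (use env1 in \<open>simp_all add: envD less_ok\<close>)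
  then show "hoare (For 0 Size ?body) s1 (150 * n + 10) (\<lambda>s'. \<forall>v<n. arrs s' 0 v = ?L' v)"
    by (rule hoare_weaken) (simp_all add: I_def)
qed simp

end

text \<open>The part of \<open>members\<close> seen after \<open>k\<close> vertices; its length is
  the rank that the next member receives.\<close>

definition class_upto :: "(nat \<Rightarrow> nat \<Rightarrow> bool) \<Rightarrow> (nat \<Rightarrow> nat) \<Rightarrow> nat list \<Rightarrow> nat \<Rightarrow> nat \<Rightarrow> nat list" where
  "class_upto a \<rho> xs k u = filter (\<lambda>w. \<rho> w = w \<and> leader a \<rho> xs w = u) [0..<k]"

lemma class_upto_0 [simp]: "class_upto a \<rho> xs 0 u = []"
  by (simp add: class_upto_def)

lemma class_upto_Suc:
  "class_upto a \<rho> xs (Suc k) u = class_upto a \<rho> xs k u @ (if \<rho> k = k \<and> leader a \<rho> xs k = u then [k] else [])"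
  by (simp add: class_upto_def)

lemma length_class_upto_le: "length (class_upto a \<rho> xs k u) \<le> k"
  unfolding class_upto_def by (rule order_trans[OF length_filter_le]) simp

lemma members_eq_class_upto:
  "members n a \<rho> xs v = class_upto a \<rho> xs n (leader a \<rho> xs v)"
  unfolding members_def class_upto_def
proof (rule filter_cong[OF refl])
  fix w
  show "\<rho> w = w \<and> agree a xs w (\<rho> v) \<longleftrightarrow> \<rho> w = w \<and> leader a \<rho> xs w = leader a \<rho> xs v"
    using leader_eq_iff[of a \<rho> xs w v] by auto
qed

lemma class_upto_nth:
  fixes a xs
  assumes "v < n" "\<rho> v = v"
  defines "u \<equiv> leader a \<rho> xs v"
  shows "length (class_upto a \<rho> xs v u) < length (class_upto a \<rho> xs n u)"
    "class_upto a \<rho> xs n u ! length (class_upto a \<rho> xs v u) = v"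
proof -
  have "[0..<n] = [0..<v] @ v # [Suc v..<n]"
    using assms(1) by (metis le0 less_imp_le_nat upt_add_eq_append upt_conv_Cons le_add_diff_inverse add_0)
  then have "class_upto a \<rho> xs n u = class_upto a \<rho> xs v u @ v # filter (\<lambda>w. \<rho> w = w \<and> leader a \<rho> xs w = u) [Suc v..<n]"
    unfolding class_upto_def using assms by simp
  then show "length (class_upto a \<rho> xs v u) < length (class_upto a \<rho> xs n u)"
    "class_upto a \<rho> xs n u ! length (class_upto a \<rho> xs v u) = v" by simp_all
qed

text \<open>Characterizes the random member by its rank, which a single pass can test without a
  stored list of the class.\<close>

lemma new_rep_rank:
  fixes a xs z
  assumes "retraction n \<rho>" "v < n"
  defines "r \<equiv> new_rep n a \<rho> xs z v" and "u \<equiv> leader a \<rho> xs v"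
  shows "r < n" "\<rho> r = r" "leader a \<rho> xs r = u"
    "length (class_upto a \<rho> xs r u) = z mod length (class_upto a \<rho> xs n u)"
proof -
  show r: "r < n" "\<rho> r = r" unfolding r_def by (rule new_rep_props[OF assms(1,2)])+
  have "agree a xs (\<rho> r) (\<rho> v)" using new_rep_props(3)[OF assms(1,2), of a xs z] r unfolding r_def by simp
  then show lr: "leader a \<rho> xs r = u" unfolding u_def by (rule leader_cong)
  let ?l = "class_upto a \<rho> xs n u"
  have l: "members n a \<rho> xs v = ?l" unfolding u_def by (rule members_eq_class_upto)
  have "?l ! length (class_upto a \<rho> xs r u) = r" and less: "length (class_upto a \<rho> xs r u) < length ?l"
    using class_upto_nth[where \<rho> = \<rho> and v = r and n = n, OF r, of a xs] lr by simp_all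
  moreover have "?l ! (z mod length ?l) = r" unfolding r_def new_rep_def Let_def l ..
  moreover have "z mod length ?l < length ?l" using less by (intro mod_less_divisor) linarith
  moreover have "distinct ?l" by (simp add: class_upto_def)
  ultimately show "length (class_upto a \<rho> xs r u) = z mod length ?l"
    by (metis nth_eq_iff_index_eq)
qed

text \<open>Ensures that the pass selecting new representatives writes only one vertex per
  class.\<close>

lemma rank_inj:
  assumes "v < n" "\<rho> v = v" "w < n" "\<rho> w = w" "leader a \<rho> xs v = leader a \<rho> xs w"
    "length (class_upto a \<rho> xs v (leader a \<rho> xs v)) = length (class_upto a \<rho> xs w (leader a \<rho> xs w))"
  shows "v = w"
proof -
  have "v = class_upto a \<rho> xs n (leader a \<rho> xs v) ! length (class_upto a \<rho> xs v (leader a \<rho> xs v))"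
    by (rule class_upto_nth(2)[OF assms(1), where \<rho> = \<rho>, OF assms(2), symmetric])
  also have "\<dots> = class_upto a \<rho> xs n (leader a \<rho> xs w) ! length (class_upto a \<rho> xs w (leader a \<rho> xs w))"
    unfolding assms(6) unfolding assms(5) ..
  also have "\<dots> = w" by (rule class_upto_nth(2)[OF assms(3), where \<rho> = \<rho>, OF assms(4)])
  finally show ?thesis .
qed

lemma length_cluster_le:
  assumes "cluster_lists n \<rho> L" "u \<in> active n \<rho>"
  shows "length (L u) \<le> n"
proof -
  have "length (L u) = card (set (L u))" using assms by (metis cluster_lists_def distinct_card)
  also have "\<dots> \<le> card {..<n}" using assms by (intro card_mono) (auto simp: cluster_lists_def)
  finally show ?thesis by simp
qed

text \<open>A crude bound, which serves to keep these sums within a machine word.\<close>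

lemma sum_class_upto_le:
  assumes "cluster_lists n \<rho> L" "k \<le> n"
  shows "sum_list (map (\<lambda>v. length (L v)) (class_upto a \<rho> xs k u)) \<le> k * n"
  using assms(2)
proof (induction k)
  case (Suc k)
  have "length (L k) \<le> n" if "\<rho> k = k"
    using that Suc.prems by (intro length_cluster_le[OF assms(1)]) (simp add: active_def)
  then show ?case using Suc by (auto simp: class_upto_Suc)
qed simp

definition shift where
  "shift a \<rho> xs L v = sum_list (map (\<lambda>v. length (L v)) (class_upto a \<rho> xs v (leader a \<rho> xs v)))"

text \<open>Inside a concatenation a list is displaced by the total length of those before it. Hence
  lists are represented by the positions of their elements, and merging them is one addition per
  vertex.\<close>

lemma position_concat:
  assumes L: "cluster_lists n \<rho> L" and p: "\<And>v j. v \<in> active n \<rho> \<Longrightarrow> j < length (L v) \<Longrightarrow> p (L v ! j) = j"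
    and "k \<le> n" "J < length (concat (map L (class_upto a \<rho> xs k u)))"
  shows "(let v = concat (map L (class_upto a \<rho> xs k u)) ! J in p v + shift a \<rho> xs L (\<rho> v)) = J"
  using assms(3,4)
proof (induction k)
  case (Suc k)
  let ?l = "concat (map L (class_upto a \<rho> xs k u))"
  show ?case
  proof (cases "\<rho> k = k \<and> leader a \<rho> xs k = u")
    case True
    then have eq: "concat (map L (class_upto a \<rho> xs (Suc k) u)) = ?l @ L k" by (simp add: class_upto_Suc)
    show ?thesis
    proof (cases "J < length ?l")
      case True
      then show ?thesis using Suc.IH Suc.prems(1) unfolding eq by (simp add: nth_append)
    next
      case False
      define j where "j = J - length ?l"
      have j: "j < length (L k)" "J = length ?l + j" using Suc.prems(2) False unfolding eq j_def by auto
      have k: "k \<in> active n \<rho>" using True Suc.prems(1) by (simp add: active_def)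
      have "L k ! j \<in> set (L k)" using j(1) by (rule nth_mem)
      then have "\<rho> (L k ! j) = k" using L k by (simp add: cluster_lists_def)
      moreover have "shift a \<rho> xs L k = length ?l"
        using True unfolding shift_def by (simp add: length_concat comp_def)
      ultimately show ?thesis using p[OF k j(1)] unfolding eq j(2) by (simp add: nth_append Let_def)
    qed
  next
    case False
    then have "class_upto a \<rho> xs (Suc k) u = class_upto a \<rho> xs k u" by (auto simp: class_upto_Suc)
    then show ?thesis using Suc by simp
  qed
qed simp

context graph_input
begin

lemma less_ok3: "v < n \<Longrightarrow> n * n + (16 * v + 3) \<le> M" "v < n \<Longrightarrow> n * n + (16 * v + 4) \<le> M"
  "v < n \<Longrightarrow> n * n + (16 * v + 5) \<le> M" "v < n \<Longrightarrow> n * n + (16 * v + 6) \<le> M"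
  "v < n \<Longrightarrow> n * n + (16 * v + 7) \<le> M" "v < n \<Longrightarrow> n * n + (16 * v + 8) \<le> M"
  "v < n \<Longrightarrow> n * n + (16 * v + 9) \<le> M" "v < n \<Longrightarrow> n * n + (16 * v + 10) \<le> M"
  "v < n \<Longrightarrow> n * n + (16 * v + 11) \<le> M" "v < n \<Longrightarrow> n * n + (16 * v + 12) \<le> M"
  "v < n \<Longrightarrow> n * n + (16 * v + 14) \<le> M"
  by (rule less_ok; simp)+

lemma edist_eq_0: "aval (edist e f) s = 0 \<longleftrightarrow> aval e s = aval f s"
  by auto

lemma edist_ok:
  assumes "aok e s" "aok f s" shows "aok (edist e f) s"
proof -
  have "aval e s \<le> wmax s" "aval f s \<le> wmax s" using assms aval_le_wmax by auto
  then show ?thesis using assms by (cases "aval e s \<le> aval f s") auto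
qed

definition ranked where
  "ranked \<rho> xs L k s \<longleftrightarrow>
    (\<forall>u<n. arrs s 3 u = length (class_upto a \<rho> xs k u) \<and>
       arrs s 4 u = sum_list (map (\<lambda>v. length (L v)) (class_upto a \<rho> xs k u))) \<and>
    (\<forall>v<k. \<rho> v = v \<longrightarrow> arrs s 5 v = length (class_upto a \<rho> xs v (leader a \<rho> xs v)) \<and> arrs s 6 v = shift a \<rho> xs L v)"

lemma rank_step:
  fixes s :: loop_state
  assumes k: "k < n" and env: "env s" and I: "ranked \<rho> xs L k s"
    and s: "arrs s 2 k = \<rho> k" "\<rho> k < n" "arrs s 0 k = leader a \<rho> xs k" "\<rho> k = k \<Longrightarrow> arrs s 9 k = length (L k)"
    and L: "cluster_lists n \<rho> L"
  shows "hoare (If (edist (Get 2 (Var 0)) (Var 0)) Skip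
      (Assign 1 (Get 0 (Var 0)) ;; Put 5 (Var 0) (Get 3 (Var 1)) ;;
       Put 3 (Var 1) (Get 3 (Var 1) [+] Const 1) ;; Put 6 (Var 0) (Get 4 (Var 1)) ;;
       Put 4 (Var 1) (Get 4 (Var 1) [+] Get 9 (Var 0)))) (set_var 0 k s) 120 (ranked \<rho> xs L (Suc k))"
proof (rule hoare_If[where U = 90])
  show "aok (edist (Get 2 (Var 0)) (Var 0)) (set_var 0 k s)"
    using k s by (intro edist_ok) (simp_all add: envD env less_ok)
  show "hoare Skip (set_var 0 k s) 90 (ranked \<rho> xs L (Suc k))"
    if "aval (edist (Get 2 (Var 0)) (Var 0)) (set_var 0 k s) \<noteq> 0"
  proof -
    have "\<rho> k \<noteq> k" using that s by (auto simp: edist_eq_0)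
    then have "ranked \<rho> xs L (Suc k) (set_var 0 k s)"
      using I unfolding ranked_def class_upto_Suc by (auto simp: less_Suc_eq)
    then show ?thesis by (simp add: hoare_def)
  qed
  assume "aval (edist (Get 2 (Var 0)) (Var 0)) (set_var 0 k s) = 0"
  then have \<rho>: "\<rho> k = k" using s unfolding edist_eq_0 by simp
  let ?u = "leader a \<rho> xs k"
  let ?c = "class_upto a \<rho> xs k ?u"
  have u: "?u < n" using leader_le[of a \<rho> xs k] k by simp
  have c: "length ?c \<le> n" using length_class_upto_le[of a \<rho> xs k ?u] k by simp
  have sh: "sum_list (map (\<lambda>v. length (L v)) ?c) \<le> n * n"
    using sum_class_upto_le[OF L, of k a xs ?u] k by (meson le_trans less_imp_le mult_le_mono1)
  have "length (L k) \<le> n" using \<rho> k by (intro length_cluster_le[OF L]) (simp add: active_def)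
  then have bnd: "length ?c \<le> M" "Suc (length ?c) \<le> M" "sum_list (map (\<lambda>v. length (L v)) ?c) \<le> M" "length (L k) \<le> M"
    "sum_list (map (\<lambda>v. length (L v)) ?c) + length (L k) \<le> M"
    using c sh by (intro word_ok; linarith)+
  have I': "arrs s 3 ?u = length ?c" "arrs s 4 ?u = sum_list (map (\<lambda>v. length (L v)) ?c)"
    using I u unfolding ranked_def by auto
  let ?s = "s\<lparr>vars := (vars s)(0 := k, 1 := ?u), arrs := (arrs s)(5 := (arrs s 5)(k := length ?c),
     3 := (arrs s 3)(?u := Suc (length ?c)), 6 := (arrs s 6)(k := shift a \<rho> xs L k),
     4 := (arrs s 4)(?u := sum_list (map (\<lambda>v. length (L v)) ?c) + length (L k)))\<rparr>"
  have "ranked \<rho> xs L (Suc k) ?s"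
    using I \<rho> unfolding ranked_def class_upto_Suc by (auto simp: less_Suc_eq)
  then show "hoare (Assign 1 (Get 0 (Var 0)) ;; Put 5 (Var 0) (Get 3 (Var 1)) ;;
       Put 3 (Var 1) (Get 3 (Var 1) [+] Const 1) ;; Put 6 (Var 0) (Get 4 (Var 1)) ;;
       Put 4 (Var 1) (Get 4 (Var 1) [+] Get 9 (Var 0))) (set_var 0 k s) 90 (ranked \<rho> xs L (Suc k))"
    using k u s(3) s(4)[OF \<rho>] bnd by (simp add: hoare_def envD env less_ok less_ok3 I' shift_def)
qed simp

text \<open>Each vertex lies in exactly one list, so array 8 inverts all the lists at once. Sizes
  are meaningful only at representatives.\<close>

definition stores :: "(nat \<Rightarrow> nat) \<Rightarrow> (nat \<Rightarrow> nat list) \<Rightarrow> loop_state \<Rightarrow> bool" where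
  "stores \<rho> L s \<longleftrightarrow> (\<forall>v<n. arrs s 2 v = \<rho> v) \<and>
    (\<forall>u\<in>active n \<rho>. arrs s 9 u = length (L u) \<and> (\<forall>j<length (L u). arrs s 8 (L u ! j) = j))"

lemma stores_position_less:
  assumes "stores \<rho> L s" "cluster_lists n \<rho> L" "retraction n \<rho>" "v < n"
  shows "arrs s 8 v < n"
proof -
  have act: "\<rho> v \<in> active n \<rho>" using assms(3,4) by (simp add: active_def retraction_def)
  then have "v \<in> set (L (\<rho> v))" using assms(2,4) by (simp add: cluster_lists_def)
  then obtain j where "j < length (L (\<rho> v))" "L (\<rho> v) ! j = v" by (auto simp: in_set_conv_nth)
  moreover from this(1) have "arrs s 8 (L (\<rho> v) ! j) = j" using assms(1) act unfolding stores_def by blast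
  ultimately show ?thesis using length_cluster_le[OF assms(2) act] by simp
qed

lemma regroup_correct:
  assumes env: "env s" and st: "stores \<rho> L s" and \<rho>: "retraction n \<rho>" and L: "cluster_lists n \<rho> L"
    and lead: "\<And>v. v < n \<Longrightarrow> arrs s 0 v = leader a \<rho> xs v" and z: "vars s 3 = z" "z < n"
  shows "hoare regroup s (400 * n + 50) (stores (new_rep n a \<rho> xs z) (merge_lists n a \<rho> xs L))"
proof -
  let ?nr = "new_rep n a \<rho> xs z" and ?l = "leader a \<rho> xs"
  let ?cl = "class_upto a \<rho> xs"
  have \<rho>n: "\<rho> v < n" if "v < n" for v using \<rho> that by (simp add: retraction_def)
  have ln: "?l v < n" if "v < n" for v using leader_le[of a \<rho> xs v] that by simp
  have s2: "arrs s 2 v = \<rho> v" if "v < n" for v using st that by (simp add: stores_def)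
  have s9: "arrs s 9 v = length (L v)" if "v < n" "\<rho> v = v" for v using st that by (simp add: stores_def active_def)
  let ?c1 = "For 0 Size (Put 3 (Var 0) (Const 0) ;; Put 4 (Var 0) (Const 0))"
  let ?b2 = "If (edist (Get 2 (Var 0)) (Var 0)) Skip
      (Assign 1 (Get 0 (Var 0)) ;; Put 5 (Var 0) (Get 3 (Var 1)) ;;
       Put 3 (Var 1) (Get 3 (Var 1) [+] Const 1) ;; Put 6 (Var 0) (Get 4 (Var 1)) ;;
       Put 4 (Var 1) (Get 4 (Var 1) [+] Get 9 (Var 0)))"
  let ?b3 = "If (edist (Get 2 (Var 0)) (Var 0)) Skip
      (Assign 1 (Get 0 (Var 0)) ;;
       If (edist (Get 5 (Var 0)) (Var 3 [%] Get 3 (Var 1))) Skip (Put 7 (Var 1) (Var 0)))"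
  let ?b4 = "Put 8 (Var 0) (Get 8 (Var 0) [+] Get 6 (Get 2 (Var 0))) ;;
      Put 2 (Var 0) (Get 7 (Get 0 (Var 0))) ;; Put 9 (Var 0) (Get 4 (Get 0 (Var 0)))"
  have h1: "hoare ?c1 s (30 * n + 5) (ranked \<rho> xs L 0)"
  proof (rule hoare_weaken[OF hoare_For_const[where T = 20 and b = n and T' = "30 * n + 5" and I = "\<lambda>k s'. \<forall>u<k. arrs s' 3 u = 0 \<and> arrs s' 4 u = 0"]])
    fix k s' assume k: "k < n" and I: "\<forall>u<k. arrs s' 3 u = 0 \<and> arrs s' 4 u = 0" and fr: "frame ?c1 s s'"
    show "hoare (Put 3 (Var 0) (Const 0) ;; Put 4 (Var 0) (Const 0)) (set_var 0 k s') 20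
        (\<lambda>s'. \<forall>u<Suc k. arrs s' 3 u = 0 \<and> arrs s' 4 u = 0)"
      using k I by (simp add: hoare_def envD env_frame[OF fr env] less_ok less_ok3 less_Suc_eq)
  qed (use env in \<open>simp_all add: envD less_ok ranked_def\<close>)
  have h2: "hoare (For 0 Size ?b2) s1 (127 * n + 5) (ranked \<rho> xs L n)"
    if I: "ranked \<rho> xs L 0 s1" and fr1: "frame ?c1 s s1" for s1
  proof (rule hoare_For_const[where T = 120 and I = "ranked \<rho> xs L" and b = n])
    have env1: "env s1" by (rule env_frame[OF fr1 env])
    then show "aok Size s1" "aval Size s1 = n" by (simp_all add: envD less_ok)
    fix k s' assume k: "k < n" and I: "ranked \<rho> xs L k s'" and fr: "frame (For 0 Size ?b2) s1 s'"
    have "arrs s' 2 = arrs s 2" "arrs s' 0 = arrs s 0" "arrs s' 9 = arrs s 9"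
      using fr fr1 unfolding frame_def by simp_all
    then show "hoare ?b2 (set_var 0 k s') 120 (ranked \<rho> xs L (Suc k))"
      using k s2 s9 lead \<rho>n by (intro rank_step I env_frame[OF fr env1] L) simp_all
  qed (use I in simp_all)
  \<comment> \<open>Array 7 is indexed by leaders; by \<open>rank_inj\<close> no later vertex of the
    class overwrites the entry.\<close>
  define I3 where "I3 k s' \<longleftrightarrow> (\<forall>v<k. \<rho> v = v \<longrightarrow> length (?cl v (?l v)) = z mod length (?cl n (?l v)) \<longrightarrow> arrs s' 7 (?l v) = v)"
    for k and s' :: loop_state
  have h3: "hoare (For 0 Size ?b3) s2 (107 * n + 5) (I3 n)"
    if rk: "ranked \<rho> xs L n s2" and fr1: "frame ?c1 s s1" and fr2: "frame (For 0 Size ?b2) s1 s2" for s1 s2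
  proof (rule hoare_For_const[where T = 100 and I = I3 and b = n])
    have env2: "env s2" by (rule env_frame[OF fr2 env_frame[OF fr1 env]])
    then show "aok Size s2" "aval Size s2 = n" by (simp_all add: envD less_ok)
    show "I3 0 s2" by (simp add: I3_def)
    fix k s' assume k: "k < n" and I: "I3 k s'" and fr: "frame (For 0 Size ?b3) s2 s'"
    have same: "arrs s' 2 = arrs s 2" "arrs s' 0 = arrs s 0" "vars s' 3 = z"
      using fr fr2 fr1 z unfolding frame_def by simp_all
    have same2: "arrs s' 3 = arrs s2 3" "arrs s' 5 = arrs s2 5" using fr unfolding frame_def by simp_all
    have env': "env s'" by (rule env_frame[OF fr env2])
    let ?u = "?l k"
    have c3: "arrs s' 3 ?u = length (?cl n ?u)" using rk ln[OF k] unfolding same2 ranked_def by simp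
    have c5: "arrs s' 5 k = length (?cl k ?u)" if "\<rho> k = k" using rk k that unfolding same2 ranked_def by simp
    have bnd: "length (?cl n ?u) \<le> M" "length (?cl k ?u) \<le> M" "z mod length (?cl n ?u) \<le> M" "z \<le> M"
    proof -
      show "z \<le> M" by (rule less_ok(1)[OF z(2)])
      show "length (?cl n ?u) \<le> M" using length_class_upto_le[of a \<rho> xs n ?u] less_ok(8) by (rule le_trans)
      show "length (?cl k ?u) \<le> M" using length_class_upto_le[of a \<rho> xs k ?u] less_ok(1)[OF k] by (rule le_trans)
      show "z mod length (?cl n ?u) \<le> M" using mod_less_eq_dividend[of z] less_ok(1)[OF z(2)] by (rule le_trans)
    qed
    show "hoare ?b3 (set_var 0 k s') 100 (I3 (Suc k))"
    proof (rule hoare_If[where U = 70])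
      show "aok (edist (Get 2 (Var 0)) (Var 0)) (set_var 0 k s')"
        using k same s2 \<rho>n by (intro edist_ok) (simp_all add: envD env' less_ok)
      show "hoare Skip (set_var 0 k s') 70 (I3 (Suc k))"
        if "aval (edist (Get 2 (Var 0)) (Var 0)) (set_var 0 k s') \<noteq> 0"
      proof -
        have "\<rho> k \<noteq> k" using that s2[OF k] same by (auto simp: edist_eq_0)
        then have "I3 (Suc k) (set_var 0 k s')" using I unfolding I3_def by (auto simp: less_Suc_eq)
        then show ?thesis by (simp add: hoare_def)
      qed
      assume "aval (edist (Get 2 (Var 0)) (Var 0)) (set_var 0 k s') = 0"
      then have \<rho>k: "\<rho> k = k" using s2[OF k] same unfolding edist_eq_0 by simp
      show "hoare (Assign 1 (Get 0 (Var 0)) ;;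
       If (edist (Get 5 (Var 0)) (Var 3 [%] Get 3 (Var 1))) Skip (Put 7 (Var 1) (Var 0))) (set_var 0 k s') 70 (I3 (Suc k))"
      proof (cases "length (?cl k ?u) = z mod length (?cl n ?u)")
        case True
        have "I3 (Suc k) (s'\<lparr>vars := (vars s')(0 := k, 1 := ?u), arrs := (arrs s')(7 := (arrs s' 7)(?u := k))\<rparr>)"
          unfolding I3_def
        proof (intro allI impI)
          fix v assume v: "v < Suc k" "\<rho> v = v" "length (?cl v (?l v)) = z mod length (?cl n (?l v))"
          show "arrs (s'\<lparr>vars := (vars s')(0 := k, 1 := ?u), arrs := (arrs s')(7 := (arrs s' 7)(?u := k))\<rparr>) 7 (?l v) = v"
          proof (cases "v = k")
            case False
            then have "v < k" using v(1) by simp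
            have "?l v \<noteq> ?u"
            proof
              assume eq: "?l v = ?u"
              then have "length (?cl v (?l v)) = length (?cl k (?l k))" using v(3) True by simp
              from rank_inj[OF _ v(2) k \<rho>k eq this] \<open>v < k\<close> k show False by simp
            qed
            then show ?thesis using I \<open>v < k\<close> v unfolding I3_def by simp
          qed simp
        qed
        then show ?thesis
          using k ln[OF k] lead[OF k] bnd True \<rho>k
          by (simp add: hoare_def envD env' less_ok less_ok3 same c3 c5)
      next
        case False
        have "I3 (Suc k) (s'\<lparr>vars := (vars s')(0 := k, 1 := ?u)\<rparr>)"
          using I False unfolding I3_def by (auto simp: less_Suc_eq)
        moreover have "length (?cl k ?u) - z mod length (?cl n ?u) + (z mod length (?cl n ?u) - length (?cl k ?u)) \<le> M"
          "length (?cl k ?u) - z mod length (?cl n ?u) \<le> M" "z mod length (?cl n ?u) - length (?cl k ?u) \<le> M"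
          using bnd by linarith+
        ultimately show ?thesis
          using k ln[OF k] lead[OF k] bnd False \<rho>k
          by (simp add: hoare_def envD env' less_ok less_ok3 same c3 c5)
      qed
    qed simp
  qed simp
  \<comment> \<open>The position is updated before the representative, because the shift has to be
    looked up at the old representative, which array 2 still holds at that moment.\<close>
  define I4 where "I4 k s' \<longleftrightarrow> (\<forall>v<n. arrs s' 2 v = (if v < k then ?nr v else \<rho> v) \<and>
      arrs s' 8 v = (if v < k then arrs s 8 v + shift a \<rho> xs L (\<rho> v) else arrs s 8 v) \<and>
      (v < k \<longrightarrow> arrs s' 9 v = sum_list (map (\<lambda>v. length (L v)) (?cl n (?l v)))))" for k and s' :: loop_state
  have h4: "hoare (For 0 Size ?b4) s3 (87 * n + 5) (I4 n)"
    if rk: "ranked \<rho> xs L n s2" and I: "I3 n s3" and fr1: "frame ?c1 s s1" and fr2: "frame (For 0 Size ?b2) s1 s2"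
      and fr3: "frame (For 0 Size ?b3) s2 s3" for s1 s2 s3
  proof (rule hoare_For_const[where T = 80 and I = I4 and b = n])
    have env3: "env s3" by (rule env_frame[OF fr3 env_frame[OF fr2 env_frame[OF fr1 env]]])
    then show "aok Size s3" "aval Size s3 = n" by (simp_all add: envD less_ok)
    have same: "arrs s3 2 = arrs s 2" "arrs s3 0 = arrs s 0" "arrs s3 8 = arrs s 8"
      "arrs s3 4 = arrs s2 4" "arrs s3 6 = arrs s2 6"
      using fr3 fr2 fr1 unfolding frame_def by simp_all
    show "I4 0 s3" by (simp add: I4_def same s2)
    fix k s' assume k: "k < n" and I': "I4 k s'" and fr: "frame (For 0 Size ?b4) s3 s'"
    have env': "env s'" by (rule env_frame[OF fr env3])
    have same': "arrs s' 0 = arrs s 0" "arrs s' 7 = arrs s3 7" "arrs s' 4 = arrs s2 4" "arrs s' 6 = arrs s2 6"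
      using fr same unfolding frame_def by simp_all
    note r = new_rep_rank[OF \<rho> k, of a xs z]
    have "arrs s3 7 (?l (?nr k)) = ?nr k" using I[unfolded I3_def, rule_format, OF r(1,2)] r(3,4) by simp
    then have a7: "arrs s' 7 (?l k) = ?nr k" using r(3) same' by simp
    have a4: "arrs s' 4 (?l k) = sum_list (map (\<lambda>v. length (L v)) (?cl n (?l k)))"
      using rk ln[OF k] same' unfolding ranked_def by simp
    have "\<rho> (\<rho> k) = \<rho> k" using \<rho> k by (simp add: retraction_def)
    then have a6: "arrs s' 6 (\<rho> k) = shift a \<rho> xs L (\<rho> k)"
      using rk \<rho>n[OF k] same' unfolding ranked_def by simp
    have a28: "arrs s' 2 k = \<rho> k" "arrs s' 8 k = arrs s 8 k" using I' k unfolding I4_def by simp_all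
    have sum_n: "sum_list (map (\<lambda>v. length (L v)) (?cl n (?l k))) \<le> n * n"
      using sum_class_upto_le[OF L, of n a xs "?l k"] by simp
    have sh_n: "shift a \<rho> xs L (\<rho> k) \<le> n * n" unfolding shift_def
      using sum_class_upto_le[OF L, of "\<rho> k" a xs "?l (\<rho> k)"] \<rho>n[OF k] by (meson le_trans less_imp_le mult_le_mono1)
    have p_n: "arrs s 8 k < n" by (rule stores_position_less[OF st L \<rho> k])
    have bnd: "sum_list (map (\<lambda>v. length (L v)) (?cl n (?l k))) \<le> M" "shift a \<rho> xs L (\<rho> k) \<le> M" "arrs s 8 k \<le> M"
      "arrs s 8 k + shift a \<rho> xs L (\<rho> k) \<le> M"
      using sum_n sh_n p_n by (intro word_ok; linarith)+
    have "I4 (Suc k) (s'\<lparr>vars := (vars s')(0 := k), arrs := (arrs s')(8 := (arrs s' 8)(k := arrs s 8 k + shift a \<rho> xs L (\<rho> k)),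
        2 := (arrs s' 2)(k := ?nr k), 9 := (arrs s' 9)(k := sum_list (map (\<lambda>v. length (L v)) (?cl n (?l k)))))\<rparr>)"
      using I' unfolding I4_def by (auto simp: less_Suc_eq)
    then show "hoare ?b4 (set_var 0 k s') 80 (I4 (Suc k))"
      using k ln[OF k] lead[OF k] \<rho>n[OF k] bnd r(1)
      by (simp add: hoare_def envD env' less_ok less_ok3 same'(1) a7 a4 a6 a28)
  qed simp
  have final: "stores ?nr (merge_lists n a \<rho> xs L) s'" if I: "I4 n s'" for s'
    unfolding stores_def
  proof (intro conjI allI impI ballI)
    show "arrs s' 2 v = ?nr v" if "v < n" for v using I that unfolding I4_def by simp
    fix r assume "r \<in> active n ?nr"
    then have r: "r < n" by (simp add: active_def)
    have m: "merge_lists n a \<rho> xs L r = concat (map L (?cl n (?l r)))"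
      by (simp add: merge_lists_def members_eq_class_upto)
    show "arrs s' 9 r = length (merge_lists n a \<rho> xs L r)"
      using I r unfolding I4_def m by (simp add: length_concat comp_def)
    fix j assume j: "j < length (merge_lists n a \<rho> xs L r)"
    let ?v = "merge_lists n a \<rho> xs L r ! j"
    have "?v \<in> set (merge_lists n a \<rho> xs L r)" using j by (rule nth_mem)
    then have "?v < n" using cluster_lists_merge[OF \<rho> L, of a xs z] \<open>r \<in> active n ?nr\<close>
      by (simp add: cluster_lists_def)
    then have "arrs s' 8 ?v = arrs s 8 ?v + shift a \<rho> xs L (\<rho> ?v)" using I unfolding I4_def by simp
    also have "\<dots> = j"
      using position_concat[OF L, of "arrs s 8" n j a xs "?l r"] st j unfolding m by (simp add: stores_def Let_def)
    finally show "arrs s' 8 ?v = j" .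
  qed
  show ?thesis unfolding regroup_def
  proof (rule hoare_Seq[OF h1])
    fix s1 assume 1: "ranked \<rho> xs L 0 s1" "frame ?c1 s s1"
    show "hoare (For 0 Size ?b2 ;; For 0 Size ?b3 ;; For 0 Size ?b4) s1 (330 * n + 20)
        (stores ?nr (merge_lists n a \<rho> xs L))"
    proof (rule hoare_Seq[OF h2[OF 1]])
      fix s2 assume 2: "ranked \<rho> xs L n s2" "frame (For 0 Size ?b2) s1 s2"
      show "hoare (For 0 Size ?b3 ;; For 0 Size ?b4) s2 (200 * n + 10) (stores ?nr (merge_lists n a \<rho> xs L))"
      proof (rule hoare_Seq[OF h3[OF 2(1) 1(2) 2(2)]])
        fix s3 assume 3: "I3 n s3" "frame (For 0 Size ?b3) s2 s3"
        show "hoare (For 0 Size ?b4) s3 (87 * n + 5) (stores ?nr (merge_lists n a \<rho> xs L))"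
          by (rule hoare_weaken[OF h4[OF 2(1) 3(1) 1(2) 2(2) 3(2)]]) (simp_all add: final)
      qed simp
    qed simp
  qed simp
qed

lemma cluster_correct:
  assumes env: "env s" and st: "stores \<rho> L s" and \<rho>: "retraction n \<rho>" and L: "cluster_lists n \<rho> L"
    and m: "vars s 5 = m" "m \<le> n" and t: "tape s = t" "Suc m \<le> length t" "set t \<subseteq> {..<n}"
  shows "hoare cluster s (500 * (n + 1) * (m + 1))
    (\<lambda>s'. stores (new_rep n a \<rho> (take m t) (t ! m)) (merge_lists n a \<rho> (take m t) L) s' \<and> tape s' = drop (Suc m) t)"
proof -
  have \<rho>n: "\<rho> v < n" if "v < n" for v using \<rho> that by (simp add: retraction_def)
  have tn: "t ! k < n" if "k \<le> m" for k
  proof -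
    have "t ! k \<in> set t" using that t(2) by (intro nth_mem) simp
    then show ?thesis using t(3) by blast
  qed
  let ?c1 = "For 0 Size (Put 0 (Var 0) (Const 0))"
  let ?c2 = "For 4 (Var 5) (Draw 2 ;; refine)"
  define I where "I k s' \<longleftrightarrow> (\<forall>v<n. arrs s' 0 v = leader a \<rho> (take k t) v) \<and> tape s' = drop k t" for k and s' :: loop_state
  have h1: "hoare ?c1 s (20 * n + 5) (\<lambda>s'. \<forall>v<n. arrs s' 0 v = 0)"
  proof (rule hoare_For_const[where T = 10 and I = "\<lambda>k s'. \<forall>u<k. arrs s' 0 u = 0"])
    fix k s' assume k: "k < n" and I: "\<forall>u<k. arrs s' 0 u = 0" and fr: "frame ?c1 s s'"
    show "hoare (Put 0 (Var 0) (Const 0)) (set_var 0 k s') 10 (\<lambda>s'. \<forall>u<Suc k. arrs s' 0 u = 0)"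
      using k I by (simp add: hoare_def envD env_frame[OF fr env] less_ok less_Suc_eq)
  qed (use env in \<open>simp_all add: envD less_ok\<close>)
  have h2: "hoare ?c2 s1 (5 + m * (200 * n + 30)) (I m)"
    if 0: "\<forall>v<n. arrs s1 0 v = 0" and fr1: "frame ?c1 s s1" for s1
  proof (rule hoare_For_const[where T = "200 * n + 22" and I = I and b = m])
    have env1: "env s1" by (rule env_frame[OF fr1 env])
    have v5: "vars s1 5 = m" "tape s1 = t" using fr1 m t unfolding frame_def by simp_all
    then show "aok (Var 5) s1" "aval (Var 5) s1 = m" using m(2) less_ok(8) by (simp_all add: envD env1)
    \<comment> \<open>Before any column is sampled there is one class, led by vertex 0; this is what
      the first loop stores.\<close>
    have "leader a \<rho> [] v = 0" for v using Least_eq_0[of "\<lambda>w. agree a [] (\<rho> w) (\<rho> v)"]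
      by (simp add: leader_def agree_def)
    then show "I 0 s1" using 0 v5 unfolding I_def by simp
    fix k s' assume k: "k < m" and I: "I k s'" and fr: "frame ?c2 s1 s'"
    have env': "env s'" by (rule env_frame[OF fr env1])
    have same: "arrs s' 2 = arrs s 2" using fr fr1 unfolding frame_def by (simp add: refine_def)
    have tape: "tape s' = drop k t" using I by (simp add: I_def)
    have kt: "k < length t" using k t(2) by simp
    have hd: "hd (drop k t) = t ! k" "drop k t \<noteq> []" "tl (drop k t) = drop (Suc k) t"
      using kt by (simp_all add: hd_drop_conv_nth tl_drop drop_Suc)
    show "hoare (Draw 2 ;; refine) (set_var 4 k s') (200 * n + 22) (I (Suc k))"
    proof (rule hoare_Seq[where U = "200 * n + 20"])
      let ?P = "\<lambda>s2. arrs s2 = arrs s' \<and> vars s2 2 = t ! k \<and> tape s2 = drop (Suc k) t"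
      show "hoare (Draw 2) (set_var 4 k s') 1 ?P"
        using tn[of k] k kt by (simp add: hoare_def tape hd envD env' less_ok)
      fix s2 assume s2: "?P s2" and fr2: "frame (Draw 2) (set_var 4 k s') s2"
      have env2: "env s2" using env_frame[OF fr2] env' by simp
      have "hoare refine s2 (200 * n + 20) (\<lambda>s3. (\<forall>v<n. arrs s3 0 v = leader a \<rho> (take k t @ [t ! k]) v) \<and> frame refine s2 s3)"
        using s2 I st same tn[of k] k \<rho>n
        by (intro hoare_frame refine_correct[OF env2]) (simp_all add: I_def stores_def)
      then show "hoare refine s2 (200 * n + 20) (I (Suc k))"
      proof (rule hoare_weaken)
        fix s3 assume "(\<forall>v<n. arrs s3 0 v = leader a \<rho> (take k t @ [t ! k]) v) \<and> frame refine s2 s3"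
        moreover from this have "tape s3 = tape s2" unfolding frame_def by (simp add: refine_def)
        ultimately show "I (Suc k) s3" using s2 kt unfolding I_def by (simp add: take_Suc_conv_app_nth)
      qed simp
    qed simp
  qed simp
  have h34: "hoare (Draw 3 ;; regroup) s2 (400 * n + 51) (\<lambda>s'. stores (new_rep n a \<rho> (take m t) (t ! m)) (merge_lists n a \<rho> (take m t) L) s' \<and> tape s' = drop (Suc m) t)"
    if I: "I m s2" and fr1: "frame ?c1 s s1" and fr2: "frame ?c2 s1 s2" for s1 s2
  proof (rule hoare_Seq[where U = "400 * n + 50"])
    have env2: "env s2" by (rule env_frame[OF fr2 env_frame[OF fr1 env]])
    have same: "arrs s2 2 = arrs s 2" "arrs s2 8 = arrs s 8" "arrs s2 9 = arrs s 9"
      using fr2 fr1 unfolding frame_def by (simp_all add: refine_def)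
    have tape: "tape s2 = drop m t" using I by (simp add: I_def)
    have mt: "m < length t" using t(2) by simp
    have hd: "hd (drop m t) = t ! m" "drop m t \<noteq> []" "tl (drop m t) = drop (Suc m) t"
      using mt by (simp_all add: hd_drop_conv_nth tl_drop drop_Suc)
    let ?P = "\<lambda>s3. arrs s3 = arrs s2 \<and> vars s3 3 = t ! m \<and> tape s3 = drop (Suc m) t"
    show "hoare (Draw 3) s2 1 ?P" using tn[of m] mt by (simp add: hoare_def tape hd envD env2 less_ok)
    fix s3 assume s3: "?P s3" and fr3: "frame (Draw 3) s2 s3"
    have env3: "env s3" by (rule env_frame[OF fr3 env2])
    have "stores \<rho> L s3" using st s3 same unfolding stores_def by simp
    then have "hoare regroup s3 (400 * n + 50) (\<lambda>s'. stores (new_rep n a \<rho> (take m t) (t ! m)) (merge_lists n a \<rho> (take m t) L) s' \<and> frame regroup s3 s')"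
      using s3 I tn[of m] by (intro hoare_frame regroup_correct[OF env3 _ \<rho> L]) (simp_all add: I_def)
    then show "hoare regroup s3 (400 * n + 50) (\<lambda>s'. stores (new_rep n a \<rho> (take m t) (t ! m)) (merge_lists n a \<rho> (take m t) L) s' \<and> tape s' = drop (Suc m) t)"
    proof (rule hoare_weaken)
      fix s' assume *: "stores (new_rep n a \<rho> (take m t) (t ! m)) (merge_lists n a \<rho> (take m t) L) s' \<and> frame regroup s3 s'"
      then have "tape s' = tape s3" unfolding frame_def by (simp add: regroup_def)
      then show "stores (new_rep n a \<rho> (take m t) (t ! m)) (merge_lists n a \<rho> (take m t) L) s' \<and> tape s' = drop (Suc m) t"
        using * s3 by simp
    qed simp
  qed simp
  show ?thesis unfolding cluster_def
  proof (rule hoare_Seq[OF h1])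
    fix s1 assume 1: "\<forall>v<n. arrs s1 0 v = 0" "frame ?c1 s s1"
    show "hoare (?c2 ;; Draw 3 ;; regroup) s1 (5 + m * (200 * n + 30) + (400 * n + 51))
      (\<lambda>s'. stores (new_rep n a \<rho> (take m t) (t ! m)) (merge_lists n a \<rho> (take m t) L) s' \<and> tape s' = drop (Suc m) t)"
      by (rule hoare_Seq[OF h2[OF 1]]) (use h34 1 in auto)
  qed (simp add: algebra_simps)
qed

end

text \<open>The loop performs one round more than there are levels, so the last sample is empty and
  everything is merged. The alternations of the resulting ordering are then counted outright, which
  takes quadratic time, so that the orderings of independent runs can be compared; array 11 keeps
  the best.\<close>

definition attempt :: com where
  "attempt = For 0 Size (Put 2 (Var 0) (Var 0) ;; Put 8 (Var 0) (Const 0) ;; Put 9 (Var 0) (Const 1)) ;;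
    Assign 5 Size ;;
    For 6 (Var 10 [+] Const 1) (cluster ;; Assign 5 (Var 5 [/] Const 2)) ;;
    For 0 Size (Put 10 (Get 8 (Var 0)) (Var 0)) ;;
    Assign 7 (Const 0) ;;
    For 2 Size (For 0 (Size [-] Const 1)
      (If (edist (Adj (Get 10 (Var 0)) (Var 2)) (Adj (Get 10 (Var 0 [+] Const 1)) (Var 2)))
        (Assign 7 (Var 7 [+] Const 1)) Skip)) ;;
    If (Var 8 [-] Var 7) (Assign 8 (Var 7) ;; For 0 Size (Put 11 (Var 0) (Get 10 (Var 0)))) Skip"

definition sample_sizes :: "nat \<Rightarrow> nat \<Rightarrow> nat list" where
  "sample_sizes n k = map (\<lambda>i. n div 2 ^ i) [0..<k]"

lemma sample_sizes_0 [simp]: "sample_sizes n 0 = []"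
  by (simp add: sample_sizes_def)

lemma sample_sizes_Suc: "sample_sizes n (Suc k) = sample_sizes n k @ [n div 2 ^ k]"
  by (simp add: sample_sizes_def)

lemma draws_append [simp]: "draws (ms @ ms') = draws ms + draws ms'"
  by (simp add: draws_def)

lemma draws_sample_sizes_mono: "i \<le> k \<Longrightarrow> draws (sample_sizes n i) \<le> draws (sample_sizes n k)"
  by (induction rule: dec_induct) (simp_all add: sample_sizes_Suc)

text \<open>The extra term \<open>2 * (n div 2 ^ k)\<close> makes the geometric bound inductive.
  That all samples of a clustering together have \<open>O(n)\<close> columns is what makes its time
  quadratic.\<close>

lemma sum_halves: "(\<Sum>i<k. n div 2 ^ i) + 2 * (n div 2 ^ k) \<le> 2 * (n::nat)"
proof (induction k)
  case (Suc k)
  have "2 * (n div 2 ^ Suc k) \<le> n div 2 ^ k"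
    by (simp only: power_Suc mult.commute[of 2] div_mult2_eq)
  then show ?case using Suc by simp
qed simp

lemma rounds_final_tape:
  "rounds n a ms (\<rho>, L, c, t) = (\<rho>', L', c', t') \<Longrightarrow> t' = drop (draws ms) t"
proof (induction ms arbitrary: \<rho> L c t)
  case (Cons m ms)
  from Cons.prems have "rounds n a ms (new_rep n a \<rho> (take m t) (t ! m), merge_lists n a \<rho> (take m t) L,
     c + round_cost n a \<rho> (new_rep n a \<rho> (take m t) (t ! m)), drop (Suc m) t) = (\<rho>', L', c', t')"
    by (simp add: cluster_round_apply)
  from Cons.IH[OF this] show ?case by (simp add: draws_def add.commute)
qed (simp add: draws_def)

lemma alternations_sum:
  "length l = n \<Longrightarrow> alternations b l = (\<Sum>j<n - 1. of_bool (b (l ! j) \<noteq> b (l ! Suc j)))"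
proof -
  assume "length l = n"
  then have "{j. Suc j < length l \<and> b (l ! j) \<noteq> b (l ! Suc j)} = {..<n - 1} \<inter> {j. b (l ! j) \<noteq> b (l ! Suc j)}" by auto
  then show ?thesis by (simp add: alternations_conv_nth of_bool_def sum.If_cases)
qed

definition crossings :: "nat \<Rightarrow> (nat \<Rightarrow> nat \<Rightarrow> bool) \<Rightarrow> nat list \<Rightarrow> nat" where
  "crossings n a ord = (\<Sum>x<n. alternations (\<lambda>v. a v x) ord)"

context graph_input
begin

text \<open>The value \<open>n * n + 1\<close> exceeds every possible number of alternations and
  stands for an ordering not yet found.\<close>

definition best_order :: "loop_state \<Rightarrow> bool" where
  "best_order s \<longleftrightarrow> vars s 8 \<le> n * n + 1 \<and> (vars s 8 \<le> n * n \<longrightarrow>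
     (\<exists>ord. distinct ord \<and> set ord = {..<n} \<and> (\<forall>j<n. arrs s 11 j = ord ! j) \<and> crossings n a ord = vars s 8))"

lemma attempt_init:
  assumes env: "env s"
  shows "hoare (For 0 Size (Put 2 (Var 0) (Var 0) ;; Put 8 (Var 0) (Const 0) ;; Put 9 (Var 0) (Const 1))) s
    (40 * n + 5) (stores (\<lambda>v. v) (\<lambda>v. [v]))" (is "hoare ?c _ _ _")
proof (rule hoare_weaken[OF hoare_For_const[where T = 30 and b = n and T' = "40 * n + 5" and
      I = "\<lambda>k s'. \<forall>u<k. arrs s' 2 u = u \<and> arrs s' 8 u = 0 \<and> arrs s' 9 u = 1"]])
  fix k s' assume k: "k < n" and I: "\<forall>u<k. arrs s' 2 u = u \<and> arrs s' 8 u = 0 \<and> arrs s' 9 u = 1" and fr: "frame ?c s s'"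
  show "hoare (Put 2 (Var 0) (Var 0) ;; Put 8 (Var 0) (Const 0) ;; Put 9 (Var 0) (Const 1)) (set_var 0 k s') 30
      (\<lambda>s'. \<forall>u<Suc k. arrs s' 2 u = u \<and> arrs s' 8 u = 0 \<and> arrs s' 9 u = 1)"
    using k I by (simp add: hoare_def envD env_frame[OF fr env] less_ok less_ok3 less_Suc_eq)
qed (use env in \<open>simp_all add: envD less_ok stores_def active_def\<close>)

abbreviation "rounds_body \<equiv> cluster ;; Assign 5 (Var 5 [/] Const 2)"

definition after_rounds where
  "after_rounds t i s \<longleftrightarrow> (\<forall>\<rho> L c t'. rounds n a (sample_sizes n i) (start t) = (\<rho>, L, c, t') \<longrightarrow>
     stores \<rho> L s \<and> tape s = t' \<and> vars s 5 = n div 2 ^ i)"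

lemma attempt_rounds:
  assumes env: "env s" and st: "stores (\<lambda>v. v) (\<lambda>v. [v]) s" and v5: "vars s 5 = n"
    and lg: "vars s 10 = lg" "lg \<le> n"
    and t: "tape s = t" "draws (sample_sizes n (Suc lg)) \<le> length t" "set t \<subseteq> {..<n}"
  shows "hoare (For 6 (Var 10 [+] Const 1) rounds_body) s (2000 * (n + 1) * (n + 1)) (after_rounds t (Suc lg))"
proof (rule hoare_For[where T = "\<lambda>i. 500 * (n + 1) * (n div 2 ^ i + 1) + 7" and I = "after_rounds t" and b = "Suc lg"])
  have "Suc lg \<le> M" using lg(2) M by linarith
  then show "aok (Var 10 [+] Const 1) s" "aval (Var 10 [+] Const 1) s = Suc lg"
    using lg by (simp_all add: envD env less_ok)
  show "after_rounds t 0 s" unfolding after_rounds_def using st v5 t by simp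
next
  fix i s' assume i: "i < Suc lg" and I: "after_rounds t i s'" and fr: "frame (For 6 (Var 10 [+] Const 1) rounds_body) s s'"
  obtain \<rho> L c t' where r: "rounds n a (sample_sizes n i) (start t) = (\<rho>, L, c, t')" by (metis prod_cases4)
  have inv: "retraction n \<rho>" "cluster_lists n \<rho> L" using rounds_invariant[OF r start_invariant] by auto
  have t': "t' = drop (draws (sample_sizes n i)) t" by (rule rounds_final_tape[OF r])
  let ?m = "n div 2 ^ i"
  have "draws (sample_sizes n i) + Suc ?m \<le> draws (sample_sizes n (Suc lg))"
    using draws_sample_sizes_mono[of "Suc i" "Suc lg" n] i by (simp add: sample_sizes_Suc draws_def)
  then have len: "Suc ?m \<le> length t'" using t(2) unfolding t' by simp
  have set: "set t' \<subseteq> {..<n}" using t(3) set_drop_subset unfolding t' by fast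
  have env': "env s'" by (rule env_frame[OF fr env])
  have st': "stores \<rho> L s'" "tape s' = t'" "vars s' 5 = ?m" using I r unfolding after_rounds_def by auto
  have cl: "hoare cluster (set_var 6 i s') (500 * (n + 1) * (?m + 1))
      (\<lambda>s'. stores (new_rep n a \<rho> (take ?m t') (t' ! ?m)) (merge_lists n a \<rho> (take ?m t') L) s' \<and> tape s' = drop (Suc ?m) t')"
    using st' env' len set by (intro cluster_correct inv) (simp_all add: stores_def)
  show "hoare rounds_body (set_var 6 i s') (500 * (n + 1) * (?m + 1) + 7) (after_rounds t (Suc i))"
  proof (rule hoare_Seq[OF cl, where U = 7])
    fix s2 assume *: "stores (new_rep n a \<rho> (take ?m t') (t' ! ?m)) (merge_lists n a \<rho> (take ?m t') L) s2 \<and> tape s2 = drop (Suc ?m) t'"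
      and fr2: "frame cluster (set_var 6 i s') s2"
    have env2: "env s2" using env_frame[OF fr2] env' by simp
    have v2: "vars s2 5 = ?m" using fr2 st'(3) unfolding frame_def by (simp add: cluster_def refine_def regroup_def)
    have half: "?m div 2 = n div 2 ^ Suc i" by (simp add: div_mult2_eq[symmetric] mult.commute)
    have "after_rounds t (Suc i) (set_var 5 (?m div 2) s2)"
      using * r unfolding after_rounds_def sample_sizes_Suc half by (simp add: cluster_round_apply stores_def)
    moreover have "?m \<le> M" "?m div 2 \<le> M" "2 \<le> M" using M n by (auto intro!: word_ok order_trans[OF div_le_dividend])
    ultimately show "hoare (Assign 5 (Var 5 [/] Const 2)) s2 7 (after_rounds t (Suc i))"
      by (simp add: hoare_def v2 envD env2)
  qed simp
next
  \<comment> \<open>Round \<open>i\<close> takes time proportional to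
    \<open>(n + 1) * (n div 2 ^ i + 1)\<close>: the halves sum up to at most \<open>2 * n\<close>,
    the ones to \<open>Suc lg \<le> n + 1\<close>.\<close>
  have "(\<Sum>i<Suc lg. 500 * (n + 1) * (n div 2 ^ i + 1) + 7 + 7) =
      500 * (n + 1) * ((\<Sum>i<Suc lg. n div 2 ^ i) + Suc lg) + 14 * Suc lg"
    by (simp only: sum.distrib sum_distrib_left[symmetric]) (simp add: algebra_simps)
  also have "\<dots> \<le> 500 * (n + 1) * (2 * n + (n + 1)) + 14 * (n + 1)"
    using sum_halves[of n "Suc lg"] lg(2) by (intro add_mono mult_le_mono) auto
  finally show "alen (Var 10 [+] Const 1) + 3 + (\<Sum>i<Suc lg. 500 * (n + 1) * (n div 2 ^ i + 1) + 7 + 7) \<le> 2000 * (n + 1) * (n + 1)"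
    using n by (simp add: algebra_simps)
qed

lemma attempt_order:
  assumes env: "env s" and ord: "length ord = n" "set ord = {..<n}" "\<And>j. j < n \<Longrightarrow> arrs s 8 (ord ! j) = j"
  shows "hoare (For 0 Size (Put 10 (Get 8 (Var 0)) (Var 0))) s (30 * n + 5) (\<lambda>s'. \<forall>j<n. arrs s' 10 j = ord ! j)"
    (is "hoare ?c _ _ _")
proof (rule hoare_weaken[OF hoare_For_const[where T = 20 and b = n and T' = "30 * n + 5" and
      I = "\<lambda>k s'. \<forall>v<k. arrs s' 10 (arrs s 8 v) = v"]])
  have pos: "arrs s 8 v < n" "ord ! arrs s 8 v = v" if v: "v < n" for v
  proof -
    have "v \<in> set ord" using v ord(2) by simp
    then obtain j where "j < n" "ord ! j = v" unfolding in_set_conv_nth ord(1) by blast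
    then show "arrs s 8 v < n" "ord ! arrs s 8 v = v" using ord(3)[of j] by simp_all
  qed
  fix k s' assume k: "k < n" and I: "\<forall>v<k. arrs s' 10 (arrs s 8 v) = v" and fr: "frame ?c s s'"
  have same: "arrs s' 8 = arrs s 8" using fr unfolding frame_def by simp
  have neq: "arrs s 8 v \<noteq> arrs s 8 k" if "v < k" for v
    using pos(2)[of v] pos(2)[OF k] that k by fastforce
  then have "\<forall>v<Suc k. ((arrs s' 10)(arrs s 8 k := k)) (arrs s 8 v) = v" using I by (simp add: less_Suc_eq)
  then show "hoare (Put 10 (Get 8 (Var 0)) (Var 0)) (set_var 0 k s') 20 (\<lambda>s'. \<forall>v<Suc k. arrs s' 10 (arrs s 8 v) = v)"
    using k pos(1)[OF k] by (simp add: hoare_def envD env_frame[OF fr env] less_ok less_ok3 same)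
next
  fix s' assume *: "\<forall>v<n. arrs s' 10 (arrs s 8 v) = v"
  show "\<forall>j<n. arrs s' 10 j = ord ! j"
  proof (intro allI impI)
    fix j assume j: "j < n"
    then have "ord ! j \<in> set ord" using ord(1) by simp
    then have "arrs s' 10 (arrs s 8 (ord ! j)) = ord ! j" using * ord(2) by blast
    then show "arrs s' 10 j = ord ! j" unfolding ord(3)[OF j] .
  qed
qed (use env in \<open>simp_all add: envD less_ok\<close>)

lemma attempt_count:
  assumes env: "env s" and ord: "length ord = n" "set ord = {..<n}" "\<forall>j<n. arrs s 10 j = ord ! j" and v7: "vars s 7 = 0"
  shows "hoare (For 2 Size (For 0 (Size [-] Const 1)
      (If (edist (Adj (Get 10 (Var 0)) (Var 2)) (Adj (Get 10 (Var 0 [+] Const 1)) (Var 2)))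
        (Assign 7 (Var 7 [+] Const 1)) Skip))) s (100 * (n + 1) * (n + 1)) (\<lambda>s'. vars s' 7 = crossings n a ord)"
proof -
  let ?b = "If (edist (Adj (Get 10 (Var 0)) (Var 2)) (Adj (Get 10 (Var 0 [+] Const 1)) (Var 2)))
        (Assign 7 (Var 7 [+] Const 1)) Skip"
  let ?in = "For 0 (Size [-] Const 1) ?b"
  let ?f = "\<lambda>x j. of_bool (a (ord ! j) x \<noteq> a (ord ! Suc j) x) :: nat"
  have sum_le: "(\<Sum>j<k. ?f x j) \<le> k" for x k
    using sum_bounded_above[of "{..<k}" "?f x" 1] by simp
  have ordn: "ord ! j < n" if "j < n" for j using ord(1,2) that nth_mem[of j ord] by simp
  show ?thesis
  proof (rule hoare_weaken[OF hoare_For_const[where T = "80 * n + 10" and b = n and T' = "100 * (n + 1) * (n + 1)"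
        and I = "\<lambda>k s'. vars s' 7 = (\<Sum>x<k. \<Sum>j<n - 1. ?f x j)"]])
    fix x s' assume x: "x < n" and I: "vars s' 7 = (\<Sum>x<x. \<Sum>j<n - 1. ?f x j)" and fr: "frame (For 2 Size ?in) s s'"
    have env': "env s'" by (rule env_frame[OF fr env])
    have A: "vars s' 7 \<le> n * n"
    proof -
      have "vars s' 7 \<le> (\<Sum>x<x. n)" unfolding I by (intro sum_mono order_trans[OF sum_le]) simp
      also have "\<dots> \<le> n * n" using x by simp
      finally show ?thesis .
    qed
    show "hoare ?in (set_var 2 x s') (80 * n + 10) (\<lambda>s'. vars s' 7 = (\<Sum>x<Suc x. \<Sum>j<n - 1. ?f x j))"
    proof (rule hoare_weaken[OF hoare_For_const[where T = 70 and b = "n - 1" and T' = "80 * n + 10"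
          and I = "\<lambda>k s''. vars s'' 7 = vars s' 7 + (\<Sum>j<k. ?f x j)"]])
      show "aok (Size [-] Const 1) (set_var 2 x s')" "aval (Size [-] Const 1) (set_var 2 x s') = n - 1"
        using order_trans[OF diff_le_self less_ok(8), of "Suc 0"] by (simp_all add: envD env' less_ok)
    next
      fix k s'' assume k: "k < n - 1" and I2: "vars s'' 7 = vars s' 7 + (\<Sum>j<k. ?f x j)"
        and fr2: "frame ?in (set_var 2 x s') s''"
      have env'': "env s''" using env_frame[OF fr2] env' by simp
      have same: "vars s'' 2 = x" "arrs s'' 10 = arrs s 10" using fr2 fr unfolding frame_def by simp_all
      have k': "k < n" "Suc k < n" using k by auto
      have "vars s'' 7 \<le> n * n + n" using A sum_le[of x k] k' I2 by linarith
      then have bnd: "vars s'' 7 \<le> M" "Suc (vars s'' 7) \<le> M" by (intro word_ok; linarith)+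
      have v10: "arrs s 10 k = ord ! k" "arrs s 10 (Suc k) = ord ! Suc k" using ord(3) k' by auto
      show "hoare ?b (set_var 0 k s'') 70 (\<lambda>s''. vars s'' 7 = vars s' 7 + (\<Sum>j<Suc k. ?f x j))"
        using k' x ordn[OF k'(1)] ordn[OF k'(2)] bnd I2
        by (cases "a (ord ! k) x = a (ord ! Suc k) x")
          (simp_all add: hoare_def envD env'' less_ok less_ok3 less_ok3[of "Suc k", simplified] same v10)
    qed (use I in simp_all)
  next
    fix s' assume "vars s' 7 = (\<Sum>x<n. \<Sum>j<n - 1. ?f x j)"
    then show "vars s' 7 = crossings n a ord" unfolding crossings_def by (simp add: alternations_sum[OF ord(1)])
  qed (use env v7 in \<open>simp_all add: envD less_ok algebra_simps\<close>)
qed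

lemma crossings_le:
  assumes "length ord = n"
  shows "crossings n a ord \<le> n * n"
proof -
  have "crossings n a ord \<le> (\<Sum>x<n. n)"
    unfolding crossings_def
  proof (intro sum_mono)
    fix x
    have "alternations (\<lambda>v. a v x) ord \<le> (\<Sum>j<n - 1. 1)"
      unfolding alternations_sum[OF assms] by (intro sum_mono) simp
    then show "alternations (\<lambda>v. a v x) ord \<le> n" by simp
  qed
  then show ?thesis by simp
qed

lemma attempt_best:
  assumes env: "env s" and ord: "length ord = n" "set ord = {..<n}" "\<forall>j<n. arrs s 10 j = ord ! j"
    and v7: "vars s 7 = crossings n a ord" and best: "best_order s"
  shows "hoare (If (Var 8 [-] Var 7) (Assign 8 (Var 7) ;; For 0 Size (Put 11 (Var 0) (Get 10 (Var 0)))) Skip) s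
    (30 * n + 30) (\<lambda>s'. best_order s' \<and> vars s' 8 \<le> vars s 8 \<and> vars s' 8 \<le> crossings n a ord)"
proof (rule hoare_If[where U = "30 * n + 20"])
  let ?c = "For 0 Size (Put 11 (Var 0) (Get 10 (Var 0)))"
  have A: "crossings n a ord \<le> n * n" by (rule crossings_le[OF ord(1)])
  have "vars s 8 \<le> n * n + 1" using best by (simp add: best_order_def)
  then have bnd: "vars s 8 \<le> M" "vars s 7 \<le> M" "vars s 8 - vars s 7 \<le> M"
    using A v7 by (intro word_ok; linarith)+
  then show "aok (Var 8 [-] Var 7) s" by (simp add: envD env)
  have ordn: "ord ! j < n" if "j < n" for j using ord(1,2) that nth_mem[of j ord] by simp
  show "hoare (Assign 8 (Var 7) ;; ?c) s (30 * n + 20) (\<lambda>s'. best_order s' \<and> vars s' 8 \<le> vars s 8 \<and> vars s' 8 \<le> crossings n a ord)"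
    if "aval (Var 8 [-] Var 7) s \<noteq> 0"
  proof (rule hoare_Seq[where V = 4 and R = "\<lambda>s1. s1 = set_var 8 (vars s 7) s" and U = "30 * n + 5"])
    show "hoare (Assign 8 (Var 7)) s 4 (\<lambda>s1. s1 = set_var 8 (vars s 7) s)" using bnd by (simp add: hoare_def envD env)
    fix s1 assume s1: "s1 = set_var 8 (vars s 7) s"
    then have env1: "env s1" using env by simp
    have "hoare ?c s1 (30 * n + 5) (\<lambda>s'. (\<forall>j<n. arrs s' 11 j = ord ! j) \<and> frame ?c s1 s')"
    proof (rule hoare_frame, rule hoare_For_const[where T = 20 and b = n and I = "\<lambda>k s'. \<forall>j<k. arrs s' 11 j = ord ! j"])
      fix k s' assume k: "k < n" and I: "\<forall>j<k. arrs s' 11 j = ord ! j" and fr: "frame ?c s1 s'"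
      have "arrs s' 10 k = ord ! k" using fr k ord(3) s1 unfolding frame_def by simp
      then show "hoare (Put 11 (Var 0) (Get 10 (Var 0))) (set_var 0 k s') 20 (\<lambda>s'. \<forall>j<Suc k. arrs s' 11 j = ord ! j)"
        using k I ordn[OF k] by (simp add: hoare_def envD env_frame[OF fr env1] less_ok less_ok3 less_Suc_eq)
    qed (use env1 in \<open>simp_all add: envD less_ok\<close>)
    then show "hoare ?c s1 (30 * n + 5) (\<lambda>s'. best_order s' \<and> vars s' 8 \<le> vars s 8 \<and> vars s' 8 \<le> crossings n a ord)"
    proof (rule hoare_weaken)
      fix s' assume *: "(\<forall>j<n. arrs s' 11 j = ord ! j) \<and> frame ?c s1 s'"
      then have v8: "vars s' 8 = crossings n a ord" using s1 v7 unfolding frame_def by simp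
      have dist: "distinct ord" using ord(1,2) by (metis card_distinct card_lessThan)
      have "best_order s'" unfolding best_order_def v8 using * ord A dist by auto
      then show "best_order s' \<and> vars s' 8 \<le> vars s 8 \<and> vars s' 8 \<le> crossings n a ord"
        using that v7 v8 by simp
    qed simp
  qed simp
  show "hoare Skip s (30 * n + 20) (\<lambda>s'. best_order s' \<and> vars s' 8 \<le> vars s 8 \<and> vars s' 8 \<le> crossings n a ord)"
    if "aval (Var 8 [-] Var 7) s = 0"
    using that best v7 by (simp add: hoare_def)
qed simp

lemma attempt_correct:
  assumes env: "env s" and lg: "vars s 10 = lg" "lg \<le> n" "n < 2 ^ lg" and best: "best_order s"
    and t: "tape s = t" "draws (sample_sizes n (Suc lg)) \<le> length t" "set t \<subseteq> {..<n}"
  shows "hoare attempt s (3000 * (n + 1) * (n + 1)) (\<lambda>s'. best_order s' \<and> vars s' 8 \<le> vars s 8 \<and>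
    vars s' 8 \<le> n * n \<and> vars s' 8 \<le> 2 * cost_of (rounds n a (sample_sizes n (Suc lg)) (start t)) \<and>
    tape s' = drop (draws (sample_sizes n (Suc lg))) t)" (is "hoare _ _ _ ?Q")
proof -
  let ?c1 = "For 0 Size (Put 2 (Var 0) (Var 0) ;; Put 8 (Var 0) (Const 0) ;; Put 9 (Var 0) (Const 1))"
  let ?c3 = "For 6 (Var 10 [+] Const 1) rounds_body"
  let ?c4 = "For 0 Size (Put 10 (Get 8 (Var 0)) (Var 0))"
  let ?c6 = "For 2 Size (For 0 (Size [-] Const 1)
      (If (edist (Adj (Get 10 (Var 0)) (Var 2)) (Adj (Get 10 (Var 0 [+] Const 1)) (Var 2)))
        (Assign 7 (Var 7 [+] Const 1)) Skip))"
  let ?c7 = "If (Var 8 [-] Var 7) (Assign 8 (Var 7) ;; For 0 Size (Put 11 (Var 0) (Get 10 (Var 0)))) Skip"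
  let ?ms = "sample_sizes n (Suc lg)"
  obtain \<rho> L c t' where r: "rounds n a ?ms (start t) = (\<rho>, L, c, t')" by (metis prod_cases4)
  have t': "t' = drop (draws ?ms) t" by (rule rounds_final_tape[OF r])
  \<comment> \<open>\<open>n < 2 ^ lg\<close> makes the last sample empty, as
    \<open>rounds_order\<close> requires.\<close>
  have ms: "?ms = sample_sizes n lg @ [0]" using lg(3) by (simp add: sample_sizes_Suc)
  define ord where "ord = L (\<rho> 0)"
  note o = rounds_order[OF r[unfolded ms] n, folded ord_def]
  have len: "length ord = n" using distinct_card[OF o(1)] o(2) by simp
  have cross: "crossings n a ord \<le> 2 * c" using o(4) by (simp add: crossings_def)
  have act: "\<rho> 0 \<in> active n \<rho>"
    using rounds_invariant[OF r start_invariant] n by (simp add: active_def retraction_def)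
  note sub = cluster_def refine_def regroup_def
  show ?thesis unfolding attempt_def
  proof (rule hoare_Seq[OF attempt_init[OF env]])
    fix s1 assume 1: "stores (\<lambda>v. v) (\<lambda>v. [v]) s1" and fr1: "frame ?c1 s s1"
    have env1: "env s1" by (rule env_frame[OF fr1 env])
    have v1: "vars s1 10 = lg" "tape s1 = t" "vars s1 8 = vars s 8" "arrs s1 11 = arrs s 11"
      using fr1 lg t unfolding frame_def by simp_all
    show "hoare (Assign 5 Size ;; ?c3 ;; ?c4 ;; Assign 7 (Const 0) ;; ?c6 ;; ?c7) s1 (2400 * (n + 1) * (n + 1)) ?Q"
    proof (rule hoare_Seq[where V = 4 and R = "\<lambda>s2. s2 = set_var 5 n s1"])
      show "hoare (Assign 5 Size) s1 4 (\<lambda>s2. s2 = set_var 5 n s1)" by (simp add: hoare_def envD env1 less_ok)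
      fix s2 assume s2: "s2 = set_var 5 n s1"
      have env2: "env s2" using env1 s2 by simp
      have "hoare ?c3 s2 (2000 * (n + 1) * (n + 1)) (after_rounds t (Suc lg))"
        using 1 v1 s2 lg t by (intro attempt_rounds[OF env2]) (simp_all add: stores_def)
      then show "hoare (?c3 ;; ?c4 ;; Assign 7 (Const 0) ;; ?c6 ;; ?c7) s2 (2300 * (n + 1) * (n + 1)) ?Q"
      proof (rule hoare_Seq)
        fix s3 assume 3: "after_rounds t (Suc lg) s3" and fr3: "frame ?c3 s2 s3"
        have env3: "env s3" by (rule env_frame[OF fr3 env2])
        have v3: "vars s3 8 = vars s 8" "arrs s3 11 = arrs s 11"
          using fr3 s2 v1 unfolding frame_def by (simp_all add: sub)
        have st3: "stores \<rho> L s3" "tape s3 = t'" using 3 r unfolding after_rounds_def by auto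
        have pos: "arrs s3 8 (ord ! j) = j" if "j < n" for j
        proof -
          have "j < length (L (\<rho> 0))" using that len unfolding ord_def by simp
          then show ?thesis using st3(1) act unfolding stores_def ord_def by blast
        qed
        show "hoare (?c4 ;; Assign 7 (Const 0) ;; ?c6 ;; ?c7) s3 (200 * (n + 1) * (n + 1)) ?Q"
        proof (rule hoare_Seq[OF attempt_order[OF env3 len o(2) pos]])
          fix s4 assume 4: "\<forall>j<n. arrs s4 10 j = ord ! j" and fr4: "frame ?c4 s3 s4"
          have env4: "env s4" by (rule env_frame[OF fr4 env3])
          have v4: "vars s4 8 = vars s 8" "arrs s4 11 = arrs s 11" "tape s4 = t'"
            using fr4 v3 st3 unfolding frame_def by simp_all
          show "hoare (Assign 7 (Const 0) ;; ?c6 ;; ?c7) s4 (160 * (n + 1) * (n + 1)) ?Q"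
          proof (rule hoare_Seq[where V = 3 and R = "\<lambda>s5. s5 = set_var 7 0 s4"])
            show "hoare (Assign 7 (Const 0)) s4 3 (\<lambda>s5. s5 = set_var 7 0 s4)" by (simp add: hoare_def envD env4 less_ok)
            fix s5 assume s5: "s5 = set_var 7 0 s4"
            have env5: "env s5" using env4 s5 by simp
            show "hoare (?c6 ;; ?c7) s5 (150 * (n + 1) * (n + 1)) ?Q"
            proof (rule hoare_Seq[OF attempt_count[OF env5 len o(2)]])
              fix s6 assume 6: "vars s6 7 = crossings n a ord" and fr6: "frame ?c6 s5 s6"
              have env6: "env s6" by (rule env_frame[OF fr6 env5])
              have v6: "vars s6 8 = vars s 8" "arrs s6 11 = arrs s 11" "tape s6 = t'" "arrs s6 10 = arrs s4 10"
                using fr6 s5 v4 unfolding frame_def by simp_all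
              have "best_order s6" using best v6 unfolding best_order_def by simp
              then have "hoare ?c7 s6 (30 * n + 30) (\<lambda>s'. (best_order s' \<and> vars s' 8 \<le> vars s6 8 \<and> vars s' 8 \<le> crossings n a ord) \<and> frame ?c7 s6 s')"
                using 4 v6 6 by (intro hoare_frame attempt_best[OF env6 len o(2)]) simp_all
              then show "hoare ?c7 s6 (30 * n + 30) ?Q"
              proof (rule hoare_weaken)
                fix s' assume *: "(best_order s' \<and> vars s' 8 \<le> vars s6 8 \<and> vars s' 8 \<le> crossings n a ord) \<and> frame ?c7 s6 s'"
                then have "tape s' = t'" using v6 unfolding frame_def by simp
                moreover have "vars s' 8 \<le> n * n" using * crossings_le[OF len] by linarith
                moreover have "vars s' 8 \<le> 2 * cost_of (rounds n a ?ms (start t))"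
                  using * cross unfolding r by simp
                ultimately show "?Q s'" using * v6 t' by simp
              qed simp
            qed (use 4 s5 in \<open>simp_all add: algebra_simps\<close>)
          qed (simp add: algebra_simps)
        qed (simp_all add: algebra_simps)
      qed (simp add: algebra_simps)
    qed (simp add: algebra_simps)
  qed (simp add: algebra_simps)
qed

end

section \<open>From the best ordering to the printed decomposition\<close>

section \<open>The complete program\<close>

text \<open>Loops have a bound fixed on entry, so the doubling is offered \<open>n\<close> times and
  takes place while \<open>2 ^ k \<le> n\<close>. Variable 8 starts above every possible number of
  alternations.\<close>

definition setup_size :: com where
  "setup_size = Assign 10 (Const 0) ;; Assign 11 (Const 1) ;;
    For 0 Size (If (Size [+] Const 1 [-] Var 11)
      (Assign 11 (Var 11 [*] Const 2) ;; Assign 10 (Var 10 [+] Const 1)) Skip) ;;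
    Assign 8 (Size [*] Size [+] Const 1)"

text \<open>Row-major addressing; the row length \<open>2 ^ k\<close> stays fixed while the current
  part of the rows shrinks from level to level.\<close>

definition cell :: "aexp \<Rightarrow> aexp" where
  "cell e = Var 0 [*] Var 11 [+] e"

text \<open>The product of truncated differences is nonzero exactly for positions after that of the
  vertex and below \<open>n\<close>. This orients the edges and also keeps \<open>Adj\<close> away
  from the padding.\<close>

definition setup_blocks :: com where
  "setup_blocks = For 0 Size (Put 12 (Get 11 (Var 0)) (Var 0)) ;;
    For 0 Size (For 17 (Var 11) (If ((Size [-] Var 17) [*] (Var 17 [-] Get 12 (Var 0)))
      (Put 13 (cell (Var 17)) (Adj (Var 0) (Get 11 (Var 17)))) (Put 13 (cell (Var 17)) (Const 0)))) ;;
    Assign 12 (Var 11) ;; Assign 13 (Const 1)"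

text \<open>One pass over the vertices per block; with at most \<open>2 ^ k \<le> 2 * n\<close>
  blocks on a level, the time per level is quadratic.\<close>

definition collect_users :: com where
  "collect_users = Assign 16 (Const 0) ;;
    For 0 Size (If (Get 13 (cell (Var 15)) [*] (Const 1 [-] Get 13 (cell (Var 15 [+] Const 1 [-] Const 2 [*] (Var 15 [%] Const 2)))))
      (Put 14 (Var 16) (Var 0) ;; Assign 16 (Var 16 [+] Const 1)) Skip)"

definition emit_block :: com where
  "emit_block = If (Var 16) (Emit (Var 13) ;; Emit (Var 16) ;;
      For 17 (Var 13) (Emit (Get 11 (Var 15 [*] Var 13 [+] Var 17))) ;; For 17 (Var 16) (Emit (Get 14 (Var 17)))) Skip"

text \<open>Works in place: cell \<open>i\<close> of a row is overwritten only after cells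
  \<open>2 * i\<close> and \<open>2 * i + 1\<close> have been read, and later steps read from
  \<open>2 * i + 2\<close> on.\<close>

definition halve_blocks :: com where
  "halve_blocks = For 0 Size (For 15 (Var 12) (Put 13 (cell (Var 15))
     (Get 13 (cell (Const 2 [*] Var 15)) [*] Get 13 (cell (Const 2 [*] Var 15 [+] Const 1)))))"

definition emit_level :: com where
  "emit_level = For 15 (Var 12) (collect_users ;; emit_block) ;; Assign 12 (Var 12 [/] Const 2) ;;
    halve_blocks ;; Assign 13 (Var 13 [*] Const 2)"

definition main :: com where
  "main = setup_size ;; For 9 (Var 10) attempt ;; setup_blocks ;; For 14 (Var 10) emit_level"

lemma cell_inj: "q < N \<Longrightarrow> q' < N \<Longrightarrow> v * N + q = v' * N + q' \<longleftrightarrow> v = v' \<and> q = (q'::nat)"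
proof -
  assume q: "q < N" "q' < N"
  have "v = v'" if "v * N + q = v' * N + q'"
  proof -
    have "v = (v * N + q) div N" using q(1) by simp
    also have "\<dots> = v'" unfolding that using q(2) by simp
    finally show ?thesis .
  qed
  then show ?thesis by auto
qed

lemma sibling_less: "q < 2 ^ k \<Longrightarrow> 0 < k \<Longrightarrow> sibling q < 2 ^ k"
proof -
  assume q: "q < 2 ^ k" and "0 < k"
  then obtain j where k: "k = Suc j" by (cases k) auto
  have "sibling q div 2 = q div 2" using sibling_div_2[of q "sibling q"] by simp
  moreover have "q div 2 < 2 ^ j" using q unfolding k by (intro less_mult_imp_div_less) simp
  ultimately have "sibling q div 2 < 2 ^ j" by simp
  then show ?thesis unfolding k by simp
qed

context graph_input
begin

lemma setup_size_correct:
  assumes env: "env s"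
  shows "hoare setup_size s (40 * n + 40) (\<lambda>s'. \<exists>k. vars s' 10 = k \<and> vars s' 11 = 2 ^ k \<and> n < 2 ^ k \<and> 2 ^ k \<le> 2 * n \<and> k \<le> n \<and>
    vars s' 8 = n * n + 1)"
proof -
  let ?b = "If (Size [+] Const 1 [-] Var 11) (Assign 11 (Var 11 [*] Const 2) ;; Assign 10 (Var 10 [+] Const 1)) Skip"
  define I where "I i s' \<longleftrightarrow> (\<exists>k. vars s' 10 = k \<and> vars s' 11 = 2 ^ k \<and> k \<le> i \<and> 2 ^ k \<le> 2 * n \<and> (n < 2 ^ k \<or> k = i))"
    for i and s' :: loop_state
  have loop: "hoare (For 0 Size ?b) s1 (30 * n + 5) (I n)" if 1: "vars s1 10 = 0" "vars s1 11 = 1" "env s1" for s1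
  proof (rule hoare_For_const[where T = 22 and I = I and b = n])
    show "I 0 s1" unfolding I_def using 1 n by simp
    fix i s' assume i: "i < n" and I: "I i s'" and fr: "frame (For 0 Size ?b) s1 s'"
    have env': "env s'" by (rule env_frame[OF fr 1(3)])
    obtain k where k: "vars s' 10 = k" "vars s' 11 = 2 ^ k" "k \<le> i" "2 ^ k \<le> 2 * n" "n < 2 ^ k \<or> k = i"
      using I unfolding I_def by blast
    show "hoare ?b (set_var 0 i s') 22 (I (Suc i))"
    proof (cases "2 ^ k \<le> n")
      case True
      then have "I (Suc i) (set_var 10 (Suc k) (set_var 11 (2 ^ k * 2) (set_var 0 i s')))"
        using k unfolding I_def by auto
      moreover have "2 ^ k \<le> M" "2 ^ k * 2 \<le> M" "k \<le> M" "Suc k \<le> M" "2 \<le> M" "Suc n \<le> M" "Suc n - 2 ^ k \<le> M"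
        using True k(3) i M by linarith+
      ultimately show ?thesis using True by (simp add: hoare_def envD env' less_ok k mult.commute)
    next
      case False
      then have "I (Suc i) (set_var 0 i s')" using k unfolding I_def by auto
      moreover have "2 ^ k \<le> M" "Suc n \<le> M" using k(4) M by linarith+
      ultimately show ?thesis using False by (simp add: hoare_def envD env' less_ok k)
    qed
  qed (use 1 in \<open>simp_all add: envD less_ok\<close>)
  show ?thesis unfolding setup_size_def
  proof (rule hoare_Seq[where V = 3 and R = "\<lambda>s1. s1 = set_var 10 0 s"])
    show "hoare (Assign 10 (Const 0)) s 3 (\<lambda>s1. s1 = set_var 10 0 s)" by (simp add: hoare_def envD env less_ok)
    fix s1 assume s1: "s1 = set_var 10 0 s"
    show "hoare (Assign 11 (Const 1) ;; For 0 Size ?b ;; Assign 8 (Size [*] Size [+] Const 1)) s1 (40 * n + 30)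
      (\<lambda>s'. \<exists>k. vars s' 10 = k \<and> vars s' 11 = 2 ^ k \<and> n < 2 ^ k \<and> 2 ^ k \<le> 2 * n \<and> k \<le> n \<and> vars s' 8 = n * n + 1)"
    proof (rule hoare_Seq[where V = 3 and R = "\<lambda>s2. s2 = set_var 11 1 s1"])
      show "hoare (Assign 11 (Const 1)) s1 3 (\<lambda>s2. s2 = set_var 11 1 s1)" using env s1 by (simp add: hoare_def envD less_ok)
      fix s2 assume s2: "s2 = set_var 11 1 s1"
      show "hoare (For 0 Size ?b ;; Assign 8 (Size [*] Size [+] Const 1)) s2 (40 * n + 20)
        (\<lambda>s'. \<exists>k. vars s' 10 = k \<and> vars s' 11 = 2 ^ k \<and> n < 2 ^ k \<and> 2 ^ k \<le> 2 * n \<and> k \<le> n \<and> vars s' 8 = n * n + 1)"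
      proof (rule hoare_Seq[OF loop, where U = 10])
        fix s3 assume I: "I n s3" and fr: "frame (For 0 Size ?b) s2 s3"
        have env3: "env s3" using env_frame[OF fr] env s1 s2 by simp
        \<comment> \<open>If the doubling took place in every iteration, then \<open>k = n\<close>,
          and \<open>n < 2 ^ k\<close> holds all the same.\<close>
        have "n < 2 ^ n" by (rule less_exp)
        then have "\<exists>k. vars s3 10 = k \<and> vars s3 11 = 2 ^ k \<and> n < 2 ^ k \<and> 2 ^ k \<le> 2 * n \<and> k \<le> n" using I unfolding I_def by auto
        moreover have "Suc (n * n) \<le> M" using M by linarith
        ultimately show "hoare (Assign 8 (Size [*] Size [+] Const 1)) s3 10
          (\<lambda>s'. \<exists>k. vars s' 10 = k \<and> vars s' 11 = 2 ^ k \<and> n < 2 ^ k \<and> 2 ^ k \<le> 2 * n \<and> k \<le> n \<and> vars s' 8 = n * n + 1)"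
          by (simp add: hoare_def envD env3 less_ok)
      qed (use s1 s2 env in simp_all)
    qed simp
  qed simp
qed

text \<open>The runs read disjoint segments of the tape, each of the same length, and the recorded
  minimum is below the bound of each of them.\<close>

lemma attempts_correct:
  assumes env: "env s" and k: "vars s 10 = k" "k \<le> n" "n < 2 ^ k" and best: "vars s 8 = n * n + 1"
    and t: "tape s = t" "k * draws (sample_sizes n (Suc k)) \<le> length t" "set t \<subseteq> {..<n}"
  shows "hoare (For 9 (Var 10) attempt) s (k * (3000 * (n + 1) * (n + 1) + 7) + 5)
    (\<lambda>s'. best_order s' \<and> vars s' 8 \<le> n * n \<and>
      (\<forall>i<k. vars s' 8 \<le> 2 * cost_of (rounds n a (sample_sizes n (Suc k)) (start (drop (i * draws (sample_sizes n (Suc k))) t)))))"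
proof -
  let ?ms = "sample_sizes n (Suc k)"
  let ?D = "draws ?ms"
  define I where "I i s' \<longleftrightarrow> best_order s' \<and> (0 < i \<longrightarrow> vars s' 8 \<le> n * n) \<and> tape s' = drop (i * ?D) t \<and>
    (\<forall>j<i. vars s' 8 \<le> 2 * cost_of (rounds n a ?ms (start (drop (j * ?D) t))))" for i and s' :: loop_state
  have "hoare (For 9 (Var 10) attempt) s (k * (3000 * (n + 1) * (n + 1) + 7) + 5) (I k)"
  proof (rule hoare_For_const[where T = "3000 * (n + 1) * (n + 1)" and I = I and b = k])
    have "k \<le> M" using k(2) less_ok(8) by linarith
    then show "aok (Var 10) s" "aval (Var 10) s = k" using k by (simp_all add: envD env)
    show "I 0 s" unfolding I_def best_order_def using best t by simp
    fix i s' assume i: "i < k" and I: "I i s'" and fr: "frame (For 9 (Var 10) attempt) s s'"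
    have env': "env s'" by (rule env_frame[OF fr env])
    have v10: "vars s' 10 = k" using fr k unfolding frame_def
      by (simp add: attempt_def cluster_def refine_def regroup_def)
    let ?t = "drop (i * ?D) t"
    have "Suc i * ?D \<le> k * ?D" using i by (intro mult_le_mono1) simp
    then have len: "?D \<le> length ?t" using t(2) by simp
    have "set ?t \<subseteq> {..<n}" using t(3) set_drop_subset by fast
    then have "hoare attempt (set_var 9 i s') (3000 * (n + 1) * (n + 1)) (\<lambda>s''. best_order s'' \<and> vars s'' 8 \<le> vars (set_var 9 i s') 8 \<and>
        vars s'' 8 \<le> n * n \<and> vars s'' 8 \<le> 2 * cost_of (rounds n a ?ms (start ?t)) \<and> tape s'' = drop ?D ?t)"
      using I env' v10 k len unfolding I_def by (intro attempt_correct) (simp_all add: best_order_def)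
    then show "hoare attempt (set_var 9 i s') (3000 * (n + 1) * (n + 1)) (I (Suc i))"
    proof (rule hoare_weaken)
      fix s'' assume *: "best_order s'' \<and> vars s'' 8 \<le> vars (set_var 9 i s') 8 \<and>
        vars s'' 8 \<le> n * n \<and> vars s'' 8 \<le> 2 * cost_of (rounds n a ?ms (start ?t)) \<and> tape s'' = drop ?D ?t"
      have "vars s'' 8 \<le> 2 * cost_of (rounds n a ?ms (start (drop (j * ?D) t)))" if "j < Suc i" for j
      proof (cases "j = i")
        case False
        then have "vars s' 8 \<le> 2 * cost_of (rounds n a ?ms (start (drop (j * ?D) t)))" using I that unfolding I_def by simp
        then show ?thesis using * by simp
      qed (use * in simp)
      then show "I (Suc i) s''" using * unfolding I_def by (simp add: add.commute)
    qed simp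
  qed simp
  then show ?thesis
  proof (rule hoare_weaken)
    have "0 < k" using k(3) n by (cases k) auto
    then show "best_order s' \<and> vars s' 8 \<le> n * n \<and>
      (\<forall>i<k. vars s' 8 \<le> 2 * cost_of (rounds n a ?ms (start (drop (i * ?D) t))))" if "I k s'" for s'
      using that unfolding I_def by simp
  qed simp
qed

text \<open>Only the first \<open>2 ^ (k - l)\<close> cells of a row are current; the others are
  left over from lower levels.\<close>

definition block_state :: "nat list \<Rightarrow> (nat \<Rightarrow> nat) \<Rightarrow> nat \<Rightarrow> nat \<Rightarrow> loop_state \<Rightarrow> bool" where
  "block_state ord ps k l s \<longleftrightarrow> vars s 11 = 2 ^ k \<and> vars s 12 = 2 ^ (k - l) \<and> vars s 13 = 2 ^ l \<and>
    (\<forall>j<n. arrs s 11 j = ord ! j) \<and>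
    (\<forall>v<n. \<forall>q<2 ^ (k - l). arrs s 13 (v * 2 ^ k + q) = of_bool (full (later_nbr n a ord ps v) l q))"

lemma square_expand: "c * (m + 1) * (m + 1) = c * (m * m) + 2 * (c * m) + (c :: nat)"
  by (simp add: distrib_left distrib_right)

lemma cell_le:
  assumes "v < n" "q < N" "N \<le> 2 * n"
  shows "v * N + q \<le> 2 * (n * n)"
proof -
  have "v * N + q < Suc v * N" using assms(2) by simp
  also have "\<dots> \<le> n * N" using assms(1) by (intro mult_le_mono1) simp
  also have "\<dots> \<le> n * (2 * n)" using assms(3) by (intro mult_le_mono2)
  finally show ?thesis by simp
qed

lemma cell_ok:
  assumes "v < n" "q < N" "N \<le> 2 * n"
  shows "v * N + q \<le> M" "n * n + (16 * (v * N + q) + 13) \<le> M" "v * N \<le> M" "q \<le> M" "N \<le> M" "v \<le> M"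
    "n * n + (16 * (v * N) + 16 * q + 13) \<le> M" "n * n + (16 * (v * N) + (16 * q + 13)) \<le> M"
proof -
  note le = cell_le[OF assms]
  show "v * N + q \<le> M" by (rule word_ok) (use le in linarith)
  then show "v * N \<le> M" "q \<le> M" by simp_all
  show "N \<le> M" "v \<le> M" by (rule word_ok, use assms in linarith)+
  show "n * n + (16 * (v * N + q) + 13) \<le> M" by (rule addr_ok) (use le in linarith, simp)
  then show "n * n + (16 * (v * N) + 16 * q + 13) \<le> M" "n * n + (16 * (v * N) + (16 * q + 13)) \<le> M"
    by (simp_all add: distrib_left add.assoc)
qed

lemma setup_blocks_correct:
  assumes env: "env s" and k: "vars s 11 = 2 ^ k" "2 ^ k \<le> 2 * n"
    and ord: "distinct ord" "set ord = {..<n}" "length ord = n" "\<forall>j<n. arrs s 11 j = ord ! j"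
  shows "hoare setup_blocks s (200 * (n + 1) * (n + 1)) (\<lambda>s'. \<exists>ps. (\<forall>j<n. ps (ord ! j) = j) \<and> block_state ord ps k 0 s')"
proof -
  let ?c1 = "For 0 Size (Put 12 (Get 11 (Var 0)) (Var 0))"
  let ?b = "If ((Size [-] Var 17) [*] (Var 17 [-] Get 12 (Var 0)))
      (Put 13 (cell (Var 17)) (Adj (Var 0) (Get 11 (Var 17)))) (Put 13 (cell (Var 17)) (Const 0))"
  let ?c2 = "For 0 Size (For 17 (Var 11) ?b)"
  have ordn: "ord ! j < n" if "j < n" for j using ord(2,3) that nth_mem[of j ord] by simp
  have h1: "hoare ?c1 s (30 * n + 5) (\<lambda>s'. \<forall>j<n. arrs s' 12 (ord ! j) = j)"
  proof (rule hoare_For_const[where T = 20 and b = n and I = "\<lambda>k s'. \<forall>j<k. arrs s' 12 (ord ! j) = j"])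
    fix j s' assume j: "j < n" and I: "\<forall>i<j. arrs s' 12 (ord ! i) = i" and fr: "frame ?c1 s s'"
    have same: "arrs s' 11 j = ord ! j" using fr ord(4) j unfolding frame_def by simp
    have "ord ! i \<noteq> ord ! j" if "i < j" for i using nth_eq_iff_index_eq[OF ord(1), of i j] that j ord(3) by simp
    then have "\<forall>i<Suc j. ((arrs s' 12)(ord ! j := j)) (ord ! i) = i" using I by (simp add: less_Suc_eq)
    then show "hoare (Put 12 (Get 11 (Var 0)) (Var 0)) (set_var 0 j s') 20 (\<lambda>s'. \<forall>i<Suc j. arrs s' 12 (ord ! i) = i)"
      using j ordn[OF j] by (simp add: hoare_def envD env_frame[OF fr env] less_ok less_ok3 same)
  qed (use env in \<open>simp_all add: envD less_ok\<close>)
  have h2: "hoare ?c2 s1 (150 * (n + 1) * (n + 1)) (\<lambda>s'. \<forall>v<n. \<forall>j<2 ^ k. arrs s' 13 (v * 2 ^ k + j) = of_bool (later_nbr n a ord (arrs s1 12) v j))"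
    if 1: "\<forall>j<n. arrs s1 12 (ord ! j) = j" and fr1: "frame ?c1 s s1" for s1
  proof (rule hoare_For_const[where T = "120 * n + 10" and b = n and I = "\<lambda>u s'. \<forall>v<u. \<forall>j<2 ^ k. arrs s' 13 (v * 2 ^ k + j) = of_bool (later_nbr n a ord (arrs s1 12) v j)"])
    let ?B = "later_nbr n a ord (arrs s1 12)"
    have env1: "env s1" by (rule env_frame[OF fr1 env])
    then show "aok Size s1" "aval Size s1 = n" by (simp_all add: envD less_ok)
    fix v s' assume v: "v < n" and I: "\<forall>u<v. \<forall>j<2 ^ k. arrs s' 13 (u * 2 ^ k + j) = of_bool (?B u j)" and fr2: "frame ?c2 s1 s'"
    have env': "env s'" by (rule env_frame[OF fr2 env1])
    have v11: "vars s' 11 = 2 ^ k" using fr2 fr1 k unfolding frame_def by (simp add: cell_def)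
    show "hoare (For 17 (Var 11) ?b) (set_var 0 v s') (120 * n + 10) (\<lambda>s'. \<forall>u<Suc v. \<forall>j<2 ^ k. arrs s' 13 (u * 2 ^ k + j) = of_bool (?B u j))"
    proof (rule hoare_weaken[OF hoare_For_const[where T = 50 and b = "2 ^ k" and T' = "120 * n + 10" and
         I = "\<lambda>i s'. (\<forall>u<v. \<forall>j<2 ^ k. arrs s' 13 (u * 2 ^ k + j) = of_bool (?B u j)) \<and> (\<forall>j<i. arrs s' 13 (v * 2 ^ k + j) = of_bool (?B v j))"]])
      show "aok (Var 11) (set_var 0 v s')" "aval (Var 11) (set_var 0 v s') = 2 ^ k"
        using v11 cell_ok(5)[OF v _ k(2), of 0] by (simp_all add: envD env')
      fix i s'' assume i: "i < 2 ^ k" and fr3: "frame (For 17 (Var 11) ?b) (set_var 0 v s') s''"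
        and I2: "(\<forall>u<v. \<forall>j<2 ^ k. arrs s'' 13 (u * 2 ^ k + j) = of_bool (?B u j)) \<and> (\<forall>j<i. arrs s'' 13 (v * 2 ^ k + j) = of_bool (?B v j))"
      have env'': "env s''" using env_frame[OF fr3] env' by simp
      have same: "vars s'' 0 = v" "vars s'' 11 = 2 ^ k" "arrs s'' 12 = arrs s1 12" "arrs s'' 11 = arrs s 11"
        using fr3 fr2 fr1 v11 unfolding frame_def by (simp_all add: cell_def)
      have ps: "arrs s1 12 v < n"
      proof -
        have "v \<in> set ord" using v ord(2) by simp
        then obtain j where "j < n" "ord ! j = v" unfolding in_set_conv_nth ord(3) by blast
        then show ?thesis using 1 by auto
      qed
      note c = cell_ok[OF v i k(2)]
      have I3: "(\<forall>u<v. \<forall>j<2 ^ k. ((arrs s'' 13)(v * 2 ^ k + i := of_bool (?B v i))) (u * 2 ^ k + j) = of_bool (?B u j)) \<and>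
          (\<forall>j<Suc i. ((arrs s'' 13)(v * 2 ^ k + i := of_bool (?B v i))) (v * 2 ^ k + j) = of_bool (?B v j))"
        using I2 i by (auto simp: cell_inj less_Suc_eq)
      have prod: "(n - i) * (i - arrs s1 12 v) \<le> M"
      proof -
        have "(n - i) * (i - arrs s1 12 v) \<le> n * (2 * n)" using i k(2) by (intro mult_le_mono) auto
        then show ?thesis by (intro word_ok) simp
      qed
      have bnd: "n - i \<le> M" "i - arrs s1 12 v \<le> M" using less_ok(8) c(4) by linarith+
      show "hoare ?b (set_var 17 i s'') 50 (\<lambda>s'. (\<forall>u<v. \<forall>j<2 ^ k. arrs s' 13 (u * 2 ^ k + j) = of_bool (?B u j)) \<and> (\<forall>j<Suc i. arrs s' 13 (v * 2 ^ k + j) = of_bool (?B v j)))"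
      proof (cases "i < n \<and> arrs s1 12 v < i")
        case True
        then have eq: "?B v i \<longleftrightarrow> a v (ord ! i)" by (simp add: later_nbr_def)
        show ?thesis using True v ps c prod bnd ordn[of i] ord(4) I3[unfolded eq]
          by (simp add: hoare_def cell_def envD env'' less_ok less_ok3 same)
      next
        case False
        then have "\<not> ?B v i" by (auto simp: later_nbr_def)
        moreover have "(n - i) * (i - arrs s1 12 v) = 0" using False by auto
        ultimately show ?thesis using v ps c bnd I3 prod
          by (simp add: hoare_def cell_def envD env'' less_ok less_ok3 same del: mult_eq_0_iff)
      qed
    next
      fix s'' assume "(\<forall>u<v. \<forall>j<2 ^ k. arrs s'' 13 (u * 2 ^ k + j) = of_bool (?B u j)) \<and> (\<forall>j<2 ^ k. arrs s'' 13 (v * 2 ^ k + j) = of_bool (?B v j))"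
      then show "\<forall>u<Suc v. \<forall>j<2 ^ k. arrs s'' 13 (u * 2 ^ k + j) = of_bool (?B u j)" by (simp add: less_Suc_eq)
    qed (use I k(2) in simp_all)
  next
    show "alen Size + 3 + n * (120 * n + 10 + 7) \<le> 150 * (n + 1) * (n + 1)" by (simp add: algebra_simps)
  qed simp
  show ?thesis unfolding setup_blocks_def
  proof (rule hoare_Seq[OF h1])
    fix s1 assume 1: "\<forall>j<n. arrs s1 12 (ord ! j) = j" "frame ?c1 s s1"
    show "hoare (?c2 ;; Assign 12 (Var 11) ;; Assign 13 (Const 1)) s1 (160 * (n + 1) * (n + 1))
      (\<lambda>s'. \<exists>ps. (\<forall>j<n. ps (ord ! j) = j) \<and> block_state ord ps k 0 s')"
    proof (rule hoare_Seq[OF h2[OF 1], where U = 7])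
      fix s2 assume 2: "\<forall>v<n. \<forall>j<2 ^ k. arrs s2 13 (v * 2 ^ k + j) = of_bool (later_nbr n a ord (arrs s1 12) v j)"
        and fr2: "frame ?c2 s1 s2"
      have env2: "env s2" by (rule env_frame[OF fr2 env_frame[OF 1(2) env]])
      have v: "vars s2 11 = 2 ^ k" "arrs s2 11 = arrs s 11"
        using fr2 1(2) k unfolding frame_def by (simp_all add: cell_def)
      have "block_state ord (arrs s1 12) k 0 (set_var 13 1 (set_var 12 (2 ^ k) s2))"
        using 2 v ord(4) unfolding block_state_def by (simp add: full_0)
      then have "\<exists>ps. (\<forall>j<n. ps (ord ! j) = j) \<and> block_state ord ps k 0 (set_var 13 1 (set_var 12 (2 ^ k) s2))"
        using 1(1) by blast
      then show "hoare (Assign 12 (Var 11) ;; Assign 13 (Const 1)) s2 7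
        (\<lambda>s'. \<exists>ps. (\<forall>j<n. ps (ord ! j) = j) \<and> block_state ord ps k 0 s')"
        using cell_ok(5)[OF n _ k(2), of 0] by (simp add: hoare_def envD env2 less_ok v)
    qed (unfold square_expand, linarith)
  qed (unfold square_expand, linarith)
qed

lemma collect_users_correct:
  assumes env: "env s" and bs: "block_state ord ps k l s" and q: "vars s 15 = q" "q < 2 ^ (k - l)"
    and l: "l < k" and k: "2 ^ k \<le> 2 * n"
  defines "U \<equiv> users n a ord ps (l, q)"
  shows "hoare collect_users s (80 * n + 10) (\<lambda>s'. vars s' 16 = length U \<and> (\<forall>i<length U. arrs s' 14 i = U ! i))"
proof -
  let ?B = "later_nbr n a ord ps"
  let ?b = "If (Get 13 (cell (Var 15)) [*] (Const 1 [-] Get 13 (cell (Var 15 [+] Const 1 [-] Const 2 [*] (Var 15 [%] Const 2)))))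
      (Put 14 (Var 16) (Var 0) ;; Assign 16 (Var 16 [+] Const 1)) Skip"
  define F where "F i = filter (\<lambda>v. chosen (?B v) l q) [0..<i]" for i
  have U: "U = F n" by (simp add: U_def F_def users_def)
  have sib: "Suc q - 2 * (q mod 2) = sibling q" by (simp add: sibling_def)
  \<comment> \<open>This is where \<open>l < k\<close> matters: on a level with a single block the
    sibling would lie outside the tree.\<close>
  have sq: "sibling q < 2 ^ (k - l)" using q(2) l by (intro sibling_less) simp_all
  have N: "(2::nat) ^ (k - l) \<le> 2 ^ k" by (intro power_increasing) auto
  have qN: "q < 2 ^ k" "sibling q < 2 ^ k" by (rule less_le_trans[OF q(2) N], rule less_le_trans[OF sq N])
  have "hoare (For 0 Size ?b) s1 (80 * n + 5) (\<lambda>s'. vars s' 16 = length U \<and> (\<forall>i<length U. arrs s' 14 i = U ! i))"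
    if s1: "s1 = set_var 16 0 s" for s1
    unfolding U
  proof (rule hoare_For_const[where T = 65 and b = n and I = "\<lambda>i s'. vars s' 16 = length (F i) \<and> (\<forall>j<length (F i). arrs s' 14 j = F i ! j)"])
    have env1: "env s1" using env s1 by simp
    then show "aok Size s1" "aval Size s1 = n" by (simp_all add: envD less_ok)
    show "vars s1 16 = length (F 0) \<and> (\<forall>j<length (F 0). arrs s1 14 j = F 0 ! j)" by (simp add: s1 F_def)
    fix v s' assume v: "v < n" and I: "vars s' 16 = length (F v) \<and> (\<forall>j<length (F v). arrs s' 14 j = F v ! j)"
      and fr: "frame (For 0 Size ?b) s1 s'"
    have env': "env s'" by (rule env_frame[OF fr env1])
    have same: "vars s' 15 = q" "vars s' 11 = 2 ^ k" "arrs s' 13 = arrs s 13"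
      using fr s1 q bs unfolding frame_def block_state_def by simp_all
    have cells: "arrs s 13 (v * 2 ^ k + q) = of_bool (full (?B v) l q)"
      "arrs s 13 (v * 2 ^ k + sibling q) = of_bool (full (?B v) l (sibling q))"
      using bs v q(2) sq unfolding block_state_def by simp_all
    have len: "length (F v) \<le> v" unfolding F_def by (rule order_trans[OF length_filter_le]) simp
    then have "length (F v) < n" using v by simp
    note c = cell_ok[OF v qN(1) k] cell_ok[OF v qN(2) k]
    have bnd: "Suc q \<le> M" "2 * (q mod 2) \<le> M" "q mod 2 \<le> M" "2 \<le> M" "v * 2 ^ k + q \<le> M"
    proof -
      show "Suc q \<le> M" using qN k M by linarith
      show "2 * (q mod 2) \<le> M" "q mod 2 \<le> M" "2 \<le> M" using M by (simp_all add: mod2_eq_if)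
    qed (rule c)
    show "hoare ?b (set_var 0 v s') 65 (\<lambda>s'. vars s' 16 = length (F (Suc v)) \<and> (\<forall>j<length (F (Suc v)). arrs s' 14 j = F (Suc v) ! j))"
    proof (cases "chosen (?B v) l q")
      case True
      then have F: "F (Suc v) = F v @ [v]" by (simp add: F_def)
      have "full (?B v) l q" "\<not> full (?B v) l (sibling q)" using True by (simp_all add: chosen_def)
      then show ?thesis using I v c bnd \<open>length (F v) < n\<close>
        by (simp add: hoare_def cell_def envD env' less_ok less_ok3 same cells sib F nth_append less_Suc_eq)
    next
      case False
      then have F: "F (Suc v) = F v" by (simp add: F_def)
      show ?thesis
      proof (cases "full (?B v) l q")
        case full: True
        then have "full (?B v) l (sibling q)" using False by (simp add: chosen_def)
        then show ?thesis using full I v c bnd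
          by (simp add: hoare_def cell_def envD env' less_ok less_ok3 same cells sib F)
      next
        case nfull: False
        show ?thesis using nfull I v c bnd
          by (simp add: hoare_def cell_def envD env' less_ok less_ok3 same cells sib F)
      qed
    qed
  qed simp
  note loop = this
  show ?thesis unfolding collect_users_def
  proof (rule hoare_Seq[where V = 3 and R = "\<lambda>s1. s1 = set_var 16 0 s" and U = "80 * n + 5"])
    show "hoare (Assign 16 (Const 0)) s 3 (\<lambda>s1. s1 = set_var 16 0 s)"
      by (simp add: hoare_def envD env less_ok)
  qed (rule loop, assumption, simp)
qed

lemma emit_block_correct:
  assumes env: "env s" and bs: "block_state ord ps k l s" and q: "vars s 15 = q" "q < 2 ^ (k - l)"
    and l: "l < k" and k: "2 ^ k \<le> 2 * n" and ord: "set ord = {..<n}" "length ord = n"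
    and U: "U = users n a ord ps (l, q)" "vars s 16 = length U" "\<And>i. i < length U \<Longrightarrow> arrs s 14 i = U ! i"
  shows "hoare emit_block s (100 * n + 30)
    (\<lambda>s'. outs s' = outs s @ concat (map encode_parts (parts n a ord ps [(l, q)])))"
proof -
  let ?B = "later_nbr n a ord ps"
  let ?c3 = "For 17 (Var 13) (Emit (Get 11 (Var 15 [*] Var 13 [+] Var 17)))"
  let ?c4 = "For 17 (Var 16) (Emit (Get 14 (Var 17)))"
  let ?b = "2 ^ l :: nat"
  have v13: "vars s 13 = ?b" using bs by (simp add: block_state_def)
  have "?b \<le> 2 ^ k" using l by (intro power_increasing) auto
  then have b: "?b \<le> 2 * n" using k by (rule order_trans)
  then have bM: "?b \<le> M" using M by linarith
  have Un: "length U \<le> n" unfolding U(1) users_def using length_filter_le[of _ "[0..<n]"] by (metis (no_types, lifting) case_prod_conv length_upt minus_nat.diff_0)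
  have UM: "length U \<le> M" using Un less_ok(8) by linarith
  have set_U: "v < n" "full (?B v) l q" if "v \<in> set U" for v
    using that unfolding U(1) users_def chosen_def by auto
  have ordn: "ord ! j < n" if "j < n" for j using ord that nth_mem[of j ord] by simp
  \<comment> \<open>A block with a user is full for it and so lies within the ordering; array 11 is
    read only below \<open>n\<close>.\<close>
  have cells: "q * ?b + j < n" if "U \<noteq> []" "j < ?b" for j
  proof -
    have "hd U \<in> set U" using that(1) by simp
    moreover have "(q * ?b + j) div ?b = q" using that(2) by simp
    ultimately have "?B (hd U) (q * ?b + j)" using set_U(2) unfolding full_def by blast
    then show ?thesis by (simp add: later_nbr_def)
  qed
  let ?o2 = "outs s @ [?b, length U]"
  let ?o3 = "?o2 @ block ord (l, q)"
  have h3: "hoare ?c3 s2 (22 * (2 * n) + 5) (\<lambda>s'. outs s' = ?o3)"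
    if s2: "s2 = s\<lparr>outs := ?o2\<rparr>" and ne: "U \<noteq> []" for s2
  proof (rule hoare_weaken[OF hoare_For_const[where T = 15 and b = ?b and T' = "22 * (2 * n) + 5" and
      I = "\<lambda>i s'. outs s' = ?o2 @ map (\<lambda>j. ord ! (q * ?b + j)) [0..<i]"]])
    have env2: "env s2" using env s2 by simp
    then show "aok (Var 13) s2" "aval (Var 13) s2 = ?b" using s2 v13 bM by (simp_all add: envD)
    fix j s' assume j: "j < ?b" and I: "outs s' = ?o2 @ map (\<lambda>j. ord ! (q * ?b + j)) [0..<j]" and fr: "frame ?c3 s2 s'"
    have env': "env s'" by (rule env_frame[OF fr env2])
    have same: "vars s' 15 = q" "vars s' 13 = ?b" "arrs s' 11 = arrs s 11"
      using fr s2 q v13 unfolding frame_def by simp_all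
    have idx: "q * ?b + j < n" by (rule cells[OF ne j])
    then have "arrs s 11 (q * ?b + j) = ord ! (q * ?b + j)" using bs by (simp add: block_state_def)
    moreover have "q * ?b \<le> M" "q \<le> M" "j \<le> M" "q * ?b + j \<le> M" "ord ! (q * ?b + j) \<le> M"
    proof -
      show "q * ?b + j \<le> M" by (rule less_ok(1)[OF idx])
      then show "q * ?b \<le> M" "j \<le> M" by simp_all
      then show "q \<le> M" by (metis le_trans mult.right_neutral mult_le_mono2 one_le_numeral one_le_power)
      show "ord ! (q * ?b + j) \<le> M" by (rule less_ok(1)[OF ordn[OF idx]])
    qed
    moreover have "n * n + (16 * (q * ?b + j) + 11) \<le> M" by (rule less_ok3(9)[OF idx])
    ultimately show "hoare (Emit (Get 11 (Var 15 [*] Var 13 [+] Var 17))) (set_var 17 j s') 15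
      (\<lambda>s'. outs s' = ?o2 @ map (\<lambda>j. ord ! (q * ?b + j)) [0..<Suc j])"
      using I bM by (simp add: hoare_def envD env' less_ok same distrib_left)
  next
    show "outs s2 = ?o2 @ map (\<lambda>j. ord ! (q * ?b + j)) [0..<0]" using s2 by simp
    show "alen (Var 13) + 3 + ?b * (15 + 7) \<le> 22 * (2 * n) + 5" using b by simp
    show "22 * (2 * n) + 5 \<le> 22 * (2 * n) + 5" by simp
    fix s' assume "outs s' = ?o2 @ map (\<lambda>j. ord ! (q * ?b + j)) [0..<?b]"
    then show "outs s' = ?o3" by (simp add: block_def)
  qed
  have h4: "hoare ?c4 s3 (20 * n + 5) (\<lambda>s'. outs s' = ?o3 @ U)"
    if o3: "outs s3 = ?o3" and fr3: "frame ?c3 (s\<lparr>outs := ?o2\<rparr>) s3" for s3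
  proof (rule hoare_weaken[OF hoare_For_const[where T = 10 and b = "length U" and T' = "20 * n + 5" and
      I = "\<lambda>i s'. outs s' = ?o3 @ take i U"]])
    have env3: "env s3" using env_frame[OF fr3] env by simp
    have v16: "vars s3 16 = length U" using fr3 U(2) unfolding frame_def by simp
    then show "aok (Var 16) s3" "aval (Var 16) s3 = length U" using UM by (simp_all add: envD env3)
    fix i s' assume i: "i < length U" and I: "outs s' = ?o3 @ take i U" and fr: "frame ?c4 s3 s'"
    have env': "env s'" by (rule env_frame[OF fr env3])
    have "arrs s' 14 i = U ! i" using fr fr3 U(3)[OF i] unfolding frame_def by simp
    moreover have "U ! i < n" using set_U(1) nth_mem[OF i] by blast
    moreover have "i < n" using i Un by simp
    ultimately show "hoare (Emit (Get 14 (Var 17))) (set_var 17 i s') 10 (\<lambda>s'. outs s' = ?o3 @ take (Suc i) U)"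
      using I i by (simp add: hoare_def envD env' less_ok less_ok3 take_Suc_conv_app_nth)
  qed (use o3 Un in simp_all)
  show ?thesis unfolding emit_block_def
  proof (rule hoare_If[where U = "70 * n + 20"])
    show "aok (Var 16) s" using UM U(2) by (simp add: envD env)
    show "hoare Skip s (70 * n + 20) (\<lambda>s'. outs s' = outs s @ concat (map encode_parts (parts n a ord ps [(l, q)])))"
      if "aval (Var 16) s = 0"
      using that U(2) by (simp add: hoare_def parts_def U(1))
    assume "aval (Var 16) s \<noteq> 0"
    then have ne: "U \<noteq> []" using U(2) by auto
    have enc: "?o3 @ U = outs s @ concat (map encode_parts (parts n a ord ps [(l, q)]))"
      using ne U(1) by (simp add: parts_def encode_parts_def block_def)
    show "hoare (Emit (Var 13) ;; Emit (Var 16) ;; ?c3 ;; ?c4) s (70 * n + 20)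
      (\<lambda>s'. outs s' = outs s @ concat (map encode_parts (parts n a ord ps [(l, q)])))"
    proof (rule hoare_Seq[where V = 3 and R = "\<lambda>s1. s1 = s\<lparr>outs := outs s @ [?b]\<rparr>" and U = "70 * n + 15"])
      show "hoare (Emit (Var 13)) s 3 (\<lambda>s1. s1 = s\<lparr>outs := outs s @ [?b]\<rparr>)" using v13 bM by (simp add: hoare_def envD env)
      fix s1 assume s1: "s1 = s\<lparr>outs := outs s @ [?b]\<rparr>"
      show "hoare (Emit (Var 16) ;; ?c3 ;; ?c4) s1 (70 * n + 15) (\<lambda>s'. outs s' = outs s @ concat (map encode_parts (parts n a ord ps [(l, q)])))"
      proof (rule hoare_Seq[where V = 3 and R = "\<lambda>s2. s2 = s\<lparr>outs := ?o2\<rparr>" and U = "70 * n + 12"])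
        show "hoare (Emit (Var 16)) s1 3 (\<lambda>s2. s2 = s\<lparr>outs := ?o2\<rparr>)" using s1 U(2) UM env by (simp add: hoare_def envD)
        fix s2 assume s2: "s2 = s\<lparr>outs := ?o2\<rparr>"
        show "hoare (?c3 ;; ?c4) s2 (70 * n + 12) (\<lambda>s'. outs s' = outs s @ concat (map encode_parts (parts n a ord ps [(l, q)])))"
          unfolding enc[symmetric] by (rule hoare_Seq[OF h3[OF s2 ne] h4]) (simp_all add: s2)
      qed simp
    qed simp
  qed simp
qed

lemma block_state_frame:
  assumes "frame c s s'" "block_state ord ps k l s" "{11, 12, 13} \<inter> writes c = {}" "{11, 13} \<inter> puts c = {}"
  shows "block_state ord ps k l s'"
proof -
  have "vars s' 11 = vars s 11" "vars s' 12 = vars s 12" "vars s' 13 = vars s 13" "arrs s' 11 = arrs s 11" "arrs s' 13 = arrs s 13"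
    using assms unfolding frame_def by blast+
  then show ?thesis using assms(2) unfolding block_state_def by simp
qed

lemma emit_blocks_correct:
  assumes env: "env s" and bs: "block_state ord ps k l s"
    and l: "l < k" and k: "2 ^ k \<le> 2 * n" and ord: "set ord = {..<n}" "length ord = n"
  shows "hoare (For 15 (Var 12) (collect_users ;; emit_block)) s (500 * (n + 1) * (n + 1))
    (\<lambda>s'. outs s' = outs s @ concat (map encode_parts (parts n a ord ps (map (Pair l) [0..<2 ^ (k - l)]))))"
proof (rule hoare_For_const[where T = "200 * n + 50" and b = "2 ^ (k - l)" and
    I = "\<lambda>q s'. outs s' = outs s @ concat (map encode_parts (parts n a ord ps (map (Pair l) [0..<q])))"])
  let ?c = "For 15 (Var 12) (collect_users ;; emit_block)"
  have "(2::nat) ^ (k - l) \<le> 2 ^ k" by (intro power_increasing) auto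
  then have N: "(2::nat) ^ (k - l) \<le> 2 * n" using k by (rule order_trans)
  then have "2 ^ (k - l) \<le> M" using M by linarith
  then show "aok (Var 12) s" "aval (Var 12) s = 2 ^ (k - l)" using bs by (simp_all add: block_state_def envD env)
  show "outs s = outs s @ concat (map encode_parts (parts n a ord ps (map (Pair l) [0..<0])))" by (simp add: parts_def)
  show "alen (Var 12) + 3 + 2 ^ (k - l) * (200 * n + 50 + 7) \<le> 500 * (n + 1) * (n + 1)"
  proof -
    have "2 ^ (k - l) * (200 * n + 50 + 7) \<le> 2 * n * (200 * n + 50 + 7)" using N by (rule mult_le_mono1)
    then show ?thesis by (simp add: algebra_simps)
  qed
  note sub = collect_users_def emit_block_def cell_def
  fix q s' assume q: "q < 2 ^ (k - l)" and I: "outs s' = outs s @ concat (map encode_parts (parts n a ord ps (map (Pair l) [0..<q])))"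
    and fr: "frame ?c s s'"
  have env': "env s'" by (rule env_frame[OF fr env])
  have bs': "block_state ord ps k l (set_var 15 q s')"
    using block_state_frame[OF fr bs] by (simp add: sub block_state_def)
  let ?U = "users n a ord ps (l, q)"
  have "hoare collect_users (set_var 15 q s') (80 * n + 10) (\<lambda>s'. vars s' 16 = length ?U \<and> (\<forall>i<length ?U. arrs s' 14 i = ?U ! i))"
    using env' q by (intro collect_users_correct[OF _ bs' _ _ l k]) simp_all
  then show "hoare (collect_users ;; emit_block) (set_var 15 q s') (200 * n + 50)
      (\<lambda>s'. outs s' = outs s @ concat (map encode_parts (parts n a ord ps (map (Pair l) [0..<Suc q]))))"
  proof (rule hoare_Seq)
    fix s2 assume 2: "vars s2 16 = length ?U \<and> (\<forall>i<length ?U. arrs s2 14 i = ?U ! i)" and fr2: "frame collect_users (set_var 15 q s') s2"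
    have env2: "env s2" using env_frame[OF fr2] env' by simp
    have bs2: "block_state ord ps k l s2" by (rule block_state_frame[OF fr2 bs']) (simp_all add: sub)
    have v: "vars s2 15 = q" "outs s2 = outs s'" using fr2 unfolding frame_def by (simp_all add: sub)
    have "hoare emit_block s2 (100 * n + 30) (\<lambda>s'. outs s' = outs s2 @ concat (map encode_parts (parts n a ord ps [(l, q)])))"
      using 2 v q by (intro emit_block_correct[OF env2 bs2 _ _ l k ord refl]) simp_all
    then show "hoare emit_block s2 (100 * n + 30) (\<lambda>s'. outs s' = outs s @ concat (map encode_parts (parts n a ord ps (map (Pair l) [0..<Suc q]))))"
      by (rule hoare_weaken) (simp_all add: v I parts_def)
  qed simp
qed

lemma halve_blocks_correct:
  assumes env: "env s" and l: "l < k" and k: "2 ^ k \<le> 2 * n" and v11: "vars s 11 = 2 ^ k" and v12: "vars s 12 = 2 ^ (k - Suc l)"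
    and cells: "\<forall>v<n. \<forall>q<2 ^ (k - l). arrs s 13 (v * 2 ^ k + q) = of_bool (full (B v) l q)"
  shows "hoare halve_blocks s (300 * (n + 1) * (n + 1))
    (\<lambda>s'. \<forall>v<n. \<forall>q<2 ^ (k - Suc l). arrs s' 13 (v * 2 ^ k + q) = of_bool (full (B v) (Suc l) q))"
proof -
  let ?w = "2 ^ (k - Suc l) :: nat" and ?N = "2 ^ k :: nat"
  let ?p = "Put 13 (cell (Var 15)) (Get 13 (cell (Const 2 [*] Var 15)) [*] Get 13 (cell (Const 2 [*] Var 15 [+] Const 1)))"
  let ?in = "For 15 (Var 12) ?p"
  have w2: "2 * ?w = 2 ^ (k - l)" using l by (simp flip: power_Suc add: Suc_diff_Suc)
  have wN: "(2::nat) ^ (k - l) \<le> ?N" by (intro power_increasing) auto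
  have w_le: "?w \<le> 2 * n" using order_trans[OF wN k] unfolding w2[symmetric] by linarith
  define row where "row f v \<longleftrightarrow> (\<forall>q<?w. f (v * ?N + q) = (of_bool (full (B v) (Suc l) q) :: nat))" for f v
  define old where "old f v i \<longleftrightarrow> (\<forall>q<2 ^ (k - l). i \<le> q \<longrightarrow> f (v * ?N + q) = (of_bool (full (B v) l q) :: nat))" for f v i
  define I where "I v s' \<longleftrightarrow> (\<forall>u<v. row (arrs s' 13) u) \<and> (\<forall>u<n. v \<le> u \<longrightarrow> old (arrs s' 13) u 0)" for v and s' :: loop_state
  \<comment> \<open>In row \<open>v\<close> the cells below \<open>i\<close> already belong to level
    \<open>Suc l\<close>, those from \<open>i\<close> on still to level \<open>l\<close>. The cells
    to be read next are of the latter kind because \<open>i \<le> 2 * i\<close>.\<close>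
  define J where "J v i s' \<longleftrightarrow> (\<forall>u<v. row (arrs s' 13) u) \<and> (\<forall>u<n. v < u \<longrightarrow> old (arrs s' 13) u 0) \<and>
     (\<forall>q<i. arrs s' 13 (v * ?N + q) = of_bool (full (B v) (Suc l) q)) \<and> old (arrs s' 13) v i" for v i and s' :: loop_state
  have "hoare halve_blocks s (300 * (n + 1) * (n + 1)) (I n)"
    unfolding halve_blocks_def
  proof (rule hoare_For_const[where T = "140 * n + 10" and b = n and I = I])
    show "I 0 s" unfolding I_def old_def using cells by simp
    show "aok Size s" "aval Size s = n" by (simp_all add: envD env less_ok)
    show "alen Size + 3 + n * (140 * n + 10 + 7) \<le> 300 * (n + 1) * (n + 1)"
      unfolding square_expand by (simp add: distrib_left)
    fix v s' assume v: "v < n" and Iv: "I v s'" and fr: "frame (For 0 Size ?in) s s'"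
    have env': "env s'" by (rule env_frame[OF fr env])
    have v': "vars s' 11 = ?N" "vars s' 12 = ?w" using fr v11 v12 unfolding frame_def by (simp_all add: cell_def)
    show "hoare ?in (set_var 0 v s') (140 * n + 10) (I (Suc v))"
    proof (rule hoare_weaken[OF hoare_For_const[where T = 60 and b = ?w and T' = "140 * n + 10" and I = "J v"]])
      have "?w \<le> M" using w_le M by linarith
      then show "aok (Var 12) (set_var 0 v s')" "aval (Var 12) (set_var 0 v s') = ?w" by (simp_all add: envD env' v')
      show "J v 0 (set_var 0 v s')" using Iv v unfolding I_def J_def by simp
      show "alen (Var 12) + 3 + ?w * (60 + 7) \<le> 140 * n + 10" using w_le by simp
      fix i s2 assume i: "i < ?w" and J: "J v i s2" and fr2: "frame ?in (set_var 0 v s') s2"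
      have env2: "env s2" using env_frame[OF fr2] env' by simp
      have v2: "vars s2 0 = v" "vars s2 11 = ?N" using fr2 v' unfolding frame_def by (simp_all add: cell_def)
      have i2: "2 * i < 2 ^ (k - l)" "Suc (2 * i) < 2 ^ (k - l)" using i unfolding w2[symmetric] by simp_all
      have iN: "i < ?N" "2 * i < ?N" "Suc (2 * i) < ?N" using i2 wN by linarith+
      have o: "arrs s2 13 (v * ?N + q) = of_bool (full (B v) l q)" if "q < 2 ^ (k - l)" "i \<le> q" for q
        using J that unfolding J_def old_def by blast
      have c13: "arrs s2 13 (v * ?N + 2 * i) = of_bool (full (B v) l (2 * i))"
        "arrs s2 13 (v * ?N + Suc (2 * i)) = of_bool (full (B v) l (Suc (2 * i)))"
        by (rule o[OF i2(1)], simp, rule o[OF i2(2)], simp)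
      let ?new = "of_bool (full (B v) (Suc l) i) :: nat"
      let ?f = "(arrs s2 13)(v * ?N + i := ?new)"
      have prod: "of_bool (full (B v) l (2 * i)) * of_bool (full (B v) l (Suc (2 * i))) = ?new"
        by (simp add: full_Suc)
      have other: "?f (u * ?N + q) = arrs s2 13 (u * ?N + q)" if "u \<noteq> v \<or> q \<noteq> i" "q < ?N" for u q
        using that cell_inj[OF that(2) iN(1), of u v] by auto
      have "J v (Suc i) (set_var 15 i s2\<lparr>arrs := (arrs s2)(13 := ?f)\<rparr>)"
        unfolding J_def
      proof (intro conjI allI impI)
        fix u assume u: "u < v"
        then have row: "row (arrs s2 13) u" using J unfolding J_def by blast
        have eq: "arrs (set_var 15 i s2\<lparr>arrs := (arrs s2)(13 := ?f)\<rparr>) 13 = ?f" by simp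
        show "row (arrs (set_var 15 i s2\<lparr>arrs := (arrs s2)(13 := ?f)\<rparr>) 13) u"
          unfolding eq row_def
        proof (intro allI impI)
          fix q assume q: "q < ?w"
          then have "q < ?N" using w2 wN by linarith
          then have "?f (u * ?N + q) = arrs s2 13 (u * ?N + q)" using u by (intro other) simp_all
          also have "\<dots> = of_bool (full (B u) (Suc l) q)" using row q unfolding row_def by blast
          finally show "?f (u * ?N + q) = of_bool (full (B u) (Suc l) q)" .
        qed
      next
        fix u assume u: "u < n" "v < u"
        show "old (arrs (set_var 15 i s2\<lparr>arrs := (arrs s2)(13 := ?f)\<rparr>) 13) u 0"
          (is "old ?g u 0")
        proof -
          have old: "old (arrs s2 13) u 0" using J u unfolding J_def by blast
          have eq: "?g = ?f" by simp
          show ?thesis unfolding eq old_def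
          proof (intro allI impI)
            fix q :: nat assume q: "q < 2 ^ (k - l)"
            then have "q < ?N" using wN by linarith
            then have "?f (u * ?N + q) = arrs s2 13 (u * ?N + q)" using u by (intro other) simp_all
            also have "\<dots> = of_bool (full (B u) l q)" using old q unfolding old_def by blast
            finally show "?f (u * ?N + q) = of_bool (full (B u) l q)" .
          qed
        qed
      next
        fix q assume "q < Suc i"
        then show "arrs (set_var 15 i s2\<lparr>arrs := (arrs s2)(13 := ?f)\<rparr>) 13 (v * ?N + q) = of_bool (full (B v) (Suc l) q)"
          using J unfolding J_def by (cases "q = i") simp_all
      next
        show "old (arrs (set_var 15 i s2\<lparr>arrs := (arrs s2)(13 := ?f)\<rparr>) 13) v (Suc i)"
          using J unfolding J_def old_def by simp
      qed
      moreover note cell_ok[OF v iN(1) k] cell_ok[OF v iN(2) k] cell_ok[OF v iN(3) k]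
      moreover have "?new \<le> M" "2 \<le> M" using M by (simp_all add: of_bool_def)
      ultimately show "hoare ?p (set_var 15 i s2) 60 (J v (Suc i))"
        using v iN prod by (simp add: hoare_def cell_def envD env2 less_ok v2 c13[simplified])
    next
      fix s2 assume "J v ?w s2"
      then show "I (Suc v) s2" unfolding J_def I_def row_def by (auto simp: less_Suc_eq Suc_le_eq)
    qed simp
  qed
  then show ?thesis by (rule hoare_weaken) (simp_all add: I_def row_def)
qed

lemma emit_level_correct:
  assumes env: "env s" and bs: "block_state ord ps k l s"
    and l: "l < k" and k: "2 ^ k \<le> 2 * n" and ord: "set ord = {..<n}" "length ord = n"
    and out: "outs s = concat (map encode_parts (parts n a ord ps (blocks k l)))"
  shows "hoare emit_level s (900 * (n + 1) * (n + 1)) (\<lambda>s'. block_state ord ps k (Suc l) s' \<and>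
    outs s' = concat (map encode_parts (parts n a ord ps (blocks k (Suc l)))))" (is "hoare _ _ _ ?Q")
proof -
  let ?c = "For 15 (Var 12) (collect_users ;; emit_block)"
  note sub = collect_users_def emit_block_def halve_blocks_def cell_def
  have w2: "2 * 2 ^ (k - Suc l) = (2::nat) ^ (k - l)" using l by (simp flip: power_Suc add: Suc_diff_Suc)
  have "(2::nat) ^ (k - l) \<le> 2 ^ k" by (intro power_increasing) auto
  then have "(2::nat) ^ (k - l) \<le> 2 * n" using k by (rule order_trans)
  then have wM: "(2::nat) ^ (k - l) \<le> M" "(2::nat) ^ (k - Suc l) \<le> M" using M unfolding w2[symmetric] by linarith+
  have "(2::nat) ^ Suc l \<le> 2 ^ k" using l by (intro power_increasing) auto
  then have "(2::nat) ^ Suc l \<le> 2 * n" using k by (rule order_trans)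
  then have bM: "(2::nat) ^ l * 2 \<le> M" "(2::nat) ^ l \<le> M" "2 \<le> M" using M by simp_all
  show ?thesis unfolding emit_level_def
  proof (rule hoare_Seq[OF emit_blocks_correct[OF env bs l k ord]])
    fix s1 assume o1: "outs s1 = outs s @ concat (map encode_parts (parts n a ord ps (map (Pair l) [0..<2 ^ (k - l)])))"
      and fr1: "frame ?c s s1"
    have env1: "env s1" by (rule env_frame[OF fr1 env])
    have bs1: "block_state ord ps k l s1" by (rule block_state_frame[OF fr1 bs]) (simp_all add: sub)
    have out1: "outs s1 = concat (map encode_parts (parts n a ord ps (blocks k (Suc l))))"
      unfolding o1 out by (simp add: blocks_def parts_def)
    show "hoare (Assign 12 (Var 12 [/] Const 2) ;; halve_blocks ;; Assign 13 (Var 13 [*] Const 2)) s1 (320 * (n + 1) * (n + 1)) ?Q"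
    proof (rule hoare_Seq[where V = 10 and R = "\<lambda>s2. s2 = set_var 12 (2 ^ (k - Suc l)) s1" and U = "300 * (n + 1) * (n + 1) + 10"])
      have "2 ^ (k - l) div 2 = (2::nat) ^ (k - Suc l)" unfolding w2[symmetric] by simp
      then show "hoare (Assign 12 (Var 12 [/] Const 2)) s1 10 (\<lambda>s2. s2 = set_var 12 (2 ^ (k - Suc l)) s1)"
        using bs1 wM bM by (simp add: hoare_def envD env1 block_state_def)
      fix s2 assume s2: "s2 = set_var 12 (2 ^ (k - Suc l)) s1"
      have env2: "env s2" using env1 s2 by simp
      have "hoare halve_blocks s2 (300 * (n + 1) * (n + 1)) (\<lambda>s'. \<forall>v<n. \<forall>q<2 ^ (k - Suc l). arrs s' 13 (v * 2 ^ k + q) =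
          of_bool (full (later_nbr n a ord ps v) (Suc l) q))"
        using bs1 s2 by (intro halve_blocks_correct[OF env2 l k]) (simp_all add: block_state_def)
      then show "hoare (halve_blocks ;; Assign 13 (Var 13 [*] Const 2)) s2 (300 * (n + 1) * (n + 1) + 10) ?Q"
      proof (rule hoare_Seq[where U = 10])
        fix s3 assume 3: "\<forall>v<n. \<forall>q<2 ^ (k - Suc l). arrs s3 13 (v * 2 ^ k + q) = of_bool (full (later_nbr n a ord ps v) (Suc l) q)"
          and fr3: "frame halve_blocks s2 s3"
        have env3: "env s3" by (rule env_frame[OF fr3 env2])
        have same: "vars s3 11 = vars s1 11" "vars s3 12 = 2 ^ (k - Suc l)" "vars s3 13 = vars s1 13" "arrs s3 11 = arrs s1 11" "outs s3 = outs s1"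
          using fr3 s2 unfolding frame_def by (simp_all add: sub)
        have "vars s1 13 = 2 ^ l" using bs1 by (simp add: block_state_def)
        moreover have "block_state ord ps k (Suc l) (set_var 13 (2 ^ l * 2) s3)"
          using 3 bs1 same unfolding block_state_def by simp
        ultimately show "hoare (Assign 13 (Var 13 [*] Const 2)) s3 10 ?Q"
          using bM out1 by (simp add: hoare_def envD env3 same)
      qed simp
    qed (unfold square_expand, linarith)
  qed (unfold square_expand, linarith)
qed

lemma main_correct:
  assumes env: "env s" and k: "n < 2 ^ k" "2 ^ k \<le> 2 * n"
    and t: "tape s = t" "k * draws (sample_sizes n (Suc k)) \<le> length t" "set t \<subseteq> {..<n}" and out: "outs s = []"
  shows "hoare main s (5000 * (k + 1) * (n + 1) * (n + 1)) (\<lambda>s'. \<exists>ord ps. length ord = n \<and> set ord = {..<n} \<and> (\<forall>j<n. ps (ord ! j) = j) \<and>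
     outs s' = concat (map encode_parts (parts n a ord ps (blocks k k))) \<and>
     (\<forall>i<k. crossings n a ord \<le> 2 * cost_of (rounds n a (sample_sizes n (Suc k)) (start (drop (i * draws (sample_sizes n (Suc k))) t)))))"
    (is "hoare _ _ _ ?Q")
proof -
  let ?C = "\<lambda>i. 2 * cost_of (rounds n a (sample_sizes n (Suc k)) (start (drop (i * draws (sample_sizes n (Suc k))) t)))"
  let ?c2 = "For 9 (Var 10) attempt"
  note sub = setup_size_def attempt_def cluster_def refine_def regroup_def setup_blocks_def cell_def
    emit_level_def collect_users_def emit_block_def halve_blocks_def
  show ?thesis unfolding main_def
  proof (rule hoare_Seq[OF setup_size_correct[OF env]])
    fix s1 assume ex: "\<exists>k. vars s1 10 = k \<and> vars s1 11 = 2 ^ k \<and> n < 2 ^ k \<and> 2 ^ k \<le> 2 * n \<and> k \<le> n \<and> vars s1 8 = n * n + 1"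
      and fr1: "frame setup_size s s1"
    then obtain k' where k': "vars s1 10 = k'" "vars s1 11 = 2 ^ k'" "n < 2 ^ k'" "2 ^ k' \<le> 2 * n" "k' \<le> n" "vars s1 8 = n * n + 1" by blast
    \<comment> \<open>The inequalities \<open>n < 2 ^ k\<close> and \<open>2 ^ k \<le> 2 * n\<close>
      determine \<open>k\<close>, so the value computed by the program is the given one.\<close>
    have p: "(2::nat) ^ k < 2 ^ Suc k'" "(2::nat) ^ k' < 2 ^ Suc k" using k k' by (simp_all only: power_Suc)
    have "k < Suc k'" by (rule power_less_imp_less_exp[OF _ p(1)]) simp
    moreover have "k' < Suc k" by (rule power_less_imp_less_exp[OF _ p(2)]) simp
    ultimately have kk: "k' = k" by simp
    note v1 = k'[unfolded kk]
    have env1: "env s1" by (rule env_frame[OF fr1 env])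
    have t1: "tape s1 = t" "outs s1 = []" using fr1 t out unfolding frame_def by (simp_all add: sub)
    have "hoare ?c2 s1 (k * (3000 * (n + 1) * (n + 1) + 7) + 5) (\<lambda>s'. best_order s' \<and> vars s' 8 \<le> n * n \<and> (\<forall>i<k. vars s' 8 \<le> ?C i))"
      using v1 t t1 by (intro attempts_correct[OF env1]) simp_all
    then show "hoare (?c2 ;; setup_blocks ;; For 14 (Var 10) emit_level) s1
        (k * (3000 * (n + 1) * (n + 1) + 7) + 5 + (200 * (n + 1) * (n + 1) + (k * (900 * (n + 1) * (n + 1) + 7) + 5))) ?Q"
    proof (rule hoare_Seq)
      fix s2 assume 2: "best_order s2 \<and> vars s2 8 \<le> n * n \<and> (\<forall>i<k. vars s2 8 \<le> ?C i)" and fr2: "frame ?c2 s1 s2"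
      have env2: "env s2" by (rule env_frame[OF fr2 env1])
      have v2: "vars s2 10 = k" "vars s2 11 = 2 ^ k" "outs s2 = []" using fr2 v1 t1 unfolding frame_def by (simp_all add: sub)
      obtain ord where ord: "distinct ord" "set ord = {..<n}" "\<forall>j<n. arrs s2 11 j = ord ! j" "crossings n a ord = vars s2 8"
        using 2 unfolding best_order_def by blast
      have len: "length ord = n" using distinct_card[OF ord(1)] ord(2) by simp
      show "hoare (setup_blocks ;; For 14 (Var 10) emit_level) s2 (200 * (n + 1) * (n + 1) + (k * (900 * (n + 1) * (n + 1) + 7) + 5)) ?Q"
      proof (rule hoare_Seq[OF setup_blocks_correct[OF env2 v2(2) k(2) ord(1,2) len ord(3)]])
        fix s3 assume "\<exists>ps. (\<forall>j<n. ps (ord ! j) = j) \<and> block_state ord ps k 0 s3" and fr3: "frame setup_blocks s2 s3"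
        then obtain ps where ps: "\<forall>j<n. ps (ord ! j) = j" "block_state ord ps k 0 s3" by blast
        have env3: "env s3" by (rule env_frame[OF fr3 env2])
        have v3: "vars s3 10 = k" "outs s3 = []" using fr3 v2 unfolding frame_def by (simp_all add: sub)
        let ?I = "\<lambda>l s'. block_state ord ps k l s' \<and> outs s' = concat (map encode_parts (parts n a ord ps (blocks k l)))"
        have "hoare (For 14 (Var 10) emit_level) s3 (k * (900 * (n + 1) * (n + 1) + 7) + 5) (?I k)"
        proof (rule hoare_For_const[where T = "900 * (n + 1) * (n + 1)" and b = k and I = ?I])
          have "k \<le> M" using v1(5) less_ok(8) by (rule le_trans)
          then show "aok (Var 10) s3" "aval (Var 10) s3 = k" using v3 by (simp_all add: envD env3)
          show "?I 0 s3" using ps v3 by (simp add: blocks_def parts_def)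
          fix l s' assume l: "l < k" and I: "?I l s'" and fr: "frame (For 14 (Var 10) emit_level) s3 s'"
          have "env (set_var 14 l s')" using env_frame[OF fr env3] by simp
          moreover have "block_state ord ps k l (set_var 14 l s')" using I unfolding block_state_def by simp
          ultimately show "hoare emit_level (set_var 14 l s') (900 * (n + 1) * (n + 1)) (?I (Suc l))"
            using I l by (intro emit_level_correct[OF _ _ l k(2) ord(2) len]) simp_all
        qed simp
        then show "hoare (For 14 (Var 10) emit_level) s3 (k * (900 * (n + 1) * (n + 1) + 7) + 5) ?Q"
        proof (rule hoare_weaken)
          fix s' assume "?I k s'"
          moreover have "\<forall>i<k. crossings n a ord \<le> ?C i" using 2 ord(4) by simp
          ultimately show "?Q s'" using len ord(2) ps(1) by blast
        qed simp
      qed simp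
    qed simp
  next
    have "40 * n + 40 \<le> 40 * (n + 1) * (n + 1)" by (simp add: distrib_left)
    moreover have "k * 14 \<le> 14 * (k * ((n + 1) * (n + 1)))" by (simp add: distrib_left distrib_right)
    moreover have "10 \<le> 10 * (n + 1) * (n + 1)" by simp
    ultimately show "40 * n + 40 + (k * (3000 * (n + 1) * (n + 1) + 7) + 5 + (200 * (n + 1) * (n + 1) + (k * (900 * (n + 1) * (n + 1) + 7) + 5)))
      \<le> 5000 * (k + 1) * (n + 1) * (n + 1)"
      by (simp only: distrib_left distrib_right mult.assoc mult_1_left mult_1_right mult.left_commute[of k])
  qed
qed

end

section \<open>From the loop program to halting runs of the machine\<close>

section \<open>Running the program\<close>

text \<open>The leading instruction puts \<open>n * n\<close>, where the arrays begin, into register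
  1; the compiled code therefore starts at address 1.\<close>

definition algorithm :: program where
  "algorithm = Arith Mul (Suc 0) 0 0 # ccomp main 0 1"

definition levels :: "nat \<Rightarrow> nat" where
  "levels n = (LEAST k. n < 2 ^ k)"

definition time_bound :: "nat \<Rightarrow> nat" where
  "time_bound n = 5000 * (levels n + 1) * (n + 1) * (n + 1) + 1"

lemma less_levels: "n < 2 ^ levels n"
  unfolding levels_def by (rule LeastI[of _ n]) (rule less_exp)

lemma power_le_if_less_levels: "j < levels n \<Longrightarrow> 2 ^ j \<le> n"
  unfolding levels_def using not_less_Least by (metis not_le)

lemma levels_pos: "0 < n \<Longrightarrow> 0 < levels n"
  using less_levels[of n] by (cases "levels n") auto

lemma power_levels_le: "0 < n \<Longrightarrow> 2 ^ levels n \<le> 2 * n"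
proof -
  assume "0 < n"
  then obtain j where j: "levels n = Suc j" using levels_pos[of n] by (cases "levels n") auto
  then show ?thesis using power_le_if_less_levels[of j n] by simp
qed

text \<open>The exponent 10 leaves a factor \<open>(n + 2) ^ 8 \<ge> 3 ^ 8 = 6561\<close> to absorb
  the constant 1000, already for \<open>n = 1\<close>.\<close>

lemma word_bound: "0 < n \<Longrightarrow> 1000 * (n * n) + 1000 * n + 1000 \<le> word_max 10 n"
proof -
  assume n: "0 < n"
  have "3 ^ 8 \<le> (n + 2) ^ 8" using n by (intro power_mono) auto
  then have "6561 * (n + 2) ^ 2 \<le> (n + 2) ^ 8 * (n + 2) ^ 2" by (intro mult_le_mono1) simp
  also have "\<dots> = word_max 10 n" by (simp add: word_max_def flip: power_add)
  finally have "6561 * (n + 2) ^ 2 \<le> word_max 10 n" .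
  moreover have "1000 * (n * n) + 1000 * n + 1000 \<le> 6561 * (n + 2) ^ 2" by (simp add: power2_eq_square algebra_simps)
  ultimately show ?thesis by linarith
qed

definition adjacent :: "nat ugraph \<Rightarrow> nat \<Rightarrow> nat \<Rightarrow> bool" where
  "adjacent G u v \<longleftrightarrow> {u, v} \<in> edges G"

abbreviation "sizes n \<equiv> sample_sizes n (Suc (levels n))"
abbreviation "segment n i t \<equiv> drop (i * draws (sizes n)) t"
abbreviation "clustering_cost n a t \<equiv> cost_of (rounds n a (sizes n) (start t))"

definition start_state :: "nat ugraph \<Rightarrow> nat list \<Rightarrow> loop_state" where
  "start_state G t = (let n = card (verts G) in
     \<lparr>vsize = n, vadj = (\<lambda>u v. of_bool (adjacent G u v)), wmax = word_max 10 n, vars = (\<lambda>_. 0),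
      arrs = (\<lambda>_ _. 0), tape = t, outs = []\<rparr>)"

text \<open>Purely deterministic: every sufficiently long tape yields a decomposition, and its size
  is bounded through the cost of each of the \<open>levels n\<close> segments, so a single good
  segment suffices.\<close>

lemma algorithm_correct:
  assumes G: "simple_graph G" "verts G = {0..<n}" and n: "0 < n"
    and t: "levels n * draws (sizes n) \<le> length t" "set t \<subseteq> {..<n}"
  shows "\<exists>j\<le>time_bound n. \<exists>\<sigma> ys. (tape_step (word_max 10 n) algorithm ^^ j) (init_state G, t) = (\<sigma>, ys) \<and>
    halted algorithm \<sigma> \<and> (\<exists>\<B>. represents (outp \<sigma>) \<B> \<and> biclique_decomposition G \<B> \<and>
     (\<forall>i<levels n. cover_size \<B> \<le> levels n * (4 * n + 2 * clustering_cost n (adjacent G) (segment n i t))))"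
proof -
  let ?M = "word_max 10 n" and ?k = "levels n" and ?a = "adjacent G"
  let ?s = "start_state G t"
  interpret graph_input n ?a ?M by unfold_locales (use n word_bound in auto)
  have card: "card (verts G) = n" using G(2) by simp
  let ?\<sigma>0 = "init_state G"
  let ?\<sigma>1 = "?\<sigma>0\<lparr>pc := 1, regs := (regs ?\<sigma>0)(Suc 0 := n * n)\<rparr>"
  have nn: "n * n \<le> ?M" using word_bound[OF n] by linarith
  have "reach ?M algorithm 1 (?\<sigma>0, t) (?\<sigma>1, t)"
    using nn by (intro reach_step) (simp_all add: init_state_def card Let_def algorithm_def set_reg_def)
  moreover have "sim ?s ?\<sigma>1"
  proof -
    have "(u * n + v) div n = u" "(u * n + v) mod n = v" if "v < n" for u v using that by simp_all
    then show ?thesis using addr_bound[of _ n]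
      by (simp add: sim_def start_state_def init_state_def card Let_def vreg_def adjacent_def)
  qed
  moreover have "hoare main ?s (5000 * (?k + 1) * (n + 1) * (n + 1)) (\<lambda>s'. \<exists>ord ps. length ord = n \<and> set ord = {..<n} \<and> (\<forall>j<n. ps (ord ! j) = j) \<and>
     outs s' = concat (map encode_parts (parts n ?a ord ps (blocks ?k ?k))) \<and>
     (\<forall>i<?k. crossings n ?a ord \<le> 2 * clustering_cost n ?a (segment n i t)))"
    by (rule main_correct)
      (use t less_levels power_levels_le[OF n] in \<open>simp_all add: env_def start_state_def card Let_def\<close>)
  then obtain ord ps where h: "cok main ?s" "cost main ?s \<le> 5000 * (?k + 1) * (n + 1) * (n + 1)"
    "length ord = n" "set ord = {..<n}" "\<forall>j<n. ps (ord ! j) = j"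
    "outs (sem main ?s) = concat (map encode_parts (parts n ?a ord ps (blocks ?k ?k)))"
    "\<forall>i<?k. crossings n ?a ord \<le> 2 * clustering_cost n ?a (segment n i t)"
    unfolding hoare_def by blast
  have code: "code_at algorithm (pc ?\<sigma>1) (ccomp main 0 (pc ?\<sigma>1))"
    by (simp add: algorithm_def code_at_def)
  have wm: "wmax ?s = ?M" "tape ?s = t" by (simp_all add: start_state_def card Let_def)
  obtain j \<sigma> where j: "j \<le> cost main ?s" "reach ?M algorithm j (?\<sigma>1, t) (\<sigma>, tape (sem main ?s))"
    "sim (sem main ?s) \<sigma>" "pc \<sigma> = 1 + clen main"
    using ccomp_correct[OF code \<open>sim ?s ?\<sigma>1\<close> h(1)] unfolding ends_in_def wm by auto
  have "reach ?M algorithm (1 + j) (?\<sigma>0, t) (\<sigma>, tape (sem main ?s))"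
    using \<open>reach ?M algorithm 1 (?\<sigma>0, t) (?\<sigma>1, t)\<close> j(2) by (rule reach_trans)
  then have run: "(tape_step ?M algorithm ^^ (1 + j)) (?\<sigma>0, t) = (\<sigma>, tape (sem main ?s))" unfolding reach_def .
  have halt: "halted algorithm \<sigma>" using j(4) by (simp add: halted_def algorithm_def)
  interpret ordered_graph G n ?a ord ps ?k
    by unfold_locales (use G h less_levels in \<open>auto simp: adjacent_def\<close>)
  have "outp \<sigma> = concat (map encode_parts (parts n ?a ord ps (blocks ?k ?k)))"
    using j(3) h(6) by (simp add: sim_def)
  then have rep: "represents (outp \<sigma>) bicliques" unfolding represents_def bicliques_def by blast
  have "cover_size bicliques \<le> ?k * (4 * n + 2 * clustering_cost n ?a (segment n i t))" if "i < ?k" for i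
  proof -
    have "cover_size bicliques \<le> ?k * 2 ^ ?k + ?k * (crossings n ?a ord + 2 * n)"
      using cover_size_le by (simp add: crossings_def)
    also have "\<dots> \<le> ?k * (2 * n) + ?k * (2 * clustering_cost n ?a (segment n i t) + 2 * n)"
      using h(7) that power_levels_le[OF n] by (intro add_mono mult_le_mono2) auto
    also have "\<dots> = ?k * (4 * n + 2 * clustering_cost n ?a (segment n i t))" by (simp add: distrib_left)
    finally show ?thesis .
  qed
  moreover have "1 + j \<le> time_bound n" using j(1) h(2) unfolding time_bound_def by linarith
  ultimately show ?thesis using run halt rep decomposition by blast
qed

lemma keeps_size_algorithm: "ins \<in> set algorithm \<Longrightarrow> keeps_size ins"
  unfolding algorithm_def by (auto intro: keeps_size_ccomp)

section \<open>Independent repetitions and Markov's inequality\<close>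

section \<open>Probability of success\<close>

text \<open>The segments are disjoint and hence independent; the remaining \<open>r\<close> cells
  are free.\<close>

lemma card_all_segments:
  assumes "X \<subseteq> tapes n D"
  shows "card {t\<in>tapes n (k * D + r). \<forall>i<k. take D (drop (i * D) t) \<in> X} = card X ^ k * n ^ r"
proof (induction k)
  case 0
  have "{t \<in> tapes n r. True} = tapes n r" by simp
  then show ?case by simp
next
  case (Suc k)
  let ?P = "\<lambda>k t. \<forall>i<k. take D (drop (i * D) t) \<in> X"
  have card: "card {t\<in>tapes n m. Q t} = (\<Sum>t\<in>tapes n m. of_bool (Q t))" for m and Q :: "nat list \<Rightarrow> bool"
    by (simp add: of_bool_def sum.If_cases Int_def)
  have split: "?P (Suc k) (s @ t) \<longleftrightarrow> s \<in> X \<and> ?P k t" if "s \<in> tapes n D" for s t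
  proof -
    have "length s = D" using that by (simp add: tapes_def)
    then have "take D (drop (Suc i * D) (s @ t)) = take D (drop (i * D) t)" for i by simp
    moreover have "take D (drop (0 * D) (s @ t)) = s" using \<open>length s = D\<close> by simp
    ultimately show ?thesis by (metis (no_types, lifting) less_Suc_eq_0_disj zero_less_Suc)
  qed
  have "card {t\<in>tapes n (Suc k * D + r). ?P (Suc k) t} =
      (\<Sum>s\<in>tapes n D. \<Sum>t\<in>tapes n (k * D + r). of_bool (?P (Suc k) (s @ t)))"
    unfolding card using sum_tapes_add[of "\<lambda>t. of_bool (?P (Suc k) t)" n D "k * D + r"] by (simp only: mult_Suc add.assoc)
  also have "\<dots> = (\<Sum>s\<in>tapes n D. \<Sum>t\<in>tapes n (k * D + r). of_bool (s \<in> X) * of_bool (?P k t))"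
    by (intro sum.cong refl) (simp only: split of_bool_conj)
  also have "\<dots> = (\<Sum>s\<in>tapes n D. of_bool (s \<in> X)) * (\<Sum>t\<in>tapes n (k * D + r). of_bool (?P k t))"
    by (simp only: sum_product)
  also have "(\<Sum>s\<in>tapes n D. of_bool (s \<in> X)) = card X"
  proof -
    have "tapes n D \<inter> X = X" using assms by blast
    then show ?thesis by (simp add: of_bool_def sum.If_cases)
  qed
  also have "(\<Sum>t\<in>tapes n (k * D + r). of_bool (?P k t)) = card X ^ k * n ^ r" using Suc unfolding card .
  finally show ?case by simp
qed

lemma card_markov:
  fixes f :: "nat list \<Rightarrow> nat"
  assumes "(\<Sum>t\<in>tapes n D. real (f t)) \<le> real n ^ D * b" "0 < b"
  shows "2 * card {t\<in>tapes n D. 2 * b < real (f t)} \<le> n ^ D"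
proof -
  let ?X = "{t\<in>tapes n D. 2 * b < real (f t)}"
  have "real (card ?X) * (2 * b) = (\<Sum>t\<in>?X. 2 * b)" by simp
  also have "\<dots> \<le> (\<Sum>t\<in>?X. real (f t))" by (intro sum_mono) simp
  also have "\<dots> \<le> (\<Sum>t\<in>tapes n D. real (f t))" by (intro sum_mono2) auto
  also have "\<dots> \<le> real n ^ D * b" by (rule assms)
  finally have "(2 * real (card ?X)) * b \<le> real n ^ D * b" by (simp add: algebra_simps)
  then have "2 * real (card ?X) \<le> real n ^ D" using assms(2) by simp
  then have "real (2 * card ?X) \<le> real (n ^ D)" by simp
  then show ?thesis by (simp only: of_nat_le_iff)
qed

lemma clustering_cost_take:
  assumes "draws (sizes n) \<le> length t"
  shows "clustering_cost n a t = clustering_cost n a (take (draws (sizes n)) t)"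
proof -
  let ?D = "draws (sizes n)"
  obtain \<rho> L c t' where r: "rounds n a (sizes n) (start (take ?D t)) = (\<rho>, L, c, t')" by (metis prod_cases4)
  have "rounds n a (sizes n) (start (take ?D t @ drop ?D t)) = (\<rho>, L, c, t' @ drop ?D t)"
    using rounds_tape[of "sizes n" "take ?D t" n a "\<lambda>v. v" "\<lambda>v. [v]" 0 "drop ?D t"] assms r by simp
  then show ?thesis using r by simp
qed

text \<open>The size can exceed the bound only if all \<open>levels n\<close> segments are bad, each
  with probability at most 1/2 by Markov's inequality; and \<open>n < 2 ^ levels n\<close>. The 4 in
  front of \<open>b\<close> is a 2 from Markov's inequality times the 2 relating alternations to
  clustering costs.\<close>

lemma success_prob_size:
  assumes G: "simple_graph G" "verts G = {0..<n}" and n: "0 < n"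
    and b: "(\<Sum>t\<in>tapes n (draws (sizes n)). real (clustering_cost n (adjacent G) t)) \<le> real n ^ draws (sizes n) * b" "0 < b"
  shows "success_prob algorithm 10 (time_bound n) G
    (\<lambda>\<B>. biclique_decomposition G \<B> \<and> real (cover_size \<B>) \<le> real (levels n) * (4 * real n + 4 * b)) \<ge> 1 - 1 / real n"
proof -
  let ?D = "draws (sizes n)" and ?k = "levels n"
  \<comment> \<open>The tape is longer than what is read, because \<open>run_eq_tape\<close> asks
    for at least as many cells as time steps.\<close>
  let ?N = "?k * ?D + time_bound n"
  let ?f = "clustering_cost n (adjacent G)"
  define X where "X = {t\<in>tapes n ?D. 2 * b < real (?f t)}"
  define Bad where "Bad = {t\<in>tapes n ?N. \<forall>i<?k. take ?D (drop (i * ?D) t) \<in> X}"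
  let ?A = "tapes n ?N - Bad"
  have "card Bad = card X ^ ?k * n ^ time_bound n"
    unfolding Bad_def by (rule card_all_segments) (auto simp: X_def)
  then have "2 ^ ?k * card Bad = (2 * card X) ^ ?k * n ^ time_bound n" by (simp add: power_mult_distrib)
  also have "\<dots> \<le> (n ^ ?D) ^ ?k * n ^ time_bound n"
    using card_markov[OF b] unfolding X_def by (intro mult_le_mono1 power_mono) auto
  also have "\<dots> = n ^ ?N" by (simp add: power_add mult.commute flip: power_mult)
  finally have bad: "2 ^ ?k * card Bad \<le> n ^ ?N" .
  have "n * card Bad \<le> 2 ^ ?k * card Bad" using less_levels[of n] by (intro mult_le_mono1) simp
  then have "real (n * card Bad) \<le> real (n ^ ?N)" using bad by (intro of_nat_mono) (rule le_trans)
  then have bad': "real (card Bad) / real n ^ ?N \<le> 1 / real n" using n by (simp add: field_simps)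
  have "card ?A = n ^ ?N - card Bad" by (subst card_Diff_subset) (auto simp: Bad_def)
  moreover have "card Bad \<le> n ^ ?N" using card_mono[of "tapes n ?N" Bad] by (simp add: Bad_def)
  ultimately have "real (card ?A) / real n ^ ?N = 1 - real (card Bad) / real n ^ ?N"
    using n by (simp add: of_nat_diff diff_divide_distrib)
  then have "1 - 1 / real n \<le> real (card ?A) / real n ^ ?N" using bad' by simp
  also have "\<dots> \<le> success_prob algorithm 10 (time_bound n) G
    (\<lambda>\<B>. biclique_decomposition G \<B> \<and> real (cover_size \<B>) \<le> real (levels n) * (4 * real n + 4 * b))"
  proof (rule success_prob_ge[OF keeps_size_algorithm n])
    show "card (verts G) = n" using G(2) by simp
    show "time_bound n \<le> ?N" by simp
    show "?A \<subseteq> tapes n ?N" by blast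
    fix t assume t: "t \<in> ?A"
    then have len: "length t = ?N" and set: "set t \<subseteq> {..<n}" by (auto simp: tapes_def)
    obtain i where i: "i < ?k" "take ?D (drop (i * ?D) t) \<notin> X" using t unfolding Bad_def by blast
    have "Suc i * ?D \<le> ?k * ?D" using i(1) by (intro mult_le_mono1) simp
    then have D: "?D \<le> length (drop (i * ?D) t)" unfolding length_drop len by simp
    have "set (take ?D (drop (i * ?D) t)) \<subseteq> set t" by (meson order_trans set_drop_subset set_take_subset)
    then have "take ?D (drop (i * ?D) t) \<in> tapes n ?D" using set D by (simp add: tapes_def)
    then have "real (?f (take ?D (drop (i * ?D) t))) \<le> 2 * b" using i(2) unfolding X_def by simp
    then have f: "real (?f (segment n i t)) \<le> 2 * b" using clustering_cost_take[OF D] by simp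
    have tl: "?k * ?D \<le> length t" unfolding len by simp
    from algorithm_correct[OF G n tl set]
    obtain j \<sigma> ys \<B> where j: "j \<le> time_bound n" "(tape_step (word_max 10 n) algorithm ^^ j) (init_state G, t) = (\<sigma>, ys)"
      "halted algorithm \<sigma>" "represents (outp \<sigma>) \<B>" "biclique_decomposition G \<B>"
      "\<forall>i<?k. cover_size \<B> \<le> ?k * (4 * n + 2 * ?f (segment n i t))" by blast
    have "real (cover_size \<B>) \<le> real (?k * (4 * n + 2 * ?f (segment n i t)))"
      using j(6) i(1) by (intro of_nat_mono) blast
    also have "\<dots> = real ?k * (4 * real n + 2 * real (?f (segment n i t)))" by simp
    also have "\<dots> \<le> real ?k * (4 * real n + 4 * b)" using f by (intro mult_left_mono) auto
    finally show "\<exists>j\<le>time_bound n. \<exists>\<sigma> ys. (tape_step (word_max 10 n) algorithm ^^ j) (init_state G, t) = (\<sigma>, ys) \<and>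
       halted algorithm \<sigma> \<and> (\<exists>\<B>. represents (outp \<sigma>) \<B> \<and> biclique_decomposition G \<B> \<and>
         real (cover_size \<B>) \<le> real ?k * (4 * real n + 4 * b))"
      using j(1-5) by blast
  qed
  finally show ?thesis .
qed

text \<open>Chance affects only the size, so all tapes count as successes.\<close>

lemma success_prob_decomposition:
  assumes G: "simple_graph G" "verts G = {0..<n}" and n: "0 < n"
  shows "success_prob algorithm 10 (time_bound n) G (biclique_decomposition G) \<ge> 1"
proof -
  let ?N = "levels n * draws (sizes n) + time_bound n"
  have "real (card (tapes n ?N)) / real n ^ ?N \<le> success_prob algorithm 10 (time_bound n) G (biclique_decomposition G)"
  proof (rule success_prob_ge[OF keeps_size_algorithm n])
    fix t assume "t \<in> tapes n ?N"
    then have "levels n * draws (sizes n) \<le> length t" "set t \<subseteq> {..<n}" by (auto simp: tapes_def)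
    from algorithm_correct[OF G n this]
    show "\<exists>j\<le>time_bound n. \<exists>\<sigma> ys. (tape_step (word_max 10 n) algorithm ^^ j) (init_state G, t) = (\<sigma>, ys) \<and>
       halted algorithm \<sigma> \<and> (\<exists>\<B>. represents (outp \<sigma>) \<B> \<and> biclique_decomposition G \<B>)" by blast
  qed (use G in simp_all)
  then show ?thesis using n by simp
qed

section \<open>Expected cost and asymptotics under polynomial neighborhood complexity\<close>

section \<open>Graphs of bounded neighborhood complexity\<close>

lemma card_traces_le_nbh_complexity:
  assumes "finite (verts G)" "C \<subseteq> verts G"
  shows "card ((\<lambda>v. nbhd G v \<inter> C) ` verts G) \<le> nbh_complexity G (card C)"
  unfolding nbh_complexity_def
proof (rule Max_ge)
  let ?S = "{card {nbhd G v \<inter> D |v. v \<in> verts G} |D. D \<subseteq> verts G \<and> card D = card C}"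
  have "?S \<subseteq> (\<lambda>D. card {nbhd G v \<inter> D |v. v \<in> verts G}) ` Pow (verts G)" by blast
  then show "finite ?S" using assms(1) by (meson finite_Pow_iff finite_imageI finite_subset)
  have "(\<lambda>v. nbhd G v \<inter> C) ` verts G = {nbhd G v \<inter> C |v. v \<in> verts G}" by blast
  then show "card ((\<lambda>v. nbhd G v \<inter> C) ` verts G) \<in> ?S" using assms(2) by auto
qed

lemma adjacent_trace: "{x\<in>C. adjacent G u x} = nbhd G u \<inter> C"
  by (auto simp: adjacent_def nbhd_def)

text \<open>Exponentials outgrow powers. The resulting \<open>s\<close> depends only on
  \<open>c\<close> and \<open>d\<close>, and it will bound the VC dimension, since a shattered set
  of \<open>s\<close> columns has \<open>2 ^ s\<close> traces.\<close>

lemma powr_less_power_2: "\<exists>s. c * real s powr d < 2 ^ s \<and> 0 < s"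
proof -
  have "((\<lambda>s. c * real s powr d / 2 powr real s) \<longlongrightarrow> 0) sequentially" by real_asymp
  then have "eventually (\<lambda>s. c * real s powr d / 2 powr real s < 1) sequentially"
    by (rule order_tendstoD) simp
  then have "eventually (\<lambda>s. c * real s powr d / 2 powr real s < 1 \<and> 0 < s) sequentially"
    using eventually_gt_at_top[of "0::nat"] by (rule eventually_conj)
  then obtain s where "c * real s powr d / 2 powr real s < 1" "0 < s"
    by (metis (mono_tags, lifting) eventually_sequentially order_refl)
  then have "c * real s powr d < 2 ^ s \<and> 0 < s" by (simp add: divide_less_eq powr_realpow)
  then show ?thesis ..
qed

text \<open>The case \<open>m = 0\<close> is separate because the empty sample still has one trace,
  whereas \<open>0 powr d = 0\<close>. The cap \<open>real n\<close> takes effect in the rounds with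
  large samples.\<close>

definition trace_bound :: "real \<Rightarrow> real \<Rightarrow> nat \<Rightarrow> nat \<Rightarrow> real" where
  "trace_bound c d n m = (if m = 0 then 1 else min (real n) (c * real m powr d))"

context
  fixes G :: "nat ugraph" and n :: nat and c d :: real
  assumes G: "simple_graph G" "verts G = {0..<n}" and n: "0 < n" and c: "0 < c" and d: "1 \<le> d"
    and nbh: "\<forall>m\<in>{1..n}. real (nbh_complexity G m) \<le> c * real m powr d"
begin

lemma card_traces_le:
  assumes "C \<subseteq> {..<n}" "C \<noteq> {}"
  shows "real (card ((\<lambda>u. {x\<in>C. adjacent G u x}) ` {..<n})) \<le> c * real (card C) powr d"
proof -
  have "card C \<le> n" "0 < card C" using assms card_mono[of "{..<n}" C] by (auto simp: card_gt_0_iff finite_subset)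
  then have "real (nbh_complexity G (card C)) \<le> c * real (card C) powr d" using nbh by simp
  moreover have "card ((\<lambda>v. nbhd G v \<inter> C) ` {0..<n}) \<le> nbh_complexity G (card C)"
    using card_traces_le_nbh_complexity[of G C] G(2) assms(1) by (simp add: atLeast0LessThan)
  ultimately show ?thesis unfolding adjacent_trace by (simp add: atLeast0LessThan)
qed

text \<open>The condition on \<open>s\<close> concerns sets of exactly \<open>s\<close> columns, so
  a larger shattered set is cut down first; subsets of shattered sets are shattered.\<close>

lemma vc_adjacent:
  assumes s: "c * real s powr d < 2 ^ s" "0 < s" "s \<le> n"
  shows "vc_at_most n (adjacent G) {..<n} s"
  unfolding vc_at_most_def
proof (intro allI impI)
  fix Y assume Y: "Y \<subseteq> {..<n}" "\<forall>T\<subseteq>Y. \<exists>u\<in>{..<n}. {x\<in>Y. adjacent G u x} = T"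
  show "card Y \<le> s"
  proof (rule ccontr)
    assume "\<not> card Y \<le> s"
    then obtain S where S: "S \<subseteq> Y" "card S = s" by (meson nat_le_linear obtain_subset_with_card_n)
    have fin: "finite S" using S(1) Y(1) by (meson finite_lessThan finite_subset)
    have "Pow S \<subseteq> (\<lambda>u. {x\<in>S. adjacent G u x}) ` {..<n}"
    proof
      fix T assume "T \<in> Pow S"
      then have T: "T \<subseteq> S" by simp
      then obtain u where u: "u \<in> {..<n}" "{x\<in>Y. adjacent G u x} = T" using Y(2) S(1) by (meson order_trans)
      have "{x\<in>S. adjacent G u x} = T" using u(2) S(1) T by blast
      then show "T \<in> (\<lambda>u. {x\<in>S. adjacent G u x}) ` {..<n}" using u(1) by blast
    qed
    then have "card (Pow S) \<le> card ((\<lambda>u. {x\<in>S. adjacent G u x}) ` {..<n})" by (intro card_mono) auto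
    then have "2 ^ s \<le> card ((\<lambda>u. {x\<in>S. adjacent G u x}) ` {..<n})" using card_Pow[OF fin] S(2) by simp
    then have "real (2 ^ s) \<le> real (card ((\<lambda>u. {x\<in>S. adjacent G u x}) ` {..<n}))" by (rule of_nat_mono)
    moreover have "real (card ((\<lambda>u. {x\<in>S. adjacent G u x}) ` {..<n})) \<le> c * real (card S) powr d"
      using S s(2) Y(1) by (intro card_traces_le) auto
    ultimately have "real (2 ^ s) \<le> c * real s powr d" unfolding S(2) by (rule order_trans)
    then show False using s(1) by simp
  qed
qed

lemma sum_clustering_cost_le:
  assumes s: "c * real s powr d < 2 ^ s" "0 < s" "s \<le> n"
  shows "(\<Sum>t\<in>tapes n (draws (sizes n)). real (clustering_cost n (adjacent G) t)) \<le>
    real n ^ draws (sizes n) * cost_bound n s (trace_bound c d n) (real n) (sizes n)"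
proof -
  have g: "real (card ((\<lambda>u. {x\<in>set xs. adjacent G u x}) ` {..<n})) \<le> trace_bound c d n (length xs)"
    if xs: "set xs \<subseteq> {..<n}" for xs
  proof (cases "xs = []")
    case True
    have "(\<lambda>u. {x\<in>set xs. adjacent G u x}) ` {..<n} = {{}}" using True n by auto
    then show ?thesis using True by (simp add: trace_bound_def)
  next
    case False
    have "real (card ((\<lambda>u. {x\<in>set xs. adjacent G u x}) ` {..<n})) \<le> c * real (card (set xs)) powr d"
      using xs False by (intro card_traces_le) auto
    \<comment> \<open>Sampling is with replacement, so there may be fewer distinct columns than
      draws.\<close>
    also have "\<dots> \<le> c * real (length xs) powr d"
      using c d card_length[of xs] by (intro mult_left_mono powr_mono2) auto
    finally have "real (card ((\<lambda>u. {x\<in>set xs. adjacent G u x}) ` {..<n})) \<le> c * real (length xs) powr d" .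
    moreover have "card ((\<lambda>u. {x\<in>set xs. adjacent G u x}) ` {..<n}) \<le> n"
      using card_image_le[of "{..<n}"] by simp
    ultimately show ?thesis using False by (simp add: trace_bound_def)
  qed
  have "(\<Sum>t\<in>tapes n (draws (sizes n)). real (clustering_cost n (adjacent G) t)) \<le>
    real n ^ draws (sizes n) * (real 0 + cost_bound n s (trace_bound c d n) (real n) (sizes n))"
  proof (rule sum_rounds_cost[OF start_invariant(1) _ vc_adjacent[OF s] g])
    show "real (card (active n (\<lambda>v. v))) \<le> real n" by (simp add: active_def)
  qed
  then show ?thesis by simp
qed

end

lemma cost_bound_eq:
  "cost_bound n s g r ms = 4 * real n * real s *
     (\<Sum>i<length ms. (case i of 0 \<Rightarrow> r | Suc j \<Rightarrow> g (ms ! j)) / real (Suc (ms ! i)))"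
proof (induction ms arbitrary: r)
  case (Cons m ms)
  have "(\<Sum>i<length ms. (case i of 0 \<Rightarrow> g m | Suc j \<Rightarrow> g (ms ! j)) / real (Suc (ms ! i))) =
      (\<Sum>i<length ms. g ((m # ms) ! i) / real (Suc (ms ! i)))"
    by (intro sum.cong refl) (auto split: nat.split)
  then show ?case by (simp add: Cons sum.lessThan_Suc_shift distrib_left del: sum.lessThan_Suc)
qed simp

text \<open>The number of representatives in a round is governed by the previous sample, about twice
  as large; \<open>Suc (m div 2) \<ge> m / 2\<close> turns this mismatch into the factor 2. The
  leading 1 accounts for the first round, with \<open>n\<close> representatives and \<open>n\<close>
  sampled columns.\<close>

lemma cost_bound_sizes_le:
  assumes n: "0 < n" and c: "0 < c"
  shows "cost_bound n s (trace_bound c d n) (real n) (sizes n) \<le>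
    4 * real n * real s * (1 + (\<Sum>j<levels n. 2 * min (real n / real (n div 2 ^ j)) (c * real (n div 2 ^ j) powr (d - 1))))"
proof -
  let ?m = "\<lambda>j. n div 2 ^ j"
  have nth: "sizes n ! j = ?m j" if "j < Suc (levels n)" for j
    using that unfolding sample_sizes_def by (simp del: upt_Suc)
  have len: "length (sizes n) = Suc (levels n)" by (simp add: sample_sizes_def)
  have ratio: "trace_bound c d n (?m j) / real (Suc (?m (Suc j))) \<le> 2 * min (real n / real (?m j)) (c * real (?m j) powr (d - 1))"
    if j: "j < levels n" for j
  proof -
    have "2 ^ j \<le> n" by (rule power_le_if_less_levels[OF j])
    then have pos: "0 < ?m j" by (simp add: div_greater_zero_iff)
    have "?m (Suc j) = ?m j div 2" by (simp add: div_mult2_eq[symmetric] mult.commute)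
    then have half: "real (?m j) / 2 \<le> real (Suc (?m (Suc j)))" by (simp add: field_simps)
    have tb: "trace_bound c d n (?m j) = min (real n) (c * real (?m j) powr d)" using pos by (simp add: trace_bound_def)
    have "trace_bound c d n (?m j) / real (Suc (?m (Suc j))) \<le> trace_bound c d n (?m j) / (real (?m j) / 2)"
      using half pos c unfolding tb by (intro divide_left_mono) (auto intro!: mult_pos_pos)
    also have "\<dots> = 2 * (min (real n) (c * real (?m j) powr d) / real (?m j))" by (simp add: tb)
    also have "\<dots> = 2 * min (real n / real (?m j)) (c * real (?m j) powr d / real (?m j))"
      using pos by (simp add: min_divide_distrib_right)
    also have "c * real (?m j) powr d / real (?m j) = c * real (?m j) powr (d - 1)"
      using pos by (simp add: powr_diff)
    finally show ?thesis .
  qed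
  have "cost_bound n s (trace_bound c d n) (real n) (sizes n) = 4 * real n * real s *
     (real n / real (Suc n) + (\<Sum>j<levels n. trace_bound c d n (?m j) / real (Suc (?m (Suc j)))))"
    unfolding cost_bound_eq len by (subst sum.lessThan_Suc_shift) (simp add: nth del: sum.lessThan_Suc)
  also have "\<dots> \<le> 4 * real n * real s * (1 + (\<Sum>j<levels n. 2 * min (real n / real (?m j)) (c * real (?m j) powr (d - 1))))"
    by (intro mult_left_mono add_mono sum_mono ratio) auto
  finally show ?thesis .
qed

text \<open>With exponent 1 the bound is the same in all rounds after the first, without geometric
  decay in either direction. This gives one of the two logarithms; the dyadic levels give the
  other.\<close>

lemma cost_bound_linear:
  assumes "0 < n" "0 < c"
  shows "cost_bound n s (trace_bound c 1 n) (real n) (sizes n) \<le> 4 * real n * real s * (1 + 2 * c * real (levels n))"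
proof -
  have "(\<Sum>j<levels n. 2 * min (real n / real (n div 2 ^ j)) (c * real (n div 2 ^ j) powr (1 - 1))) \<le> (\<Sum>j<levels n. 2 * c)"
  proof (intro sum_mono mult_left_mono)
    fix j assume "j \<in> {..<levels n}"
    then have "2 ^ j \<le> n" by (simp add: power_le_if_less_levels)
    then have "0 < n div 2 ^ j" by (simp add: div_greater_zero_iff)
    then show "min (real n / real (n div 2 ^ j)) (c * real (n div 2 ^ j) powr (1 - 1)) \<le> c" by simp
  qed simp
  then have "4 * real n * real s * (1 + (\<Sum>j<levels n. 2 * min (real n / real (n div 2 ^ j)) (c * real (n div 2 ^ j) powr (1 - 1)))) \<le>
      4 * real n * real s * (1 + 2 * c * real (levels n))" by (intro mult_left_mono) (simp_all add: mult.commute mult.left_commute)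
  then show ?thesis by (rule order_trans[OF cost_bound_sizes_le[OF assms]])
qed

text \<open>Two geometric sums, meeting at the sample size \<open>n powr (1 / d)\<close>.\<close>

lemma sum_min_le:
  fixes c d :: real
  assumes n: "0 < n" and c: "0 < c" and d: "1 < d"
  shows "(\<Sum>j<levels n. 2 * min (real n / real (n div 2 ^ j)) (c * real (n div 2 ^ j) powr (d - 1))) \<le>
    (8 + 2 * c / (1 - 2 powr (1 - d))) * real n powr (1 - 1 / d)"
proof -
  let ?N = "real n powr (1 - 1 / d)" and ?q = "2 powr (1 - d)"
  \<comment> \<open>\<open>?N < 2 ^ j\<close> means \<open>n / 2 ^ j < n powr (1 / d)\<close>: at
    level \<open>J\<close> the sample size drops below the point where, up to constants, the two
    terms of the minimum balance.\<close>
  define J where "J = (LEAST j. ?N < 2 ^ j)"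
  have J: "?N < 2 ^ J" unfolding J_def
  proof (rule LeastI_ex)
    show "\<exists>j. ?N < 2 ^ j" by (rule real_arch_pow) simp
  qed
  have q: "0 < ?q" "?q < 1" using d by (simp_all add: powr_less_one)
  have exp: "(real n powr (1 / d)) powr (d - 1) = ?N" using d by (simp add: powr_powr diff_divide_distrib)
  have N: "1 \<le> ?N" using n d by (intro ge_one_powr_ge_zero) auto
  have first: "(\<Sum>j<J. (2::real) ^ j) \<le> 2 * ?N"
  proof (cases J)
    case (Suc i)
    have "\<not> ?N < 2 ^ i" using not_less_Least[of i "\<lambda>j. ?N < 2 ^ j"] Suc unfolding J_def by simp
    then have "2 ^ J \<le> 2 * ?N" using Suc by simp
    moreover have "(\<Sum>j<J. (2::real) ^ j) = 2 ^ J - 1" by (simp add: geometric_sum)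
    ultimately show ?thesis by simp
  qed simp
  have small: "2 * min (real n / real (n div 2 ^ j)) (c * real (n div 2 ^ j) powr (d - 1)) \<le> 4 * 2 ^ j"
    if j: "j < levels n" for j
  proof -
    have "2 ^ j \<le> n" by (rule power_le_if_less_levels[OF j])
    then have pos: "0 < n div 2 ^ j" by (simp add: div_greater_zero_iff)
    have "n < 2 ^ j * Suc (n div 2 ^ j)" using dividend_less_times_div[of "2 ^ j" n] by simp
    also have "\<dots> \<le> 2 ^ j * (2 * (n div 2 ^ j))" using pos by (intro mult_le_mono2) simp
    finally have "n \<le> 2 * 2 ^ j * (n div 2 ^ j)" by simp
    then have "real n \<le> real (2 * 2 ^ j * (n div 2 ^ j))" by (rule of_nat_mono)
    then have "real n / real (n div 2 ^ j) \<le> 2 * 2 ^ j" using pos by (simp add: divide_le_eq)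
    then show ?thesis by (simp add: min.coboundedI1)
  qed
  \<comment> \<open>Beyond \<open>J\<close> each halving gains the factor
    \<open>2 powr (1 - d)\<close>, which is below 1 because \<open>d > 1\<close>.\<close>
  have large: "2 * min (real n / real (n div 2 ^ (J + i))) (c * real (n div 2 ^ (J + i)) powr (d - 1)) \<le> 2 * c * ?N * ?q ^ i" for i
  proof -
    have "real (n div 2 ^ (J + i)) \<le> real n / 2 ^ (J + i)" using of_nat_div_le_of_nat[of n "2 ^ (J + i)"] by simp
    also have "\<dots> = real n / 2 ^ J / 2 ^ i" by (simp add: power_add)
    also have "\<dots> \<le> real n / ?N / 2 ^ i" using J N n by (intro divide_right_mono divide_left_mono) (auto intro!: mult_pos_pos)
    also have "real n / ?N = real n powr (1 / d)" using n by (simp add: powr_diff)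
    finally have "real (n div 2 ^ (J + i)) powr (d - 1) \<le> (real n powr (1 / d) / 2 ^ i) powr (d - 1)"
      using d by (intro powr_mono2) auto
    also have "\<dots> = ?N / (2 ^ i) powr (d - 1)" by (simp add: powr_divide exp)
    also have "(2 ^ i) powr (d - 1) = (2 powr (d - 1)) ^ i"
      by (simp add: powr_realpow[symmetric] powr_powr mult.commute)
    also have "?N / (2 powr (d - 1)) ^ i = ?N * ?q ^ i"
    proof -
      have "?q = inverse (2 powr (d - 1))" by (simp flip: powr_minus)
      then show ?thesis by (simp add: power_inverse divide_inverse)
    qed
    finally have "c * real (n div 2 ^ (J + i)) powr (d - 1) \<le> c * (?N * ?q ^ i)" using c by (intro mult_left_mono) auto
    then show ?thesis by (simp add: min.coboundedI2)
  qed
  let ?f = "\<lambda>j. 2 * min (real n / real (n div 2 ^ j)) (c * real (n div 2 ^ j) powr (d - 1))"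
  have nonneg: "0 \<le> ?f j" for j using c by simp
  have "(\<Sum>j<levels n. ?f j) \<le> (\<Sum>j\<in>{..<levels n} \<inter> {..<J}. ?f j) + (\<Sum>j\<in>{..<levels n} - {..<J}. ?f j)"
    by (subst sum.union_disjoint[symmetric]) (auto simp: Int_Diff_Un simp del: lessThan_minus_lessThan)
  also have "(\<Sum>j\<in>{..<levels n} \<inter> {..<J}. ?f j) \<le> (\<Sum>j\<in>{..<levels n} \<inter> {..<J}. 4 * 2 ^ j)"
    by (intro sum_mono small) auto
  also have "\<dots> \<le> (\<Sum>j<J. 4 * 2 ^ j)" by (intro sum_mono2) auto
  also have "\<dots> = 4 * (\<Sum>j<J. 2 ^ j)" by (simp only: sum_distrib_left)
  also have "\<dots> \<le> 8 * ?N" using first by simp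
  also have "(\<Sum>j\<in>{..<levels n} - {..<J}. ?f j) \<le> (\<Sum>j\<in>(+) J ` {..<levels n}. ?f j)"
  proof (rule sum_mono2)
    show "{..<levels n} - {..<J} \<subseteq> (+) J ` {..<levels n}"
    proof
      fix j assume "j \<in> {..<levels n} - {..<J}"
      then have "j = J + (j - J)" "j - J < levels n" by auto
      then show "j \<in> (+) J ` {..<levels n}" by blast
    qed
  qed (use nonneg in auto)
  also have "\<dots> = (\<Sum>i<levels n. ?f (J + i))" by (subst sum.reindex) (auto simp: inj_on_def)
  also have "\<dots> \<le> (\<Sum>i<levels n. 2 * c * ?N * ?q ^ i)" by (intro sum_mono large)
  also have "\<dots> = 2 * c * ?N * (\<Sum>i<levels n. ?q ^ i)" by (simp only: sum_distrib_left)
  also have "\<dots> \<le> 2 * c * ?N * (1 / (1 - ?q))"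
  proof (intro mult_left_mono)
    have "(\<Sum>i<levels n. ?q ^ i) = (1 - ?q ^ levels n) / (1 - ?q)" using q d by (simp add: sum_gp_strict)
    also have "\<dots> \<le> 1 / (1 - ?q)" using q by (intro divide_right_mono) auto
    finally show "(\<Sum>i<levels n. ?q ^ i) \<le> 1 / (1 - ?q)" .
  qed (use c in auto)
  finally show ?thesis by (simp add: distrib_right)
qed

lemma cost_bound_superlinear:
  assumes "0 < n" "0 < c" "1 < d"
  shows "cost_bound n s (trace_bound c d n) (real n) (sizes n) \<le>
    4 * real n * real s * (1 + (8 + 2 * c / (1 - 2 powr (1 - d))) * real n powr (1 - 1 / d))"
  by (rule order_trans[OF cost_bound_sizes_le[OF assms(1,2)] mult_left_mono[OF add_left_mono[OF sum_min_le[OF assms]]]]) simp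

text \<open>From \<open>2 ^ levels n \<le> 2 * n\<close> together with
  \<open>2 / 3 \<le> ln 2 < 1 \<le> ln n\<close>; the last inequality is the reason for
  \<open>3 \<le> n\<close>.\<close>

lemma levels_le_ln:
  assumes "3 \<le> n"
  shows "real (levels n) \<le> 3 * ln (real n)"
proof -
  have "real (2 ^ levels n) \<le> real (2 * n)" using power_levels_le[of n] assms by (intro of_nat_mono) simp
  then have "ln (2 ^ levels n) \<le> ln (2 * real n)" using assms by simp
  then have "real (levels n) * ln 2 \<le> ln 2 + ln (real n)" using assms by (simp add: ln_realpow ln_mult)
  moreover have "1 \<le> ln (real n)" using assms exp_le by (subst ln_ge_iff) (auto intro: order_trans)
  moreover have "real (levels n) * (2 / 3) \<le> real (levels n) * ln 2"
    using ln2_ge_two_thirds by (intro mult_left_mono) auto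
  moreover have "ln (2::real) < 1" by (rule ln_2_less_1)
  ultimately show ?thesis by linarith
qed

text \<open>The number of dyadic levels costs one logarithm, whatever the exponent.\<close>

lemma size_bound_in_O:
  fixes h :: "nat \<Rightarrow> real"
  assumes "\<And>n. 3 \<le> n \<Longrightarrow> \<bar>4 * real n + 4 * B n\<bar> \<le> C * h n" "\<And>n. 3 \<le> n \<Longrightarrow> 0 \<le> h n"
  shows "(\<lambda>n. real (levels n) * (4 * real n + 4 * B n)) \<in> O(\<lambda>n. h n * ln (real n))"
proof (rule bigoI[of _ "3 * C"])
  show "\<forall>\<^sub>F n in sequentially. norm (real (levels n) * (4 * real n + 4 * B n)) \<le> 3 * C * norm (h n * ln (real n))"
    using eventually_ge_at_top[of "3::nat"]
  proof eventually_elim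
    case (elim n)
    have "norm (real (levels n) * (4 * real n + 4 * B n)) = real (levels n) * \<bar>4 * real n + 4 * B n\<bar>"
      by (simp add: abs_mult)
    also have "\<dots> \<le> (3 * ln (real n)) * (C * h n)"
      using elim by (intro mult_mono levels_le_ln assms) auto
    also have "\<dots> = 3 * C * norm (h n * ln (real n))" using assms(2)[OF elim] elim by simp
    finally show ?case .
  qed
qed

text \<open>Treats both regimes at once. The convergence is uniform over the graphs because the two
  thresholds, \<open>s \<le> n\<close> and \<open>1 / n < \<epsilon>\<close>, do not depend on the
  graph.\<close>

lemma whp_size:
  assumes d: "1 \<le> d" and c: "0 < c" and s: "c * real s powr d < 2 ^ s" "0 < s"
    and b: "\<And>n. 0 < n \<Longrightarrow> cost_bound n s (trace_bound c d n) (real n) (sizes n) \<le> b n" "\<And>n. 0 < n \<Longrightarrow> 0 < b n"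
  shows "whp (\<lambda>G. \<forall>m\<in>{1..card (verts G)}. real (nbh_complexity G m) \<le> c * real m powr d)
    (\<lambda>n G. success_prob algorithm 10 (time_bound n) G
      (\<lambda>\<B>. biclique_decomposition G \<B> \<and> real (cover_size \<B>) \<le> real (levels n) * (4 * real n + 4 * b n)))"
  unfolding whp_def
proof (intro allI impI)
  fix \<epsilon> :: real assume \<epsilon>: "\<epsilon> > 0"
  then have "eventually (\<lambda>n. 1 / real n < \<epsilon>) sequentially"
    by (intro order_tendstoD[OF lim_1_over_n]) 
  then show "\<forall>\<^sub>F n in sequentially. \<forall>G. simple_graph G \<and> verts G = {0..<n} \<and>
      (\<forall>m\<in>{1..card (verts G)}. real (nbh_complexity G m) \<le> c * real m powr d) \<longrightarrow>
      1 - \<epsilon> \<le> success_prob algorithm 10 (time_bound n) G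
      (\<lambda>\<B>. biclique_decomposition G \<B> \<and> real (cover_size \<B>) \<le> real (levels n) * (4 * real n + 4 * b n))"
    using eventually_ge_at_top[of s]
  proof eventually_elim
    case (elim n)
    show ?case
    proof (intro allI impI)
      fix G assume G: "simple_graph G \<and> verts G = {0..<n} \<and>
        (\<forall>m\<in>{1..card (verts G)}. real (nbh_complexity G m) \<le> c * real m powr d)"
      have n: "0 < n" using elim(2) s(2) by simp
      have nbh: "\<forall>m\<in>{1..n}. real (nbh_complexity G m) \<le> c * real m powr d" using G by simp
      have "(\<Sum>t\<in>tapes n (draws (sizes n)). real (clustering_cost n (adjacent G) t)) \<le>
          real n ^ draws (sizes n) * cost_bound n s (trace_bound c d n) (real n) (sizes n)"
        using G by (intro sum_clustering_cost_le[OF _ _ n c d nbh s elim(2)]) simp_all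
      also have "\<dots> \<le> real n ^ draws (sizes n) * b n" by (intro mult_left_mono b n) simp
      finally have "1 - 1 / real n \<le> success_prob algorithm 10 (time_bound n) G
        (\<lambda>\<B>. biclique_decomposition G \<B> \<and> real (cover_size \<B>) \<le> real (levels n) * (4 * real n + 4 * b n))"
        using G b(2)[OF n] by (intro success_prob_size n) simp_all
      then show "1 - \<epsilon> \<le> success_prob algorithm 10 (time_bound n) G
        (\<lambda>\<B>. biclique_decomposition G \<B> \<and> real (cover_size \<B>) \<le> real (levels n) * (4 * real n + 4 * b n))"
        using elim(1) by linarith
    qed
  qed
qed

lemma time_bound_in_O: "(\<lambda>n. real (time_bound n)) \<in> O(\<lambda>n. real n ^ 2 * ln (real n))"
proof (rule bigoI[of _ 80001])
  show "\<forall>\<^sub>F n in sequentially. norm (real (time_bound n)) \<le> 80001 * norm (real n ^ 2 * ln (real n))"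
    using eventually_ge_at_top[of "3::nat"]
  proof eventually_elim
    case (elim n)
    have ln: "1 \<le> ln (real n)" using elim exp_le by (subst ln_ge_iff) (auto intro: order_trans)
    have sq: "(real n + 1) * (real n + 1) \<le> 4 * real n ^ 2"
    proof -
      have "(real n + 1) * (real n + 1) \<le> (2 * real n) * (2 * real n)" using elim by (intro mult_mono) auto
      then show ?thesis by (simp add: power2_eq_square)
    qed
    have "real (levels n) + 1 \<le> 4 * ln (real n)" using levels_le_ln[OF elim] ln by linarith
    then have "(real (levels n) + 1) * ((real n + 1) * (real n + 1)) \<le> (4 * ln (real n)) * (4 * real n ^ 2)"
      using ln by (intro mult_mono[OF _ sq]) auto
    then have main: "(real (levels n) + 1) * ((real n + 1) * (real n + 1)) \<le> 16 * (real n ^ 2 * ln (real n))"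
      by (simp add: mult.commute)
    have one: "1 \<le> real n ^ 2 * ln (real n)" using mult_mono[of 1 "real n ^ 2" 1 "ln (real n)"] ln elim by simp
    have "real (time_bound n) = 5000 * ((real (levels n) + 1) * ((real n + 1) * (real n + 1))) + 1"
      by (simp add: time_bound_def algebra_simps)
    also have "\<dots> \<le> 5000 * (16 * (real n ^ 2 * ln (real n))) + real n ^ 2 * ln (real n)"
      using main one by (intro add_mono mult_left_mono) auto
    finally have "real (time_bound n) \<le> 80001 * (real n ^ 2 * ln (real n))" by (simp add: mult.commute)
    then show ?case using ln by simp
  qed
qed

theorem theorem1:
  shows "\<exists>(P :: program) (k :: nat) (T :: nat \<Rightarrow> nat).
    (\<lambda>n. real (T n)) \<in> O(\<lambda>n. real n ^ 2 * ln (real n)) \<and>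
    whp (\<lambda>G. True) (\<lambda>n G. success_prob P k (T n) G (biclique_decomposition G)) \<and>
    (\<forall>c d :: real. c > 0 \<and> d > 1 \<longrightarrow>
      (\<exists>S :: nat \<Rightarrow> real. S \<in> O(\<lambda>n. real n powr (2 - 1 / d) * ln (real n)) \<and>
        whp (\<lambda>G. \<forall>m\<in>{1..card (verts G)}. real (nbh_complexity G m) \<le> c * real m powr d)
          (\<lambda>n G. success_prob P k (T n) G
             (\<lambda>\<B>. biclique_decomposition G \<B> \<and> real (cover_size \<B>) \<le> S n)))) \<and>
    (\<forall>c :: real. c > 0 \<longrightarrow>
      (\<exists>S :: nat \<Rightarrow> real. S \<in> O(\<lambda>n. real n * ln (real n) ^ 2) \<and>
        whp (\<lambda>G. \<forall>m\<in>{1..card (verts G)}. real (nbh_complexity G m) \<le> c * real m)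
          (\<lambda>n G. success_prob P k (T n) G
             (\<lambda>\<B>. biclique_decomposition G \<B> \<and> real (cover_size \<B>) \<le> S n))))"
proof (intro exI[of _ algorithm] exI[of _ 10] exI[of _ time_bound] conjI time_bound_in_O allI impI)
  show "whp (\<lambda>G. True) (\<lambda>n G. success_prob algorithm 10 (time_bound n) G (biclique_decomposition G))"
    unfolding whp_def
  proof (intro allI impI)
    fix \<epsilon> :: real assume "\<epsilon> > 0"
    show "\<forall>\<^sub>F n in sequentially. \<forall>G. simple_graph G \<and> verts G = {0..<n} \<and> True \<longrightarrow>
        1 - \<epsilon> \<le> success_prob algorithm 10 (time_bound n) G (biclique_decomposition G)"
      using eventually_gt_at_top[of "0::nat"]
    proof eventually_elim
      case (elim n)
      show ?case
      proof (intro allI impI)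
        fix G assume "simple_graph G \<and> verts G = {0..<n} \<and> True"
        then have "1 \<le> success_prob algorithm 10 (time_bound n) G (biclique_decomposition G)"
          by (intro success_prob_decomposition elim) simp_all
        then show "1 - \<epsilon> \<le> success_prob algorithm 10 (time_bound n) G (biclique_decomposition G)"
          using \<open>\<epsilon> > 0\<close> by linarith
      qed
    qed
  qed
next
  fix c d :: real assume "c > 0 \<and> d > 1"
  then have c: "0 < c" and d: "1 < d" by auto
  obtain s where s: "c * real s powr d < 2 ^ s" "0 < s" using powr_less_power_2 by blast
  define C where "C = 8 + 2 * c / (1 - 2 powr (1 - d))"
  have "2 powr (1 - d) < (1::real)" using d by (simp add: powr_less_one)
  then have C: "0 \<le> C" using c unfolding C_def by simp
  \<comment> \<open>The summand 1 keeps \<open>b n\<close> positive for every \<open>n\<close>, as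
    Markov's inequality requires.\<close>
  define b where "b n = 4 * real n * real s * (1 + C * real n powr (1 - 1 / d)) + 1" for n
  let ?S = "\<lambda>n. real (levels n) * (4 * real n + 4 * b n)"
  have b_pos: "0 < b n" for n using C unfolding b_def by (intro add_nonneg_pos mult_nonneg_nonneg) auto
  have "whp (\<lambda>G. \<forall>m\<in>{1..card (verts G)}. real (nbh_complexity G m) \<le> c * real m powr d)
    (\<lambda>n G. success_prob algorithm 10 (time_bound n) G (\<lambda>\<B>. biclique_decomposition G \<B> \<and> real (cover_size \<B>) \<le> ?S n))"
  proof (rule whp_size[OF _ c s])
    fix n :: nat assume "0 < n"
    then show "cost_bound n s (trace_bound c d n) (real n) (sizes n) \<le> b n"
      using cost_bound_superlinear[OF _ c d, of n s] unfolding b_def C_def by simp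
  qed (use d b_pos in auto)
  moreover have "?S \<in> O(\<lambda>n. real n powr (2 - 1 / d) * ln (real n))"
  proof (rule size_bound_in_O)
    fix n :: nat assume n: "3 \<le> n"
    let ?h = "real n powr (2 - 1 / d)"
    have h: "real n * real n powr (1 - 1 / d) = ?h"
    proof -
      have "2 - 1 / d = 1 + (1 - 1 / d)" by simp
      then show ?thesis using n by (simp only: powr_add) simp
    qed
    have "1 \<le> real n powr (1 - 1 / d)" using n d by (intro ge_one_powr_ge_zero) auto
    then have "real n * 1 \<le> ?h" unfolding h[symmetric] by (intro mult_left_mono) auto
    then have nh: "real n \<le> ?h" "1 \<le> ?h" using n by auto
    have "b n = 4 * real s * (real n + C * ?h) + 1" unfolding b_def h[symmetric] by (simp add: algebra_simps)
    also have "\<dots> \<le> 4 * real s * (?h + C * ?h) + ?h" using nh C by (intro add_mono mult_left_mono) auto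
    finally have "b n \<le> (4 * real s * (1 + C) + 1) * ?h" by (simp add: algebra_simps)
    then have "4 * real n + 4 * b n \<le> (4 + 4 * (4 * real s * (1 + C) + 1)) * ?h" using nh by (simp add: distrib_right)
    moreover have "0 \<le> 4 * real n + 4 * b n" using b_pos[of n] by simp
    ultimately show "\<bar>4 * real n + 4 * b n\<bar> \<le> (4 + 4 * (4 * real s * (1 + C) + 1)) * ?h" by simp
  qed simp
  ultimately show "\<exists>S. S \<in> O(\<lambda>n. real n powr (2 - 1 / d) * ln (real n)) \<and>
      whp (\<lambda>G. \<forall>m\<in>{1..card (verts G)}. real (nbh_complexity G m) \<le> c * real m powr d)
        (\<lambda>n G. success_prob algorithm 10 (time_bound n) G
          (\<lambda>\<B>. biclique_decomposition G \<B> \<and> real (cover_size \<B>) \<le> S n))" by blast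
next
  fix c :: real assume c: "c > 0"
  obtain s where s: "c * real s powr 1 < 2 ^ s" "0 < s" using powr_less_power_2 by blast
  define b where "b n = 4 * real n * real s * (1 + 2 * c * real (levels n)) + 1" for n
  let ?S = "\<lambda>n. real (levels n) * (4 * real n + 4 * b n)"
  have b_pos: "0 < b n" for n using c unfolding b_def by (intro add_nonneg_pos mult_nonneg_nonneg) auto
  have "whp (\<lambda>G. \<forall>m\<in>{1..card (verts G)}. real (nbh_complexity G m) \<le> c * real m powr 1)
    (\<lambda>n G. success_prob algorithm 10 (time_bound n) G (\<lambda>\<B>. biclique_decomposition G \<B> \<and> real (cover_size \<B>) \<le> ?S n))"
  proof (rule whp_size[OF _ c s])
    fix n :: nat assume "0 < n"
    then show "cost_bound n s (trace_bound c 1 n) (real n) (sizes n) \<le> b n"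
      using cost_bound_linear[OF _ c, of n s] unfolding b_def by simp
  qed (use b_pos in auto)
  \<comment> \<open>The linear case is the exponent 1 of \<open>whp_size\<close>.\<close>
  then have "whp (\<lambda>G. \<forall>m\<in>{1..card (verts G)}. real (nbh_complexity G m) \<le> c * real m)
    (\<lambda>n G. success_prob algorithm 10 (time_bound n) G (\<lambda>\<B>. biclique_decomposition G \<B> \<and> real (cover_size \<B>) \<le> ?S n))"
    by simp
  moreover have "?S \<in> O(\<lambda>n. (real n * ln (real n)) * ln (real n))"
  proof (rule size_bound_in_O)
    fix n :: nat assume n: "3 \<le> n"
    let ?h = "real n * ln (real n)"
    have ln: "1 \<le> ln (real n)" using n exp_le by (subst ln_ge_iff) (auto intro: order_trans)
    have "real n * 1 \<le> ?h" using ln by (intro mult_left_mono) auto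
    moreover have "1 \<le> real n" using n by simp
    ultimately have nh: "real n \<le> ?h" "1 \<le> ?h" by linarith+
    have "real n * real (levels n) \<le> real n * (3 * ln (real n))" by (intro mult_left_mono levels_le_ln n) simp
    then have lev: "real n * real (levels n) \<le> 3 * ?h" by simp
    have "b n = 4 * real s * (real n + 2 * c * (real n * real (levels n))) + 1" unfolding b_def by (simp add: algebra_simps)
    also have "\<dots> \<le> 4 * real s * (?h + 2 * c * (3 * ?h)) + ?h"
      using nh lev c by (intro add_mono mult_left_mono) auto
    finally have "b n \<le> (4 * real s * (1 + 6 * c) + 1) * ?h" by (simp add: algebra_simps)
    then have "4 * real n + 4 * b n \<le> (4 + 4 * (4 * real s * (1 + 6 * c) + 1)) * ?h" using nh by (simp add: distrib_right)
    moreover have "0 \<le> 4 * real n + 4 * b n" using b_pos[of n] by simp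
    ultimately show "\<bar>4 * real n + 4 * b n\<bar> \<le> (4 + 4 * (4 * real s * (1 + 6 * c) + 1)) * ?h" by simp
  qed simp
  then have "?S \<in> O(\<lambda>n. real n * ln (real n) ^ 2)" by (simp add: power2_eq_square mult.assoc)
  ultimately show "\<exists>S. S \<in> O(\<lambda>n. real n * ln (real n) ^ 2) \<and>
      whp (\<lambda>G. \<forall>m\<in>{1..card (verts G)}. real (nbh_complexity G m) \<le> c * real m)
        (\<lambda>n G. success_prob algorithm 10 (time_bound n) G
          (\<lambda>\<B>. biclique_decomposition G \<B> \<and> real (cover_size \<B>) \<le> S n))" by blast
qed

end
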